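(* For every $\varepsilon$ with $0<\varepsilon<0.15$ there is a Monte Carlo (randomized, correct with high probability) algorithm which, given any instance of the maximum concurrent flow problem with $k$ commodities on a directed graph with $n$ vertices and $m$ arcs, with minimum capacity $1$ and maximum capacity $U$, finds a $(1-4\varepsilon)$-approximate solution in expected time $\widetilde{O}((m+k)n\varepsilon^{-2}\log U)$.
   Context: An instance of the maximum concurrent flow problem consists of a directed graph $G=(V,E)$ without parallel arcs, $n=|V|\ge 2$, $m=|E|$, arc capacities $u:E\to\mathbb{R}^+$, $k$ distinct source-sink pairs $(s_1,t_1),\dots,(s_k,t_k)$ of vertices with $s_i\neq t_i$, and a demand $d_i>0$ for each commodity $i$. Capacities are normalized so that $\min_e u(e)=1$, and $U:=\max_e u(e)$. A feasible multicommodity flow is a tuple $f=(f_1,\dots,f_k)$, where each $f_i:E\to\mathbb{R}_{\ge 0}$ is a flow from $s_i$ to $t_i$ (flow conservation holds at all vertices other than $s_i,t_i$), such that $\sum_i f_i(e)\le u(e)$ for every arc $e$. The task is to find a feasible multicommodity flow routing $\lambda d_i$ units of each commodity $i$ from $s_i$ to $t_i$ with $\lambda$ as large as possible; let $\lambda^*$ be the maximum value of $\lambda$. A $(1-4\varepsilon)$-approximate solution is a feasible multicommodity flow routing at least $\lambda d_i$ units of each commodity $i$ for some $\lambda\ge(1-4\varepsilon)\lambda^*$. The notation $\widetilde{O}(\cdot)$ hides factors poly-logarithmic in $n$ and $1/\varepsilon$; inside asymptotic bounds logarithmic factors are read as being at least $1$. "With high probability" means with probability at least $1-n^{-c}$ for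 an absolute constant $c>0$, over the internal randomness of the algorithm. Running time is the number of elementary operations, with arithmetic operations and comparisons on the numbers involved at unit cost. *)

theory Defs
  imports "HOL-Probability.Probability" "Graph_Theory.Pair_Digraph"
begin

section \<open>Maximum concurrent flow\<close>

text \<open>
  In a \<open>pair_pre_digraph\<close> an arc is a pair (tail, head), so there are no parallel arcs; loops are
  not excluded. Commodities are numbered \<open>0, \<dots>, num_com - 1\<close>.
\<close>

record mcf_instance =
  graph :: "nat pair_pre_digraph"
  capacity :: "nat \<times> nat \<Rightarrow> real"
  num_com :: nat
  source :: "nat \<Rightarrow> nat"
  sink :: "nat \<Rightarrow> nat"
  demand :: "nat \<Rightarrow> real"

definition num_verts :: "mcf_instance \<Rightarrow> nat" where
  "num_verts I = card (pverts (graph I))"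

definition num_arcs :: "mcf_instance \<Rightarrow> nat" where
  "num_arcs I = card (parcs (graph I))"

definition max_capacity :: "mcf_instance \<Rightarrow> real" where
  "max_capacity I = Max (capacity I ` parcs (graph I))"

text \<open>
  The normalisation of the minimum capacity presupposes an arc, and the existence of a maximum
  throughput presupposes a commodity.
\<close>

definition valid_instance :: "mcf_instance \<Rightarrow> bool" where
  "valid_instance I \<longleftrightarrow>
     pair_fin_digraph (graph I) \<and>
     pverts (graph I) = {..<num_verts I} \<and> num_verts I \<ge> 2 \<and>
     parcs (graph I) \<noteq> {} \<and>
     Min (capacity I ` parcs (graph I)) = 1 \<and>
     num_com I \<ge> 1 \<and>
     (\<forall>i<num_com I. source I i \<in> pverts (graph I) \<and> sink I i \<in> pverts (graph I) \<and>
                    source I i \<noteq> sink I i \<and> demand I i > 0) \<and>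
     inj_on (\<lambda>i. (source I i, sink I i)) {..<num_com I}"

definition is_flow ::
    "nat pair_pre_digraph \<Rightarrow> nat \<Rightarrow> nat \<Rightarrow> (nat \<times> nat \<Rightarrow> real) \<Rightarrow> bool" where
  "is_flow G s t g \<longleftrightarrow>
     (\<forall>e\<in>parcs G. g e \<ge> 0) \<and>
     (\<forall>v\<in>pverts G - {s, t}. (\<Sum>e\<in>in_arcs G v. g e) = (\<Sum>e\<in>out_arcs G v. g e))"

definition flow_value :: "nat pair_pre_digraph \<Rightarrow> nat \<Rightarrow> (nat \<times> nat \<Rightarrow> real) \<Rightarrow> real" where
  "flow_value G s g = (\<Sum>e\<in>out_arcs G s. g e) - (\<Sum>e\<in>in_arcs G s. g e)"

definition feasible_mcf :: "mcf_instance \<Rightarrow> (nat \<Rightarrow> nat \<times> nat \<Rightarrow> real) \<Rightarrow> bool" where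
  "feasible_mcf I f \<longleftrightarrow>
     (\<forall>i<num_com I. is_flow (graph I) (source I i) (sink I i) (f i)) \<and>
     (\<forall>e\<in>parcs (graph I). (\<Sum>i<num_com I. f i e) \<le> capacity I e)"

definition max_throughput :: "mcf_instance \<Rightarrow> real" where
  "max_throughput I =
     (GREATEST l. \<exists>f. feasible_mcf I f \<and>
        (\<forall>i<num_com I. flow_value (graph I) (source I i) (f i) = l * demand I i))"

definition approx_solution ::
    "real \<Rightarrow> mcf_instance \<Rightarrow> (nat \<Rightarrow> nat \<times> nat \<Rightarrow> real) \<Rightarrow> bool" where
  "approx_solution r I f \<longleftrightarrow>
     feasible_mcf I f \<and>
     (\<exists>l \<ge> r * max_throughput I.
        \<forall>i<num_com I. flow_value (graph I) (source I i) (f i) \<ge> l * demand I i)"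


section \<open>Randomised algorithms with unit-cost arithmetic\<close>

text \<open>
  Programs run on a random access machine with registers and unbounded arrays, holding either
  natural numbers (for counting and addressing) or real numbers. There is deliberately no integer
  division, no rounding of reals to naturals and no real constant: with unit costs, the first two
  would make the machine unrealistically powerful, and real constants could carry arbitrary
  advice. Subtraction of naturals is truncated, and division by the real zero gives zero.
  Randomness comes from fair coin flips.
\<close>

datatype nat_op = NAdd | NSub | NMul
datatype real_op = RAdd | RSub | RMul | RDiv

datatype test =
    NLess nat nat | NLeq nat nat | NEq nat nat
  | RLess nat nat | RLeq nat nat | REq nat nat

datatype program =
    Skip
  | NConst nat nat               \<comment> \<open>target register, constant\<close>
  | NArith nat_op nat nat nat    \<comment> \<open>target register, operand registers\<close>
  | NLoad nat nat nat            \<comment> \<open>target register, array, index register\<close>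
  | NStore nat nat nat           \<comment> \<open>array, index register, source register\<close>
  | RofN nat nat                 \<comment> \<open>real target register, nat source register\<close>
  | RArith real_op nat nat nat
  | RLoad nat nat nat
  | RStore nat nat nat
  | Flip nat                     \<comment> \<open>nat target register, receives 0 or 1\<close>
  | Seq program program
  | Cond test program program
  | While test program

record machine =
  nreg :: "nat \<Rightarrow> nat"
  rreg :: "nat \<Rightarrow> real"
  narr :: "nat \<Rightarrow> nat \<Rightarrow> nat"
  rarr :: "nat \<Rightarrow> nat \<Rightarrow> real"
  steps :: nat

fun nat_arith :: "nat_op \<Rightarrow> nat \<Rightarrow> nat \<Rightarrow> nat" where
  "nat_arith NAdd x y = x + y"
| "nat_arith NSub x y = x - y"
| "nat_arith NMul x y = x * y"

fun real_arith :: "real_op \<Rightarrow> real \<Rightarrow> real \<Rightarrow> real" where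
  "real_arith RAdd x y = x + y"
| "real_arith RSub x y = x - y"
| "real_arith RMul x y = x * y"
| "real_arith RDiv x y = x / y"

fun holds :: "test \<Rightarrow> machine \<Rightarrow> bool" where
  "holds (NLess x y) \<sigma> \<longleftrightarrow> nreg \<sigma> x < nreg \<sigma> y"
| "holds (NLeq x y) \<sigma> \<longleftrightarrow> nreg \<sigma> x \<le> nreg \<sigma> y"
| "holds (NEq x y) \<sigma> \<longleftrightarrow> nreg \<sigma> x = nreg \<sigma> y"
| "holds (RLess x y) \<sigma> \<longleftrightarrow> rreg \<sigma> x < rreg \<sigma> y"
| "holds (RLeq x y) \<sigma> \<longleftrightarrow> rreg \<sigma> x \<le> rreg \<sigma> y"
| "holds (REq x y) \<sigma> \<longleftrightarrow> rreg \<sigma> x = rreg \<sigma> y"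

definition tick :: "machine \<Rightarrow> machine" where
  "tick \<sigma> = \<sigma>\<lparr>steps := Suc (steps \<sigma>)\<rparr>"

definition set_nreg :: "nat \<Rightarrow> nat \<Rightarrow> machine \<Rightarrow> machine" where
  "set_nreg x a \<sigma> = \<sigma>\<lparr>nreg := (nreg \<sigma>)(x := a)\<rparr>"

definition set_rreg :: "nat \<Rightarrow> real \<Rightarrow> machine \<Rightarrow> machine" where
  "set_rreg x a \<sigma> = \<sigma>\<lparr>rreg := (rreg \<sigma>)(x := a)\<rparr>"

definition set_narr :: "nat \<Rightarrow> nat \<Rightarrow> nat \<Rightarrow> machine \<Rightarrow> machine" where
  "set_narr A j a \<sigma> = \<sigma>\<lparr>narr := (narr \<sigma>)(A := (narr \<sigma> A)(j := a))\<rparr>"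

definition set_rarr :: "nat \<Rightarrow> nat \<Rightarrow> real \<Rightarrow> machine \<Rightarrow> machine" where
  "set_rarr A j a \<sigma> = \<sigma>\<lparr>rarr := (rarr \<sigma>)(A := (rarr \<sigma> A)(j := a))\<rparr>"

text \<open>
  The semantics is a subprobability distribution on final states; the missing mass is the
  probability of nontermination.
\<close>

partial_function (spmf) while_spmf ::
    "('s \<Rightarrow> bool) \<Rightarrow> ('s \<Rightarrow> 's) \<Rightarrow> ('s \<Rightarrow> 's spmf) \<Rightarrow> 's \<Rightarrow> 's spmf" where
  "while_spmf b h body \<sigma> =
     (if b \<sigma> then bind_spmf (body (h \<sigma>)) (\<lambda>\<sigma>'. while_spmf b h body \<sigma>')
      else return_spmf (h \<sigma>))"

primrec exec :: "program \<Rightarrow> machine \<Rightarrow> machine spmf" where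
  "exec Skip \<sigma> = return_spmf \<sigma>"
| "exec (NConst x a) \<sigma> = return_spmf (set_nreg x a (tick \<sigma>))"
| "exec (NArith c x y z) \<sigma> =
     return_spmf (set_nreg x (nat_arith c (nreg \<sigma> y) (nreg \<sigma> z)) (tick \<sigma>))"
| "exec (NLoad x A y) \<sigma> = return_spmf (set_nreg x (narr \<sigma> A (nreg \<sigma> y)) (tick \<sigma>))"
| "exec (NStore A y x) \<sigma> = return_spmf (set_narr A (nreg \<sigma> y) (nreg \<sigma> x) (tick \<sigma>))"
| "exec (RofN x y) \<sigma> = return_spmf (set_rreg x (real (nreg \<sigma> y)) (tick \<sigma>))"
| "exec (RArith c x y z) \<sigma> =
     return_spmf (set_rreg x (real_arith c (rreg \<sigma> y) (rreg \<sigma> z)) (tick \<sigma>))"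
| "exec (RLoad x A y) \<sigma> = return_spmf (set_rreg x (rarr \<sigma> A (nreg \<sigma> y)) (tick \<sigma>))"
| "exec (RStore A y x) \<sigma> = return_spmf (set_rarr A (nreg \<sigma> y) (rreg \<sigma> x) (tick \<sigma>))"
| "exec (Flip x) \<sigma> = map_spmf (\<lambda>b. set_nreg x (of_bool b) (tick \<sigma>)) coin_spmf"
| "exec (Seq P Q) \<sigma> = bind_spmf (exec P \<sigma>) (exec Q)"
| "exec (Cond b P Q) \<sigma> = (if holds b \<sigma> then exec P (tick \<sigma>) else exec Q (tick \<sigma>))"
| "exec (While b P) \<sigma> = while_spmf (holds b) tick (exec P) \<sigma>"

definition expected_steps :: "machine spmf \<Rightarrow> ennreal" where
  "expected_steps p =
     (if lossless_spmf p then (\<integral>\<^sup>+ \<sigma>. ennreal (real (steps \<sigma>)) \<partial>measure_spmf p) else \<infinity>)"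


section \<open>Input and output of a concurrent flow algorithm\<close>

text \<open>
  The arcs are presented to the algorithm as a list in an arbitrary order. The real register 0
  holds the accuracy parameter. All memory that does not hold input is zero.
\<close>

definition arc_listing :: "mcf_instance \<Rightarrow> (nat \<times> nat) list \<Rightarrow> bool" where
  "arc_listing I es \<longleftrightarrow> distinct es \<and> set es = parcs (graph I)"

definition input_state :: "real \<Rightarrow> mcf_instance \<Rightarrow> (nat \<times> nat) list \<Rightarrow> machine" where
  "input_state \<epsilon> I es =
     (let n = num_verts I; m = num_arcs I; k = num_com I in
      \<lparr> nreg = (\<lambda>_. 0)(0 := n, 1 := m, 2 := k),
        rreg = (\<lambda>_. 0)(0 := \<epsilon>),
        narr = (\<lambda>_ _. 0)(0 := (\<lambda>j. if j < m then fst (es ! j) else 0),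
                         1 := (\<lambda>j. if j < m then snd (es ! j) else 0),
                         2 := (\<lambda>i. if i < k then source I i else 0),
                         3 := (\<lambda>i. if i < k then sink I i else 0)),
        rarr = (\<lambda>_ _. 0)(0 := (\<lambda>j. if j < m then capacity I (es ! j) else 0),
                         1 := (\<lambda>i. if i < k then demand I i else 0)),
        steps = 0 \<rparr>)"

text \<open>
  The flow of commodity \<open>i\<close> on the \<open>j\<close>-th arc is read off entry \<open>i * m + j\<close> of the real array 2.
  As this array is initially zero, only nonzero flow values have to be written; writing out all
  \<open>k * m\<close> values could by itself exceed the running time \<open>(m + k) * n\<close>.
\<close>

definition output_flow ::
    "mcf_instance \<Rightarrow> (nat \<times> nat) list \<Rightarrow> machine \<Rightarrow> nat \<Rightarrow> nat \<times> nat \<Rightarrow> real" where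
  "output_flow I es \<sigma> i e =
     rarr \<sigma> 2 (i * num_arcs I + the_inv_into {..<num_arcs I} ((!) es) e)"

text \<open>Logarithmic factors in asymptotic bounds are read as being at least 1.\<close>

definition log1 :: "real \<Rightarrow> real" where
  "log1 x = max 1 (ln x)"

end

theory Submission
  imports Defs
begin

text \<open>
  The algorithm is a multiplicative weights scheme for concurrent flow (Garg--Koenemann, in
  Fleischer's variant with a threshold per commodity), which pushes flow along nearly shortest
  paths with respect to arc weights that grow with the load. In the analysis, the weights are
  compared with a path decomposition of a maximum concurrent flow, so it suffices that the search
  finds paths nearly as short as those of one fixed decomposition. This permits sampling: a random
  sequence of centres meets, with high probability, every path \<open>P\<close> of the decomposition in one of
  its first \<open>N / length P\<close> members.

  For every centre, the distances to and from it are maintained under increasing weights. Labels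
  are rounded, the relative rounding error per arc of centre \<open>c\<close> being \<open>(c + 1) / (K * N)\<close>; this is
  harmless on paths with at most \<open>N / (c + 1)\<close> arcs, and summing the number of label changes over
  all centres gives a harmonic sum. A potential counting the remaining label increases, cursor
  advances, weight roundings, threshold raises and arc saturations bounds the running time on
  every outcome of the coin flips. The randomness only affects the quality of the solution, which
  is feasible in any case.

  The amount shipped per round grows geometrically, by so small a factor that it stays below the
  maximum throughput until the algorithm stops; hence no estimate of that throughput is needed.
\<close>

section \<open>Weakest preconditions\<close>

text \<open>One search structure per commodity would cost a factor \<open>k\<close>, and rounding
  fine enough for paths with \<open>n\<close> arcs makes every label change about \<open>n\<close>
  times. Shared centres remove the first factor: a commodity is routed from its source to a centre
  and on to its sink, so a centre needs one search towards it and one away from it. Against the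
  second factor helps that late centres are needed for short paths only and may therefore be coarse.
  The shortest paths met during the run depend on the sampled centres, which rules out a union bound
  over them; the paths of one optimal flow do not, and there are at most
  \<open>k * m \<le> n ^ 4\<close> of them. Splicing two walks at a centre may use an arc twice;
  this is the origin of the exponent 2 in the weight bound and of the 2 in
  \<open>T' = T + 2\<close>. Flow is divided by \<open>T'\<close> when it is written, which saves a
  rescaling pass over the output. A round can be compared with the optimum if it ships at most the
  optimum: round 0 ships half of a trivial lower bound, and later rounds are tied to what has been
  shipped feasibly before.\<close>

definition wp :: "program \<Rightarrow> (machine \<Rightarrow> bool) \<Rightarrow> machine \<Rightarrow> bool" where
  "wp P Q \<sigma> \<longleftrightarrow> lossless_spmf (exec P \<sigma>) \<and> (\<forall>\<sigma>'\<in>set_spmf (exec P \<sigma>). Q \<sigma>')"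

lemma wp_simps:
  "wp Skip Q \<sigma> = Q \<sigma>"
  "wp (NConst x a) Q \<sigma> = Q (set_nreg x a (tick \<sigma>))"
  "wp (NArith c x y z) Q \<sigma> = Q (set_nreg x (nat_arith c (nreg \<sigma> y) (nreg \<sigma> z)) (tick \<sigma>))"
  "wp (NLoad x A y) Q \<sigma> = Q (set_nreg x (narr \<sigma> A (nreg \<sigma> y)) (tick \<sigma>))"
  "wp (NStore A y x) Q \<sigma> = Q (set_narr A (nreg \<sigma> y) (nreg \<sigma> x) (tick \<sigma>))"
  "wp (RofN x y) Q \<sigma> = Q (set_rreg x (real (nreg \<sigma> y)) (tick \<sigma>))"
  "wp (RArith d x y z) Q \<sigma> = Q (set_rreg x (real_arith d (rreg \<sigma> y) (rreg \<sigma> z)) (tick \<sigma>))"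
  "wp (RLoad x A y) Q \<sigma> = Q (set_rreg x (rarr \<sigma> A (nreg \<sigma> y)) (tick \<sigma>))"
  "wp (RStore A y x) Q \<sigma> = Q (set_rarr A (nreg \<sigma> y) (rreg \<sigma> x) (tick \<sigma>))"
  "wp (Flip x) Q \<sigma> = (\<forall>b. Q (set_nreg x (of_bool b) (tick \<sigma>)))"
  "wp (Seq P P') Q \<sigma> = wp P (wp P' Q) \<sigma>"
  "wp (Cond b P P') Q \<sigma> = (if holds b \<sigma> then wp P Q (tick \<sigma>) else wp P' Q (tick \<sigma>))"
  by (auto simp: wp_def set_bind_spmf)

lemma wp_Skip: "wp Skip Q = Q"
  by (simp add: wp_simps fun_eq_iff)

lemma wp_Seq: "wp (Seq P P') Q = wp P (wp P' Q)"
  by (simp add: wp_simps fun_eq_iff)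

lemma wp_mono: "wp P Q \<sigma> \<Longrightarrow> (\<And>\<sigma>'. Q \<sigma>' \<Longrightarrow> R \<sigma>') \<Longrightarrow> wp P R \<sigma>"
  by (auto simp: wp_def)

lemma machine_sel_simps [simp]:
  "nreg (set_nreg x a \<sigma>) = (nreg \<sigma>)(x := a)" "rreg (set_nreg x a \<sigma>) = rreg \<sigma>"
  "narr (set_nreg x a \<sigma>) = narr \<sigma>" "rarr (set_nreg x a \<sigma>) = rarr \<sigma>"
  "steps (set_nreg x a \<sigma>) = steps \<sigma>"
  "nreg (set_rreg x b \<sigma>) = nreg \<sigma>" "rreg (set_rreg x b \<sigma>) = (rreg \<sigma>)(x := b)"
  "narr (set_rreg x b \<sigma>) = narr \<sigma>" "rarr (set_rreg x b \<sigma>) = rarr \<sigma>"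
  "steps (set_rreg x b \<sigma>) = steps \<sigma>"
  "nreg (set_narr A j a \<sigma>) = nreg \<sigma>" "rreg (set_narr A j a \<sigma>) = rreg \<sigma>"
  "narr (set_narr A j a \<sigma>) = (narr \<sigma>)(A := (narr \<sigma> A)(j := a))" "rarr (set_narr A j a \<sigma>) = rarr \<sigma>"
  "steps (set_narr A j a \<sigma>) = steps \<sigma>"
  "nreg (set_rarr A j b \<sigma>) = nreg \<sigma>" "rreg (set_rarr A j b \<sigma>) = rreg \<sigma>"
  "narr (set_rarr A j b \<sigma>) = narr \<sigma>" "rarr (set_rarr A j b \<sigma>) = (rarr \<sigma>)(A := (rarr \<sigma> A)(j := b))"
  "steps (set_rarr A j b \<sigma>) = steps \<sigma>"
  "nreg (tick \<sigma>) = nreg \<sigma>" "rreg (tick \<sigma>) = rreg \<sigma>" "narr (tick \<sigma>) = narr \<sigma>"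
  "rarr (tick \<sigma>) = rarr \<sigma>" "steps (tick \<sigma>) = Suc (steps \<sigma>)"
  by (simp_all add: set_nreg_def set_rreg_def set_narr_def set_rarr_def tick_def)

text \<open>Fixpoint induction over the loop functional. Admissibility holds because the support of
  the limit of a chain of subdistributions is the union of the supports, so every outcome already
  occurs after finitely many iterations and is linked to the start by finitely many
  \<open>R\<close>-steps.\<close>

lemma set_spmf_while:
  assumes "\<sigma>' \<in> set_spmf (while_spmf b h body \<sigma>)"
    and body: "\<And>s s'. s' \<in> set_spmf (body s) \<Longrightarrow> R s s'"
    and h: "\<And>s. R s (h s)"
    and trans: "\<And>s t u. R s t \<Longrightarrow> R t u \<Longrightarrow> R s u"
  shows "R \<sigma> \<sigma>'"
proof -
  define ok where "ok w \<longleftrightarrow> (\<forall>s s'. s' \<in> set_spmf (w s) \<longrightarrow> R s s')" for w :: "'a \<Rightarrow> 'a spmf"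
  have "ok (while_spmf b h body)"
  proof (induction rule: while_spmf.fixp_induct)
    case 1
    show ?case
    proof (rule ccpo.admissibleI)
      fix A :: "(((('a \<Rightarrow> bool) \<times> ('a \<Rightarrow> 'a)) \<times> ('a \<Rightarrow> 'a spmf)) \<times> 'a \<Rightarrow> 'a spmf) set"
      assume chain: "Complete_Partial_Order.chain spmf.le_fun A" and ne: "A \<noteq> {}"
        and ok: "\<forall>w\<in>A. ok (curry (curry (curry w)) b h body)"
      show "ok (curry (curry (curry (spmf.lub_fun A))) b h body)"
        unfolding ok_def
      proof (intro allI impI)
        fix s s'
        assume "s' \<in> set_spmf (curry (curry (curry (spmf.lub_fun A))) b h body s)"
        then have *: "s' \<in> set_spmf (lub_spmf {y. \<exists>f\<in>A. y = f (((b, h), body), s)})"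
          by (simp add: fun_lub_def)
        have "Complete_Partial_Order.chain (ord_spmf (=)) {y. \<exists>f\<in>A. y = f (((b, h), body), s)}"
          using chain_fun[OF chain] by auto
        with * obtain w where "w \<in> A" "s' \<in> set_spmf (w (((b, h), body), s))"
          by (subst (asm) set_lub_spmf) auto
        with ok show "R s s'"
          by (auto simp: ok_def)
      qed
    qed
  next
    case 2
    show ?case by (simp add: ok_def)
  next
    case (3 w)
    have "R s s'" if s': "s' \<in> set_spmf (if b s then body (h s) \<bind> w b h body else return_spmf (h s))" for s s'
    proof (cases "b s")
      case True
      with s' obtain t where "t \<in> set_spmf (body (h s))" "s' \<in> set_spmf (w b h body t)"
        by (auto simp: set_bind_spmf)
      with 3 have "R (h s) t" "R t s'"
        using body by (auto simp: ok_def)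
      with h show ?thesis by (meson trans)
    qed (use s' h in simp)
    then show ?case
      by (simp add: ok_def)
  qed
  with assms(1) show ?thesis
    by (auto simp: ok_def)
qed

text \<open>Together with the tick of every loop test this makes the step counter strictly
  increasing from one iteration to the next; the loop rules use it as termination measure.\<close>

lemma exec_steps_mono: "\<sigma>' \<in> set_spmf (exec P \<sigma>) \<Longrightarrow> steps \<sigma> \<le> steps \<sigma>'"
proof (induction P arbitrary: \<sigma> \<sigma>')
  case (Seq P Q)
  then obtain \<tau> where "\<tau> \<in> set_spmf (exec P \<sigma>)" "\<sigma>' \<in> set_spmf (exec Q \<tau>)"
    by (auto simp: set_bind_spmf)
  with Seq.IH(1)[of \<tau> \<sigma>] Seq.IH(2)[of \<sigma>' \<tau>] show ?case by simp
next
  case (Cond b P Q)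
  then show ?case using Cond.IH(1)[of \<sigma>' "tick \<sigma>"] Cond.IH(2)[of \<sigma>' "tick \<sigma>"]
    by (auto split: if_splits)
next
  case (While b P)
  from While.prems[simplified] show ?case
    by (rule set_spmf_while) (auto intro: While.IH order_trans)
qed auto

text \<open>\<open>wrN\<close>, \<open>wrR\<close>, \<open>wrNA\<close> and \<open>wrRA\<close>
  over-approximate syntactically which natural and real registers and arrays a program may write.
  Arrays are treated as wholes.\<close>

primrec wrN :: "program \<Rightarrow> nat set" where
  "wrN Skip = {}"
| "wrN (NConst x a) = {x}"
| "wrN (NArith c x y z) = {x}"
| "wrN (NLoad x A y) = {x}"
| "wrN (NStore A y x) = {}"
| "wrN (RofN x y) = {}"
| "wrN (RArith d x y z) = {}"
| "wrN (RLoad x A y) = {}"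
| "wrN (RStore A y x) = {}"
| "wrN (Flip x) = {x}"
| "wrN (Seq P Q) = wrN P \<union> wrN Q"
| "wrN (Cond b P Q) = wrN P \<union> wrN Q"
| "wrN (While b P) = wrN P"

primrec wrR :: "program \<Rightarrow> nat set" where
  "wrR Skip = {}"
| "wrR (NConst x a) = {}"
| "wrR (NArith c x y z) = {}"
| "wrR (NLoad x A y) = {}"
| "wrR (NStore A y x) = {}"
| "wrR (RofN x y) = {x}"
| "wrR (RArith d x y z) = {x}"
| "wrR (RLoad x A y) = {x}"
| "wrR (RStore A y x) = {}"
| "wrR (Flip x) = {}"
| "wrR (Seq P Q) = wrR P \<union> wrR Q"
| "wrR (Cond b P Q) = wrR P \<union> wrR Q"
| "wrR (While b P) = wrR P"

primrec wrNA :: "program \<Rightarrow> nat set" where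
  "wrNA Skip = {}"
| "wrNA (NConst x a) = {}"
| "wrNA (NArith c x y z) = {}"
| "wrNA (NLoad x A y) = {}"
| "wrNA (NStore A y x) = {A}"
| "wrNA (RofN x y) = {}"
| "wrNA (RArith d x y z) = {}"
| "wrNA (RLoad x A y) = {}"
| "wrNA (RStore A y x) = {}"
| "wrNA (Flip x) = {}"
| "wrNA (Seq P Q) = wrNA P \<union> wrNA Q"
| "wrNA (Cond b P Q) = wrNA P \<union> wrNA Q"
| "wrNA (While b P) = wrNA P"

primrec wrRA :: "program \<Rightarrow> nat set" where
  "wrRA Skip = {}"
| "wrRA (NConst x a) = {}"
| "wrRA (NArith c x y z) = {}"
| "wrRA (NLoad x A y) = {}"
| "wrRA (NStore A y x) = {}"
| "wrRA (RofN x y) = {}"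
| "wrRA (RArith d x y z) = {}"
| "wrRA (RLoad x A y) = {}"
| "wrRA (RStore A y x) = {A}"
| "wrRA (Flip x) = {}"
| "wrRA (Seq P Q) = wrRA P \<union> wrRA Q"
| "wrRA (Cond b P Q) = wrRA P \<union> wrRA Q"
| "wrRA (While b P) = wrRA P"

text \<open>The step counter is left out, and for a fixed \<open>P\<close> the relation is reflexive
  and transitive. It survives any number of iterations, so invariants need not list what a loop body
  cannot touch.\<close>

definition frame :: "program \<Rightarrow> machine \<Rightarrow> machine \<Rightarrow> bool" where
  "frame P \<sigma> \<sigma>' \<longleftrightarrow>
     (\<forall>r. r \<notin> wrN P \<longrightarrow> nreg \<sigma>' r = nreg \<sigma> r) \<and>
     (\<forall>r. r \<notin> wrR P \<longrightarrow> rreg \<sigma>' r = rreg \<sigma> r) \<and>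
     (\<forall>A. A \<notin> wrNA P \<longrightarrow> narr \<sigma>' A = narr \<sigma> A) \<and>
     (\<forall>A. A \<notin> wrRA P \<longrightarrow> rarr \<sigma>' A = rarr \<sigma> A)"

lemma frameD:
  assumes "frame P \<sigma> \<sigma>'"
  shows "r \<notin> wrN P \<Longrightarrow> nreg \<sigma>' r = nreg \<sigma> r" "r \<notin> wrR P \<Longrightarrow> rreg \<sigma>' r = rreg \<sigma> r"
    "r \<notin> wrNA P \<Longrightarrow> narr \<sigma>' r = narr \<sigma> r" "r \<notin> wrRA P \<Longrightarrow> rarr \<sigma>' r = rarr \<sigma> r"
  using assms by (auto simp: frame_def)

lemma frame_exec: "\<sigma>' \<in> set_spmf (exec P \<sigma>) \<Longrightarrow> frame P \<sigma> \<sigma>'"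
proof (induction P arbitrary: \<sigma> \<sigma>')
  case (Seq P Q)
  then obtain \<tau> where "\<tau> \<in> set_spmf (exec P \<sigma>)" "\<sigma>' \<in> set_spmf (exec Q \<tau>)"
    by (auto simp: set_bind_spmf)
  with Seq.IH(1)[of \<tau> \<sigma>] Seq.IH(2)[of \<sigma>' \<tau>] show ?case by (simp add: frame_def)
next
  case (Cond b P Q)
  then show ?case
    using Cond.IH(1)[of \<sigma>' "tick \<sigma>"] Cond.IH(2)[of \<sigma>' "tick \<sigma>"]
    by (auto split: if_splits simp: frame_def)
next
  case (While b P)
  from While.prems[simplified] show ?case
    by (rule set_spmf_while) (insert While.IH, auto simp: frame_def)
qed (auto simp: frame_def)

section \<open>Loop rules with explicit step bounds\<close>

lemma wp_While_unfold:
  "wp (While b P) Q \<sigma> =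
     (if holds b \<sigma> then wp P (wp (While b P) Q) (tick \<sigma>) else Q (tick \<sigma>))"
  by (auto simp: wp_def set_bind_spmf while_spmf.simps[of "holds b" tick "exec P" \<sigma>])

text \<open>No separate variant is asked for: each test ticks, so a bound on the step counter under
  the invariant already forces termination. A running-time proof is thus also the termination proof.
  The frame from loop entry is supplied to every obligation.\<close>

lemma wp_While:
  assumes "Inv \<sigma>"
    and body: "\<And>\<sigma>'. Inv \<sigma>' \<Longrightarrow> frame P \<sigma> \<sigma>' \<Longrightarrow> holds b \<sigma>' \<Longrightarrow> wp P Inv (tick \<sigma>')"
    and bound: "\<And>\<sigma>'. Inv \<sigma>' \<Longrightarrow> frame P \<sigma> \<sigma>' \<Longrightarrow> real (steps \<sigma>') \<le> Bd"
    and exit: "\<And>\<sigma>'. Inv \<sigma>' \<Longrightarrow> frame P \<sigma> \<sigma>' \<Longrightarrow> \<not> holds b \<sigma>' \<Longrightarrow> Q (tick \<sigma>')"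
  shows "wp (While b P) Q \<sigma>"
proof -
  have "wp (While b P) Q \<sigma>'" if "Inv \<sigma>'" "frame P \<sigma> \<sigma>'" for \<sigma>'
    using that
  proof (induction "nat \<lceil>Bd\<rceil> - steps \<sigma>'" arbitrary: \<sigma>' rule: less_induct)
    case less
    show ?case
    proof (cases "holds b \<sigma>'")
      case True
      have "steps \<sigma>' \<le> nat \<lceil>Bd\<rceil>"
        using bound[OF less.prems] by linarith
      have "wp (While b P) Q \<tau>"
        if \<tau>: "\<tau> \<in> set_spmf (exec P (tick \<sigma>'))" and inv: "Inv \<tau>" for \<tau>
      proof (rule less.hyps[OF _ inv])
        show fr: "frame P \<sigma> \<tau>"
          using frame_exec[OF \<tau>] less.prems(2) by (simp add: frame_def)
        have "steps \<sigma>' < steps \<tau>"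
          using exec_steps_mono[OF \<tau>] by simp
        moreover have "steps \<tau> \<le> nat \<lceil>Bd\<rceil>"
          using bound[OF inv fr] by linarith
        ultimately show "nat \<lceil>Bd\<rceil> - steps \<tau> < nat \<lceil>Bd\<rceil> - steps \<sigma>'"
          by linarith
      qed
      with body[OF less.prems True] have "wp P (wp (While b P) Q) (tick \<sigma>')"
        by (auto simp: wp_def)
      with True show ?thesis
        by (subst wp_While_unfold) simp
    next
      case False
      with exit[OF less.prems] show ?thesis
        by (subst wp_While_unfold) simp
    qed
  qed
  with assms(1) show ?thesis
    by (simp add: frame_def)
qed

text \<open>Amortised rule for counting loops: an iteration may exceed \<open>Bd\<close> by as much
  as the potential \<open>\<phi>\<close> drops. Nonnegativity of \<open>\<phi>\<close> turns the
  amortised bound into the bound on the step counter that \<open>wp_While\<close> wants; the final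
  \<open>+ 1\<close> pays for the failing test.\<close>

lemma wp_For_pot:
  assumes "Inv (nreg \<sigma> t) \<sigma>" "nreg \<sigma> t \<le> L" "nreg \<sigma> l = L" "l \<notin> wrN P"
    and body: "\<And>\<sigma>' j. Inv j \<sigma>' \<Longrightarrow> frame P \<sigma> \<sigma>' \<Longrightarrow> nreg \<sigma>' t = j \<Longrightarrow> j < L \<Longrightarrow>
          wp P (\<lambda>\<tau>. nreg \<tau> t = Suc j \<and> Inv (Suc j) \<tau> \<and>
            real (steps \<tau>) + \<phi> \<tau> \<le> real (steps \<sigma>') + \<phi> \<sigma>' + Bd) (tick \<sigma>')"
    and exit: "\<And>\<sigma>'. Inv L \<sigma>' \<Longrightarrow> frame P \<sigma> \<sigma>' \<Longrightarrow> nreg \<sigma>' t = L \<Longrightarrow>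
          real (steps \<sigma>') + \<phi> \<sigma>' \<le> real (steps \<sigma>) + \<phi> \<sigma> + real (L - nreg \<sigma> t) * Bd + 1 \<Longrightarrow> Q \<sigma>'"
    and tick: "\<And>\<sigma>' j. Inv j (tick \<sigma>') = Inv j \<sigma>'" "\<And>\<sigma>'. \<phi> (tick \<sigma>') = \<phi> \<sigma>'"
    and nonneg: "\<And>\<sigma>' j. Inv j \<sigma>' \<Longrightarrow> frame P \<sigma> \<sigma>' \<Longrightarrow> j \<le> L \<Longrightarrow> \<phi> \<sigma>' \<ge> 0" and Bd: "Bd \<ge> 0"
  shows "wp (While (NLess t l) P) Q \<sigma>"
proof (rule wp_While[where Bd = "real (steps \<sigma>) + \<phi> \<sigma> + real (L - nreg \<sigma> t) * Bd" and
      Inv = "\<lambda>\<sigma>'. nreg \<sigma> t \<le> nreg \<sigma>' t \<and> nreg \<sigma>' t \<le> L \<and> Inv (nreg \<sigma>' t) \<sigma>' \<and>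
         real (steps \<sigma>') + \<phi> \<sigma>' \<le> real (steps \<sigma>) + \<phi> \<sigma> + real (nreg \<sigma>' t - nreg \<sigma> t) * Bd"],
      goal_cases)
  case 1
  then show ?case using assms by simp
next
  case (2 \<tau>)
  from 2 have le: "nreg \<sigma> t \<le> nreg \<tau> t" by simp
  have "nreg \<tau> l = L" using 2 assms(3,4) by (simp add: frame_def)
  with 2 have "nreg \<tau> t < L" by simp
  with 2 have "wp P (\<lambda>\<tau>'. nreg \<tau>' t = Suc (nreg \<tau> t) \<and> Inv (Suc (nreg \<tau> t)) \<tau>' \<and>
      real (steps \<tau>') + \<phi> \<tau>' \<le> real (steps \<tau>) + \<phi> \<tau> + Bd) (tick \<tau>)"
    by (intro body) auto
  then show ?case
    by (rule wp_mono) (use 2 le \<open>nreg \<tau> t < L\<close> in \<open>auto simp: Suc_diff_le algebra_simps\<close>)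
next
  case (3 \<tau>)
  have "real (nreg \<tau> t - nreg \<sigma> t) * Bd \<le> real (L - nreg \<sigma> t) * Bd"
    using 3 Bd by (intro mult_right_mono) auto
  moreover have "\<phi> \<tau> \<ge> 0" using 3 by (intro nonneg) auto
  ultimately show ?case using 3 by linarith
next
  case (4 \<tau>)
  have "nreg \<tau> l = L" using 4 assms(3,4) by (simp add: frame_def)
  with 4 have *: "nreg \<tau> t = L" by auto
  show ?case
    by (rule exit) (use 4 * in \<open>auto simp: tick frame_def\<close>)
qed

lemma wp_For:
  assumes "Inv (nreg \<sigma> t) \<sigma>" "nreg \<sigma> t \<le> L" "nreg \<sigma> l = L" "l \<notin> wrN P"
    and body: "\<And>\<sigma>' j. Inv j \<sigma>' \<Longrightarrow> frame P \<sigma> \<sigma>' \<Longrightarrow> nreg \<sigma>' t = j \<Longrightarrow> j < L \<Longrightarrow>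
          wp P (\<lambda>\<tau>. nreg \<tau> t = Suc j \<and> Inv (Suc j) \<tau> \<and> real (steps \<tau>) \<le> real (steps \<sigma>') + Bd) (tick \<sigma>')"
    and exit: "\<And>\<sigma>'. Inv L \<sigma>' \<Longrightarrow> frame P \<sigma> \<sigma>' \<Longrightarrow> nreg \<sigma>' t = L \<Longrightarrow>
          real (steps \<sigma>') \<le> real (steps \<sigma>) + real (L - nreg \<sigma> t) * Bd + 1 \<Longrightarrow> Q \<sigma>'"
    and Inv_tick: "\<And>\<sigma>' j. Inv j (tick \<sigma>') = Inv j \<sigma>'"
    and Bd: "Bd \<ge> 0"
  shows "wp (While (NLess t l) P) Q \<sigma>"
  by (rule wp_For_pot[where Inv = Inv and \<phi> = "\<lambda>_. 0" and L = L and Bd = Bd]) (use assms in simp_all)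

section \<open>Flows and path decompositions\<close>

text \<open>Net outflow at \<open>z\<close> in signed form: a loop at \<open>z\<close> cancels, and
  sums over vertices can be exchanged with sums over arcs.\<close>

definition excess :: "(nat \<times> nat) set \<Rightarrow> (nat \<times> nat \<Rightarrow> real) \<Rightarrow> nat \<Rightarrow> real" where
  "excess E g z = (\<Sum>e\<in>E. g e * (of_bool (fst e = z) - of_bool (snd e = z)))"

lemma excess_eq:
  assumes "finite E"
  shows "excess E g z = (\<Sum>e\<in>{e\<in>E. fst e = z}. g e) - (\<Sum>e\<in>{e\<in>E. snd e = z}. g e)"
  using assms unfolding excess_def
  by (simp add: sum.inter_filter[symmetric] right_diff_distrib sum_subtractf of_bool_def
      if_distrib[of "\<lambda>x. _ * x"] cong: if_cong)

lemma flow_value_excess: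
  "finite (parcs G) \<Longrightarrow> flow_value G s g = excess (parcs G) g s"
  by (simp add: flow_value_def excess_eq in_arcs_def out_arcs_def)

lemma is_flow_excess:
  assumes "finite (parcs G)"
  shows "is_flow G s t g \<longleftrightarrow>
    (\<forall>e\<in>parcs G. g e \<ge> 0) \<and> (\<forall>z\<in>pverts G - {s, t}. excess (parcs G) g z = 0)"
  using assms unfolding is_flow_def excess_eq[OF assms] in_arcs_def out_arcs_def
  by (simp add: eq_commute[of "sum g {e \<in> parcs G. fst e = _}"])

lemma pcas_append: "pcas u (P @ Q) v \<longleftrightarrow> (\<exists>w. pcas u P w \<and> pcas w Q v)"
  by (induction P arbitrary: u) auto

lemma pawalk_verts_split:
  assumes "pcas u P v" "z \<in> set (pawalk_verts u P)"
  obtains P1 P2 where "P = P1 @ P2" "pcas u P1 z" "pcas z P2 v"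
  using assms
proof (induction P arbitrary: u thesis)
  case Nil
  from Nil.prems(1)[of "[]" "[]"] Nil.prems(2,3) show ?case by simp
next
  case (Cons e P)
  show ?case
  proof (cases "z = u")
    case True
    with Cons.prems(1)[of "[]" "e # P"] Cons.prems(2) show ?thesis by simp
  next
    case False
    with Cons.prems have "pcas (snd e) P v" "z \<in> set (pawalk_verts (snd e) P)" by auto
    then obtain P1 P2 where "P = P1 @ P2" "pcas (snd e) P1 z" "pcas z P2 v"
      using Cons.IH by blast
    with Cons.prems(1)[of "e # P1" P2] Cons.prems(2) show ?thesis by simp
  qed
qed

lemma distinct_pawalk_verts_suffix:
  assumes "pcas u (P @ Q) v" "pcas u P w" "distinct (pawalk_verts u (P @ Q))"
  shows "distinct (pawalk_verts w Q)"
  using assms by (induction P arbitrary: u) auto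

text \<open>Shortcutting: when the new first vertex already lies on the simple walk obtained for the
  rest, the part before that occurrence is cut off.\<close>

lemma pcas_simple:
  assumes "pcas u P v"
  obtains Q where "pcas u Q v" "set Q \<subseteq> set P" "distinct (pawalk_verts u Q)"
  using assms
proof (induction P arbitrary: u thesis)
  case Nil
  from Nil.prems(1)[of "[]"] Nil.prems(2) show ?case by simp
next
  case (Cons e P)
  then obtain Q where Q: "pcas (snd e) Q v" "set Q \<subseteq> set P" "distinct (pawalk_verts (snd e) Q)"
    by (metis pcas.simps(2))
  show ?case
  proof (cases "u \<in> set (pawalk_verts (snd e) Q)")
    case True
    with Q(1) obtain Q1 Q2 where Q12: "Q = Q1 @ Q2" "pcas (snd e) Q1 u" "pcas u Q2 v"
      by (auto elim: pawalk_verts_split)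
    have "distinct (pawalk_verts u Q2)"
      using distinct_pawalk_verts_suffix[of "snd e" Q1 Q2 v u] Q Q12 by simp
    with Cons.prems(1)[of Q2] Q Q12 show ?thesis by auto
  next
    case False
    with Cons.prems(1)[of "e # Q"] Cons.prems(2) Q show ?thesis by auto
  qed
qed

lemma length_pawalk_verts: "length (pawalk_verts u P) = Suc (length P)"
  by (induction P arbitrary: u) auto

lemma distinct_arcs_of_pawalk_verts:
  "pcas u P v \<Longrightarrow> distinct (pawalk_verts u P) \<Longrightarrow> distinct P"
proof (induction P arbitrary: u)
  case (Cons e P)
  have "fst e' \<in> set (pawalk_verts w P)" if "e' \<in> set P" for e' w
    using that by (induction P arbitrary: w) auto
  from this[of e "snd e"] have "e \<notin> set P" using Cons.prems by auto
  moreover have "distinct P" using Cons.IH[of "snd e"] Cons.prems by simp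
  ultimately show ?case by simp
qed simp

lemma excess_path:
  assumes "pcas s P t" "distinct P" "set P \<subseteq> E" "finite E"
  shows "excess E (\<lambda>e. of_bool (e \<in> set P)) z = of_bool (z = s) - of_bool (z = t)"
proof -
  have "excess E (\<lambda>e. of_bool (e \<in> set P)) z =
      (\<Sum>e\<in>set P. of_bool (fst e = z) - of_bool (snd e = z))"
    unfolding excess_def using assms by (intro sum.mono_neutral_cong_right) auto
  also have "\<dots> = (\<Sum>e\<leftarrow>P. of_bool (fst e = z) - of_bool (snd e = z))"
    using assms(2) by (simp add: sum_list_distinct_conv_sum_set)
  also have "\<dots> = of_bool (z = s) - of_bool (z = t)"
    using assms(1) by (induction P arbitrary: s) auto
  finally show ?thesis .
qed

text \<open>Cut argument. If \<open>t\<close> were not reachable from \<open>s\<close> along arcs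
  with positive flow, the net outflow of the reachable set would be the excess of \<open>s\<close>
  alone, hence positive, although no positive arc leaves that set.\<close>

lemma flow_path:
  fixes g :: "nat \<times> nat \<Rightarrow> real"
  assumes fin: "finite E" and nonneg: "\<And>e. e \<in> E \<Longrightarrow> g e \<ge> 0"
    and cons: "\<And>z. z \<noteq> s \<Longrightarrow> z \<noteq> t \<Longrightarrow> excess E g z = 0" and pos: "excess E g s > 0"
  obtains P where "pcas s P t" "set P \<subseteq> {e\<in>E. g e > 0}" "distinct (pawalk_verts s P)"
proof -
  define S where "S = {e\<in>E. g e > 0}"
  define R where "R = {z. \<exists>P. pcas s P z \<and> set P \<subseteq> S}"
  have "t \<in> R"
  proof (rule ccontr)
    assume "t \<notin> R"
    \<comment> \<open>Restricting to \<open>s\<close> and the end vertices of arcs makes the set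
      finite, so that excesses can be summed over it.\<close>
    define V where "V = R \<inter> (fst ` E \<union> snd ` E \<union> {s})"
    have "s \<in> R" unfolding R_def by (auto intro: exI[of _ "[]"])
    have closed: "snd e \<in> R" if "e \<in> S" "fst e \<in> R" for e
    proof -
      from that(2) obtain P where "pcas s P (fst e)" "set P \<subseteq> S" by (auto simp: R_def)
      with that(1) have "pcas s (P @ [e]) (snd e)" "set (P @ [e]) \<subseteq> S"
        by (auto simp: pcas_append)
      then show ?thesis unfolding R_def by blast
    qed
    have finV: "finite V" using fin by (simp add: V_def)
    have "(\<Sum>z\<in>V. excess E g z) = (\<Sum>z\<in>{s}. excess E g z)"
      using \<open>s \<in> R\<close> \<open>t \<notin> R\<close> finV cons by (intro sum.mono_neutral_right) (auto simp: V_def)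
    moreover have "(\<Sum>z\<in>V. excess E g z) =
        (\<Sum>e\<in>E. g e * (of_bool (fst e \<in> V) - of_bool (snd e \<in> V)))"
    proof -
      have "(\<Sum>z\<in>V. of_bool (y = z)) = (of_bool (y \<in> V) :: real)" for y
        using finV by (simp add: of_bool_def)
      then show ?thesis
        unfolding excess_def
        by (subst sum.swap) (simp add: sum_distrib_left[symmetric] sum_subtractf)
    qed
    moreover have "(\<Sum>e\<in>E. g e * (of_bool (fst e \<in> V) - of_bool (snd e \<in> V))) \<le> 0"
    proof (rule sum_nonpos)
      fix e assume "e \<in> E"
      show "g e * (of_bool (fst e \<in> V) - of_bool (snd e \<in> V)) \<le> 0"
      proof (cases "g e > 0 \<and> fst e \<in> V")
        case True
        with \<open>e \<in> E\<close> closed[of e] have "snd e \<in> V" by (auto simp: V_def S_def)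
        with True show ?thesis by simp
      next
        case False
        with nonneg[OF \<open>e \<in> E\<close>] have "g e = 0 \<or> fst e \<notin> V" by auto
        with nonneg[OF \<open>e \<in> E\<close>] show ?thesis
          by (cases "fst e \<in> V"; cases "snd e \<in> V") simp_all
      qed
    qed
    ultimately show False using pos by simp
  qed
  then obtain P where "pcas s P t" "set P \<subseteq> S" by (auto simp: R_def)
  then obtain Q where "pcas s Q t" "set Q \<subseteq> S" "distinct (pawalk_verts s Q)"
    by (meson pcas_simple subset_trans)
  with that show thesis by (auto simp: S_def)
qed

text \<open>Each round subtracts the bottleneck of a path and thereby empties an arc, so the number
  of arcs carrying flow bounds the number of paths. Cycles are never extracted, which is why the
  paths load an arc only up to \<open>g e\<close> while their values add up exactly to the excess of
  \<open>s\<close>.\<close>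

lemma flow_decomposition:
  fixes g :: "nat \<times> nat \<Rightarrow> real"
  assumes fin: "finite E" and "\<And>e. e \<in> E \<Longrightarrow> g e \<ge> 0" and st: "s \<noteq> t"
    and "\<And>z. z \<noteq> s \<Longrightarrow> z \<noteq> t \<Longrightarrow> excess E g z = 0" and "excess E g s \<ge> 0"
  shows "\<exists>ps. length ps \<le> card {e\<in>E. g e > 0} \<and>
    (\<forall>(a, P)\<in>set ps. a \<ge> 0 \<and> pcas s P t \<and> set P \<subseteq> E \<and> distinct (pawalk_verts s P)) \<and>
    sum_list (map fst ps) = excess E g s \<and>
    (\<forall>e\<in>E. (\<Sum>(a, P)\<leftarrow>ps. if e \<in> set P then a else 0) \<le> g e)"
  using assms(2,4,5)
proof (induction "card {e\<in>E. g e > 0}" arbitrary: g rule: less_induct)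
  case less
  show ?case
  proof (cases "excess E g s = 0")
    case True
    then show ?thesis using less.prems by (intro exI[of _ "[]"]) auto
  next
    case False
    with less.prems have pos: "excess E g s > 0" by simp
    obtain P where P: "pcas s P t" "set P \<subseteq> {e\<in>E. g e > 0}" "distinct (pawalk_verts s P)"
      using flow_path[OF fin less.prems(1) less.prems(2) pos] by blast
    have "P \<noteq> []" using P(1) st by auto
    have dP: "distinct P" using distinct_arcs_of_pawalk_verts[OF P(1,3)] .
    define \<gamma> where "\<gamma> = Min (g ` set P)"
    have \<gamma>_le: "\<gamma> \<le> g e" if "e \<in> set P" for e
      using that by (auto simp: \<gamma>_def)
    have "\<gamma> \<in> g ` set P"
      unfolding \<gamma>_def using \<open>P \<noteq> []\<close> by (intro Min_in) auto
    then obtain e0 where e0: "e0 \<in> set P" "g e0 = \<gamma>" by auto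
    have "\<gamma> > 0" using e0 P by auto
    show ?thesis
    \<comment> \<open>Circulations can make the bottleneck exceed the remaining value. Then that
      value alone is routed, since subtracting the bottleneck would leave a negative excess.\<close>
    proof (cases "excess E g s \<le> \<gamma>")
      case True
      have "card {e\<in>E. g e > 0} > 0"
        using e0(1) P(2) fin by (auto simp: card_gt_0_iff simp del: Collect_empty_eq)
      with True show ?thesis
        using P \<gamma>_le pos less.prems
        by (intro exI[of _ "[(excess E g s, P)]"]) (auto intro: order_trans)
    next
      case False
      define g' where "g' e = g e - \<gamma> * of_bool (e \<in> set P)" for e
      have ex': "excess E g' z = excess E g z - \<gamma> * (of_bool (z = s) - of_bool (z = t))" for z
      proof -
        have "excess E g' z = excess E g z - \<gamma> * excess E (\<lambda>e. of_bool (e \<in> set P)) z"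
          unfolding excess_def g'_def
          by (simp add: sum_distrib_left left_diff_distrib sum_subtractf mult.assoc)
        with P dP fin show ?thesis
          by (subst (asm) excess_path[of s P t]) auto
      qed
      have g'_nonneg: "g' e \<ge> 0" if "e \<in> E" for e
        using \<gamma>_le[of e] less.prems(1)[OF that] by (auto simp: g'_def)
      have "{e\<in>E. g' e > 0} \<subset> {e\<in>E. g e > 0}"
        using e0 P \<open>\<gamma> > 0\<close> by (auto simp: g'_def of_bool_def split: if_splits)
      then have card: "card {e\<in>E. g' e > 0} < card {e\<in>E. g e > 0}"
        using fin by (intro psubset_card_mono) auto
      have "\<exists>ps. length ps \<le> card {e\<in>E. g' e > 0} \<and>
        (\<forall>(a, P)\<in>set ps. a \<ge> 0 \<and> pcas s P t \<and> set P \<subseteq> E \<and> distinct (pawalk_verts s P)) \<and>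
        sum_list (map fst ps) = excess E g' s \<and>
        (\<forall>e\<in>E. (\<Sum>(a, P)\<leftarrow>ps. if e \<in> set P then a else 0) \<le> g' e)"
      proof (rule less.hyps[OF card g'_nonneg])
        show "excess E g' z = 0" if "z \<noteq> s" "z \<noteq> t" for z
          using less.prems(2) that by (simp add: ex')
        show "0 \<le> excess E g' s"
          using False st by (simp add: ex')
      qed
      then obtain ps where ps: "length ps \<le> card {e\<in>E. g' e > 0}"
        "\<forall>(a, P)\<in>set ps. a \<ge> 0 \<and> pcas s P t \<and> set P \<subseteq> E \<and> distinct (pawalk_verts s P)"
        "sum_list (map fst ps) = excess E g' s"
        "\<forall>e\<in>E. (\<Sum>(a, P)\<leftarrow>ps. if e \<in> set P then a else 0) \<le> g' e" by blast
      have "(\<Sum>(a, P)\<leftarrow>(\<gamma>, P) # ps. if e \<in> set P then a else 0) \<le> g e" if "e \<in> E" for e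
        using ps(4) that by (auto simp: g'_def of_bool_def split: if_splits)
      with ps P card \<open>\<gamma> > 0\<close> st show ?thesis
        by (intro exI[of _ "(\<gamma>, P) # ps"]) (auto simp: ex')
    qed
  qed
qed

section \<open>Existence of a maximum throughput and bounds on it\<close>

lemma compact_PiE_UNIV:
  fixes S :: "'a \<Rightarrow> 'b::topological_space set"
  assumes "\<And>i. compact (S i)"
  shows "compact (PiE UNIV S)"
proof -
  have "compactin (product_topology (\<lambda>_. euclidean) UNIV) (PiE UNIV S)"
    using assms by (simp add: compactin_PiE)
  then show ?thesis unfolding euclidean_product_topology compactin_euclidean_iff .
qed
definition routable :: "mcf_instance \<Rightarrow> real \<Rightarrow> bool" where
  "routable I l \<longleftrightarrow> (\<exists>f. feasible_mcf I f \<and>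
     (\<forall>i<num_com I. flow_value (graph I) (source I i) (f i) = l * demand I i))"

locale valid_mcf =
  fixes I :: mcf_instance
  assumes valid: "valid_instance I"
begin

abbreviation "V \<equiv> pverts (graph I)"
abbreviation "E \<equiv> parcs (graph I)"
abbreviation "u \<equiv> capacity I"
abbreviation "k \<equiv> num_com I"
abbreviation "d \<equiv> demand I"
abbreviation "src \<equiv> source I"
abbreviation "snk \<equiv> sink I"

lemma finE: "finite E" and finV: "finite V"
  using valid by (auto simp: valid_instance_def pair_fin_digraph_def pair_fin_digraph_axioms_def)

lemma arcsV: "e \<in> E \<Longrightarrow> fst e \<in> V" "e \<in> E \<Longrightarrow> snd e \<in> V"
  using valid pair_wf_digraph.arc_fst_in_verts[of "graph I" e] pair_wf_digraph.arc_snd_in_verts[of "graph I" e]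
  unfolding valid_instance_def pair_fin_digraph_def by blast+

lemma u_ge_1: "e \<in> E \<Longrightarrow> u e \<ge> 1"
proof -
  assume "e \<in> E"
  then have "Min (u ` E) \<le> u e" using finE by simp
  with valid show ?thesis by (simp add: valid_instance_def)
qed

lemma k_pos: "k \<ge> 1" and d_pos: "i < k \<Longrightarrow> d i > 0" and src_snk: "i < k \<Longrightarrow> src i \<noteq> snk i"
  and srcV: "i < k \<Longrightarrow> src i \<in> V" and snkV: "i < k \<Longrightarrow> snk i \<in> V"
  using valid by (auto simp: valid_instance_def)

lemma excess_outside: "z \<notin> V \<Longrightarrow> excess E g z = 0"
  unfolding excess_def using arcsV by (intro sum.neutral) auto

lemma feasible_mcf_iff:
  "feasible_mcf I f \<longleftrightarrow>
     (\<forall>i<k. (\<forall>e\<in>E. f i e \<ge> 0) \<and> (\<forall>z. z \<noteq> src i \<longrightarrow> z \<noteq> snk i \<longrightarrow> excess E (f i) z = 0)) \<and>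
     (\<forall>e\<in>E. (\<Sum>i<k. f i e) \<le> u e)"
  unfolding feasible_mcf_def is_flow_excess[OF finE] using excess_outside by blast

lemma value_eq: "flow_value (graph I) s g = excess E g s"
  by (rule flow_value_excess[OF finE])

lemma excess_cmult: "excess E (\<lambda>e. c * g e) z = c * excess E g z"
  by (simp add: excess_def sum_distrib_left mult.assoc)

lemma excess_cong: "(\<And>e. e \<in> E \<Longrightarrow> g e = h e) \<Longrightarrow> excess E g z = excess E h z"
  unfolding excess_def by (intro sum.cong) auto

text \<open>The feasible flows form a compact set on which the throughput is continuous. Without
  attainment, \<open>GREATEST\<close> in \<open>max_throughput\<close> would carry no
  information.\<close>

lemma max_routable: "\<exists>l. routable I l \<and> (\<forall>l'. routable I l' \<longrightarrow> l' \<le> l)"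
proof -
  \<comment> \<open>Coordinates that belong to no commodity or no arc are pinned to zero, so the
    whole function space is cut down to a product of compact intervals.\<close>
  define S where "S = (\<lambda>(i, e). if i < k \<and> e \<in> E then {0..u e} else {0 :: real})"
  define C where "C = PiE UNIV S"
  \<comment> \<open>The last family of constraints eliminates the throughput by cross-multiplication
    with commodity 0, which leaves closed conditions on the flow alone.\<close>
  define Z where "Z = C \<inter> (\<Inter>i\<in>{..<k}. \<Inter>z\<in>- {src i, snk i}. {f. excess E (\<lambda>e. f (i, e)) z = 0})
     \<inter> (\<Inter>e\<in>E. {f. (\<Sum>i<k. f (i, e)) \<le> u e})
     \<inter> (\<Inter>i\<in>{..<k}. {f. excess E (\<lambda>e. f (i, e)) (src i) * d 0 =
                            excess E (\<lambda>e. f (0, e)) (src 0) * d i})"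
  have "compact C"
    unfolding C_def by (rule compact_PiE_UNIV) (simp add: S_def split: prod.split)
  have ex_cont: "continuous_on UNIV (\<lambda>f :: nat \<times> nat \<times> nat \<Rightarrow> real. excess E (\<lambda>e. f (i, e)) z)" for i z
    unfolding excess_def by (intro continuous_intros continuous_on_product_coordinates)
  have "compact Z"
    unfolding Z_def using \<open>compact C\<close>
    by (intro compact_Int_closed closed_INT ballI closed_Collect_eq closed_Collect_le
        continuous_intros ex_cont continuous_on_product_coordinates)
  define val where "val f = excess E (\<lambda>e. f (0, e)) (src 0) / d 0"
    for f :: "nat \<times> nat \<times> nat \<Rightarrow> real"
  have k0: "0 < k" using k_pos by simp
  have d0: "d 0 > 0" using d_pos[OF k0] .
  have "continuous_on Z val"
    unfolding val_def using d0
    by (intro continuous_intros continuous_on_subset[OF ex_cont]) auto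
  then have "compact (val ` Z)"
    using \<open>compact Z\<close> compact_continuous_image by blast
  moreover have "(\<lambda>_. 0) \<in> Z"
  proof -
    have "0 \<le> u e" if "e \<in> E" for e using u_ge_1[OF that] by simp
    then show ?thesis by (auto simp: Z_def C_def S_def excess_def)
  qed
  ultimately obtain l where l: "l \<in> val ` Z" "\<forall>l'\<in>val ` Z. l' \<le> l"
    using compact_attains_sup[of "val ` Z"] by blast
  have *: "routable I l' \<longleftrightarrow> l' \<in> val ` Z" for l'
  proof
    assume "routable I l'"
    then obtain f where f: "feasible_mcf I f" "\<And>i. i < k \<Longrightarrow> excess E (f i) (src i) = l' * d i"
      by (auto simp: routable_def value_eq)
    define f' where "f' = (\<lambda>(i, e). if i < k \<and> e \<in> E then f i e else 0)"
    have ex: "excess E (\<lambda>e. f' (i, e)) z = excess E (f i) z" if "i < k" for i z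
      using that by (intro excess_cong) (auto simp: f'_def)
    have "f i e \<le> u e" if "i < k" "e \<in> E" for i e
    proof -
      have "f i e \<le> (\<Sum>i<k. f i e)"
        using that f(1) by (intro member_le_sum) (auto simp: feasible_mcf_iff)
      with that f(1) show ?thesis by (auto simp: feasible_mcf_iff)
    qed
    then have "f' \<in> C" using f(1) by (auto simp: C_def S_def f'_def feasible_mcf_iff split: if_splits)
    moreover have "(\<Sum>i<k. f' (i, e)) \<le> u e" if "e \<in> E" for e
      using f(1) that by (auto simp: feasible_mcf_iff f'_def)
    ultimately have "f' \<in> Z"
      using f k0 by (auto simp: Z_def ex feasible_mcf_iff)
    moreover have "val f' = l'" using f(2)[OF k0] d0 k0 by (simp add: val_def ex)
    ultimately show "l' \<in> val ` Z" by blast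
  next
    assume "l' \<in> val ` Z"
    then obtain f where f: "f \<in> Z" "l' = val f" by blast
    have "f (i, e) \<ge> 0" if "i < k" "e \<in> E" for i e
    proof -
      have "f (i, e) \<in> S (i, e)" using f(1) by (auto simp: Z_def C_def)
      with that show ?thesis by (simp add: S_def)
    qed
    then have "feasible_mcf I (\<lambda>i e. f (i, e))"
      using f(1) by (auto simp: feasible_mcf_iff Z_def)
    moreover have "excess E (\<lambda>e. f (i, e)) (src i) = l' * d i" if "i < k" for i
    proof -
      have "excess E (\<lambda>e. f (i, e)) (src i) * d 0 = excess E (\<lambda>e. f (0, e)) (src 0) * d i"
        using f(1) that by (auto simp: Z_def)
      then have "excess E (\<lambda>e. f (i, e)) (src i) = excess E (\<lambda>e. f (0, e)) (src 0) * d i / d 0"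
        using d0 by (simp add: eq_divide_eq)
      with f(2) show ?thesis by (simp add: val_def)
    qed
    ultimately show "routable I l'"
      unfolding routable_def value_eq by (intro exI[of _ "\<lambda>i e. f (i, e)"]) auto
  qed
  from l show ?thesis by (auto simp: * simp del: image_iff)
qed

lemma routable_max_throughput: "routable I (max_throughput I)"
  and routable_le_max_throughput: "routable I l \<Longrightarrow> l \<le> max_throughput I"
proof -
  have *: "max_throughput I = Greatest (routable I)"
    unfolding max_throughput_def routable_def ..
  obtain l where "routable I l" "\<forall>l'. routable I l' \<longrightarrow> l' \<le> l" using max_routable by blast
  then have "routable I (max_throughput I) \<and> (\<forall>l'. routable I l' \<longrightarrow> l' \<le> max_throughput I)"
    unfolding * using Greatest_equality[of "routable I" l] by auto
  then show "routable I (max_throughput I)" "routable I l \<Longrightarrow> l \<le> max_throughput I" for l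
    by auto
qed

text \<open>The definition of throughput asks for exact multiples of the demands; a flow that
  overshoots is scaled down commodity by commodity, which preserves feasibility because the factors
  are at most 1.\<close>

lemma le_max_throughput:
  assumes "feasible_mcf I f" "l \<ge> 0" "\<And>i. i < k \<Longrightarrow> excess E (f i) (src i) \<ge> l * d i"
  shows "l \<le> max_throughput I"
proof (rule routable_le_max_throughput)
  define c where "c i = (if l = 0 then 0 else l * d i / excess E (f i) (src i))" for i
  have c: "0 \<le> c i \<and> c i \<le> 1 \<and> c i * excess E (f i) (src i) = l * d i" if "i < k" for i
  proof (cases "l = 0")
    case False
    with assms(2) d_pos[OF that] have "l * d i > 0" by simp
    with assms(3)[OF that] False show ?thesis by (simp add: c_def)
  qed (simp add: c_def)
  have "(\<Sum>i<k. c i * f i e) \<le> u e" if "e \<in> E" for e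
  proof -
    have "(\<Sum>i<k. c i * f i e) \<le> (\<Sum>i<k. f i e)"
      using c assms(1) that by (intro sum_mono mult_left_le_one_le) (auto simp: feasible_mcf_iff)
    with assms(1) that show ?thesis by (auto simp: feasible_mcf_iff)
  qed
  then have "feasible_mcf I (\<lambda>i e. c i * f i e)"
    using assms(1) c by (auto simp: feasible_mcf_iff excess_cmult)
  then show "routable I l"
    unfolding routable_def value_eq excess_cmult using c
    by (intro exI[of _ "\<lambda>i e. c i * f i e"]) (auto simp: excess_cmult)
qed

lemma max_throughput_nonneg: "max_throughput I \<ge> 0"
proof (rule le_max_throughput[where f = "\<lambda>_ _. 0"])
  have "0 \<le> u e" if "e \<in> E" for e using u_ge_1[OF that] by simp
  then show "feasible_mcf I (\<lambda>_ _. 0)"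
    by (auto simp: feasible_mcf_iff excess_def)
qed (auto simp: excess_def)

text \<open>Path decomposition of an optimal flow. The bound on the number of paths per commodity
  serves the union bound over sampling failures.\<close>

lemma max_throughput_paths:
  obtains ps where
    "\<And>i. i < k \<Longrightarrow> length (ps i) \<le> card E"
    "\<And>i a P. i < k \<Longrightarrow> (a, P) \<in> set (ps i) \<Longrightarrow>
       a \<ge> 0 \<and> pcas (src i) P (snk i) \<and> set P \<subseteq> E \<and> distinct (pawalk_verts (src i) P)"
    "\<And>i. i < k \<Longrightarrow> sum_list (map fst (ps i)) = max_throughput I * d i"
    "\<And>e. e \<in> E \<Longrightarrow> (\<Sum>i<k. \<Sum>(a, P)\<leftarrow>ps i. if e \<in> set P then a else 0) \<le> u e"
proof -
  obtain f where f: "feasible_mcf I f"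
    "\<And>i. i < k \<Longrightarrow> excess E (f i) (src i) = max_throughput I * d i"
    using routable_max_throughput by (auto simp: routable_def value_eq)
  define Q where "Q i ps \<longleftrightarrow> length ps \<le> card {e\<in>E. f i e > 0} \<and>
    (\<forall>(a, P)\<in>set ps. a \<ge> 0 \<and> pcas (src i) P (snk i) \<and> set P \<subseteq> E \<and> distinct (pawalk_verts (src i) P)) \<and>
    sum_list (map fst ps) = excess E (f i) (src i) \<and>
    (\<forall>e\<in>E. (\<Sum>(a, P)\<leftarrow>ps. if e \<in> set P then a else 0) \<le> f i e)" for i ps
  have "\<exists>ps. Q i ps" if "i < k" for i
    unfolding Q_def
    using f(1) that src_snk[OF that] f(2)[OF that] max_throughput_nonneg d_pos[OF that]
    by (intro flow_decomposition finE) (auto simp: feasible_mcf_iff)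
  then obtain ps where Q: "\<And>i. i < k \<Longrightarrow> Q i (ps i)" by metis
  note ps = Q[unfolded Q_def]
  show thesis
  proof (rule that[of ps])
    fix i assume "i < k"
    have "card {e\<in>E. f i e > 0} \<le> card E" using finE by (intro card_mono) auto
    with ps[OF \<open>i < k\<close>] show "length (ps i) \<le> card E" by linarith
    show "sum_list (map fst (ps i)) = max_throughput I * d i"
      using ps f(2) \<open>i < k\<close> by simp
  next
    fix e assume "e \<in> E"
    then have "(\<Sum>i<k. \<Sum>(a, P)\<leftarrow>ps i. if e \<in> set P then a else 0) \<le> (\<Sum>i<k. f i e)"
      using ps by (intro sum_mono) auto
    with f(1) \<open>e \<in> E\<close> show "(\<Sum>i<k. \<Sum>(a, P)\<leftarrow>ps i. if e \<in> set P then a else 0) \<le> u e"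
      by (auto simp: feasible_mcf_iff)
  next
    fix i a P assume "i < k" "(a, P) \<in> set (ps i)"
    with ps show "a \<ge> 0 \<and> pcas (src i) P (snk i) \<and> set P \<subseteq> E \<and> distinct (pawalk_verts (src i) P)"
      by blast
  qed
qed

text \<open>A positive optimum supplies a path for every commodity. Sending
  \<open>d i / (k * D)\<close> along it loads no arc by more than 1, the minimum capacity. The bound
  calibrates the amount shipped in round 0.\<close>

lemma max_throughput_lower:
  assumes pos: "max_throughput I > 0" and D: "\<And>i. i < k \<Longrightarrow> d i \<le> D"
  shows "1 / (real k * D) \<le> max_throughput I"
proof -
  obtain ps where ps: "\<And>i a P. i < k \<Longrightarrow> (a, P) \<in> set (ps i) \<Longrightarrow>
       a \<ge> 0 \<and> pcas (src i) P (snk i) \<and> set P \<subseteq> E \<and> distinct (pawalk_verts (src i) P)"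
    "\<And>i. i < k \<Longrightarrow> sum_list (map fst (ps i)) = max_throughput I * d i"
    using max_throughput_paths by metis
  have "\<exists>P. pcas (src i) P (snk i) \<and> set P \<subseteq> E \<and> distinct (pawalk_verts (src i) P)" if "i < k" for i
  proof -
    have "ps i \<noteq> []" using ps(2)[OF that] pos d_pos[OF that] by auto
    then obtain a P where "(a, P) \<in> set (ps i)" by (cases "ps i") auto
    with ps(1) that show ?thesis by blast
  qed
  then obtain P where P: "\<And>i. i < k \<Longrightarrow> pcas (src i) (P i) (snk i) \<and> set (P i) \<subseteq> E \<and>
      distinct (pawalk_verts (src i) (P i))" by metis
  have Dpos: "D > 0" using D[of 0] d_pos[of 0] k_pos by force
  define f where "f i e = d i / (real k * D) * of_bool (e \<in> set (P i))" for i e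
  have ex: "excess E (f i) z = d i / (real k * D) * (of_bool (z = src i) - of_bool (z = snk i))"
    if "i < k" for i z
    using excess_path[of "src i" "P i" "snk i" E z] P[OF that] distinct_arcs_of_pawalk_verts finE
    unfolding f_def excess_cmult by metis
  show ?thesis
  proof (rule le_max_throughput[where f = f])
    have "(\<Sum>i<k. f i e) \<le> u e" if "e \<in> E" for e
    proof -
      have "f i e \<le> 1 / real k" if "i < k" for i
        using D[OF that] d_pos[OF that] Dpos k_pos by (auto simp: f_def of_bool_def field_simps)
      then have "(\<Sum>i<k. f i e) \<le> (\<Sum>i<k. 1 / real k)" by (intro sum_mono) auto
      with u_ge_1[OF that] k_pos show ?thesis by simp
    qed
    then show "feasible_mcf I f"
      using Dpos d_pos by (auto simp: feasible_mcf_iff ex less_imp_le) (auto simp: f_def less_imp_le)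
  qed (use Dpos k_pos src_snk in \<open>auto simp: ex\<close>)
qed

end

section \<open>Memory layout and label potential\<close>

fun block :: "program list \<Rightarrow> program" where
  "block [] = Skip"
| "block (P # Ps) = Seq P (block Ps)"

text \<open>
  Registers 0, 1, 2 and arrays 0, 1, 2, 3 are fixed by the input convention; the output flow is
  real array 2.
\<close>

abbreviation (input) "n_reg \<equiv> 0 :: nat"
abbreviation (input) "m_reg \<equiv> 1 :: nat"
abbreviation (input) "k_reg \<equiv> 2 :: nat"
abbreviation (input) "one_reg \<equiv> 3 :: nat"
abbreviation (input) "zero_reg \<equiv> 4 :: nat"
abbreviation (input) "B_reg \<equiv> 5 :: nat"
abbreviation (input) "N_reg \<equiv> 6 :: nat"
abbreviation (input) "K_reg \<equiv> 7 :: nat"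
abbreviation (input) "nn_reg \<equiv> 8 :: nat"
abbreviation (input) "c_reg \<equiv> 9 :: nat"
abbreviation (input) "base_reg \<equiv> 10 :: nat"
abbreviation (input) "x_reg \<equiv> 11 :: nat"
abbreviation (input) "sp_reg \<equiv> 13 :: nat"
abbreviation (input) "id_reg \<equiv> 14 :: nat"
abbreviation (input) "g_reg \<equiv> 15 :: nat"
abbreviation (input) "y_reg \<equiv> 16 :: nat"
abbreviation (input) "e_reg \<equiv> 17 :: nat"
abbreviation (input) "i_reg \<equiv> 18 :: nat"
abbreviation (input) "done_reg \<equiv> 19 :: nat"
abbreviation (input) "t_reg \<equiv> 20 :: nat"
abbreviation (input) "T_reg \<equiv> 21 :: nat"
abbreviation (input) "a_reg \<equiv> 23 :: nat"
abbreviation (input) "b_reg \<equiv> 24 :: nat"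
abbreviation (input) "z_reg \<equiv> 25 :: nat"
abbreviation (input) "p_reg \<equiv> 26 :: nat"
abbreviation (input) "mm_reg \<equiv> 28 :: nat"
abbreviation (input) "wsp_reg \<equiv> 29 :: nat"
abbreviation (input) "v_reg \<equiv> 30 :: nat"
abbreviation (input) "v2_reg \<equiv> 31 :: nat"
abbreviation (input) "cc_reg \<equiv> 32 :: nat"
abbreviation (input) "ue_reg \<equiv> 33 :: nat"

abbreviation (input) "one_rr \<equiv> 1 :: nat"
abbreviation (input) "zero_rr \<equiv> 2 :: nat"
abbreviation (input) "kappa_rr \<equiv> 3 :: nat"
abbreviation (input) "kappa1_rr \<equiv> 4 :: nat"
abbreviation (input) "q_rr \<equiv> 5 :: nat"
abbreviation (input) "theta_rr \<equiv> 6 :: nat"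
abbreviation (input) "L_rr \<equiv> 7 :: nat"
abbreviation (input) "a_rr \<equiv> 8 :: nat"
abbreviation (input) "b_rr \<equiv> 9 :: nat"
abbreviation (input) "d0_rr \<equiv> 10 :: nat"
abbreviation (input) "Theta_rr \<equiv> 11 :: nat"
abbreviation (input) "rem_rr \<equiv> 12 :: nat"
abbreviation (input) "sigma_rr \<equiv> 13 :: nat"
abbreviation (input) "gamma_rr \<equiv> 14 :: nat"
abbreviation (input) "T_rr \<equiv> 15 :: nat"
abbreviation (input) "KN_rr \<equiv> 16 :: nat"
abbreviation (input) "fac_rr \<equiv> 17 :: nat"
abbreviation (input) "delta_rr \<equiv> 18 :: nat"
abbreviation (input) "U_rr \<equiv> 19 :: nat"
abbreviation (input) "D_rr \<equiv> 20 :: nat"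
abbreviation (input) "c_rr \<equiv> 21 :: nat"

abbreviation (input) "tail_arr \<equiv> 0 :: nat"
abbreviation (input) "head_arr \<equiv> 1 :: nat"
abbreviation (input) "source_arr \<equiv> 2 :: nat"
abbreviation (input) "sink_arr \<equiv> 3 :: nat"
abbreviation (input) "cent_arr \<equiv> 4 :: nat"
abbreviation (input) "nxt_arr \<equiv> 5 :: nat"
abbreviation (input) "first_arr \<equiv> 6 :: nat"
abbreviation (input) "tgt_arr \<equiv> 7 :: nat"
abbreviation (input) "und_arr \<equiv> 8 :: nat"
abbreviation (input) "cur_arr \<equiv> 9 :: nat"
abbreviation (input) "work_arr \<equiv> 10 :: nat"
abbreviation (input) "estack_arr \<equiv> 11 :: nat"

abbreviation (input) "cap_rarr \<equiv> 0 :: nat"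
abbreviation (input) "demand_rarr \<equiv> 1 :: nat"
abbreviation (input) "flow_rarr \<equiv> 2 :: nat"
abbreviation (input) "w_rarr \<equiv> 3 :: nat"
abbreviation (input) "lab_rarr \<equiv> 4 :: nat"
abbreviation (input) "theta_rarr \<equiv> 5 :: nat"
abbreviation (input) "wr_rarr \<equiv> 6 :: nat"

section \<open>Label search and walks as programs\<close>

definition scan_step :: program where
  "scan_step = block [
     NLoad y_reg tgt_arr id_reg,
     Cond (NLess y_reg n_reg) (NArith NAdd y_reg y_reg n_reg) (NArith NSub y_reg y_reg n_reg),
     NStore work_arr wsp_reg y_reg,
     NArith NAdd wsp_reg wsp_reg one_reg,
     NLoad id_reg nxt_arr id_reg]"

text \<open>Pushes the tails of all arcs entering the vertex in \<open>x_reg\<close>. Lists of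
  incoming arcs are not stored; they are read from the outgoing list of the mirror image in the
  other half of the graph, and every head found there is mirrored back.\<close>

definition scan :: program where
  "scan = block [
     Cond (NLess x_reg n_reg) (NArith NAdd y_reg x_reg n_reg) (NArith NSub y_reg x_reg n_reg),
     NLoad id_reg first_arr y_reg,
     While (NLess zero_reg id_reg) scan_step]"

text \<open>Decremental shortest paths in the style of Even and Shiloach, with a current-arc cursor
  per vertex. The top worklist entry is dropped if its label exceeds the cut-off
  \<open>\<Theta>\<close>, if it is a root, or if its cursor arc is admissible; otherwise the cursor
  advances. At the end of the list the label is raised by the factor in \<open>q_rr\<close>, and at
  least to \<open>d0\<close>. After an advance or a raise the entry stays on the worklist.\<close>

definition fix_step :: program where
  "fix_step = block [
     NArith NSub a_reg wsp_reg one_reg,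
     NLoad x_reg work_arr a_reg,
     NArith NAdd g_reg base_reg x_reg,
     RLoad L_rr lab_rarr g_reg,
     Cond (RLess Theta_rr L_rr) (NArith NAdd wsp_reg a_reg zero_reg)
     (Cond (NEq x_reg v_reg) (NArith NAdd wsp_reg a_reg zero_reg)
     (Cond (NEq x_reg v2_reg) (NArith NAdd wsp_reg a_reg zero_reg) (block [
       NLoad id_reg cur_arr g_reg,
       Cond (NEq id_reg zero_reg)
         (block [
           RArith RMul L_rr L_rr q_rr,
           Cond (RLess L_rr d0_rr) (RArith RAdd L_rr d0_rr zero_rr) Skip,
           RStore lab_rarr g_reg L_rr,
           NLoad id_reg first_arr x_reg,
           NStore cur_arr g_reg id_reg,
           scan])
         (block [
           NLoad y_reg tgt_arr id_reg,
           NLoad e_reg und_arr id_reg,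
           RLoad a_rr wr_rarr e_reg,
           NArith NAdd z_reg base_reg y_reg,
           RLoad b_rr lab_rarr z_reg,
           RArith RAdd a_rr b_rr a_rr,
           Cond (RLeq a_rr L_rr)
             (NArith NAdd wsp_reg a_reg zero_reg)
             (block [NLoad id_reg nxt_arr id_reg, NStore cur_arr g_reg id_reg])])])))]"

definition fix_labels :: program where
  "fix_labels = While (NLess zero_reg wsp_reg) fix_step"

definition enter_center :: program where
  "enter_center = block [
     NArith NMul base_reg cc_reg nn_reg,
     NLoad v_reg cent_arr cc_reg,
     NArith NAdd v2_reg n_reg v_reg,
     NArith NAdd a_reg cc_reg one_reg,
     RofN q_rr a_reg,
     RArith RDiv q_rr q_rr KN_rr,
     RArith RAdd q_rr one_rr q_rr]"

text \<open>After an arc weight has risen, cursors pointing at one of the two copies of the arc may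
  have become inadmissible. Only the tails of the copies can own such cursors, so these two vertices
  form the initial worklist.\<close>

definition update_step :: program where
  "update_step = block [
     enter_center,
     NLoad x_reg tail_arr ue_reg,
     NStore work_arr zero_reg x_reg,
     NLoad x_reg head_arr ue_reg,
     NArith NAdd x_reg n_reg x_reg,
     NStore work_arr one_reg x_reg,
     NConst wsp_reg 2,
     fix_labels,
     NArith NAdd cc_reg cc_reg one_reg]"

definition update :: program where
  "update = block [
     NConst cc_reg 0,
     While (NLess cc_reg N_reg) update_step]"

text \<open>Only arc numbers are stacked. Both walks of an augmentation are appended to the same
  stack, so splicing them costs nothing.\<close>

definition walk_step :: program where
  "walk_step = block [
     NLoad id_reg cur_arr g_reg,
     NLoad e_reg und_arr id_reg,
     NStore estack_arr sp_reg e_reg,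
     NArith NAdd sp_reg sp_reg one_reg,
     NLoad x_reg tgt_arr id_reg,
     NArith NAdd g_reg base_reg x_reg,
     RLoad L_rr lab_rarr g_reg]"

definition walk :: program where
  "walk = block [
     NArith NAdd g_reg base_reg x_reg,
     RLoad L_rr lab_rarr g_reg,
     While (RLess zero_rr L_rr) walk_step]"

section \<open>Parameters, doubled graph and label invariant\<close>

definition bits :: "nat \<Rightarrow> nat" where
  "bits n = (LEAST b. n \<le> 2 ^ b)"

text \<open>The centres are a parameter: once they are drawn, the remainder of the program flips no
  coins. Everything proved in this locale holds for every sequence of centres.\<close>

locale mcf_run = valid_mcf +
  fixes es :: "(nat \<times> nat) list" and K :: nat and cent :: "nat \<Rightarrow> nat"
  assumes listing: "arc_listing I es" and K_pos: "K \<ge> 1"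
    and cent: "cent c < num_verts I"
begin

abbreviation "n \<equiv> num_verts I"
abbreviation "m \<equiv> num_arcs I"
definition "B = bits n"
text \<open>The factor 20 makes the probability of missing a fixed path at most
  \<open>exp (- 5 * B)\<close>.\<close>

definition "N = 20 * n * B"
text \<open>Chosen so that \<open>T * \<kappa> ^ 2 = B\<close>: the loss
  \<open>ln m \<le> 2 * B\<close> in the final comparison is then a fraction of about
  \<open>2 * \<kappa>\<close> of the main term \<open>T * ln (1 + \<kappa>)\<close>.\<close>

definition "T = K * K * B"
text \<open>An arc weight times its capacity starts at \<open>\<delta>\<close> and ends at most at
  \<open>(1 + \<kappa>) ^ 2\<close>, a growth by at most \<open>T + 2\<close> powers of
  \<open>1 + \<kappa>\<close>. The same number bounds the factor by which unscaled flow overloads an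
  arc.\<close>

definition "T' = real T + 2"
definition "\<kappa> = 1 / real K"
definition "q c = 1 + real (Suc c) / (real K * real N)" for c :: nat
definition "\<delta> = 1 / (1 + \<kappa>) ^ T"
definition "U = max_capacity I"
text \<open>The smallest initial arc weight; it is also the lowest nonzero label and the initial
  search threshold.\<close>

definition "d0 = \<delta> / U"
text \<open>With favourable centres the search thresholds stay at most \<open>2 * m\<close>, so this
  cut-off never ends a good run. Labels above it are no longer repaired, which limits the number of
  raises.\<close>

definition "\<Theta> = 4 * real m"
definition "tail_of j = fst (es ! j)"
definition "head_of j = snd (es ! j)"
definition "cap j = u (es ! j)"

text \<open>
  The search works in a graph on \<open>2 * n\<close> vertices, with arcs numbered from 1: the copy \<open>r \<le> m\<close>
  of an arc leads forwards on the vertices below \<open>n\<close>, the copy \<open>r > m\<close> leads backwards on the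
  vertices from \<open>n\<close> on. The cursor value 0 stands for the end of an adjacency list.
\<close>

definition "und r = (if r \<le> m then r - 1 else r - 1 - m)"
definition "usrc r = (if r \<le> m then tail_of (und r) else n + head_of (und r))"
definition "utgt r = (if r \<le> m then head_of (und r) else n + tail_of (und r))"
text \<open>Adjacency lists are threaded by decreasing arc number: this is the successor of
  \<open>b\<close> in the list of \<open>x\<close>, and the head of the list for
  \<open>b = 2 * m + 1\<close>.\<close>

definition "prev_arc x b = Max (insert 0 {r. 1 \<le> r \<and> r < b \<and> usrc r = x})"
definition "cell c x = c * (2 * n) + x"

definition "deg x = card {r\<in>{1..2 * m}. usrc r = x}"
definition "rest x b = card {r\<in>{1..b}. usrc r = x}"
definition "cnt c l = (if l = 0 then 0 else 1 + ln (l / d0) / ln (q c))"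
definition "cnt_max c = 2 + ln (\<Theta> / d0) / ln (q c)"
text \<open>Only vertices that carry an arc or a terminal, so that a sweep costs
  \<open>m + k\<close> rather than \<open>n\<close>. Sources are needed in the forward half and
  sinks in the backward half.\<close>

definition "verts2 = usrc ` {1..2 * m} \<union> utgt ` {1..2 * m} \<union> src ` {..<k} \<union> (\<lambda>i. n + snk i) ` {..<k}"
definition "mir x = (if x < n then x + n else x - n)" for x :: nat

text \<open>
  A label of value \<open>l\<close> has been raised \<open>cnt c l\<close> times. Each raise at \<open>x\<close> pays for one sweep of the
  cursor over the arcs leaving \<open>x\<close> and for the worklist entries of the tails of the arcs entering
  \<open>x\<close>; the latter are the heads of the arcs leaving the mirror image of \<open>x\<close>.
\<close>

definition "weight x = real (deg x) + 2 * real (deg (mir x)) + 1"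
definition "pot1 c x l b = (cnt_max c - cnt c l) * weight x + real (rest x b)"
definition "pot lab cur = (\<Sum>(c, x)\<in>{..<N} \<times> verts2. pot1 c x (lab (cell c x)) (cur (cell c x)))"

text \<open>The inequality with factor \<open>q c\<close> limits how far labels overshoot distances.
  The cursor clause records that all arcs with numbers above the cursor are inadmissible; at cursor
  0 this covers every arc, which is what permits the next raise. Growing weights preserve both
  inequalities. The converse bound, that labels are realised by walks, is kept apart in
  \<open>tight\<close>.\<close>

definition lab_inv :: "(nat \<Rightarrow> real) \<Rightarrow> (nat \<Rightarrow> nat) \<Rightarrow> (nat \<Rightarrow> real) \<Rightarrow> bool" where
  "lab_inv lab cur w \<longleftrightarrow>
     (\<forall>e<m. d0 \<le> w e) \<and>
     (\<forall>c<N. lab (cell c (cent c)) = 0 \<and> lab (cell c (n + cent c)) = 0 \<and>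
       (\<forall>x<2 * n. (lab (cell c x) = 0 \<or> d0 \<le> lab (cell c x)) \<and> lab (cell c x) \<le> q c * \<Theta> \<and>
          cur (cell c x) \<le> 2 * m \<and> (cur (cell c x) \<noteq> 0 \<longrightarrow> usrc (cur (cell c x)) = x)) \<and>
       (\<forall>r\<in>{1..2 * m}.
          lab (cell c (usrc r)) \<le> q c * (lab (cell c (utgt r)) + w (und r)) \<and>
          (cur (cell c (usrc r)) < r \<longrightarrow>
             lab (cell c (usrc r)) < lab (cell c (utgt r)) + w (und r))))"

lemma es: "distinct es" "set es = E" "length es = m"
  using listing distinct_card[of es] by (auto simp: arc_listing_def num_arcs_def)

lemma es_nth: "j < m \<Longrightarrow> es ! j \<in> E"
  using es nth_mem by metis

lemma V_eq: "V = {..<n}" and n_ge_2: "n \<ge> 2"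
  using valid by (auto simp: valid_instance_def)

lemma tail_less: "j < m \<Longrightarrow> tail_of j < n" and head_less: "j < m \<Longrightarrow> head_of j < n"
  using es_nth arcsV V_eq by (auto simp: tail_of_def head_of_def)

lemma m_pos: "m \<ge> 1"
proof -
  have "E \<noteq> {}" using valid by (simp add: valid_instance_def)
  with finE show ?thesis by (simp add: num_arcs_def Suc_le_eq card_gt_0_iff)
qed

lemma bits: "n \<le> 2 ^ B" "2 ^ B < 2 * n" "B \<ge> 1"
proof -
  show "n \<le> 2 ^ B"
    unfolding B_def bits_def by (rule LeastI[of _ n]) (rule less_imp_le, rule less_exp)
  then show "B \<ge> 1" using n_ge_2 by (cases B) auto
  then have "\<not> n \<le> 2 ^ (B - 1)"
    unfolding B_def bits_def by (intro not_less_Least) simp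
  with \<open>B \<ge> 1\<close> show "2 ^ B < 2 * n" by (cases B) auto
qed

lemma N_pos: "N \<ge> 1" and T_pos: "T \<ge> 1"
  using bits n_ge_2 K_pos by (auto simp: N_def T_def Suc_le_eq)

lemma kappa_pos: "0 < \<kappa>" "\<kappa> \<le> 1"
  using K_pos by (auto simp: \<kappa>_def)

lemma cap_ge_1: "j < m \<Longrightarrow> cap j \<ge> 1"
  unfolding cap_def using es_nth u_ge_1 by blast

lemma cap_le_U: "j < m \<Longrightarrow> cap j \<le> U"
  unfolding cap_def U_def max_capacity_def using es_nth finE by (intro Max_ge) auto

lemma U_ge_1: "U \<ge> 1"
  using cap_ge_1[of 0] cap_le_U[of 0] m_pos by simp

lemma delta_pos: "0 < \<delta>" "\<delta> \<le> 1"
  using kappa_pos by (auto simp: \<delta>_def one_le_power intro!: zero_less_power)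

lemma d0_pos: "d0 > 0" "d0 \<le> 1"
  using delta_pos U_ge_1 by (auto simp: d0_def divide_le_eq)

lemma Theta_ge: "\<Theta> \<ge> 4"
  using m_pos by (simp add: \<Theta>_def)

lemma q_gt_1: "q c > 1"
  using K_pos N_pos by (simp add: q_def)

lemma und_less: "r \<in> {1..2 * m} \<Longrightarrow> und r < m"
  by (auto simp: und_def)

lemma usrc_less: "r \<in> {1..2 * m} \<Longrightarrow> usrc r < 2 * n"
  and utgt_less: "r \<in> {1..2 * m} \<Longrightarrow> utgt r < 2 * n"
  and utgt_side: "r \<in> {1..2 * m} \<Longrightarrow> utgt r < n \<longleftrightarrow> usrc r < n"
  using und_less[of r] tail_less[of "und r"] head_less[of "und r"]
  by (auto simp: usrc_def utgt_def)

lemma cell_eq_iff: "x < 2 * n \<Longrightarrow> y < 2 * n \<Longrightarrow> cell c x = cell c' y \<longleftrightarrow> c = c' \<and> x = y"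
proof
  assume xy: "x < 2 * n" "y < 2 * n" and eq: "cell c x = cell c' y"
  have "c = c'"
    using arg_cong[OF eq, of "\<lambda>z. z div (2 * n)"] xy by (simp only: cell_def div_mult_self3) simp
  with eq show "c = c' \<and> x = y" by (simp add: cell_def)
qed auto

lemma prev_less: "0 < b \<Longrightarrow> prev_arc x b < b"
  and prev_src: "prev_arc x b \<noteq> 0 \<Longrightarrow> usrc (prev_arc x b) = x"
  and prev_max: "prev_arc x b < r \<Longrightarrow> r < b \<Longrightarrow> usrc r \<noteq> x"
proof -
  have fin: "finite (insert 0 {r. 1 \<le> r \<and> r < b \<and> usrc r = x})" by simp
  have "prev_arc x b \<in> insert 0 {r. 1 \<le> r \<and> r < b \<and> usrc r = x}"
    unfolding prev_arc_def using Max_in[OF fin] by blast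
  then show "0 < b \<Longrightarrow> prev_arc x b < b" "prev_arc x b \<noteq> 0 \<Longrightarrow> usrc (prev_arc x b) = x" by auto
  show "prev_arc x b < r \<Longrightarrow> r < b \<Longrightarrow> usrc r \<noteq> x"
    using Max_ge[OF fin, of r] unfolding prev_arc_def[symmetric] by auto
qed

lemma verts2_less: "x \<in> verts2 \<Longrightarrow> x < 2 * n"
  using usrc_less utgt_less srcV snkV V_eq by (fastforce simp: verts2_def)

lemma finite_verts2: "finite verts2"
  by (simp add: verts2_def)

lemma pot_update:
  assumes "c < N" "x \<in> verts2"
  shows "pot (lab(cell c x := l)) (cur(cell c x := b)) =
    pot lab cur - pot1 c x (lab (cell c x)) (cur (cell c x)) + pot1 c x l b"
proof -
  let ?S = "{..<N} \<times> verts2"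
  have fin: "finite ?S" using finite_verts2 by simp
  have cx: "(c, x) \<in> ?S" using assms by simp
  have "(\<Sum>(c', x')\<in>?S - {(c, x)}. pot1 c' x' ((lab(cell c x := l)) (cell c' x')) ((cur(cell c x := b)) (cell c' x')))
     = (\<Sum>(c', x')\<in>?S - {(c, x)}. pot1 c' x' (lab (cell c' x')) (cur (cell c' x')))"
  proof (rule sum.cong[OF refl])
    fix p assume "p \<in> ?S - {(c, x)}"
    then obtain c' x' where p: "p = (c', x')" "x' \<in> verts2" "\<not> (c' = c \<and> x' = x)"
      by (cases p) auto
    then have "cell c' x' \<noteq> cell c x" using assms verts2_less by (simp add: cell_eq_iff)
    then show "(case p of (c', x') \<Rightarrow>
          pot1 c' x' ((lab(cell c x := l)) (cell c' x')) ((cur(cell c x := b)) (cell c' x'))) =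
        (case p of (c', x') \<Rightarrow> pot1 c' x' (lab (cell c' x')) (cur (cell c' x')))"
      by (simp add: p)
  qed
  then show ?thesis
    unfolding pot_def sum.remove[OF fin cx] by simp
qed

text \<open>A label never exceeds \<open>q c * \<Theta>\<close>, since only labels up to
  \<open>\<Theta>\<close> are raised. The additive 2 in \<open>cnt_max\<close> covers the raise from
  0 to \<open>d0\<close> and the last raise across \<open>\<Theta>\<close>.\<close>

lemma pot_nonneg:
  assumes "lab_inv lab cur w"
  shows "pot lab cur \<ge> 0"
  unfolding pot_def
proof (rule sum_nonneg)
  fix p assume "p \<in> {..<N} \<times> verts2"
  then obtain c x where p: "p = (c, x)" and cx: "c < N" "x < 2 * n" using verts2_less by auto
  then have l: "lab (cell c x) = 0 \<or> d0 \<le> lab (cell c x)" "lab (cell c x) \<le> q c * \<Theta>"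
    using assms by (auto simp: lab_inv_def)
  have lnq: "ln (q c) > 0" using q_gt_1[of c] by simp
  have lnT: "ln (\<Theta> / d0) \<ge> 0" using Theta_ge d0_pos by (simp add: divide_simps)
  have "cnt c (lab (cell c x)) \<le> cnt_max c"
  proof (cases "lab (cell c x) = 0")
    case True
    then show ?thesis using lnq lnT by (simp add: cnt_def cnt_max_def)
  next
    case False
    with l d0_pos have "d0 \<le> lab (cell c x)" "0 < lab (cell c x)" by auto
    then have "ln (lab (cell c x) / d0) \<le> ln (q c * \<Theta> / d0)"
      using l(2) d0_pos q_gt_1[of c] Theta_ge by (subst ln_le_cancel_iff) (auto simp: divide_right_mono)
    also have "\<dots> = ln (q c) + ln (\<Theta> / d0)"
      using ln_mult_pos[of "q c" "\<Theta> / d0"] q_gt_1[of c] Theta_ge d0_pos by simp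
    finally have "ln (lab (cell c x) / d0) / ln (q c) \<le> (ln (q c) + ln (\<Theta> / d0)) / ln (q c)"
      using lnq by (intro divide_right_mono) auto
    then show ?thesis
      using False lnq by (simp add: cnt_def cnt_max_def add_divide_distrib)
  qed
  then show "0 \<le> (case p of (c, x) \<Rightarrow> pot1 c x (lab (cell c x)) (cur (cell c x)))"
    by (simp add: pot1_def weight_def p)
qed

lemma lab_invD:
  assumes "lab_inv lab cur w"
  shows "e < m \<Longrightarrow> d0 \<le> w e"
    and "c < N \<Longrightarrow> lab (cell c (cent c)) = 0" "c < N \<Longrightarrow> lab (cell c (n + cent c)) = 0"
    and "c < N \<Longrightarrow> x < 2 * n \<Longrightarrow> lab (cell c x) = 0 \<or> d0 \<le> lab (cell c x)"
    and "c < N \<Longrightarrow> x < 2 * n \<Longrightarrow> 0 \<le> lab (cell c x)"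
    and "c < N \<Longrightarrow> x < 2 * n \<Longrightarrow> lab (cell c x) \<le> q c * \<Theta>"
    and "c < N \<Longrightarrow> x < 2 * n \<Longrightarrow> cur (cell c x) \<le> 2 * m"
    and "c < N \<Longrightarrow> x < 2 * n \<Longrightarrow> cur (cell c x) \<noteq> 0 \<Longrightarrow> usrc (cur (cell c x)) = x"
    and "c < N \<Longrightarrow> r \<in> {1..2 * m} \<Longrightarrow>
      lab (cell c (usrc r)) \<le> q c * (lab (cell c (utgt r)) + w (und r))"
    and "c < N \<Longrightarrow> r \<in> {1..2 * m} \<Longrightarrow> cur (cell c (usrc r)) < r \<Longrightarrow>
      lab (cell c (usrc r)) < lab (cell c (utgt r)) + w (und r)"
proof -
  show *: "c < N \<Longrightarrow> x < 2 * n \<Longrightarrow> lab (cell c x) = 0 \<or> d0 \<le> lab (cell c x)"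
    using assms by (simp add: lab_inv_def)
  then show "c < N \<Longrightarrow> x < 2 * n \<Longrightarrow> 0 \<le> lab (cell c x)"
    using d0_pos by auto
qed (use assms in \<open>unfold lab_inv_def, blast+\<close>)

text \<open>With the cursor at the end of the list every outgoing arc is strictly inadmissible, so
  multiplying the label by \<open>q c\<close> stays within the upper bound; the raise to
  \<open>d0\<close> is covered because no weight is smaller. The raise count grows by exactly one.
  Of the released \<open>weight x\<close>, the share \<open>deg x\<close> refills the cursor sweep
  and the rest pays for the scan.\<close>

lemma lab_inv_relabel:
  assumes inv: "lab_inv lab cur w" and c: "c < N" and x: "x \<in> verts2"
    and noroot: "x \<noteq> cent c" "x \<noteq> n + cent c"
    and cur: "cur (cell c x) = 0" and le: "lab (cell c x) \<le> \<Theta>"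
    and l: "l = max d0 (lab (cell c x) * q c)" and b: "b = prev_arc x (Suc (2 * m))"
  shows "lab_inv (lab(cell c x := l)) (cur(cell c x := b)) w"
    "pot (lab(cell c x := l)) (cur(cell c x := b)) \<le> pot lab cur - 2 * real (deg (mir x)) - 1"
    "lab (cell c x) \<le> l"
proof -
  have x2: "x < 2 * n" using verts2_less[OF x] .
  have q1: "q c > 1" using q_gt_1 .
  have old: "lab (cell c x) = 0 \<or> d0 \<le> lab (cell c x)"
    using inv c x2 by (auto simp: lab_inv_def)
  then have lab0: "lab (cell c x) \<ge> 0" using d0_pos by auto
  show mono: "lab (cell c x) \<le> l"
    using q1 lab0 mult_left_mono[of 1 "q c" "lab (cell c x)"] unfolding l by simp
  have l_le: "l \<le> q c * \<Theta>"
  proof -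
    have "d0 \<le> 1 * \<Theta>" using d0_pos Theta_ge by simp
    also have "\<dots> \<le> q c * \<Theta>" using q1 Theta_ge by (intro mult_right_mono) auto
    finally show ?thesis using le q1 by (simp add: l mult.commute mult_left_mono)
  qed
  have bm: "b \<le> 2 * m" using prev_less[of "Suc (2 * m)" x] by (simp add: b)
  have bs: "b \<noteq> 0 \<Longrightarrow> usrc b = x" unfolding b by (rule prev_src)
  have bmax: "b < r \<Longrightarrow> r \<le> 2 * m \<Longrightarrow> usrc r \<noteq> x" for r
    unfolding b by (rule prev_max) auto
  have inadm: "lab (cell c x) < lab (cell c (utgt r)) + w (und r)"
    if "r \<in> {1..2 * m}" "usrc r = x" for r
  proof -
    have "cur (cell c (usrc r)) < r" using that cur by simp
    from lab_invD(10)[OF inv c that(1) this] that(2) show ?thesis by simp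
  qed
  have tgt_nonneg: "lab (cell c (utgt r)) \<ge> 0" if "r \<in> {1..2 * m}" for r
    by (rule lab_invD(5)[OF inv c utgt_less[OF that]])
  have new: "l \<le> q c * (lab (cell c (utgt r)) + w (und r))"
    if "r \<in> {1..2 * m}" "usrc r = x" for r
  proof -
    have "d0 \<le> w (und r)" by (rule lab_invD(1)[OF inv und_less[OF that(1)]])
    then have "d0 \<le> 1 * (lab (cell c (utgt r)) + w (und r))" using tgt_nonneg[OF that(1)] by simp
    also have "\<dots> \<le> q c * (lab (cell c (utgt r)) + w (und r))"
      using q1 tgt_nonneg[OF that(1)] d0_pos \<open>d0 \<le> w (und r)\<close> by (intro mult_right_mono) auto
    finally show ?thesis
      using inadm[OF that] q1 by (simp add: l mult.commute mult_left_mono)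
  qed
  let ?lab = "lab(cell c x := l)" and ?cur = "cur(cell c x := b)"
  have ge: "lab y \<le> ?lab y" for y using mono by simp
  show "lab_inv ?lab ?cur w"
    unfolding lab_inv_def
  proof (intro conjI allI impI ballI)
    show "d0 \<le> w e" if "e < m" for e using inv that by (simp add: lab_inv_def)
    fix c' assume c': "c' < N"
    have r2: "cent c' < 2 * n" "n + cent c' < 2 * n" using cent[of c'] by auto
    show "?lab (cell c' (cent c')) = 0" "?lab (cell c' (n + cent c')) = 0"
      using inv c' noroot cell_eq_iff[OF r2(1) x2] cell_eq_iff[OF r2(2) x2] by (auto simp: lab_inv_def)
    show "?lab (cell c' z) = 0 \<or> d0 \<le> ?lab (cell c' z)" "?lab (cell c' z) \<le> q c' * \<Theta>"
      "?cur (cell c' z) \<le> 2 * m" if "z < 2 * n" for z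
      using inv c' that l_le bm x2 cell_eq_iff[OF that x2, of c' c] by (auto simp: lab_inv_def l)
    show "usrc (?cur (cell c' z)) = z" if "z < 2 * n" "?cur (cell c' z) \<noteq> 0" for z
      using inv c' that bs x2 cell_eq_iff[OF that(1) x2, of c' c] by (auto simp: lab_inv_def split: if_splits)
    fix r assume r: "r \<in> {1..2 * m}"
    have o: "lab (cell c' (usrc r)) \<le> q c' * (lab (cell c' (utgt r)) + w (und r))"
      "cur (cell c' (usrc r)) < r \<Longrightarrow> lab (cell c' (usrc r)) < lab (cell c' (utgt r)) + w (und r)"
      by (rule lab_invD(9,10)[OF inv c' r], assumption?)+
    note ge_t = ge[of "cell c' (utgt r)"]
    note iff = cell_eq_iff[OF usrc_less[OF r] x2, of c' c]
    show "?lab (cell c' (usrc r)) \<le> q c' * (?lab (cell c' (utgt r)) + w (und r))"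
    proof (cases "c' = c \<and> usrc r = x")
      case True
      have "l \<le> q c * (lab (cell c (utgt r)) + w (und r))" using new[OF r] True by simp
      also have "\<dots> \<le> q c * (?lab (cell c (utgt r)) + w (und r))"
        using q1 ge by (intro mult_left_mono add_right_mono) auto
      finally show ?thesis using True by simp
    next
      case False
      then have "?lab (cell c' (usrc r)) = lab (cell c' (usrc r))" using iff by auto
      also note o(1)
      also have "q c' * (lab (cell c' (utgt r)) + w (und r)) \<le> q c' * (?lab (cell c' (utgt r)) + w (und r))"
        using q_gt_1[of c'] ge by (intro mult_left_mono add_right_mono) auto
      finally show ?thesis .
    qed
    show "?lab (cell c' (usrc r)) < ?lab (cell c' (utgt r)) + w (und r)"
      if "?cur (cell c' (usrc r)) < r"
    proof (cases "c' = c \<and> usrc r = x")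
      case True
      with that bmax[of r] r show ?thesis by auto
    next
      case False
      with that o(2) ge_t iff show ?thesis by (auto split: if_splits)
    qed
  qed
  have step: "cnt c l = cnt c (lab (cell c x)) + 1"
  proof (cases "lab (cell c x) = 0")
    case True
    then show ?thesis using d0_pos by (simp add: l cnt_def)
  next
    case False
    with old have d0_le: "d0 \<le> lab (cell c x)" by simp
    also have "\<dots> \<le> lab (cell c x) * q c" using q1 lab0 mult_left_mono[of 1 "q c" "lab (cell c x)"] by simp
    finally have l': "l = lab (cell c x) * q c" by (simp add: l)
    have "ln (l / d0) = ln (lab (cell c x) / d0) + ln (q c)"
      using ln_mult_pos[of "lab (cell c x) / d0" "q c"] d0_le d0_pos q1 unfolding l' by simp
    moreover have "l \<noteq> 0" using d0_le d0_pos q1 l' by auto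
    ultimately show ?thesis
      using False q1 by (simp add: cnt_def add_divide_distrib)
  qed
  have "rest x b \<le> deg x"
    unfolding rest_def deg_def using bm by (intro card_mono) auto
  then show "pot ?lab ?cur \<le> pot lab cur - 2 * real (deg (mir x)) - 1"
    unfolding pot_update[OF c x] by (simp add: pot1_def weight_def cur step rest_def algebra_simps)
qed

text \<open>The skipped arc has just been rejected, and no arc of \<open>x\<close> lies between the
  old and the new cursor, so the cursor clause extends to all arcs above the new position.\<close>

lemma lab_inv_advance:
  assumes inv: "lab_inv lab cur w" and c: "c < N" and x: "x \<in> verts2"
    and r: "cur (cell c x) = r" "r \<noteq> 0"
    and no: "\<not> lab (cell c (utgt r)) + w (und r) \<le> lab (cell c x)" and b: "b = prev_arc (usrc r) r"
  shows "lab_inv lab (cur(cell c x := b)) w"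
    "pot lab (cur(cell c x := b)) \<le> pot lab cur - 1"
proof -
  have x2: "x < 2 * n" using verts2_less[OF x] .
  have idm: "r \<le> 2 * m" "usrc r = x" using inv c x2 r by (auto simp: lab_inv_def)
  have b': "b < r" "b \<noteq> 0 \<Longrightarrow> usrc b = x"
    using prev_less[of r] prev_src r idm by (auto simp: b)
  have bmax: "b < r' \<Longrightarrow> r' < r \<Longrightarrow> usrc r' \<noteq> x" for r'
    using prev_max[of x r r'] idm by (auto simp: b)
  let ?cur = "cur(cell c x := b)"
  show "lab_inv lab ?cur w"
    unfolding lab_inv_def
  proof (intro conjI allI impI ballI)
    show "d0 \<le> w e" if "e < m" for e using inv that by (simp add: lab_inv_def)
    fix c' assume c': "c' < N"
    show "lab (cell c' (cent c')) = 0" "lab (cell c' (n + cent c')) = 0"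
      using inv c' by (auto simp: lab_inv_def)
    show "lab (cell c' z) = 0 \<or> d0 \<le> lab (cell c' z)" "lab (cell c' z) \<le> q c' * \<Theta>"
      "?cur (cell c' z) \<le> 2 * m" if "z < 2 * n" for z
      using inv c' that b' idm by (auto simp: lab_inv_def)
    show "usrc (?cur (cell c' z)) = z" if "z < 2 * n" "?cur (cell c' z) \<noteq> 0" for z
      using inv c' that b' x2 cell_eq_iff[OF that(1) x2, of c' c] by (auto simp: lab_inv_def split: if_splits)
    fix r' assume r': "r' \<in> {1..2 * m}"
    have o: "lab (cell c' (usrc r')) \<le> q c' * (lab (cell c' (utgt r')) + w (und r'))"
      "cur (cell c' (usrc r')) < r' \<Longrightarrow> lab (cell c' (usrc r')) < lab (cell c' (utgt r')) + w (und r')"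
      by (rule lab_invD(9,10)[OF inv c' r'], assumption?)+
    show "lab (cell c' (usrc r')) \<le> q c' * (lab (cell c' (utgt r')) + w (und r'))" by (rule o(1))
    note iff = cell_eq_iff[OF usrc_less[OF r'] x2, of c' c]
    show "lab (cell c' (usrc r')) < lab (cell c' (utgt r')) + w (und r')"
      if "?cur (cell c' (usrc r')) < r'"
    proof (cases "c' = c \<and> usrc r' = x")
      case True
      with that have "b < r'" by simp
      with bmax[of r'] True have "r \<le> r'" by force
      show ?thesis
      proof (cases "r' = r")
        case True
        with no \<open>c' = c \<and> usrc r' = x\<close> show ?thesis by simp
      next
        case False
        with \<open>r \<le> r'\<close> True r o(2) show ?thesis by simp
      qed
    next
      case False
      with that o(2) iff show ?thesis by (auto split: if_splits)
    qed
  qed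
  have "r \<in> {r'\<in>{1..r}. usrc r' = x}" "r \<notin> {r'\<in>{1..b}. usrc r' = x}"
    using idm r(2) b'(1) by auto
  moreover have "{r'\<in>{1..b}. usrc r' = x} \<subseteq> {r'\<in>{1..r}. usrc r' = x}"
    using b'(1) by auto
  ultimately have "rest x b < rest x r"
    unfolding rest_def by (intro psubset_card_mono psubsetI) (simp, assumption, blast)
  moreover have "pot lab ?cur = pot lab cur - pot1 c x (lab (cell c x)) r + pot1 c x (lab (cell c x)) b"
    using pot_update[OF c x, of lab "lab (cell c x)" cur b] r(1) by simp
  ultimately show "pot lab ?cur \<le> pot lab cur - 1"
    by (simp add: pot1_def)
qed

lemma lab_inv_mono:
  assumes "lab_inv lab cur w" "\<And>e. e < m \<Longrightarrow> w e \<le> w' e"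
  shows "lab_inv lab cur w'"
  unfolding lab_inv_def
proof (intro conjI allI impI ballI)
  show "d0 \<le> w' e" if "e < m" for e
    using lab_invD(1)[OF assms(1) that] assms(2)[OF that] by simp
  fix c assume c: "c < N"
  fix r assume r: "r \<in> {1..2 * m}"
  have le: "w (und r) \<le> w' (und r)" using assms(2) und_less[OF r] .
  have o: "lab (cell c (usrc r)) \<le> q c * (lab (cell c (utgt r)) + w (und r))"
    "cur (cell c (usrc r)) < r \<Longrightarrow> lab (cell c (usrc r)) < lab (cell c (utgt r)) + w (und r)"
    by (rule lab_invD(9,10)[OF assms(1) c r], assumption?)+
  note o(1)
  also have "q c * (lab (cell c (utgt r)) + w (und r)) \<le> q c * (lab (cell c (utgt r)) + w' (und r))"
    using q_gt_1[of c] le by (intro mult_left_mono) auto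
  finally show "lab (cell c (usrc r)) \<le> q c * (lab (cell c (utgt r)) + w' (und r))" .
  show "lab (cell c (usrc r)) < lab (cell c (utgt r)) + w' (und r)" if "cur (cell c (usrc r)) < r"
    using o(2)[OF that] le by linarith
qed (use assms(1) in \<open>auto simp: lab_inv_def\<close>)

end

section \<open>Maintaining the labels\<close>

context mcf_run
begin

text \<open>Collected once, so that a single frame argument carries the constants, the adjacency
  structure and the input through every program of the main phase.\<close>

definition static :: "machine \<Rightarrow> bool" where
  "static \<sigma> \<longleftrightarrow>
     nreg \<sigma> n_reg = n \<and> nreg \<sigma> m_reg = m \<and> nreg \<sigma> k_reg = k \<and> nreg \<sigma> one_reg = 1 \<and>
     nreg \<sigma> zero_reg = 0 \<and> nreg \<sigma> N_reg = N \<and> nreg \<sigma> nn_reg = 2 * n \<and>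
     rreg \<sigma> one_rr = 1 \<and> rreg \<sigma> zero_rr = 0 \<and> rreg \<sigma> kappa_rr = \<kappa> \<and>
     rreg \<sigma> kappa1_rr = 1 + \<kappa> \<and> rreg \<sigma> d0_rr = d0 \<and> rreg \<sigma> Theta_rr = \<Theta> \<and>
     rreg \<sigma> T_rr = T' \<and> rreg \<sigma> KN_rr = real K * real N \<and> rreg \<sigma> fac_rr = 1 + 1 / (2 * T') \<and>
     (\<forall>c<N. narr \<sigma> cent_arr c = cent c) \<and>
     (\<forall>r\<in>{1..2 * m}. narr \<sigma> nxt_arr r = prev_arc (usrc r) r \<and> narr \<sigma> tgt_arr r = utgt r \<and>
        narr \<sigma> und_arr r = und r) \<and>
     (\<forall>x<2 * n. narr \<sigma> first_arr x = prev_arc x (Suc (2 * m))) \<and>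
     (\<forall>i<k. narr \<sigma> source_arr i = src i \<and> narr \<sigma> sink_arr i = snk i \<and>
        rarr \<sigma> demand_rarr i = d i) \<and>
     (\<forall>j<m. rarr \<sigma> cap_rarr j = cap j \<and> narr \<sigma> tail_arr j = tail_of j \<and>
        narr \<sigma> head_arr j = head_of j)"

lemma static_frame:
  assumes "static \<sigma>" "frame P \<sigma> \<sigma>'"
    "wrN P \<inter> {n_reg, m_reg, k_reg, one_reg, zero_reg, N_reg, nn_reg} = {}"
    "wrR P \<inter> {one_rr, zero_rr, kappa_rr, kappa1_rr, d0_rr, Theta_rr, T_rr, KN_rr, fac_rr} = {}"
    "wrNA P \<inter> {tail_arr, head_arr, source_arr, sink_arr, cent_arr, nxt_arr, first_arr, tgt_arr, und_arr} = {}"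
    "wrRA P \<inter> {cap_rarr, demand_rarr} = {}"
  shows "static \<sigma>'"
proof -
  have "r \<notin> wrN P" if "r \<in> {n_reg, m_reg, k_reg, one_reg, zero_reg, N_reg, nn_reg}" for r
    using assms(3) that by blast
  moreover have "r \<notin> wrR P"
    if "r \<in> {one_rr, zero_rr, kappa_rr, kappa1_rr, d0_rr, Theta_rr, T_rr, KN_rr, fac_rr}" for r
    using assms(4) that by blast
  moreover have "r \<notin> wrNA P"
    if "r \<in> {tail_arr, head_arr, source_arr, sink_arr, cent_arr, nxt_arr, first_arr, tgt_arr, und_arr}" for r
    using assms(5) that by blast
  moreover have "r \<notin> wrRA P" if "r \<in> {cap_rarr, demand_rarr}" for r
    using assms(6) that by blast
  ultimately show ?thesis
    using assms(1) unfolding static_def by (simp add: frameD[OF assms(2)])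
qed

text \<open>\<open>fs\<close> is the arc stack between positions \<open>a\<close> and
  \<open>b\<close>; \<open>vs\<close> is a ghost sequence of the vertices passed, which the program
  does not store. The walk never changes halves, so it is a forward or a backward walk
  throughout.\<close>

definition chain ::
  "nat \<Rightarrow> nat \<Rightarrow> (nat \<Rightarrow> real) \<Rightarrow> (nat \<Rightarrow> real) \<Rightarrow> nat \<Rightarrow> nat \<Rightarrow> (nat \<Rightarrow> nat) \<Rightarrow> (nat \<Rightarrow> nat) \<Rightarrow> bool" where
  "chain c s w lab a b vs fs \<longleftrightarrow> a \<le> b \<and> vs a = s \<and>
     (\<forall>p\<in>{a..b}. vs p \<in> verts2 \<and> (vs p < n \<longleftrightarrow> s < n)) \<and>
     (\<forall>p\<in>{a..<b}. \<exists>r\<in>{1..2 * m}. usrc r = vs p \<and> utgt r = vs (Suc p) \<and> fs p = und r \<and>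
        lab (cell c (vs (Suc p))) + w (und r) \<le> lab (cell c (vs p)))"

lemma chainE:
  assumes "chain c s w lab a b vs fs" "a \<le> p" "p < b"
  obtains r where "r \<in> {1..2 * m}" "usrc r = vs p" "utgt r = vs (Suc p)" "fs p = und r"
    "lab (cell c (vs (Suc p))) + w (und r) \<le> lab (cell c (vs p))"
proof -
  have "p \<in> {a..<b}" using assms by simp
  with assms(1) that show thesis unfolding chain_def by blast
qed

lemma chain_vs: "chain c s w lab a b vs fs \<Longrightarrow> a \<le> p \<Longrightarrow> p \<le> b \<Longrightarrow> vs p \<in> verts2"
  and chain_side: "chain c s w lab a b vs fs \<Longrightarrow> a \<le> p \<Longrightarrow> p \<le> b \<Longrightarrow> vs p < n \<longleftrightarrow> s < n"
  by (auto simp: chain_def)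

lemma chain_strict:
  assumes ch: "chain c s w lab a b vs fs" and w: "\<And>e. e < m \<Longrightarrow> w e > 0"
    and "a \<le> p" "p < p'" "p' \<le> b"
  shows "lab (cell c (vs p')) < lab (cell c (vs p))"
  using assms(4,5)
proof (induction p')
  case (Suc p')
  have "lab (cell c (vs (Suc p'))) < lab (cell c (vs p'))"
    using chainE[OF ch, of p'] Suc.prems assms(3) w und_less by (smt (verit) Suc_le_eq less_SucE less_or_eq_imp_le order_trans)
  with Suc show ?case by (cases "p = p'") auto
qed simp

text \<open>Vertices are distinct because labels decrease strictly. An underlying arc cannot recur
  either: the half determines which of its copies is meant, and the copy determines its
  tail.\<close>

lemma chain_inj:
  assumes ch: "chain c s w lab a b vs fs" and w: "\<And>e. e < m \<Longrightarrow> w e > 0"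
  shows "inj_on vs {a..b}" "inj_on fs {a..<b}" "b - a < 2 * n"
proof -
  show inj: "inj_on vs {a..b}"
  proof (rule inj_onI)
    fix p p' assume "p \<in> {a..b}" "p' \<in> {a..b}" "vs p = vs p'"
    then show "p = p'"
      using chain_strict[OF ch w, of p p'] chain_strict[OF ch w, of p' p]
      by (cases p p' rule: linorder_cases) auto
  qed
  show "inj_on fs {a..<b}"
  proof (rule inj_onI)
    fix p p' assume p: "p \<in> {a..<b}" "p' \<in> {a..<b}" and eq: "fs p = fs p'"
    obtain r where r: "r \<in> {1..2 * m}" "usrc r = vs p" "fs p = und r"
      using chainE[OF ch, of p] p by auto
    obtain r' where r': "r' \<in> {1..2 * m}" "usrc r' = vs p'" "fs p' = und r'"
      using chainE[OF ch, of p'] p by auto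
    have side: "usrc r < n \<longleftrightarrow> usrc r' < n"
      using chain_side[OF ch, of p] chain_side[OF ch, of p'] p r(2) r'(2) by simp
    have *: "usrc r < n \<longleftrightarrow> r \<le> m" if "r \<in> {1..2 * m}" for r
      using tail_less und_less[OF that] by (auto simp: usrc_def)
    have "usrc r = usrc r'"
      using side *[OF r(1)] *[OF r'(1)] eq r(3) r'(3) by (auto simp: usrc_def)
    with r(2) r'(2) p show "p = p'" using inj by (auto dest: inj_onD)
  qed
  have "card {a..b} \<le> card {..<2 * n}"
    using inj chain_vs[OF ch] verts2_less by (intro card_inj_on_le) auto
  moreover have "a \<le> b" using ch by (simp add: chain_def)
  ultimately show "b - a < 2 * n" by simp
qed

lemma chain_push:
  assumes ch: "chain c s w lab a b vs fs" and r: "r \<in> {1..2 * m}" "usrc r = vs b"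
    and adm: "lab (cell c (utgt r)) + w (und r) \<le> lab (cell c (vs b))"
  shows "chain c s w lab a (Suc b) (vs(Suc b := utgt r)) (fs(b := und r))"
proof -
  have "utgt r \<in> verts2" using r(1) by (auto simp: verts2_def)
  moreover have "utgt r < n \<longleftrightarrow> s < n"
    using utgt_side[OF r(1)] chain_side[OF ch, of b] ch r(2) by (auto simp: chain_def)
  ultimately show ?thesis
    using ch r adm unfolding chain_def by (auto simp: less_Suc_eq le_Suc_eq)
qed

text \<open>The label differences telescope, so labels dominate the weight of the walk actually
  found; this is the direction opposite to \<open>lab_path\<close>.\<close>

lemma chain_sum:
  assumes "chain c s w lab a b vs fs"
  shows "(\<Sum>p\<in>{a..<b}. w (fs p)) + lab (cell c (vs b)) \<le> lab (cell c s)"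
proof -
  have ab: "a \<le> b" and s: "vs a = s" using assms by (auto simp: chain_def)
  have "(\<Sum>p\<in>{a..<b}. w (fs p)) \<le> (\<Sum>p\<in>{a..<b}. lab (cell c (vs p)) - lab (cell c (vs (Suc p))))"
  proof (rule sum_mono)
    fix p assume "p \<in> {a..<b}"
    then obtain r where "fs p = und r"
      "lab (cell c (vs (Suc p))) + w (und r) \<le> lab (cell c (vs p))"
      using chainE[OF assms, of p] by auto
    then show "w (fs p) \<le> lab (cell c (vs p)) - lab (cell c (vs (Suc p)))" by simp
  qed
  also have "\<dots> = lab (cell c s) - lab (cell c (vs b))"
    using sum_Suc_diff'[OF ab, of "\<lambda>p. - lab (cell c (vs p))"] s by simp
  finally show ?thesis by simp
qed

definition arc_excess :: "nat \<Rightarrow> nat \<Rightarrow> real" where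
  "arc_excess e z = of_bool (tail_of e = z) - of_bool (head_of e = z)"

text \<open>Arcs of the backward half are traversed against their direction, which flips the sign: a
  backward walk from \<open>n + t\<close> to \<open>n + c\<close> stands for a forward walk from
  \<open>c\<close> to \<open>t\<close>.\<close>

lemma chain_excess:
  assumes ch: "chain c s w lab a b vs fs"
  shows "(\<Sum>p\<in>{a..<b}. arc_excess (fs p) z) =
    (if s < n then of_bool (s = z) - of_bool (vs b = z) else of_bool (vs b = n + z) - of_bool (s = n + z))"
proof -
  have ab: "a \<le> b" and s: "vs a = s" using ch by (auto simp: chain_def)
  define h :: "nat \<Rightarrow> real"
    where "h p = (if s < n then - of_bool (vs p = z) else of_bool (vs p = n + z))" for p
  have "(\<Sum>p\<in>{a..<b}. arc_excess (fs p) z) = (\<Sum>p\<in>{a..<b}. h (Suc p) - h p)"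
  proof (rule sum.cong[OF refl])
    fix p assume p: "p \<in> {a..<b}"
    then obtain r where r: "r \<in> {1..2 * m}" "usrc r = vs p" "utgt r = vs (Suc p)" "fs p = und r"
      using chainE[OF ch, of p] by auto
    have "vs p < n \<longleftrightarrow> s < n" using chain_side[OF ch, of p] p by simp
    moreover have "tail_of (und r) < n" "head_of (und r) < n"
      using und_less[OF r(1)] tail_less head_less by auto
    ultimately show "arc_excess (fs p) z = h (Suc p) - h p"
      using r(2,3) unfolding h_def arc_excess_def r(4) usrc_def utgt_def
      by (auto split: if_splits)
  qed
  also have "\<dots> = h b - h a" by (rule sum_Suc_diff'[OF ab])
  finally show ?thesis by (auto simp: h_def s)
qed

lemma mir_less: "x < 2 * n \<Longrightarrow> mir x < 2 * n" and mir_mir: "x < 2 * n \<Longrightarrow> mir (mir x) = x"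
  by (auto simp: mir_def)

text \<open>The other copy of the same arc. It exchanges the halves and turns the arc around, which
  identifies arcs entering \<open>x\<close> with arcs leaving \<open>mir x\<close>.\<close>

definition "opp r = (if r \<le> m then r + m else r - m)" for r :: nat

lemma opp:
  assumes "r \<in> {1..2 * m}"
  shows "opp r \<in> {1..2 * m}" "usrc (opp r) = mir (utgt r)" "utgt (opp r) = mir (usrc r)"
    "und (opp r) = und r" "opp (opp r) = r"
proof -
  show 1: "und (opp r) = und r" "opp r \<in> {1..2 * m}" "opp (opp r) = r"
    using assms by (auto simp: und_def opp_def)
  have "tail_of (und r) < n" "head_of (und r) < n"
    using und_less[OF assms] tail_less head_less by auto
  then show "usrc (opp r) = mir (utgt r)" "utgt (opp r) = mir (usrc r)"
    using assms unfolding usrc_def utgt_def 1 by (auto simp: mir_def opp_def)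
qed

lemma usrc_verts2: "r \<in> {1..2 * m} \<Longrightarrow> usrc r \<in> verts2"
  by (auto simp: verts2_def)

lemma rest_prev_arc:
  assumes "1 \<le> r"
  shows "rest (usrc r) (prev_arc (usrc r) r) < rest (usrc r) r"
proof -
  let ?b = "prev_arc (usrc r) r"
  have b: "?b < r" using prev_less[of r] assms by simp
  then have "r \<in> {r'\<in>{1..r}. usrc r' = usrc r}" "r \<notin> {r'\<in>{1..?b}. usrc r' = usrc r}"
    using assms by auto
  moreover have "{r'\<in>{1..?b}. usrc r' = usrc r} \<subseteq> {r'\<in>{1..r}. usrc r' = usrc r}"
    using b by auto
  ultimately show ?thesis
    unfolding rest_def by (intro psubset_card_mono psubsetI) (simp, assumption, blast)
qed

lemma rest_le_deg: "b \<le> 2 * m \<Longrightarrow> rest x b \<le> deg x"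
  unfolding rest_def deg_def by (intro card_mono) auto

lemma scan_wp:
  assumes st: "static \<sigma>" and x: "nreg \<sigma> x_reg = x" "x < 2 * n"
    and Q: "\<And>\<sigma>'. frame scan \<sigma> \<sigma>' \<Longrightarrow> nreg \<sigma> wsp_reg \<le> nreg \<sigma>' wsp_reg \<Longrightarrow>
      nreg \<sigma>' wsp_reg - nreg \<sigma> wsp_reg \<le> deg (mir x) \<Longrightarrow>
      (\<And>p. p < nreg \<sigma> wsp_reg \<Longrightarrow> narr \<sigma>' work_arr p = narr \<sigma> work_arr p) \<Longrightarrow>
      (\<And>p. nreg \<sigma> wsp_reg \<le> p \<Longrightarrow> p < nreg \<sigma>' wsp_reg \<Longrightarrow> narr \<sigma>' work_arr p \<in> verts2) \<Longrightarrow>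
      (\<And>r. r \<in> {1..2 * m} \<Longrightarrow> utgt r = x \<Longrightarrow> usrc r \<in> narr \<sigma>' work_arr ` {..<nreg \<sigma>' wsp_reg}) \<Longrightarrow>
      real (steps \<sigma>') \<le> real (steps \<sigma>) + 8 * real (nreg \<sigma>' wsp_reg - nreg \<sigma> wsp_reg) + 4 \<Longrightarrow> Q \<sigma>'"
  shows "wp scan Q \<sigma>"
proof -
  define y where "y = mir x"
  have y: "y < 2 * n" using mir_less[OF x(2)] by (simp add: y_def)
  define a where "a = nreg \<sigma> wsp_reg"
  have loop: "wp (While (NLess zero_reg id_reg) scan_step) Q \<sigma>0"
    if \<sigma>0: "nreg \<sigma>0 id_reg = prev_arc y (Suc (2 * m))" "steps \<sigma>0 \<le> steps \<sigma> + 3" "frame scan \<sigma> \<sigma>0"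
      "nreg \<sigma>0 wsp_reg = a" "narr \<sigma>0 work_arr = narr \<sigma> work_arr" for \<sigma>0
  proof -
    have st0: "static \<sigma>0"
      by (rule static_frame[OF st \<sigma>0(3)]) (simp_all add: scan_def scan_step_def)
    define Inv where "Inv \<sigma>' \<longleftrightarrow> nreg \<sigma>' id_reg \<le> 2 * m \<and>
       (nreg \<sigma>' id_reg \<noteq> 0 \<longrightarrow> usrc (nreg \<sigma>' id_reg) = y) \<and> a \<le> nreg \<sigma>' wsp_reg \<and>
       nreg \<sigma>' wsp_reg - a + rest y (nreg \<sigma>' id_reg) \<le> deg y \<and>
       (\<forall>p<a. narr \<sigma>' work_arr p = narr \<sigma> work_arr p) \<and>
       (\<forall>p\<in>{a..<nreg \<sigma>' wsp_reg}. narr \<sigma>' work_arr p \<in> verts2) \<and>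
       (\<forall>r\<in>{1..2 * m}. usrc r = y \<longrightarrow> nreg \<sigma>' id_reg < r \<longrightarrow>
          mir (utgt r) \<in> narr \<sigma>' work_arr ` {..<nreg \<sigma>' wsp_reg}) \<and>
       real (steps \<sigma>') \<le> real (steps \<sigma>) + 3 + 8 * real (nreg \<sigma>' wsp_reg - a)" for \<sigma>' :: machine
    show ?thesis
    proof (rule wp_While[where Inv = Inv and Bd = "real (steps \<sigma>) + 3 + 8 * real (deg y)"])
      have "prev_arc y (Suc (2 * m)) \<le> 2 * m" using prev_less[of "Suc (2 * m)" y] by simp
      moreover have "\<not> prev_arc y (Suc (2 * m)) < r" if "r \<le> 2 * m" "usrc r = y" for r
        using prev_max[of y "Suc (2 * m)" r] that by auto
      ultimately show "Inv \<sigma>0"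
        using prev_src[of y "Suc (2 * m)"] rest_le_deg \<sigma>0
        by (auto simp: Inv_def)
    next
      fix \<sigma>' assume "Inv \<sigma>'"
      then show "real (steps \<sigma>') \<le> real (steps \<sigma>) + 3 + 8 * real (deg y)"
        unfolding Inv_def by linarith
    next
      fix \<sigma>' assume Inv: "Inv \<sigma>'" and fr: "frame scan_step \<sigma>0 \<sigma>'"
        and h: "holds (NLess zero_reg id_reg) \<sigma>'"
      have st': "static \<sigma>'" by (rule static_frame[OF st0 fr]) (simp_all add: scan_step_def)
      define r where "r = nreg \<sigma>' id_reg"
      have r: "r \<in> {1..2 * m}" "usrc r = y"
        using Inv h st' by (auto simp: Inv_def r_def static_def)
      have st_r: "narr \<sigma>' nxt_arr r = prev_arc y r" "narr \<sigma>' tgt_arr r = utgt r"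
        using st' r by (auto simp: static_def)
      define b where "b = prev_arc y r"
      have b: "b < r" "b \<noteq> 0 \<Longrightarrow> usrc b = y" "\<And>r'. b < r' \<Longrightarrow> r' < r \<Longrightarrow> usrc r' \<noteq> y"
        "rest y b < rest y r"
        using prev_less[of r y] prev_src[of y r] prev_max[of y r] rest_prev_arc[of r] r by (auto simp: b_def)
      define z where "z = mir (utgt r)"
      have z: "z \<in> verts2"
        using usrc_verts2[OF opp(1)[OF r(1)]] opp(2)[OF r(1)] by (simp add: z_def)
      define wk sp where "wk = narr \<sigma>' work_arr" "sp = nreg \<sigma>' wsp_reg"
      have I: "a \<le> sp" "sp - a + rest y r \<le> deg y" "\<And>p. p < a \<Longrightarrow> wk p = narr \<sigma> work_arr p"
        "\<And>p. a \<le> p \<Longrightarrow> p < sp \<Longrightarrow> wk p \<in> verts2"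
        "\<And>r'. r' \<in> {1..2 * m} \<Longrightarrow> usrc r' = y \<Longrightarrow> r < r' \<Longrightarrow> mir (utgt r') \<in> wk ` {..<sp}"
        "real (steps \<sigma>') \<le> real (steps \<sigma>) + 3 + 8 * real (sp - a)"
        using Inv by (auto simp: Inv_def r_def wk_sp_def)
      have new: "mir (utgt r') \<in> (wk(sp := z)) ` {..<Suc sp}"
        if "r' \<in> {1..2 * m}" "usrc r' = y" "b < r'" for r'
      proof (cases "r' = r")
        case True
        then show ?thesis by (simp add: z_def lessThan_Suc)
      next
        case False
        with b(3)[of r'] that have "r < r'" by force
        with I(5) that obtain p where "p < sp" "mir (utgt r') = wk p" by blast
        then have "mir (utgt r') = (wk(sp := z)) p" "p < Suc sp" by auto
        then show ?thesis by blast
      qed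
      have verts: "(wk(sp := z)) p \<in> verts2" if "a \<le> p" "p < Suc sp" for p
        using that I(4) z by auto
      note F = r_def[symmetric] wk_sp_def[symmetric] st_r b_def[symmetric] st'[unfolded static_def]
      have steps': "real (steps \<sigma>') + 7 \<le> real (steps \<sigma>) + 3 + 8 * real (Suc sp - a)"
        using I(1,6) by (simp add: of_nat_diff)
      have "mir (utgt r) = (if utgt r < n then utgt r + n else utgt r - n)" by (simp add: mir_def)
      then have zz: "utgt r < n \<Longrightarrow> utgt r + n = z" "\<not> utgt r < n \<Longrightarrow> utgt r - n = z"
        by (simp_all add: z_def)
      have fin: "b \<le> 2 * m" "a \<le> Suc sp" "Suc sp - a + rest y b \<le> deg y"
        "\<And>p. p < a \<Longrightarrow> (wk(sp := z)) p = narr \<sigma> work_arr p"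
        using b r I by auto
      show "wp scan_step Inv (tick \<sigma>')"
        using fin verts new steps' b(2) zz
        by (simp add: scan_step_def wp_simps wp_Skip F Inv_def)
    next
      fix \<sigma>' assume Inv: "Inv \<sigma>'" and fr: "frame scan_step \<sigma>0 \<sigma>'"
        and h: "\<not> holds (NLess zero_reg id_reg) \<sigma>'"
      have st': "static \<sigma>'" by (rule static_frame[OF st0 fr]) (simp_all add: scan_step_def)
      then have id0: "nreg \<sigma>' id_reg = 0" using h by (simp add: static_def)
      show "Q (tick \<sigma>')"
      proof (rule Q)
        have "frame scan \<sigma>0 \<sigma>'" using fr by (simp add: frame_def scan_def)
        with \<sigma>0(3) show "frame scan \<sigma> (tick \<sigma>')" by (simp add: frame_def)
        show "usrc r \<in> narr (tick \<sigma>') work_arr ` {..<nreg (tick \<sigma>') wsp_reg}"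
          if r: "r \<in> {1..2 * m}" "utgt r = x" for r
        proof -
          have "usrc (opp r) = y" using opp(2)[OF r(1)] r(2) by (simp add: y_def)
          moreover have "mir (utgt (opp r)) = usrc r"
            using opp(3)[OF r(1)] mir_mir usrc_less[OF r(1)] by simp
          moreover have "opp r \<in> {1..2 * m}" using opp(1)[OF r(1)] .
          ultimately show ?thesis
            using Inv id0 unfolding Inv_def by (metis atLeastAtMost_iff bot_nat_0.not_eq_extremum machine_sel_simps(21,23) not_one_le_zero)
        qed
      qed (use Inv id0 in \<open>auto simp: Inv_def a_def y_def\<close>)
    qed
  qed
  have yy: "x < n \<Longrightarrow> x + n = y" "\<not> x < n \<Longrightarrow> x - n = y" by (simp_all add: y_def mir_def)
  have first: "narr \<sigma> first_arr y = prev_arc y (Suc (2 * m))" using st y by (simp add: static_def)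
  show ?thesis
    using st x(1) yy
    by (auto simp: scan_def wp_simps wp_Skip static_def first a_def frame_def intro!: loop)
qed

text \<open>Outside the worklist \<open>D\<close>, the cursor arc of a live vertex is admissible.
  With \<open>D\<close> empty, following cursors from a vertex of \<open>verts2\<close> whose label
  is at most \<open>\<Theta>\<close> descends to a root. Vertices with larger labels are exempt,
  since no walk is started from them.\<close>

definition tight :: "(nat \<Rightarrow> real) \<Rightarrow> (nat \<Rightarrow> nat) \<Rightarrow> (nat \<Rightarrow> real) \<Rightarrow> nat \<Rightarrow> nat set \<Rightarrow> bool" where
  "tight lab cur w c D \<longleftrightarrow>
     (\<forall>x\<in>verts2 - D. x \<noteq> cent c \<longrightarrow> x \<noteq> n + cent c \<longrightarrow> lab (cell c x) \<le> \<Theta> \<longrightarrow>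
        cur (cell c x) \<noteq> 0 \<and>
        lab (cell c (utgt (cur (cell c x)))) + w (und (cur (cell c x))) \<le> lab (cell c x))"

lemma tightD:
  assumes "tight lab cur w c D" "x \<in> verts2" "x \<notin> D" "x \<noteq> cent c" "x \<noteq> n + cent c" "lab (cell c x) \<le> \<Theta>"
  shows "cur (cell c x) \<noteq> 0"
    "lab (cell c (utgt (cur (cell c x)))) + w (und (cur (cell c x))) \<le> lab (cell c x)"
  using assms by (auto simp: tight_def)

lemma tight_pop:
  assumes "tight lab cur w c (insert x D)"
    and "x \<noteq> cent c \<Longrightarrow> x \<noteq> n + cent c \<Longrightarrow> lab (cell c x) \<le> \<Theta> \<Longrightarrow>
        cur (cell c x) \<noteq> 0 \<and>
        lab (cell c (utgt (cur (cell c x)))) + w (und (cur (cell c x))) \<le> lab (cell c x)"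
  shows "tight lab cur w c D"
  unfolding tight_def
proof (intro ballI impI)
  fix y assume y: "y \<in> verts2 - D" "y \<noteq> cent c" "y \<noteq> n + cent c" "lab (cell c y) \<le> \<Theta>"
  show "cur (cell c y) \<noteq> 0 \<and>
        lab (cell c (utgt (cur (cell c y)))) + w (und (cur (cell c y))) \<le> lab (cell c y)"
  proof (cases "y = x")
    case True
    with assms(2) y show ?thesis by simp
  next
    case False
    with y have "y \<notin> insert x D" by simp
    with y tightD[OF assms(1), of y] show ?thesis by auto
  qed
qed

lemma tight_advance:
  assumes t: "tight lab cur w c D" and x: "x \<in> D" "x \<in> verts2"
  shows "tight lab (cur(cell c x := b)) w c D"
  unfolding tight_def
proof (intro ballI impI)
  fix y assume y: "y \<in> verts2 - D" "y \<noteq> cent c" "y \<noteq> n + cent c" "lab (cell c y) \<le> \<Theta>"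
  have "cell c y \<noteq> cell c x"
    using y(1) x cell_eq_iff[OF verts2_less verts2_less, of y x c c] by auto
  with y tightD[OF t, of y] show "(cur(cell c x := b)) (cell c y) \<noteq> 0 \<and>
     lab (cell c (utgt ((cur(cell c x := b)) (cell c y)))) + w (und ((cur(cell c x := b)) (cell c y)))
       \<le> lab (cell c y)" by auto
qed

text \<open>Raising the label of \<open>x\<close> can invalidate only cursor arcs that end in
  \<open>x\<close>; their tails are what the scan adds to the worklist, and \<open>x\<close> itself
  stays on it.\<close>

lemma tight_relabel:
  assumes inv: "lab_inv lab cur w" and c: "c < N"
    and t: "tight lab cur w c D" and x: "x \<in> D" "x \<in> verts2"
    and D': "D \<subseteq> D'" "\<And>r. r \<in> {1..2 * m} \<Longrightarrow> utgt r = x \<Longrightarrow> usrc r \<in> D'"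
  shows "tight (lab(cell c x := l)) (cur(cell c x := b)) w c D'"
  unfolding tight_def
proof (intro ballI impI)
  fix y assume y: "y \<in> verts2 - D'" "y \<noteq> cent c" "y \<noteq> n + cent c" "(lab(cell c x := l)) (cell c y) \<le> \<Theta>"
  have y2: "y < 2 * n" and x2: "x < 2 * n" using y(1) x(2) verts2_less by auto
  have ne: "cell c y \<noteq> cell c x"
    using y(1) x(1) D' cell_eq_iff[OF y2 x2, of c c] by auto
  let ?r = "cur (cell c y)"
  have old: "?r \<noteq> 0" "lab (cell c (utgt ?r)) + w (und ?r) \<le> lab (cell c y)"
    using tightD[OF t, of y] y D'(1) ne by auto
  have r: "?r \<in> {1..2 * m}" "usrc ?r = y"
    using lab_invD(7,8)[OF inv c y2] old(1) by auto
  have "utgt ?r \<noteq> x" using D'(2)[OF r(1)] r(2) y(1) by auto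
  then have "cell c (utgt ?r) \<noteq> cell c x"
    using cell_eq_iff[OF utgt_less[OF r(1)] x2, of c c] by simp
  with ne old show "(cur(cell c x := b)) (cell c y) \<noteq> 0 \<and>
     (lab(cell c x := l)) (cell c (utgt ((cur(cell c x := b)) (cell c y)))) +
       w (und ((cur(cell c x := b)) (cell c y))) \<le> (lab(cell c x := l)) (cell c y)" by simp
qed

text \<open>Amortisation: a removal is paid by the 20 credits of its worklist entry, a cursor
  advance or a raise by the drop of \<open>pot\<close>. Other centres are untouched, which lets the
  loop over centres treat them one by one.\<close>

lemma fix_wp:
  assumes st: "static \<sigma>"
    and inv: "lab_inv (rarr \<sigma> lab_rarr) (narr \<sigma> cur_arr) (rarr \<sigma> wr_rarr)" and c: "c < N"
    and regs: "nreg \<sigma> base_reg = c * (2 * n)" "rreg \<sigma> q_rr = q c" "nreg \<sigma> v_reg = cent c"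
      "nreg \<sigma> v2_reg = n + cent c"
    and work: "\<And>p. p < nreg \<sigma> wsp_reg \<Longrightarrow> narr \<sigma> work_arr p \<in> verts2"
    and t: "tight (rarr \<sigma> lab_rarr) (narr \<sigma> cur_arr) (rarr \<sigma> wr_rarr) c
       (narr \<sigma> work_arr ` {..<nreg \<sigma> wsp_reg})"
    and Q: "\<And>\<sigma>'. frame fix_labels \<sigma> \<sigma>' \<Longrightarrow>
      lab_inv (rarr \<sigma>' lab_rarr) (narr \<sigma>' cur_arr) (rarr \<sigma>' wr_rarr) \<Longrightarrow>
      tight (rarr \<sigma>' lab_rarr) (narr \<sigma>' cur_arr) (rarr \<sigma>' wr_rarr) c {} \<Longrightarrow>
      (\<And>g. rarr \<sigma> lab_rarr g \<le> rarr \<sigma>' lab_rarr g) \<Longrightarrow>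
      (\<And>c' x. c' \<noteq> c \<Longrightarrow> x < 2 * n \<Longrightarrow> rarr \<sigma>' lab_rarr (cell c' x) = rarr \<sigma> lab_rarr (cell c' x) \<and>
          narr \<sigma>' cur_arr (cell c' x) = narr \<sigma> cur_arr (cell c' x)) \<Longrightarrow>
      real (steps \<sigma>') + 20 * pot (rarr \<sigma>' lab_rarr) (narr \<sigma>' cur_arr) \<le>
        real (steps \<sigma>) + 20 * pot (rarr \<sigma> lab_rarr) (narr \<sigma> cur_arr) + 20 * real (nreg \<sigma> wsp_reg) + 1 \<Longrightarrow>
      Q \<sigma>'"
  shows "wp fix_labels Q \<sigma>"
proof -
  define Inv where "Inv \<sigma>' \<longleftrightarrow>
     lab_inv (rarr \<sigma>' lab_rarr) (narr \<sigma>' cur_arr) (rarr \<sigma> wr_rarr) \<and>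
     tight (rarr \<sigma>' lab_rarr) (narr \<sigma>' cur_arr) (rarr \<sigma> wr_rarr) c (narr \<sigma>' work_arr ` {..<nreg \<sigma>' wsp_reg}) \<and>
     (\<forall>p<nreg \<sigma>' wsp_reg. narr \<sigma>' work_arr p \<in> verts2) \<and>
     (\<forall>g. rarr \<sigma> lab_rarr g \<le> rarr \<sigma>' lab_rarr g) \<and>
     (\<forall>c' x. c' \<noteq> c \<longrightarrow> x < 2 * n \<longrightarrow> rarr \<sigma>' lab_rarr (cell c' x) = rarr \<sigma> lab_rarr (cell c' x) \<and>
        narr \<sigma>' cur_arr (cell c' x) = narr \<sigma> cur_arr (cell c' x)) \<and>
     real (steps \<sigma>') + 20 * pot (rarr \<sigma>' lab_rarr) (narr \<sigma>' cur_arr) + 20 * real (nreg \<sigma>' wsp_reg) \<le>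
        real (steps \<sigma>) + 20 * pot (rarr \<sigma> lab_rarr) (narr \<sigma> cur_arr) + 20 * real (nreg \<sigma> wsp_reg)"
    for \<sigma>' :: machine
  note defs_simps = fix_step_def scan_def scan_step_def
  show ?thesis
    unfolding fix_labels_def
  proof (rule wp_While[where Inv = Inv and Bd = "real (steps \<sigma>) +
        20 * pot (rarr \<sigma> lab_rarr) (narr \<sigma> cur_arr) + 20 * real (nreg \<sigma> wsp_reg)"])
    show "Inv \<sigma>" using inv t work by (simp add: Inv_def)
  next
    fix \<sigma>' assume Inv: "Inv \<sigma>'"
    then have "lab_inv (rarr \<sigma>' lab_rarr) (narr \<sigma>' cur_arr) (rarr \<sigma> wr_rarr)" by (simp add: Inv_def)
    from pot_nonneg[OF this] Inv show "real (steps \<sigma>') \<le> real (steps \<sigma>) +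
        20 * pot (rarr \<sigma> lab_rarr) (narr \<sigma> cur_arr) + 20 * real (nreg \<sigma> wsp_reg)"
      unfolding Inv_def by linarith
  next
    fix \<sigma>' assume Inv: "Inv \<sigma>'" and fr: "frame fix_step \<sigma> \<sigma>'"
      and h: "\<not> holds (NLess zero_reg wsp_reg) \<sigma>'"
    have st': "static \<sigma>'" by (rule static_frame[OF st fr]) (simp_all add: defs_simps)
    then have "nreg \<sigma>' wsp_reg = 0" using h by (simp add: static_def)
    moreover have "rarr \<sigma>' wr_rarr = rarr \<sigma> wr_rarr"
      using frameD(4)[OF fr, of wr_rarr] by (simp add: defs_simps)
    moreover have "frame fix_labels \<sigma> (tick \<sigma>')" using fr by (simp add: frame_def fix_labels_def)
    ultimately show "Q (tick \<sigma>')"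
      using Inv by (intro Q) (auto simp: Inv_def)
  next
    fix \<sigma>' assume Inv: "Inv \<sigma>'" and fr: "frame fix_step \<sigma> \<sigma>'"
      and h: "holds (NLess zero_reg wsp_reg) \<sigma>'"
    have st': "static \<sigma>'" by (rule static_frame[OF st fr]) (simp_all add: defs_simps)
    have fr': "rarr \<sigma>' wr_rarr = rarr \<sigma> wr_rarr" "nreg \<sigma>' base_reg = c * (2 * n)" "rreg \<sigma>' q_rr = q c"
      "nreg \<sigma>' v_reg = cent c" "nreg \<sigma>' v2_reg = n + cent c"
      using frameD[OF fr] regs by (simp_all add: defs_simps)
    define lab cur wk sp x where defs: "lab = rarr \<sigma>' lab_rarr" "cur = narr \<sigma>' cur_arr"
      "wk = narr \<sigma>' work_arr" "sp = nreg \<sigma>' wsp_reg" "x = wk (sp - 1)"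
    define w where "w = rarr \<sigma> wr_rarr"
    have sp: "0 < sp" using h st' by (simp add: static_def defs)
    have inv': "lab_inv lab cur w" and t': "tight lab cur w c (wk ` {..<sp})"
      and wk: "\<And>p. p < sp \<Longrightarrow> wk p \<in> verts2" and mono: "\<And>g. rarr \<sigma> lab_rarr g \<le> lab g"
      and other: "\<And>c' x. c' \<noteq> c \<Longrightarrow> x < 2 * n \<Longrightarrow> lab (cell c' x) = rarr \<sigma> lab_rarr (cell c' x) \<and>
        cur (cell c' x) = narr \<sigma> cur_arr (cell c' x)"
      and steps: "real (steps \<sigma>') + 20 * pot lab cur + 20 * real sp \<le>
        real (steps \<sigma>) + 20 * pot (rarr \<sigma> lab_rarr) (narr \<sigma> cur_arr) + 20 * real (nreg \<sigma> wsp_reg)"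
      using Inv unfolding Inv_def defs w_def by auto
    have xv: "x \<in> verts2" using wk[of "sp - 1"] sp by (simp add: defs)
    have x2: "x < 2 * n" using verts2_less[OF xv] .
    have set: "wk ` {..<sp} = insert x (wk ` {..<sp - 1})"
    proof -
      have "{..<sp} = insert (sp - 1) {..<sp - 1}" using sp by auto
      then show ?thesis by (simp add: defs(5))
    qed
    have x_eq: "wk (sp - 1) = x" by (simp add: defs)
    have cellx: "c * (2 * n) + z = cell c z" for z by (simp add: cell_def)
    have spr: "real (sp - Suc 0) = real sp - 1" using sp by simp
    note F = fr' defs(1-4)[symmetric] st'[unfolded static_def] x_eq[unfolded One_nat_def] w_def[symmetric] cellx
    have wk': "wk p \<in> verts2" if "p < sp - Suc 0" for p using wk that by simp
    consider (dead) "\<Theta> < lab (cell c x)" | (root) "x = cent c \<or> x = n + cent c"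
      | (relabel) "\<not> \<Theta> < lab (cell c x)" "x \<noteq> cent c" "x \<noteq> n + cent c" "cur (cell c x) = 0"
      | (arc) "\<not> \<Theta> < lab (cell c x)" "x \<noteq> cent c" "x \<noteq> n + cent c" "cur (cell c x) \<noteq> 0"
      by blast
    then show "wp fix_step Inv (tick \<sigma>')"
    proof cases
      case dead
      then have "tight lab cur w c (wk ` {..<sp - Suc 0})"
        using tight_pop[of lab cur w c x] t' set by simp
      then show ?thesis
        using dead inv' mono other wk' steps spr
        by (simp add: fix_step_def wp_simps wp_Skip F Inv_def)
    next
      case root
      then have "tight lab cur w c (wk ` {..<sp - Suc 0})"
        using tight_pop[of lab cur w c x] t' set by auto
      then show ?thesis
        using root inv' mono other wk' steps spr
        by (auto simp add: fix_step_def wp_simps wp_Skip F Inv_def)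
    next
      case arc
      define r where "r = cur (cell c x)"
      have r: "r \<in> {1..2 * m}" "usrc r = x" "r \<noteq> 0"
        using lab_invD(7,8)[OF inv' c x2] arc(4) by (auto simp: r_def Suc_le_eq)
      have st_r: "narr \<sigma>' nxt_arr r = prev_arc (usrc r) r" "narr \<sigma>' tgt_arr r = utgt r"
        "narr \<sigma>' und_arr r = und r"
        using st' r(1) by (auto simp: static_def)
      show ?thesis
      proof (cases "lab (cell c (utgt r)) + w (und r) \<le> lab (cell c x)")
        case True
        then have "tight lab cur w c (wk ` {..<sp - Suc 0})"
          using tight_pop[of lab cur w c x "wk ` {..<sp - Suc 0}"] t' set arc r_def by simp
        then show ?thesis
          using arc(1-3) True inv' mono other wk' steps spr r_def[symmetric] r(3)
          by (simp add: fix_step_def wp_simps wp_Skip F Inv_def st_r)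
      next
        case False
        note upd = lab_inv_advance[OF inv' c xv r_def[symmetric] r(3) False refl]
        have t'': "tight lab (cur(cell c x := prev_arc (usrc r) r)) w c (wk ` {..<sp})"
          using tight_advance[OF t' _ xv] set by simp
        have other': "cell c' y \<noteq> cell c x" if "c' \<noteq> c" "y < 2 * n" for c' y
          using cell_eq_iff[OF that(2) x2, of c' c] that by simp
        show ?thesis
          using arc(1-3) False upd mono other other' wk steps r_def[symmetric] r(3) t''
          by (simp add: fix_step_def wp_simps wp_Skip F Inv_def st_r)
      qed
    next
      case relabel
      define l where "l = max d0 (lab (cell c x) * q c)"
      define b where "b = prev_arc x (Suc (2 * m))"
      have le: "lab (cell c x) \<le> \<Theta>" using relabel(1) by simp
      note upd = lab_inv_relabel[OF inv' c xv relabel(2,3,4) le l_def b_def]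
      let ?lab = "lab(cell c x := l)" and ?cur = "cur(cell c x := b)"
      have first: "narr \<sigma>' first_arr x = b" using st' x2 by (simp add: static_def b_def)
      have scan: "wp scan Inv \<tau>"
        if \<tau>: "rarr \<tau> lab_rarr = ?lab" "narr \<tau> cur_arr = ?cur" "narr \<tau> work_arr = wk" "nreg \<tau> wsp_reg = sp"
          "nreg \<tau> x_reg = x" "frame fix_step \<sigma>' \<tau>" "steps \<tau> \<le> steps \<sigma>' + 16" for \<tau>
      proof (rule scan_wp[OF _ \<tau>(5) x2])
        show "static \<tau>" by (rule static_frame[OF st' \<tau>(6)]) (simp_all add: defs_simps)
        fix \<tau>' assume fr\<tau>: "frame scan \<tau> \<tau>'" and S: "nreg \<tau> wsp_reg \<le> nreg \<tau>' wsp_reg"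
          "nreg \<tau>' wsp_reg - nreg \<tau> wsp_reg \<le> deg (mir x)"
          "\<And>p. p < nreg \<tau> wsp_reg \<Longrightarrow> narr \<tau>' work_arr p = narr \<tau> work_arr p"
          "\<And>p. nreg \<tau> wsp_reg \<le> p \<Longrightarrow> p < nreg \<tau>' wsp_reg \<Longrightarrow> narr \<tau>' work_arr p \<in> verts2"
          "\<And>r. r \<in> {1..2 * m} \<Longrightarrow> utgt r = x \<Longrightarrow> usrc r \<in> narr \<tau>' work_arr ` {..<nreg \<tau>' wsp_reg}"
          "real (steps \<tau>') \<le> real (steps \<tau>) + 8 * real (nreg \<tau>' wsp_reg - nreg \<tau> wsp_reg) + 4"
        have eq: "rarr \<tau>' lab_rarr = ?lab" "narr \<tau>' cur_arr = ?cur"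
          using frameD[OF fr\<tau>] \<tau> by (simp_all add: scan_def scan_step_def)
        have sub: "wk ` {..<sp} \<subseteq> narr \<tau>' work_arr ` {..<nreg \<tau>' wsp_reg}"
        proof
          fix y assume "y \<in> wk ` {..<sp}"
          then obtain p where "p < sp" "y = wk p" by auto
          with S(1,3) \<tau>(3,4) have "p < nreg \<tau>' wsp_reg" "y = narr \<tau>' work_arr p" by auto
          then show "y \<in> narr \<tau>' work_arr ` {..<nreg \<tau>' wsp_reg}" by blast
        qed
        have "tight ?lab ?cur w c (narr \<tau>' work_arr ` {..<nreg \<tau>' wsp_reg})"
          using tight_relabel[OF inv' c t' _ xv sub S(5)] set by blast
        moreover have "narr \<tau>' work_arr p \<in> verts2" if "p < nreg \<tau>' wsp_reg" for p
          using S(3)[of p] S(4)[of p] wk[of p] that \<tau>(3,4) by (cases "p < sp") auto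
        moreover have "rarr \<sigma> lab_rarr g \<le> ?lab g" for g
          using mono[of g] upd(3) by auto
        moreover have "?lab (cell c' y) = rarr \<sigma> lab_rarr (cell c' y)" "?cur (cell c' y) = narr \<sigma> cur_arr (cell c' y)"
          if "c' \<noteq> c" "y < 2 * n" for c' y
          using other[OF that] cell_eq_iff[OF that(2) x2, of c' c] that by simp_all
        \<comment> \<open>The drop of \<open>pot\<close> by \<open>2 * deg (mir x) + 1\<close>,
          taken 20 times, covers 20 credits for each new entry, 8 scan steps per entry, and 20
          further steps.\<close>
        moreover have "real (steps \<tau>') + 20 * pot ?lab ?cur + 20 * real (nreg \<tau>' wsp_reg) \<le>
          real (steps \<sigma>) + 20 * pot (rarr \<sigma> lab_rarr) (narr \<sigma> cur_arr) + 20 * real (nreg \<sigma> wsp_reg)"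
        proof -
          have "real (nreg \<tau>' wsp_reg) \<le> real sp + real (deg (mir x))"
            "real (steps \<tau>') \<le> real (steps \<sigma>') + 20 + 8 * real (deg (mir x))"
            using S(1,2,6) \<tau>(4,7) by linarith+
          with upd(2) steps show ?thesis by simp
        qed
        ultimately show "Inv \<tau>'"
          unfolding Inv_def eq w_def[symmetric] using upd(1) by blast
      qed
      show ?thesis
      proof (cases "lab (cell c x) * q c < d0")
        case True
        then have l: "d0 = l" by (simp add: l_def)
        show ?thesis
          using relabel True
          by (simp add: fix_step_def wp_simps wp_Skip F l first)
            (rule scan, simp_all add: F frame_def fix_step_def)
      next
        case False
        then have l: "lab (cell c x) * q c = l" by (simp add: l_def)
        show ?thesis
          using relabel False
          by (simp add: fix_step_def wp_simps wp_Skip F l first)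
            (rule scan, simp_all add: F frame_def fix_step_def)
      qed
    qed
  qed
qed

lemma tight_raise:
  assumes "tight lab cur w c {}" and inv: "lab_inv lab cur w" and c: "c < N" and e: "e < m"
  shows "tight lab cur (w(e := l)) c {tail_of e, n + head_of e}"
  unfolding tight_def
proof (intro ballI impI)
  fix x assume x: "x \<in> verts2 - {tail_of e, n + head_of e}" "x \<noteq> cent c" "x \<noteq> n + cent c"
    "lab (cell c x) \<le> \<Theta>"
  then have old: "cur (cell c x) \<noteq> 0"
    "lab (cell c (utgt (cur (cell c x)))) + w (und (cur (cell c x))) \<le> lab (cell c x)"
    using tightD[OF assms(1), of x] by auto
  have "x < 2 * n" using x verts2_less by auto
  then have "usrc (cur (cell c x)) = x"
    using lab_invD(8)[OF inv c] old(1) by auto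
  then have "und (cur (cell c x)) \<noteq> e"
    using x(1) by (auto simp: usrc_def split: if_splits)
  with old show "cur (cell c x) \<noteq> 0 \<and>
     lab (cell c (utgt (cur (cell c x)))) + (w(e := l)) (und (cur (cell c x))) \<le> lab (cell c x)"
    by simp
qed

lemma tight_cong:
  assumes "tight lab cur w c D" "lab_inv lab cur w" "c < N"
    and "\<And>x. x < 2 * n \<Longrightarrow> lab' (cell c x) = lab (cell c x) \<and> cur' (cell c x) = cur (cell c x)"
  shows "tight lab' cur' w c D"
  unfolding tight_def
proof (intro ballI impI)
  fix x assume x: "x \<in> verts2 - D" "x \<noteq> cent c" "x \<noteq> n + cent c" "lab' (cell c x) \<le> \<Theta>"
  have x2: "x < 2 * n" using x(1) verts2_less by auto
  have old: "cur (cell c x) \<noteq> 0"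
    "lab (cell c (utgt (cur (cell c x)))) + w (und (cur (cell c x))) \<le> lab (cell c x)"
    using tightD[OF assms(1), of x] x assms(4)[OF x2] by auto
  have "cur (cell c x) \<in> {1..2 * m}" using lab_invD(7)[OF assms(2,3) x2] old(1) by simp
  then show "cur' (cell c x) \<noteq> 0 \<and>
     lab' (cell c (utgt (cur' (cell c x)))) + w (und (cur' (cell c x))) \<le> lab' (cell c x)"
    using old assms(4)[OF x2] assms(4)[OF utgt_less] by simp
qed

lemma update_wp:
  assumes st: "static \<sigma>" and e: "nreg \<sigma> ue_reg = e" "e < m"
    and inv: "lab_inv (rarr \<sigma> lab_rarr) (narr \<sigma> cur_arr) (rarr \<sigma> wr_rarr)"
    and t: "\<And>c. c < N \<Longrightarrow> tight (rarr \<sigma> lab_rarr) (narr \<sigma> cur_arr) (rarr \<sigma> wr_rarr) c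
       {tail_of e, n + head_of e}"
    and Q: "\<And>\<sigma>'. frame update \<sigma> \<sigma>' \<Longrightarrow>
      lab_inv (rarr \<sigma>' lab_rarr) (narr \<sigma>' cur_arr) (rarr \<sigma>' wr_rarr) \<Longrightarrow>
      (\<And>c. c < N \<Longrightarrow> tight (rarr \<sigma>' lab_rarr) (narr \<sigma>' cur_arr) (rarr \<sigma>' wr_rarr) c {}) \<Longrightarrow>
      (\<And>g. rarr \<sigma> lab_rarr g \<le> rarr \<sigma>' lab_rarr g) \<Longrightarrow>
      real (steps \<sigma>') + 20 * pot (rarr \<sigma>' lab_rarr) (narr \<sigma>' cur_arr) \<le>
        real (steps \<sigma>) + 20 * pot (rarr \<sigma> lab_rarr) (narr \<sigma> cur_arr) + 60 * real N + 2 \<Longrightarrow>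
      Q \<sigma>'"
  shows "wp update Q \<sigma>"
proof -
  define \<sigma>0 where "\<sigma>0 = set_nreg cc_reg 0 (tick \<sigma>)"
  define Inv where "Inv j \<sigma>' \<longleftrightarrow>
     lab_inv (rarr \<sigma>' lab_rarr) (narr \<sigma>' cur_arr) (rarr \<sigma> wr_rarr) \<and>
     (\<forall>c<N. tight (rarr \<sigma>' lab_rarr) (narr \<sigma>' cur_arr) (rarr \<sigma> wr_rarr) c
         (if c < j then {} else {tail_of e, n + head_of e})) \<and>
     (\<forall>g. rarr \<sigma> lab_rarr g \<le> rarr \<sigma>' lab_rarr g)" for j :: nat and \<sigma>' :: machine
  note defs_simps = update_step_def enter_center_def fix_labels_def fix_step_def scan_def scan_step_def
  have r: "Suc e \<in> {1..2 * m}" "Suc e + m \<in> {1..2 * m}" using e by auto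
  have verts: "tail_of e \<in> verts2" "n + head_of e \<in> verts2"
    using usrc_verts2[OF r(1)] usrc_verts2[OF r(2)] e by (auto simp: usrc_def und_def)
  have "wp (While (NLess cc_reg N_reg) update_step) Q \<sigma>0"
  proof (rule wp_For_pot[where Inv = Inv and L = N and Bd = 60 and
        \<phi> = "\<lambda>\<sigma>. 20 * pot (rarr \<sigma> lab_rarr) (narr \<sigma> cur_arr)"])
    show "Inv (nreg \<sigma>0 cc_reg) \<sigma>0" using inv t by (simp add: Inv_def \<sigma>0_def)
    show "nreg \<sigma>0 cc_reg \<le> N" "nreg \<sigma>0 N_reg = N" "N_reg \<notin> wrN update_step"
      using st by (simp_all add: \<sigma>0_def static_def defs_simps)
    show "Inv j (tick \<sigma>') = Inv j \<sigma>'" for \<sigma>' j by (simp add: Inv_def)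
    show "0 \<le> 20 * pot (rarr \<sigma>' lab_rarr) (narr \<sigma>' cur_arr)" if "Inv j \<sigma>'" for \<sigma>' j
      using that pot_nonneg by (auto simp: Inv_def)
  next
    fix \<sigma>' assume Inv: "Inv N \<sigma>'" and fr: "frame update_step \<sigma>0 \<sigma>'"
      and steps: "real (steps \<sigma>') + 20 * pot (rarr \<sigma>' lab_rarr) (narr \<sigma>' cur_arr)
           \<le> real (steps \<sigma>0) + 20 * pot (rarr \<sigma>0 lab_rarr) (narr \<sigma>0 cur_arr) +
             real (N - nreg \<sigma>0 cc_reg) * 60 + 1"
    have "rarr \<sigma>' wr_rarr = rarr \<sigma> wr_rarr"
      using frameD(4)[OF fr, of wr_rarr] by (simp add: defs_simps \<sigma>0_def)
    moreover have "frame update \<sigma> \<sigma>'" using fr by (simp add: frame_def update_def \<sigma>0_def)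
    ultimately show "Q \<sigma>'"
      using Inv steps by (intro Q) (simp_all add: Inv_def \<sigma>0_def)
  next
    fix \<sigma>' j assume Inv: "Inv j \<sigma>'" and fr: "frame update_step \<sigma>0 \<sigma>'"
      and j: "nreg \<sigma>' cc_reg = j" "j < N"
    have "static \<sigma>0" using st by (simp add: \<sigma>0_def static_def)
    then have st': "static \<sigma>'" by (rule static_frame[OF _ fr]) (simp_all add: defs_simps)
    have fr': "rarr \<sigma>' wr_rarr = rarr \<sigma> wr_rarr" "nreg \<sigma>' ue_reg = e"
      using frameD[OF fr] e by (simp_all add: defs_simps \<sigma>0_def)
    have arcs: "narr \<sigma>' tail_arr e = tail_of e" "narr \<sigma>' head_arr e = head_of e" "narr \<sigma>' cent_arr j = cent j"
      using st' e(2) j by (simp_all add: static_def)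
    have inv': "lab_inv (rarr \<sigma>' lab_rarr) (narr \<sigma>' cur_arr) (rarr \<sigma> wr_rarr)"
      and mono: "\<And>g. rarr \<sigma> lab_rarr g \<le> rarr \<sigma>' lab_rarr g" using Inv by (auto simp: Inv_def)
    have t': "tight (rarr \<sigma>' lab_rarr) (narr \<sigma>' cur_arr) (rarr \<sigma> wr_rarr) c
         (if c < j then {} else {tail_of e, n + head_of e})" if "c < N" for c
      using Inv that by (auto simp: Inv_def)
    have q: "1 + real (Suc j) / (real K * real N) = q j" by (simp add: q_def)
    have key: "wp fix_labels (wp (NArith NAdd cc_reg cc_reg one_reg)
         (\<lambda>\<tau>. nreg \<tau> cc_reg = Suc j \<and> Inv (Suc j) \<tau> \<and>
             real (steps \<tau>) + 20 * pot (rarr \<tau> lab_rarr) (narr \<tau> cur_arr)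
             \<le> real (steps \<sigma>') + 20 * pot (rarr \<sigma>' lab_rarr) (narr \<sigma>' cur_arr) + 60)) \<tau>"
      if \<tau>: "frame update_step \<sigma>' \<tau>" "rarr \<tau> = rarr \<sigma>'" "narr \<tau> cur_arr = narr \<sigma>' cur_arr"
        "nreg \<tau> base_reg = j * (2 * n)" "rreg \<tau> q_rr = q j" "nreg \<tau> v_reg = cent j"
        "nreg \<tau> v2_reg = n + cent j" "nreg \<tau> wsp_reg = 2" "narr \<tau> work_arr 0 = tail_of e"
        "narr \<tau> work_arr (Suc 0) = n + head_of e" "steps \<tau> \<le> steps \<sigma>' + 15" "nreg \<tau> cc_reg = j" for \<tau>
    proof (rule fix_wp[where c = j])
      show "static \<tau>" by (rule static_frame[OF st' \<tau>(1)]) (simp_all add: defs_simps)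
      then have one: "nreg \<tau> one_reg = 1" by (simp add: static_def)
      show "lab_inv (rarr \<tau> lab_rarr) (narr \<tau> cur_arr) (rarr \<tau> wr_rarr)"
        using inv' fr' \<tau> by simp
      have two: "{..<2 :: nat} = {0, Suc 0}" by auto
      show "narr \<tau> work_arr p \<in> verts2" if "p < nreg \<tau> wsp_reg" for p
      proof -
        have "p = 0 \<or> p = Suc 0" using that \<tau>(8) by linarith
        then show ?thesis using \<tau>(9,10) verts by (elim disjE) simp_all
      qed
      show "tight (rarr \<tau> lab_rarr) (narr \<tau> cur_arr) (rarr \<tau> wr_rarr) j
         (narr \<tau> work_arr ` {..<nreg \<tau> wsp_reg})"
      proof -
        have "narr \<tau> work_arr ` {..<nreg \<tau> wsp_reg} = {tail_of e, n + head_of e}"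
          unfolding \<tau>(8) two by (simp add: \<tau>(9,10))
        then show ?thesis using t'[OF j(2)] fr' \<tau>(2,3) by simp
      qed
      fix \<rho> assume fr\<rho>: "frame fix_labels \<tau> \<rho>"
        and R: "lab_inv (rarr \<rho> lab_rarr) (narr \<rho> cur_arr) (rarr \<rho> wr_rarr)"
          "tight (rarr \<rho> lab_rarr) (narr \<rho> cur_arr) (rarr \<rho> wr_rarr) j {}"
          "\<And>g. rarr \<tau> lab_rarr g \<le> rarr \<rho> lab_rarr g"
          "\<And>c' x. c' \<noteq> j \<Longrightarrow> x < 2 * n \<Longrightarrow> rarr \<rho> lab_rarr (cell c' x) = rarr \<tau> lab_rarr (cell c' x) \<and>
              narr \<rho> cur_arr (cell c' x) = narr \<tau> cur_arr (cell c' x)"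
          "real (steps \<rho>) + 20 * pot (rarr \<rho> lab_rarr) (narr \<rho> cur_arr) \<le>
            real (steps \<tau>) + 20 * pot (rarr \<tau> lab_rarr) (narr \<tau> cur_arr) + 20 * real (nreg \<tau> wsp_reg) + 1"
      have eq: "nreg \<rho> cc_reg = j" "nreg \<rho> one_reg = 1" "rarr \<rho> wr_rarr = rarr \<sigma> wr_rarr"
        using frameD[OF fr\<rho>] \<tau> fr' one by (simp_all add: defs_simps)
      have "tight (rarr \<rho> lab_rarr) (narr \<rho> cur_arr) (rarr \<sigma> wr_rarr) c
         (if c < Suc j then {} else {tail_of e, n + head_of e})" if "c < N" for c
      proof (cases "c = j")
        case True
        with R(2) eq show ?thesis by simp
      next
        case False
        have "tight (rarr \<rho> lab_rarr) (narr \<rho> cur_arr) (rarr \<sigma> wr_rarr) c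
           (if c < j then {} else {tail_of e, n + head_of e})"
          by (rule tight_cong[OF t'[OF that] inv' that]) (use R(4)[OF False] \<tau> in auto)
        with False show ?thesis by (auto simp: less_Suc_eq)
      qed
      moreover have "rarr \<sigma> lab_rarr g \<le> rarr \<rho> lab_rarr g" for g
        using mono[of g] R(3)[of g] \<tau>(2) by simp
      ultimately show "wp (NArith NAdd cc_reg cc_reg one_reg)
         (\<lambda>\<tau>. nreg \<tau> cc_reg = Suc j \<and> Inv (Suc j) \<tau> \<and>
             real (steps \<tau>) + 20 * pot (rarr \<tau> lab_rarr) (narr \<tau> cur_arr)
             \<le> real (steps \<sigma>') + 20 * pot (rarr \<sigma>' lab_rarr) (narr \<sigma>' cur_arr) + 60) \<rho>"
        using R(1,5) eq \<tau> by (simp add: wp_simps Inv_def)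
    qed (use \<tau> j in auto)
    show "wp update_step (\<lambda>\<tau>. nreg \<tau> cc_reg = Suc j \<and> Inv (Suc j) \<tau> \<and>
             real (steps \<tau>) + 20 * pot (rarr \<tau> lab_rarr) (narr \<tau> cur_arr)
             \<le> real (steps \<sigma>') + 20 * pot (rarr \<sigma>' lab_rarr) (narr \<sigma>' cur_arr) + 60) (tick \<sigma>')"
      using j fr' arcs st'[unfolded static_def] q
      by (simp add: update_step_def enter_center_def wp_simps wp_Skip wp_Seq)
        (rule key, simp_all add: frame_def update_step_def enter_center_def)
  qed simp_all
  then show ?thesis
    by (simp add: update_def wp_simps wp_Skip \<sigma>0_def)
qed

text \<open>Labels strictly decrease, so the walk ends. A vertex with label 0 must be a root, since
  a tight non-root has a label of at least one arc weight, which is positive. The label of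
  \<open>s\<close> being at most \<open>\<Theta>\<close> keeps all later vertices live.\<close>

lemma walk_wp:
  assumes st: "static \<sigma>"
    and inv: "lab_inv (rarr \<sigma> lab_rarr) (narr \<sigma> cur_arr) (rarr \<sigma> wr_rarr)" and c: "c < N"
    and t: "tight (rarr \<sigma> lab_rarr) (narr \<sigma> cur_arr) (rarr \<sigma> wr_rarr) c {}"
    and regs: "nreg \<sigma> base_reg = c * (2 * n)" "nreg \<sigma> x_reg = s" "s \<in> verts2"
    and le: "rarr \<sigma> lab_rarr (cell c s) \<le> \<Theta>"
    and Q: "\<And>\<sigma>' vs. frame walk \<sigma> \<sigma>' \<Longrightarrow>
      chain c s (rarr \<sigma> wr_rarr) (rarr \<sigma> lab_rarr) (nreg \<sigma> sp_reg) (nreg \<sigma>' sp_reg) vs (narr \<sigma>' estack_arr) \<Longrightarrow>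
      vs (nreg \<sigma>' sp_reg) = (if s < n then cent c else n + cent c) \<Longrightarrow>
      (\<And>p. p < nreg \<sigma> sp_reg \<Longrightarrow> narr \<sigma>' estack_arr p = narr \<sigma> estack_arr p) \<Longrightarrow>
      real (steps \<sigma>') \<le> real (steps \<sigma>) + 8 * real (nreg \<sigma>' sp_reg - nreg \<sigma> sp_reg) + 3 \<Longrightarrow>
      Q \<sigma>'"
  shows "wp walk Q \<sigma>"
proof -
  define \<sigma>0 where "\<sigma>0 = set_rreg L_rr (rarr \<sigma> lab_rarr (cell c s)) (tick (set_nreg g_reg (cell c s) (tick \<sigma>)))"
  let ?a = "nreg \<sigma> sp_reg" and ?w = "rarr \<sigma> wr_rarr" and ?lab = "rarr \<sigma> lab_rarr"
  have w_pos: "?w e > 0" if "e < m" for e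
    using lab_invD(1)[OF inv that] d0_pos by simp
  define Inv where "Inv \<sigma>' \<longleftrightarrow> (\<exists>vs. chain c s ?w ?lab ?a (nreg \<sigma>' sp_reg) vs (narr \<sigma>' estack_arr) \<and>
       nreg \<sigma>' x_reg = vs (nreg \<sigma>' sp_reg)) \<and>
     nreg \<sigma>' g_reg = cell c (nreg \<sigma>' x_reg) \<and> rreg \<sigma>' L_rr = ?lab (cell c (nreg \<sigma>' x_reg)) \<and>
     (\<forall>p<?a. narr \<sigma>' estack_arr p = narr \<sigma> estack_arr p) \<and>
     real (steps \<sigma>') \<le> real (steps \<sigma>) + 2 + 8 * real (nreg \<sigma>' sp_reg - ?a)" for \<sigma>' :: machine
  have "wp (While (RLess zero_rr L_rr) walk_step) Q \<sigma>0"
  proof (rule wp_While[where Inv = Inv and Bd = "real (steps \<sigma>) + 2 + 8 * real (2 * n)"])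
    show "Inv \<sigma>0"
      using regs by (auto simp: Inv_def \<sigma>0_def chain_def intro!: exI[of _ "\<lambda>_. s"])
  next
    fix \<sigma>' assume Inv: "Inv \<sigma>'"
    then obtain vs where "chain c s ?w ?lab ?a (nreg \<sigma>' sp_reg) vs (narr \<sigma>' estack_arr)"
      by (auto simp: Inv_def)
    from chain_inj(3)[OF this w_pos] Inv
    show "real (steps \<sigma>') \<le> real (steps \<sigma>) + 2 + 8 * real (2 * n)"
      unfolding Inv_def by linarith
  next
    fix \<sigma>' assume Inv: "Inv \<sigma>'" and fr: "frame walk_step \<sigma>0 \<sigma>'"
      and h: "\<not> holds (RLess zero_rr L_rr) \<sigma>'"
    have "static \<sigma>0" using st by (simp add: \<sigma>0_def static_def)
    then have st': "static \<sigma>'" by (rule static_frame[OF _ fr]) (simp_all add: walk_step_def)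
    let ?b = "nreg \<sigma>' sp_reg"
    obtain vs where vs: "chain c s ?w ?lab ?a ?b vs (narr \<sigma>' estack_arr)" "nreg \<sigma>' x_reg = vs ?b"
      using Inv by (auto simp: Inv_def)
    have ab: "?a \<le> ?b" using vs by (simp add: chain_def)
    have x: "vs ?b \<in> verts2" "vs ?b < n \<longleftrightarrow> s < n"
      using chain_vs[OF vs(1) ab] chain_side[OF vs(1) ab] by auto
    have x2: "vs ?b < 2 * n" using verts2_less[OF x(1)] .
    have "?lab (cell c (vs ?b)) \<le> 0" using h Inv vs(2) st' by (simp add: Inv_def static_def)
    then have lab0: "?lab (cell c (vs ?b)) = 0"
      using lab_invD(5)[OF inv c x2] by simp
    have "vs ?b = cent c \<or> vs ?b = n + cent c"
    proof (rule ccontr)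
      assume "\<not> ?thesis"
      then have *: "narr \<sigma> cur_arr (cell c (vs ?b)) \<noteq> 0"
        "?lab (cell c (utgt (narr \<sigma> cur_arr (cell c (vs ?b))))) + ?w (und (narr \<sigma> cur_arr (cell c (vs ?b))))
           \<le> ?lab (cell c (vs ?b))"
        using tightD[OF t x(1)] lab0 Theta_ge by auto
      then have r: "narr \<sigma> cur_arr (cell c (vs ?b)) \<in> {1..2 * m}"
        using lab_invD(7)[OF inv c x2] by simp
      show False
        using * lab0 lab_invD(5)[OF inv c utgt_less[OF r]] w_pos[OF und_less[OF r]] by simp
    qed
    then have "vs ?b = (if s < n then cent c else n + cent c)"
      using x(2) cent[of c] by auto
    moreover have "frame walk \<sigma> (tick \<sigma>')"
      using fr by (simp add: frame_def walk_def \<sigma>0_def)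
    ultimately show "Q (tick \<sigma>')"
      using Inv vs(1) by (intro Q[of "tick \<sigma>'" vs]) (simp_all add: Inv_def)
  next
    fix \<sigma>' assume Inv: "Inv \<sigma>'" and fr: "frame walk_step \<sigma>0 \<sigma>'"
      and h: "holds (RLess zero_rr L_rr) \<sigma>'"
    have "static \<sigma>0" using st by (simp add: \<sigma>0_def static_def)
    then have st': "static \<sigma>'" by (rule static_frame[OF _ fr]) (simp_all add: walk_step_def)
    have fr': "rarr \<sigma>' = rarr \<sigma>" "narr \<sigma>' cur_arr = narr \<sigma> cur_arr" "nreg \<sigma>' base_reg = c * (2 * n)"
      using frameD[OF fr] regs by (auto simp: walk_step_def \<sigma>0_def)
    define sp fs where defs: "sp = nreg \<sigma>' sp_reg" "fs = narr \<sigma>' estack_arr"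
    obtain vs where ch: "chain c s ?w ?lab ?a sp vs fs" and x: "nreg \<sigma>' x_reg = vs sp"
      using Inv by (auto simp: Inv_def defs)
    have asp: "?a \<le> sp" using ch by (simp add: chain_def)
    have xv: "vs sp \<in> verts2" using chain_vs[OF ch asp] by simp
    have x2: "vs sp < 2 * n" using verts2_less[OF xv] .
    have L: "nreg \<sigma>' g_reg = cell c (vs sp)" "rreg \<sigma>' L_rr = ?lab (cell c (vs sp))"
      and old: "\<And>p. p < ?a \<Longrightarrow> fs p = narr \<sigma> estack_arr p"
      and steps: "real (steps \<sigma>') \<le> real (steps \<sigma>) + 2 + 8 * real (sp - ?a)"
      using Inv x by (auto simp: Inv_def defs)
    have pos: "?lab (cell c (vs sp)) > 0" using h L st' by (simp add: static_def)
    then have noroot: "vs sp \<noteq> cent c" "vs sp \<noteq> n + cent c"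
      using lab_invD(2,3)[OF inv c] by auto
    have "?lab (cell c (vs sp)) \<le> ?lab (cell c s)"
    proof (cases "sp = ?a")
      case True
      then show ?thesis using ch by (simp add: chain_def)
    next
      case False
      then show ?thesis
        using chain_strict[OF ch w_pos, of ?a sp] asp ch by (simp add: chain_def)
    qed
    with le have "?lab (cell c (vs sp)) \<le> \<Theta>" by simp
    define r where "r = narr \<sigma> cur_arr (cell c (vs sp))"
    have r0: "r \<noteq> 0" and adm: "?lab (cell c (utgt r)) + ?w (und r) \<le> ?lab (cell c (vs sp))"
      using tightD[OF t xv _ noroot \<open>?lab (cell c (vs sp)) \<le> \<Theta>\<close>] by (auto simp: r_def)
    have r: "r \<in> {1..2 * m}" "usrc r = vs sp"
      using lab_invD(7,8)[OF inv c x2] r0 by (auto simp: r_def Suc_le_eq)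
    have ch': "chain c s ?w ?lab ?a (Suc sp) (vs(Suc sp := utgt r)) (fs(sp := und r))"
      using chain_push[OF ch r adm] .
    have st_r: "narr \<sigma>' tgt_arr r = utgt r" "narr \<sigma>' und_arr r = und r"
      using st' r(1) by (auto simp: static_def)
    have cellx: "c * (2 * n) + z = cell c z" for z by (simp add: cell_def)
    have ex: "\<exists>vs. chain c s ?w ?lab ?a (Suc sp) vs (fs(sp := und r)) \<and> utgt r = vs (Suc sp)"
      using ch' by (intro exI[of _ "vs(Suc sp := utgt r)"]) simp
    have "real (Suc sp - ?a) = real (sp - ?a) + 1" using asp by (simp add: Suc_diff_le)
    then show "wp walk_step Inv (tick \<sigma>')"
      using ex steps old asp
      by (simp add: walk_step_def wp_simps wp_Skip Inv_def fr' L st'[unfolded static_def] st_r cellx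
          defs[symmetric] r_def[symmetric])
  qed
  then show ?thesis
    using regs by (simp add: walk_def wp_simps wp_Skip \<sigma>0_def cell_def)
qed

text \<open>The inequality of \<open>lab_inv\<close> is iterated along a path, losing a factor
  \<open>q c\<close> per arc. Towards the centre the induction peels off the initial arc, away from
  it the last one, because the backward half reads paths from their ends.\<close>

lemma lab_path:
  assumes inv: "lab_inv lab cur w" and c: "c < N" and "set P \<subseteq> {..<m}"
  shows "pcas x (map ((!) es) P) (cent c) \<Longrightarrow> lab (cell c x) \<le> q c ^ length P * (\<Sum>j\<leftarrow>P. w j)"
    and "pcas (cent c) (map ((!) es) P) x \<Longrightarrow> lab (cell c (n + x)) \<le> q c ^ length P * (\<Sum>j\<leftarrow>P. w j)"
proof -
  have wpos: "w j \<ge> 0" if "j < m" for j using lab_invD(1)[OF inv that] d0_pos by simp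
  have sum_pos: "(\<Sum>j\<leftarrow>P. w j) \<ge> 0" if "set P \<subseteq> {..<m}" for P
    using that wpos by (induction P) auto
  have step: "q c * (q c ^ length P * (\<Sum>j\<leftarrow>P. w j) + w j) \<le> q c ^ Suc (length P) * ((\<Sum>j\<leftarrow>P. w j) + w j)"
    if "j < m" for P j
  proof -
    have "1 * w j \<le> q c ^ length P * w j"
      using q_gt_1[of c] wpos[OF that] by (intro mult_right_mono) (auto simp: one_le_power)
    then have "q c * (q c ^ length P * (\<Sum>j\<leftarrow>P. w j) + w j)
        \<le> q c * (q c ^ length P * (\<Sum>j\<leftarrow>P. w j) + q c ^ length P * w j)"
      using q_gt_1[of c] by (intro mult_left_mono) auto
    also have "\<dots> = q c ^ Suc (length P) * ((\<Sum>j\<leftarrow>P. w j) + w j)" by (simp add: algebra_simps)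
    finally show ?thesis .
  qed
  show "pcas x (map ((!) es) P) (cent c) \<Longrightarrow> lab (cell c x) \<le> q c ^ length P * (\<Sum>j\<leftarrow>P. w j)"
    using assms(3)
  proof (induction P arbitrary: x)
    case Nil
    then show ?case using lab_invD(2)[OF inv c] by simp
  next
    case (Cons j P)
    then have j: "j < m" and r: "Suc j \<in> {1..2 * m}" by auto
    have x: "x = tail_of j" using Cons.prems by (simp add: tail_of_def)
    have IH: "lab (cell c (head_of j)) \<le> q c ^ length P * (\<Sum>j\<leftarrow>P. w j)"
      using Cons by (simp add: head_of_def)
    have "lab (cell c x) \<le> q c * (lab (cell c (head_of j)) + w j)"
      using lab_invD(9)[OF inv c r] j x by (simp add: usrc_def utgt_def und_def)
    also have "\<dots> \<le> q c * (q c ^ length P * (\<Sum>j\<leftarrow>P. w j) + w j)"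
      using IH q_gt_1[of c] by (intro mult_left_mono) auto
    also note step[OF j]
    finally show ?case by (simp add: add.commute)
  qed
  show "pcas (cent c) (map ((!) es) P) x \<Longrightarrow> lab (cell c (n + x)) \<le> q c ^ length P * (\<Sum>j\<leftarrow>P. w j)"
    using assms(3)
  proof (induction P arbitrary: x rule: rev_induct)
    case Nil
    then show ?case using lab_invD(3)[OF inv c] by simp
  next
    case (snoc j P)
    then have j: "j < m" and r: "Suc j + m \<in> {1..2 * m}" by auto
    have x: "x = head_of j" and P: "pcas (cent c) (map ((!) es) P) (tail_of j)"
      using snoc.prems by (auto simp: head_of_def tail_of_def pcas_append)
    have IH: "lab (cell c (n + tail_of j)) \<le> q c ^ length P * (\<Sum>j\<leftarrow>P. w j)"
      using snoc.IH[OF P] snoc.prems by simp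
    have "lab (cell c (n + x)) \<le> q c * (lab (cell c (n + tail_of j)) + w j)"
      using lab_invD(9)[OF inv c r] j x by (simp add: usrc_def utgt_def und_def)
    also have "\<dots> \<le> q c * (q c ^ length P * (\<Sum>j\<leftarrow>P. w j) + w j)"
      using IH q_gt_1[of c] by (intro mult_left_mono) auto
    also note step[OF j]
    finally show ?case by simp
  qed
qed

end

section \<open>Augmentations and the main loop\<close>

abbreviation (input) "row_reg \<equiv> 12 :: nat"
abbreviation (input) "inc_rr \<equiv> 23 :: nat"

definition min_step :: program where
  "min_step = block [
     NLoad e_reg estack_arr t_reg,
     RLoad a_rr cap_rarr e_reg,
     Cond (RLess a_rr gamma_rr) (RArith RAdd gamma_rr a_rr zero_rr) Skip,
     NArith NAdd t_reg t_reg one_reg]"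

text \<open>Handles one occurrence of an arc. The true weight is multiplied at once, while the
  rounded weight seen by the searches follows only when it is behind by a factor of at least
  \<open>1 + \<kappa>\<close>; the searches are therefore repaired rarely.\<close>

definition push_step :: program where
  "push_step = block [
     NLoad ue_reg estack_arr t_reg,
     NArith NAdd z_reg row_reg ue_reg,
     RLoad a_rr flow_rarr z_reg,
     RArith RAdd a_rr a_rr inc_rr,
     RStore flow_rarr z_reg a_rr,
     RLoad c_rr cap_rarr ue_reg,
     RArith RDiv a_rr gamma_rr c_rr,
     RArith RAdd a_rr one_rr a_rr,
     RLoad b_rr w_rarr ue_reg,
     RArith RMul b_rr b_rr a_rr,
     RStore w_rarr ue_reg b_rr,
     RArith RMul c_rr b_rr c_rr,
     Cond (RLeq one_rr c_rr) (NConst done_reg 1) Skip,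
     RLoad a_rr wr_rarr ue_reg,
     RArith RMul a_rr a_rr kappa1_rr,
     Cond (RLeq a_rr b_rr) (block [RStore wr_rarr ue_reg b_rr, update]) Skip,
     NArith NAdd t_reg t_reg one_reg]"

text \<open>\<open>rem_rr\<close> holds what is still to be shipped of the current commodity in this
  round; the augmentation ships the minimum of it and the capacities on the walk. The flow written
  is already divided by \<open>T'\<close>.\<close>

definition augment :: program where
  "augment = block [
     RArith RAdd gamma_rr rem_rr zero_rr,
     NConst t_reg 0,
     While (NLess t_reg sp_reg) min_step,
     RArith RSub rem_rr rem_rr gamma_rr,
     RArith RDiv inc_rr gamma_rr T_rr,
     RArith RMul gamma_rr gamma_rr kappa_rr,
     NArith NMul row_reg i_reg m_reg,
     NConst t_reg 0,
     While (NLess t_reg sp_reg) push_step]"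

context mcf_run
begin

lemmas program_defs = push_step_def min_step_def update_def update_step_def enter_center_def
  fix_labels_def fix_step_def scan_def scan_step_def walk_def walk_step_def

lemma min_wp:
  assumes st: "static \<sigma>" and fs: "\<And>p. p < nreg \<sigma> sp_reg \<Longrightarrow> narr \<sigma> estack_arr p < m"
    and t: "nreg \<sigma> t_reg = 0"
    and Q: "\<And>\<sigma>'. frame (While (NLess t_reg sp_reg) min_step) \<sigma> \<sigma>' \<Longrightarrow> rreg \<sigma>' gamma_rr \<le> rreg \<sigma> gamma_rr \<Longrightarrow>
      (\<And>p. p < nreg \<sigma> sp_reg \<Longrightarrow> rreg \<sigma>' gamma_rr \<le> cap (narr \<sigma> estack_arr p)) \<Longrightarrow>
      rreg \<sigma>' gamma_rr = rreg \<sigma> gamma_rr \<or> (\<exists>p<nreg \<sigma> sp_reg. rreg \<sigma>' gamma_rr = cap (narr \<sigma> estack_arr p)) \<Longrightarrow>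
      real (steps \<sigma>') \<le> real (steps \<sigma>) + 7 * real (nreg \<sigma> sp_reg) + 1 \<Longrightarrow> Q \<sigma>'"
  shows "wp (While (NLess t_reg sp_reg) min_step) Q \<sigma>"
proof (rule wp_For[where L = "nreg \<sigma> sp_reg" and Bd = 7 and Inv = "\<lambda>j \<sigma>'. rreg \<sigma>' gamma_rr \<le> rreg \<sigma> gamma_rr \<and>
      (\<forall>p<j. rreg \<sigma>' gamma_rr \<le> cap (narr \<sigma> estack_arr p)) \<and>
      (rreg \<sigma>' gamma_rr = rreg \<sigma> gamma_rr \<or> (\<exists>p<nreg \<sigma> sp_reg. rreg \<sigma>' gamma_rr = cap (narr \<sigma> estack_arr p)))"])
  fix \<sigma>' j
  assume Inv: "rreg \<sigma>' gamma_rr \<le> rreg \<sigma> gamma_rr \<and>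
      (\<forall>p<j. rreg \<sigma>' gamma_rr \<le> cap (narr \<sigma> estack_arr p)) \<and>
      (rreg \<sigma>' gamma_rr = rreg \<sigma> gamma_rr \<or> (\<exists>p<nreg \<sigma> sp_reg. rreg \<sigma>' gamma_rr = cap (narr \<sigma> estack_arr p)))"
    and fr: "frame min_step \<sigma> \<sigma>'" and j: "nreg \<sigma>' t_reg = j" "j < nreg \<sigma> sp_reg"
  have st': "static \<sigma>'" by (rule static_frame[OF st fr]) (simp_all add: min_step_def)
  have "narr \<sigma>' estack_arr = narr \<sigma> estack_arr" using frameD(3)[OF fr, of estack_arr] by (simp add: min_step_def)
  moreover have "rarr \<sigma>' cap_rarr (narr \<sigma> estack_arr j) = cap (narr \<sigma> estack_arr j)"
    using st' fs[OF j(2)] by (simp add: static_def)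
  ultimately show "wp min_step (\<lambda>\<tau>. nreg \<tau> t_reg = Suc j \<and> (rreg \<tau> gamma_rr \<le> rreg \<sigma> gamma_rr \<and>
      (\<forall>p<Suc j. rreg \<tau> gamma_rr \<le> cap (narr \<sigma> estack_arr p)) \<and>
      (rreg \<tau> gamma_rr = rreg \<sigma> gamma_rr \<or> (\<exists>p<nreg \<sigma> sp_reg. rreg \<tau> gamma_rr = cap (narr \<sigma> estack_arr p)))) \<and>
      real (steps \<tau>) \<le> real (steps \<sigma>') + 7) (tick \<sigma>')"
    using Inv j st'[unfolded static_def]
    by (auto simp: min_step_def wp_simps wp_Skip wp_Seq less_Suc_eq)
next
  fix \<sigma>' assume Inv: "rreg \<sigma>' gamma_rr \<le> rreg \<sigma> gamma_rr \<and>
      (\<forall>p<nreg \<sigma> sp_reg. rreg \<sigma>' gamma_rr \<le> cap (narr \<sigma> estack_arr p)) \<and>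
      (rreg \<sigma>' gamma_rr = rreg \<sigma> gamma_rr \<or> (\<exists>p<nreg \<sigma> sp_reg. rreg \<sigma>' gamma_rr = cap (narr \<sigma> estack_arr p)))"
    and fr: "frame min_step \<sigma> \<sigma>'"
    and steps: "real (steps \<sigma>') \<le> real (steps \<sigma>) + real (nreg \<sigma> sp_reg - nreg \<sigma> t_reg) * 7 + 1"
  have "frame (While (NLess t_reg sp_reg) min_step) \<sigma> \<sigma>'" using fr by (simp add: frame_def)
  then show "Q \<sigma>'" using Inv steps t by (intro Q) auto
qed (use t in \<open>simp_all add: min_step_def\<close>)

text \<open>Number of factors \<open>1 + \<kappa>\<close> by which the rounded weights can still
  grow before \<open>cap j * wr j\<close> reaches its ceiling \<open>(1 + \<kappa>) ^ 2\<close>.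
  Each raise of a rounded weight consumes one of them and causes one pass over all centres, priced
  at \<open>ev_cost\<close>.\<close>

definition "ev_pot wr = (\<Sum>j<m. ln ((1 + \<kappa>)\<^sup>2 / (cap j * wr j)) / ln (1 + \<kappa>))" for wr :: "nat \<Rightarrow> real"
definition "ev_cost = 60 * real N + 20"

lemma ev_pot_nonneg:
  assumes "\<And>j. j < m \<Longrightarrow> 0 < wr j \<and> wr j * cap j \<le> (1 + \<kappa>)\<^sup>2"
  shows "ev_pot wr \<ge> 0"
  unfolding ev_pot_def
proof (rule sum_nonneg)
  fix j assume "j \<in> {..<m}"
  then have "0 < wr j" "wr j * cap j \<le> (1 + \<kappa>)\<^sup>2" "cap j \<ge> 1" using assms cap_ge_1 by auto
  then have "1 \<le> (1 + \<kappa>)\<^sup>2 / (cap j * wr j)" by (simp add: field_simps)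
  then show "0 \<le> ln ((1 + \<kappa>)\<^sup>2 / (cap j * wr j)) / ln (1 + \<kappa>)"
    using kappa_pos by simp
qed

lemma ev_pot_raise:
  assumes e: "e < m" and wr: "0 < wr e" and l: "wr e * (1 + \<kappa>) \<le> l"
  shows "ev_pot (wr(e := l)) \<le> ev_pot wr - 1"
proof -
  have k1: "ln (1 + \<kappa>) > 0" using kappa_pos by simp
  have c: "cap e \<ge> 1" using cap_ge_1[OF e] .
  have lpos: "l > 0" using wr l kappa_pos by (smt (verit) mult_pos_pos)
  have "ln ((1 + \<kappa>)\<^sup>2 / (cap e * wr e)) = ln ((1 + \<kappa>)\<^sup>2 / (cap e * l)) + ln (l / wr e)"
    using ln_mult_pos[of "(1 + \<kappa>)\<^sup>2 / (cap e * l)" "l / wr e"] c wr lpos kappa_pos by (simp add: field_simps)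
  moreover have "ln (1 + \<kappa>) \<le> ln (l / wr e)"
    using wr l lpos kappa_pos by (subst ln_le_cancel_iff) (auto simp: field_simps)
  ultimately have "ln ((1 + \<kappa>)\<^sup>2 / (cap e * l)) / ln (1 + \<kappa>) \<le>
      (ln ((1 + \<kappa>)\<^sup>2 / (cap e * wr e)) - ln (1 + \<kappa>)) / ln (1 + \<kappa>)"
    using k1 by (intro divide_right_mono) auto
  also have "\<dots> = ln ((1 + \<kappa>)\<^sup>2 / (cap e * wr e)) / ln (1 + \<kappa>) - 1"
    using k1 by (simp add: diff_divide_distrib)
  finally have *: "ln ((1 + \<kappa>)\<^sup>2 / (cap e * l)) / ln (1 + \<kappa>) \<le>
      ln ((1 + \<kappa>)\<^sup>2 / (cap e * wr e)) / ln (1 + \<kappa>) - 1" .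
  have "e \<in> {..<m}" using e by simp
  moreover have "(\<Sum>j\<in>{..<m} - {e}. ln ((1 + \<kappa>)\<^sup>2 / (cap j * (wr(e := l)) j)) / ln (1 + \<kappa>)) =
      (\<Sum>j\<in>{..<m} - {e}. ln ((1 + \<kappa>)\<^sup>2 / (cap j * wr j)) / ln (1 + \<kappa>))"
    by (intro sum.cong) auto
  ultimately show ?thesis
    unfolding ev_pot_def using * by (simp add: sum.remove[of "{..<m}" e])
qed

text \<open>Multiplicity of arc \<open>j\<close> among the lowest \<open>t\<close> stack entries;
  splicing two arc-simple walks allows the value 2.\<close>

definition "hits fs t j = card {p. p < t \<and> fs p = j}" for fs :: "nat \<Rightarrow> nat"

lemma hits_0: "hits fs 0 j = 0"
  by (simp add: hits_def)

lemma hits_Suc: "hits fs (Suc t) j = hits fs t j + (if fs t = j then 1 else 0)"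
proof -
  have "{p. p < Suc t \<and> fs p = j} = {p. p < t \<and> fs p = j} \<union> (if fs t = j then {t} else {})"
    by (auto simp: less_Suc_eq)
  then show ?thesis unfolding hits_def by (auto simp: card_insert_if)
qed

lemma hits_mono: "t \<le> t' \<Longrightarrow> hits fs t j \<le> hits fs t' j"
  unfolding hits_def by (intro card_mono) auto

lemma sum_hits:
  assumes "\<And>p. p < t \<Longrightarrow> fs p < m"
  shows "(\<Sum>p<t. g (fs p)) = (\<Sum>j<m. real (hits fs t j) * g j)"
  using assms
proof (induction t)
  case (Suc t)
  have "(\<Sum>j<m. (if fs t = j then g j else 0)) = g (fs t)"
    using Suc.prems[of t] by simp
  moreover have "real (hits fs (Suc t) j) * g j = real (hits fs t j) * g j + (if fs t = j then g j else 0)" for j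
    by (simp add: hits_Suc algebra_simps)
  ultimately have "(\<Sum>j<m. real (hits fs (Suc t) j) * g j) = (\<Sum>j<m. real (hits fs t j) * g j) + g (fs t)"
    by (simp add: sum.distrib)
  with Suc show ?case by simp
qed (simp add: hits_0)

lemma index_eq_iff: "j < m \<Longrightarrow> j' < m \<Longrightarrow> i * m + j = i' * m + j' \<longleftrightarrow> i = i' \<and> j = j'"
proof
  assume j: "j < m" "j' < m" and eq: "i * m + j = i' * m + j'"
  have "i = i'"
    using arg_cong[OF eq, of "\<lambda>z. z div m"] j by (simp only: div_mult_self3) simp
  with eq show "i = i' \<and> j = j'" by simp
qed auto

section \<open>Effect of one augmentation on weights and flow\<close>

definition augmented ::
  "nat \<Rightarrow> real \<Rightarrow> (nat \<Rightarrow> nat) \<Rightarrow> (nat \<Rightarrow> real) \<Rightarrow> (nat \<Rightarrow> real) \<Rightarrow> (nat \<Rightarrow> real) \<Rightarrow> (nat \<Rightarrow> real) \<Rightarrow> bool" where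
  "augmented i \<gamma> h w f w' f' \<longleftrightarrow>
     (\<forall>j<m. w' j = w j * (1 + \<gamma> * \<kappa> / cap j) ^ h j) \<and>
     (\<forall>j<m. f' (i * m + j) = f (i * m + j) + real (h j) * (\<gamma> / T')) \<and>
     (\<forall>i' j. i' \<noteq> i \<longrightarrow> j < m \<longrightarrow> f' (i' * m + j) = f (i' * m + j))"

lemma augmented_Suc:
  assumes "augmented i \<gamma> (hits fs t) w f w' f'" "fs t < m"
  shows "augmented i \<gamma> (hits fs (Suc t)) w f
    (w'(fs t := w' (fs t) * (1 + \<gamma> * \<kappa> / cap (fs t))))
    (f'(i * m + fs t := f' (i * m + fs t) + \<gamma> / T'))"
  unfolding augmented_def
proof (intro conjI allI impI)
  fix j assume j: "j < m"
  show "(w'(fs t := w' (fs t) * (1 + \<gamma> * \<kappa> / cap (fs t)))) j = w j * (1 + \<gamma> * \<kappa> / cap j) ^ hits fs (Suc t) j"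
    using assms j by (auto simp: augmented_def hits_Suc)
  show "(f'(i * m + fs t := f' (i * m + fs t) + \<gamma> / T')) (i * m + j) =
      f (i * m + j) + real (hits fs (Suc t) j) * (\<gamma> / T')"
    using assms j by (auto simp: augmented_def hits_Suc algebra_simps add_divide_distrib)
  fix i' assume "i' \<noteq> i"
  then show "(f'(i * m + fs t := f' (i * m + fs t) + \<gamma> / T')) (i' * m + j) = f (i' * m + j)"
    using assms j index_eq_iff[OF j assms(2), of i' i] by (auto simp: augmented_def)
qed

text \<open>An unsaturated arc has \<open>w j * cap j < 1\<close>, and it is hit at most twice with
  an amount up to its capacity; each hit contributes at most a factor
  \<open>1 + \<kappa>\<close>.\<close>

lemma augmented_weight_le:
  assumes "augmented i \<gamma> h w f w' f'" "j < m" "h j \<le> 2" "0 \<le> \<gamma>" "h j > 0 \<Longrightarrow> \<gamma> \<le> cap j" "w j * cap j < 1" "0 < w j"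
  shows "w' j * cap j \<le> (1 + \<kappa>)\<^sup>2" "w j \<le> w' j"
proof -
  have c: "cap j \<ge> 1" using cap_ge_1[OF assms(2)] .
  have y0: "1 \<le> (1 + \<gamma> * \<kappa> / cap j) ^ h j"
    using assms(4) kappa_pos c by (intro one_le_power) auto
  have "(1 + \<gamma> * \<kappa> / cap j) ^ h j \<le> (1 + \<kappa>)\<^sup>2"
  proof (cases "h j = 0")
    case True
    then show ?thesis using kappa_pos by simp
  next
    case False
    then have "\<gamma> * \<kappa> / cap j \<le> \<kappa>"
      using assms(5) c kappa_pos by (simp add: divide_le_eq mult.commute)
    then have "(1 + \<gamma> * \<kappa> / cap j) ^ h j \<le> (1 + \<kappa>) ^ h j"
      using assms(4) kappa_pos c by (intro power_mono) auto
    also have "\<dots> \<le> (1 + \<kappa>)\<^sup>2"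
      using assms(3) kappa_pos by (intro power_increasing) auto
    finally show ?thesis .
  qed
  then have "(w j * cap j) * (1 + \<gamma> * \<kappa> / cap j) ^ h j \<le> 1 * (1 + \<kappa>)\<^sup>2"
    using assms(6,7) c y0 by (intro mult_mono) auto
  then show "w' j * cap j \<le> (1 + \<kappa>)\<^sup>2"
    using assms(1,2) by (simp add: augmented_def mult_ac)
  show "w j \<le> w' j"
    using assms(1,2,7) y0 mult_left_mono[OF y0, of "w j"] by (simp add: augmented_def)
qed

definition weights_ok :: "(nat \<Rightarrow> real) \<Rightarrow> (nat \<Rightarrow> real) \<Rightarrow> bool" where
  "weights_ok w wr \<longleftrightarrow> (\<forall>j<m. wr j \<le> w j \<and> w j < wr j * (1 + \<kappa>))"

definition labels_ok :: "(nat \<Rightarrow> real) \<Rightarrow> (nat \<Rightarrow> nat) \<Rightarrow> (nat \<Rightarrow> real) \<Rightarrow> bool" where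
  "labels_ok lab cur wr \<longleftrightarrow> lab_inv lab cur wr \<and> (\<forall>c<N. tight lab cur wr c {})"

definition full_iff :: "nat \<Rightarrow> (nat \<Rightarrow> real) \<Rightarrow> bool" where
  "full_iff dn w \<longleftrightarrow> dn \<le> 1 \<and> (dn = 1 \<longleftrightarrow> (\<exists>j<m. 1 \<le> w j * cap j))"

text \<open>Saturation does not interrupt the loop: the whole walk is processed, so that flow
  conservation holds, and an arc that occurs twice may grow past saturation.\<close>

lemma push_wp:
  assumes st: "static \<sigma>" and fs: "\<And>p. p < sp \<Longrightarrow> fs p < m" "fs = narr \<sigma> estack_arr" "sp = nreg \<sigma> sp_reg"
    and i: "nreg \<sigma> row_reg = i * m" and t: "nreg \<sigma> t_reg = 0"
    and \<gamma>: "rreg \<sigma> inc_rr = \<gamma> / T'" "rreg \<sigma> gamma_rr = \<gamma> * \<kappa>" "0 \<le> \<gamma>"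
      "\<And>p. p < sp \<Longrightarrow> \<gamma> \<le> cap (fs p)" and two: "\<And>j. hits fs sp j \<le> 2"
    and lab: "labels_ok (rarr \<sigma> lab_rarr) (narr \<sigma> cur_arr) (rarr \<sigma> wr_rarr)"
    and w: "weights_ok (rarr \<sigma> w_rarr) (rarr \<sigma> wr_rarr)" "\<And>j. j < m \<Longrightarrow> rarr \<sigma> w_rarr j * cap j < 1"
    and dn: "nreg \<sigma> done_reg = 0"
    and Q: "\<And>\<sigma>'. frame (While (NLess t_reg sp_reg) push_step) \<sigma> \<sigma>' \<Longrightarrow>
      augmented i \<gamma> (hits fs sp) (rarr \<sigma> w_rarr) (rarr \<sigma> flow_rarr) (rarr \<sigma>' w_rarr) (rarr \<sigma>' flow_rarr) \<Longrightarrow>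
      labels_ok (rarr \<sigma>' lab_rarr) (narr \<sigma>' cur_arr) (rarr \<sigma>' wr_rarr) \<Longrightarrow>
      weights_ok (rarr \<sigma>' w_rarr) (rarr \<sigma>' wr_rarr) \<Longrightarrow> full_iff (nreg \<sigma>' done_reg) (rarr \<sigma>' w_rarr) \<Longrightarrow>
      (\<And>g. rarr \<sigma> lab_rarr g \<le> rarr \<sigma>' lab_rarr g) \<Longrightarrow>
      real (steps \<sigma>') + 20 * pot (rarr \<sigma>' lab_rarr) (narr \<sigma>' cur_arr) + ev_cost * ev_pot (rarr \<sigma>' wr_rarr) \<le>
        real (steps \<sigma>) + 20 * pot (rarr \<sigma> lab_rarr) (narr \<sigma> cur_arr) + ev_cost * ev_pot (rarr \<sigma> wr_rarr)
         + 20 * real sp + 1 \<Longrightarrow> Q \<sigma>'"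
  shows "wp (While (NLess t_reg sp_reg) push_step) Q \<sigma>"
proof -
  let ?\<phi> = "\<lambda>\<sigma>. 20 * pot (rarr \<sigma> lab_rarr) (narr \<sigma> cur_arr) + ev_cost * ev_pot (rarr \<sigma> wr_rarr)"
  let ?w = "rarr \<sigma> w_rarr" and ?f = "rarr \<sigma> flow_rarr"
  define Inv where "Inv t \<sigma>' \<longleftrightarrow> t \<le> sp \<and> nreg \<sigma>' t_reg = t \<and>
      augmented i \<gamma> (hits fs t) ?w ?f (rarr \<sigma>' w_rarr) (rarr \<sigma>' flow_rarr) \<and>
      labels_ok (rarr \<sigma>' lab_rarr) (narr \<sigma>' cur_arr) (rarr \<sigma>' wr_rarr) \<and>
      weights_ok (rarr \<sigma>' w_rarr) (rarr \<sigma>' wr_rarr) \<and> full_iff (nreg \<sigma>' done_reg) (rarr \<sigma>' w_rarr) \<and>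
      (\<forall>g. rarr \<sigma> lab_rarr g \<le> rarr \<sigma>' lab_rarr g)" for t and \<sigma>' :: machine
  have hits2: "hits fs t j \<le> 2" if "t \<le> sp" for t j
    using hits_mono[OF that, of fs j] two[of j] by simp
  have wpos: "0 < rarr \<sigma>' wr_rarr j" if "Inv t \<sigma>'" "j < m" for t j \<sigma>'
    using that lab_invD(1)[of _ _ "rarr \<sigma>' wr_rarr" j] d0_pos by (fastforce simp: Inv_def labels_ok_def)
  have w0pos: "0 < ?w j" if "j < m" for j
    using that lab_invD(1)[of _ _ "rarr \<sigma> wr_rarr" j] d0_pos lab w(1)
    by (fastforce simp: labels_ok_def weights_ok_def)
  have \<gamma>_le: "\<gamma> \<le> cap j" if "hits fs t j > 0" "t \<le> sp" for t j
  proof -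
    have "{p. p < t \<and> fs p = j} \<noteq> {}" using that by (auto simp: hits_def card_gt_0_iff)
    with \<gamma>(4) that show ?thesis by auto
  qed
  have wle: "rarr \<sigma>' w_rarr j * cap j \<le> (1 + \<kappa>)\<^sup>2" if "Inv t \<sigma>'" "j < m" for t j \<sigma>'
    using augmented_weight_le(1)[of i \<gamma> "hits fs t" ?w ?f "rarr \<sigma>' w_rarr" "rarr \<sigma>' flow_rarr" j]
      that hits2 \<gamma>(3) \<gamma>_le w(2) w0pos by (auto simp: Inv_def)
  have ev0: "ev_pot (rarr \<sigma>' wr_rarr) \<ge> 0" if "Inv t \<sigma>'" for t \<sigma>'
  proof (rule ev_pot_nonneg)
    fix j assume j: "j < m"
    have "rarr \<sigma>' wr_rarr j * cap j \<le> rarr \<sigma>' w_rarr j * cap j"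
      using that j cap_ge_1[OF j] by (intro mult_right_mono) (auto simp: Inv_def weights_ok_def)
    with wle[OF that j] wpos[OF that j]
    show "0 < rarr \<sigma>' wr_rarr j \<and> rarr \<sigma>' wr_rarr j * cap j \<le> (1 + \<kappa>)\<^sup>2" by simp
  qed
  have cost: "ev_cost \<ge> 0" by (simp add: ev_cost_def)
  show ?thesis
  proof (rule wp_For_pot[where Inv = Inv and L = sp and Bd = 20 and \<phi> = ?\<phi>])
    have "augmented i \<gamma> (hits fs 0) ?w ?f ?w ?f" by (simp add: augmented_def hits_0)
    moreover have "full_iff 0 ?w" using w(2) by (force simp: full_iff_def)
    ultimately show "Inv (nreg \<sigma> t_reg) \<sigma>" using t lab w dn by (simp add: Inv_def)
    show "nreg \<sigma> t_reg \<le> sp" "nreg \<sigma> sp_reg = sp" using t fs by auto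
    show "sp_reg \<notin> wrN push_step" by (simp add: program_defs)
    show "Inv j (tick \<sigma>') = Inv j \<sigma>'" for j \<sigma>' by (simp add: Inv_def)
    show "0 \<le> ?\<phi> \<sigma>'" if "Inv j \<sigma>'" for j \<sigma>'
      using that ev0[OF that] cost pot_nonneg[of "rarr \<sigma>' lab_rarr"]
      by (auto simp: Inv_def labels_ok_def)
  next
    fix \<sigma>' assume "Inv sp \<sigma>'" "frame push_step \<sigma> \<sigma>'"
      "real (steps \<sigma>') + ?\<phi> \<sigma>' \<le> real (steps \<sigma>) + ?\<phi> \<sigma> + real (sp - nreg \<sigma> t_reg) * 20 + 1"
    then show "Q \<sigma>'" using t by (intro Q) (auto simp: Inv_def frame_def)
  next
    fix \<sigma>' j assume Inv: "Inv j \<sigma>'" and fr: "frame push_step \<sigma> \<sigma>'"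
      and j: "nreg \<sigma>' t_reg = j" "j < sp"
    have st': "static \<sigma>'" by (rule static_frame[OF st fr]) (simp_all add: program_defs)
    have fr': "narr \<sigma>' estack_arr = fs" "nreg \<sigma>' row_reg = i * m" "rreg \<sigma>' inc_rr = \<gamma> / T'"
      "rreg \<sigma>' gamma_rr = \<gamma> * \<kappa>"
      using frameD[OF fr] fs i \<gamma> by (simp_all add: program_defs)
    define e where "e = fs j"
    have e: "e < m" using fs(1)[OF j(2)] by (simp add: e_def)
    have cap_e: "rarr \<sigma>' cap_rarr e = cap e" "cap e \<ge> 1"
      using st' e cap_ge_1 by (auto simp: static_def)
    define w wr f where defs: "w = rarr \<sigma>' w_rarr" "wr = rarr \<sigma>' wr_rarr" "f = rarr \<sigma>' flow_rarr"
    define l where "l = w e * (1 + \<gamma> * \<kappa> / cap e)"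
    define fl where "fl = f (i * m + e) + \<gamma> / T'"
    have I: "augmented i \<gamma> (hits fs j) ?w ?f w f"
      "labels_ok (rarr \<sigma>' lab_rarr) (narr \<sigma>' cur_arr) wr" "weights_ok w wr"
      "full_iff (nreg \<sigma>' done_reg) w" "\<And>g. rarr \<sigma> lab_rarr g \<le> rarr \<sigma>' lab_rarr g"
      using Inv by (auto simp: Inv_def defs)
    have aug: "augmented i \<gamma> (hits fs (Suc j)) ?w ?f (w(e := l)) (f(i * m + e := fl))"
      using augmented_Suc[OF I(1)] e unfolding e_def l_def fl_def by simp
    have wr_e: "0 < wr e" using wpos[OF Inv e] by (simp add: defs)
    have w_e: "0 < w e" using wr_e I(3) e by (auto simp: weights_ok_def)
    have l_ge: "w e \<le> l"
      using w_e \<gamma>(3) kappa_pos cap_e unfolding l_def by (simp add: mult_ge1_I)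
    have full0: "full_iff (nreg \<sigma>' done_reg) (w(e := l))" if "\<not> 1 \<le> l * cap e"
    proof -
      have "\<not> 1 \<le> w e * cap e"
        using that mult_right_mono[OF l_ge, of "cap e"] cap_e(2) by linarith
      with that I(4) e show ?thesis unfolding full_iff_def by (metis fun_upd_apply)
    qed
    have full1: "full_iff (Suc 0) (w(e := l))" if "1 \<le> l * cap e"
      using that e by (auto simp: full_iff_def intro!: exI[of _ e])
    have sum_eq: "1 + \<gamma> * \<kappa> / cap e = 1 + \<gamma> * \<kappa> / rarr \<sigma>' cap_rarr e" using cap_e by simp
    define post where "post \<tau> \<longleftrightarrow> nreg \<tau> t_reg = Suc j \<and> Inv (Suc j) \<tau> \<and>
      real (steps \<tau>) + ?\<phi> \<tau> \<le> real (steps \<sigma>') + ?\<phi> \<sigma>' + 20" for \<tau>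
    have low: "weights_ok (w(e := l)) wr" if "\<not> wr e * (1 + \<kappa>) \<le> l"
      using that I(3) l_ge e by (auto simp: weights_ok_def)
    have upd: "wp update (wp (NArith NAdd t_reg t_reg one_reg) post) \<tau>"
      if \<tau>: "frame push_step \<sigma>' \<tau>" "wr e * (1 + \<kappa>) \<le> l" "rarr \<tau> w_rarr = w(e := l)"
        "rarr \<tau> wr_rarr = wr(e := l)" "rarr \<tau> flow_rarr = f(i * m + e := fl)"
        "rarr \<tau> lab_rarr = rarr \<sigma>' lab_rarr" "narr \<tau> cur_arr = narr \<sigma>' cur_arr"
        "full_iff (nreg \<tau> done_reg) (w(e := l))" "nreg \<tau> ue_reg = e" "steps \<tau> \<le> steps \<sigma>' + 20"
        "nreg \<tau> t_reg = j" for \<tau>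
    proof (rule update_wp[OF _ \<tau>(9) e])
      show st_\<tau>: "static \<tau>" by (rule static_frame[OF st' \<tau>(1)]) (simp_all add: program_defs)
      have "wr e * 1 \<le> wr e * (1 + \<kappa>)" using wr_e kappa_pos by (intro mult_left_mono) auto
      then have wr_l: "wr e \<le> l" using \<tau>(2) by simp
      show "lab_inv (rarr \<tau> lab_rarr) (narr \<tau> cur_arr) (rarr \<tau> wr_rarr)"
        unfolding \<tau> by (rule lab_inv_mono[of _ _ wr]) (use I(2) wr_l in \<open>auto simp: labels_ok_def\<close>)
      show "tight (rarr \<tau> lab_rarr) (narr \<tau> cur_arr) (rarr \<tau> wr_rarr) c {tail_of e, n + head_of e}"
        if "c < N" for c
        unfolding \<tau> using I(2) that e by (intro tight_raise) (auto simp: labels_ok_def)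
      fix \<rho> assume fr\<rho>: "frame update \<tau> \<rho>"
        and R: "lab_inv (rarr \<rho> lab_rarr) (narr \<rho> cur_arr) (rarr \<rho> wr_rarr)"
          "\<And>c. c < N \<Longrightarrow> tight (rarr \<rho> lab_rarr) (narr \<rho> cur_arr) (rarr \<rho> wr_rarr) c {}"
          "\<And>g. rarr \<tau> lab_rarr g \<le> rarr \<rho> lab_rarr g"
          "real (steps \<rho>) + 20 * pot (rarr \<rho> lab_rarr) (narr \<rho> cur_arr) \<le>
            real (steps \<tau>) + 20 * pot (rarr \<tau> lab_rarr) (narr \<tau> cur_arr) + 60 * real N + 2"
      have eq: "rarr \<rho> w_rarr = w(e := l)" "rarr \<rho> wr_rarr = wr(e := l)" "rarr \<rho> flow_rarr = f(i * m + e := fl)"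
        "nreg \<rho> done_reg = nreg \<tau> done_reg" "nreg \<rho> t_reg = j" "nreg \<rho> one_reg = nreg \<tau> one_reg"
        using frameD[OF fr\<rho>] \<tau> by (simp_all add: program_defs)
      have one: "nreg \<tau> one_reg = 1" using st_\<tau> by (simp add: static_def)
      have "wr e * 1 < wr e * (1 + \<kappa>)" using wr_e kappa_pos by (intro mult_strict_left_mono) auto
      then have "0 < l" using \<tau>(2) wr_e by linarith
      then have "l < l * (1 + \<kappa>)" using kappa_pos by simp
      then have wok: "weights_ok (w(e := l)) (wr(e := l))"
        using I(3) by (auto simp: weights_ok_def)
      have "rarr \<sigma> lab_rarr g \<le> rarr \<rho> lab_rarr g" for g
        using R(3)[of g] I(5)[of g] \<tau>(6) by simp
      then have "Inv (Suc j) (set_nreg t_reg (Suc j) (tick \<rho>))"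
        using R(1,2) aug wok j \<tau>(8) by (simp add: Inv_def labels_ok_def eq)
      moreover have "ev_cost * ev_pot (wr(e := l)) \<le> ev_cost * (ev_pot wr - 1)"
        using ev_pot_raise[where wr = wr and e = e and l = l] e wr_e \<tau>(2) cost by (intro mult_left_mono) auto
      then have "real (steps \<rho>) + 1 + ?\<phi> \<rho> \<le> real (steps \<sigma>') + ?\<phi> \<sigma>' + 20"
        using R(4) \<tau>(10) unfolding eq \<tau>(6,7) defs(2)[symmetric]
        by (simp add: right_diff_distrib) (simp add: ev_cost_def)
      ultimately show "wp (NArith NAdd t_reg t_reg one_reg) post \<rho>"
        by (simp add: wp_simps post_def eq one)
    qed
    have fin: "post \<tau>"
      if "\<not> wr e * (1 + \<kappa>) \<le> l" "rarr \<tau> w_rarr = w(e := l)" "rarr \<tau> wr_rarr = wr"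
        "rarr \<tau> flow_rarr = f(i * m + e := fl)" "rarr \<tau> lab_rarr = rarr \<sigma>' lab_rarr"
        "narr \<tau> cur_arr = narr \<sigma>' cur_arr" "full_iff (nreg \<tau> done_reg) (w(e := l))"
        "nreg \<tau> t_reg = Suc j" "steps \<tau> \<le> steps \<sigma>' + 20" for \<tau>
      using that aug low I j by (simp add: Inv_def post_def defs)
    note F = fr' defs[symmetric] j(1) e_def[symmetric] cap_e(1) l_def[symmetric] fl_def[symmetric]
      st'[unfolded static_def One_nat_def]
    have "wp push_step post (tick \<sigma>')"
    proof (cases "1 \<le> l * cap e")
      case True
      show ?thesis
      proof (cases "wr e * (1 + \<kappa>) \<le> l")
        case low: True
        show ?thesis
          using True low
          by (simp add: push_step_def wp_simps wp_Skip wp_Seq F)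
            (rule upd, simp_all add: F frame_def push_step_def full1[OF True])
      next
        case False
        show ?thesis
          using True False
          by (simp add: push_step_def wp_simps wp_Skip wp_Seq F)
            (rule fin, simp_all add: F full1[OF True])
      qed
    next
      case no: False
      show ?thesis
      proof (cases "wr e * (1 + \<kappa>) \<le> l")
        case low: True
        show ?thesis
          using no low
          by (simp add: push_step_def wp_simps wp_Skip wp_Seq F)
            (rule upd, simp_all add: F frame_def push_step_def full0[OF no])
      next
        case False
        show ?thesis
          using no False
          by (simp add: push_step_def wp_simps wp_Skip wp_Seq F)
            (rule fin, simp_all add: F full0[OF no])
      qed
    qed
    then show "wp push_step (\<lambda>\<tau>. nreg \<tau> t_reg = Suc j \<and> Inv (Suc j) \<tau> \<and>
        real (steps \<tau>) + ?\<phi> \<tau> \<le> real (steps \<sigma>') + ?\<phi> \<sigma>' + 20) (tick \<sigma>')"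
      unfolding post_def .
  qed simp_all
qed

end

text \<open>Labels, and with them the estimates through a centre, only grow. A rejected centre
  therefore stays rejected until the threshold rises or the commodity changes; the centre counter is
  reset at these two events and kept during augmentations.\<close>

definition step :: program where
  "step = Cond (RLeq rem_rr zero_rr)
     (block [
       NArith NAdd i_reg i_reg one_reg,
       Cond (NEq i_reg k_reg)
         (block [NConst i_reg 0, NArith NAdd p_reg p_reg one_reg, RArith RMul sigma_rr sigma_rr fac_rr]) Skip,
       RLoad a_rr demand_rarr i_reg,
       RArith RMul rem_rr sigma_rr a_rr,
       NConst c_reg 0])
     (block [
       RLoad theta_rr theta_rarr i_reg,
       Cond (NEq c_reg N_reg)
         (block [
           RArith RMul theta_rr theta_rr kappa1_rr,
           RStore theta_rarr i_reg theta_rr,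
           NConst c_reg 0,
           Cond (RLess Theta_rr theta_rr) (NConst done_reg 1) Skip])
         (block [
           NArith NMul base_reg c_reg nn_reg,
           NLoad x_reg source_arr i_reg,
           NArith NAdd g_reg base_reg x_reg,
           RLoad a_rr lab_rarr g_reg,
           NLoad y_reg sink_arr i_reg,
           NArith NAdd y_reg n_reg y_reg,
           NArith NAdd g_reg base_reg y_reg,
           RLoad b_rr lab_rarr g_reg,
           RArith RAdd a_rr a_rr b_rr,
           Cond (RLeq a_rr theta_rr)
             (block [NConst sp_reg 0, walk, NArith NAdd x_reg y_reg zero_reg, walk, augment])
             (NArith NAdd c_reg c_reg one_reg)])])"

text \<open>The part of memory on which correctness depends, without registers of intermediate
  computations. The analysis works with transitions between such records.\<close>

record astate =
  aw :: "nat \<Rightarrow> real"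
  awr :: "nat \<Rightarrow> real"
  af :: "nat \<Rightarrow> real"
  ath :: "nat \<Rightarrow> real"
  alab :: "nat \<Rightarrow> real"
  acur :: "nat \<Rightarrow> nat"
  ai :: nat
  ap :: nat
  ac :: nat
  arem :: real
  adn :: nat

definition abs_state :: "machine \<Rightarrow> astate" where
  "abs_state \<sigma> = \<lparr>aw = rarr \<sigma> w_rarr, awr = rarr \<sigma> wr_rarr, af = rarr \<sigma> flow_rarr, ath = rarr \<sigma> theta_rarr,
     alab = rarr \<sigma> lab_rarr, acur = narr \<sigma> cur_arr, ai = nreg \<sigma> i_reg, ap = nreg \<sigma> p_reg,
     ac = nreg \<sigma> c_reg, arem = rreg \<sigma> rem_rr, adn = nreg \<sigma> done_reg\<rparr>"

context mcf_run
begin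

definition "D = Max (d ` {..<k})"
text \<open>Amount shipped in round \<open>p\<close> per unit of demand. It starts at half of the
  lower bound \<open>1 / (k * D)\<close> for a positive optimum, and the growth rate is the one for
  which \<open>sig_le\<close> holds without knowledge of the optimum.\<close>

definition "sig p = (1 + 1 / (2 * T')) ^ p / (2 * real k * D)" for p :: nat

lemma d_le_D: "i < k \<Longrightarrow> d i \<le> D"
  unfolding D_def by (intro Max_ge) auto

lemma D_pos: "D > 0"
  using d_le_D[of 0] d_pos[of 0] k_pos by force

lemma T'_ge: "T' \<ge> 3"
  using T_pos by (simp add: T'_def)

lemma sig_pos: "sig p > 0"
  unfolding sig_def using D_pos k_pos T'_ge
  by (intro divide_pos_pos zero_less_power mult_pos_pos add_pos_pos) auto

definition work_pot :: "astate \<Rightarrow> real" where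
  "work_pot s = 20 * pot (alab s) (acur s) + ev_cost * ev_pot (awr s)"

definition inv0 :: "astate \<Rightarrow> bool" where
  "inv0 s \<longleftrightarrow> labels_ok (alab s) (acur s) (awr s) \<and> weights_ok (aw s) (awr s) \<and>
     ai s < k \<and> ac s \<le> N \<and> (\<forall>i<k. ath s i \<le> \<Theta>) \<and> adn s = 0 \<and> (\<forall>j<m. aw s j * cap j < 1)"

definition next_com :: "astate \<Rightarrow> astate \<Rightarrow> bool" where
  "next_com s s' \<longleftrightarrow> arem s \<le> 0 \<and>
     (let i' = if Suc (ai s) = k then 0 else Suc (ai s); p' = if Suc (ai s) = k then Suc (ap s) else ap s
      in s' = s\<lparr>ai := i', ap := p', ac := 0, arem := sig p' * d i'\<rparr>)"

definition raise_threshold :: "astate \<Rightarrow> astate \<Rightarrow> bool" where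
  "raise_threshold s s' \<longleftrightarrow> 0 < arem s \<and> ac s = N \<and>
     (let t = ath s (ai s) * (1 + \<kappa>)
      in s' = s\<lparr>ath := (ath s)(ai s := t), ac := 0, adn := if \<Theta> < t then 1 else 0\<rparr>)"

definition next_center :: "astate \<Rightarrow> astate \<Rightarrow> bool" where
  "next_center s s' \<longleftrightarrow> 0 < arem s \<and> ac s < N \<and>
     ath s (ai s) < alab s (cell (ac s) (src (ai s))) + alab s (cell (ac s) (n + snk (ai s))) \<and>
     s' = s\<lparr>ac := Suc (ac s)\<rparr>"

text \<open>The walk enters only through the arcs it uses, its rounded weight and its boundary; the
  vertices and labels by which it was found are forgotten.\<close>

definition augments :: "(nat \<Rightarrow> nat) \<Rightarrow> nat \<Rightarrow> real \<Rightarrow> astate \<Rightarrow> astate \<Rightarrow> bool" where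
  "augments fs l \<gamma> s s' \<longleftrightarrow> 0 < arem s \<and> ac s < N \<and>
     (\<forall>p<l. fs p < m) \<and> (\<forall>j. hits fs l j \<le> 2) \<and> l \<le> 4 * n \<and>
     (\<Sum>p<l. awr s (fs p)) \<le> ath s (ai s) \<and>
     (\<forall>z<n. (\<Sum>p<l. arc_excess (fs p) z) = of_bool (src (ai s) = z) - of_bool (snk (ai s) = z)) \<and>
     0 \<le> \<gamma> \<and> \<gamma> \<le> arem s \<and> (\<forall>p<l. \<gamma> \<le> cap (fs p)) \<and> (\<gamma> = arem s \<or> (\<exists>p<l. \<gamma> = cap (fs p))) \<and>
     augmented (ai s) \<gamma> (hits fs l) (aw s) (af s) (aw s') (af s') \<and>
     labels_ok (alab s') (acur s') (awr s') \<and> weights_ok (aw s') (awr s') \<and> full_iff (adn s') (aw s') \<and>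
     (\<forall>g. alab s g \<le> alab s' g) \<and>
     ath s' = ath s \<and> ai s' = ai s \<and> ap s' = ap s \<and> ac s' = ac s \<and> arem s' = arem s - \<gamma>"

lemma mult_add_cell: "c * (2 * n) + z = cell c z"
  by (simp add: cell_def)

lemma augment_wp:
  assumes st: "static \<sigma>" and i: "nreg \<sigma> i_reg = i"
    and fs: "\<And>p. p < l \<Longrightarrow> fs p < m" "fs = narr \<sigma> estack_arr" "l = nreg \<sigma> sp_reg"
    and two: "\<And>j. hits fs l j \<le> 2" and rem: "0 < rreg \<sigma> rem_rr"
    and lab: "labels_ok (rarr \<sigma> lab_rarr) (narr \<sigma> cur_arr) (rarr \<sigma> wr_rarr)"
    and w: "weights_ok (rarr \<sigma> w_rarr) (rarr \<sigma> wr_rarr)" "\<And>j. j < m \<Longrightarrow> rarr \<sigma> w_rarr j * cap j < 1"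
    and dn: "nreg \<sigma> done_reg = 0"
    and Q: "\<And>\<sigma>' \<gamma>. frame augment \<sigma> \<sigma>' \<Longrightarrow> 0 \<le> \<gamma> \<Longrightarrow> \<gamma> \<le> rreg \<sigma> rem_rr \<Longrightarrow> (\<And>p. p < l \<Longrightarrow> \<gamma> \<le> cap (fs p)) \<Longrightarrow>
      \<gamma> = rreg \<sigma> rem_rr \<or> (\<exists>p<l. \<gamma> = cap (fs p)) \<Longrightarrow> rreg \<sigma>' rem_rr = rreg \<sigma> rem_rr - \<gamma> \<Longrightarrow>
      augmented i \<gamma> (hits fs l) (rarr \<sigma> w_rarr) (rarr \<sigma> flow_rarr) (rarr \<sigma>' w_rarr) (rarr \<sigma>' flow_rarr) \<Longrightarrow>
      labels_ok (rarr \<sigma>' lab_rarr) (narr \<sigma>' cur_arr) (rarr \<sigma>' wr_rarr) \<Longrightarrow>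
      weights_ok (rarr \<sigma>' w_rarr) (rarr \<sigma>' wr_rarr) \<Longrightarrow> full_iff (nreg \<sigma>' done_reg) (rarr \<sigma>' w_rarr) \<Longrightarrow>
      (\<And>g. rarr \<sigma> lab_rarr g \<le> rarr \<sigma>' lab_rarr g) \<Longrightarrow>
      real (steps \<sigma>') + work_pot (abs_state \<sigma>') \<le> real (steps \<sigma>) + work_pot (abs_state \<sigma>) + 27 * real l + 9 \<Longrightarrow> Q \<sigma>'"
  shows "wp augment Q \<sigma>"
proof -
  have part2: "wp (While (NLess t_reg sp_reg) push_step) Q \<tau>"
    if \<tau>: "frame augment \<sigma> \<tau>" "nreg \<tau> row_reg = i * m" "nreg \<tau> t_reg = 0" "rreg \<tau> inc_rr = \<gamma> / T'"
      "rreg \<tau> gamma_rr = \<gamma> * \<kappa>" "0 \<le> \<gamma>" "\<gamma> \<le> rreg \<sigma> rem_rr" "\<And>p. p < l \<Longrightarrow> \<gamma> \<le> cap (fs p)"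
      "\<gamma> = rreg \<sigma> rem_rr \<or> (\<exists>p<l. \<gamma> = cap (fs p))" "rreg \<tau> rem_rr = rreg \<sigma> rem_rr - \<gamma>"
      "rarr \<tau> = rarr \<sigma>" "narr \<tau> = narr \<sigma>" "nreg \<tau> sp_reg = l" "nreg \<tau> done_reg = 0"
      "real (steps \<tau>) \<le> real (steps \<sigma>) + 7 * real l + 8" for \<tau> \<gamma>
  proof (rule push_wp[where fs = fs and sp = l and i = i and \<gamma> = \<gamma>])
    show "static \<tau>" by (rule static_frame[OF st \<tau>(1)]) (simp_all add: augment_def program_defs)
    fix \<sigma>' assume fr: "frame (While (NLess t_reg sp_reg) push_step) \<tau> \<sigma>'"
      and P: "augmented i \<gamma> (hits fs l) (rarr \<tau> w_rarr) (rarr \<tau> flow_rarr) (rarr \<sigma>' w_rarr) (rarr \<sigma>' flow_rarr)"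
        "labels_ok (rarr \<sigma>' lab_rarr) (narr \<sigma>' cur_arr) (rarr \<sigma>' wr_rarr)"
        "weights_ok (rarr \<sigma>' w_rarr) (rarr \<sigma>' wr_rarr)" "full_iff (nreg \<sigma>' done_reg) (rarr \<sigma>' w_rarr)"
        "\<And>g. rarr \<tau> lab_rarr g \<le> rarr \<sigma>' lab_rarr g"
        "real (steps \<sigma>') + 20 * pot (rarr \<sigma>' lab_rarr) (narr \<sigma>' cur_arr) + ev_cost * ev_pot (rarr \<sigma>' wr_rarr)
          \<le> real (steps \<tau>) + 20 * pot (rarr \<tau> lab_rarr) (narr \<tau> cur_arr) + ev_cost * ev_pot (rarr \<tau> wr_rarr)
            + 20 * real l + 1"
    have "frame augment \<tau> \<sigma>'" using fr by (simp add: frame_def augment_def)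
    with \<tau>(1) have fr': "frame augment \<sigma> \<sigma>'" by (simp add: frame_def)
    have "rreg \<sigma>' rem_rr = rreg \<tau> rem_rr"
      using frameD(2)[OF fr, of rem_rr] by (simp add: program_defs)
    then show "Q \<sigma>'"
      using fr' P \<tau> by (intro Q[of \<sigma>' \<gamma>]) (simp_all add: work_pot_def abs_state_def)
  qed (use \<tau> lab w two fs in auto)
  have part1: "wp (While (NLess t_reg sp_reg) min_step) (wp (block [
      RArith RSub rem_rr rem_rr gamma_rr,
      RArith RDiv inc_rr gamma_rr T_rr,
      RArith RMul gamma_rr gamma_rr kappa_rr,
      NArith NMul row_reg i_reg m_reg,
      NConst t_reg 0,
      While (NLess t_reg sp_reg) push_step]) Q) \<tau>"
    if \<tau>: "frame augment \<sigma> \<tau>" "nreg \<tau> t_reg = 0" "rreg \<tau> gamma_rr = rreg \<sigma> rem_rr" "rarr \<tau> = rarr \<sigma>"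
      "narr \<tau> = narr \<sigma>" "nreg \<tau> sp_reg = l" "nreg \<tau> done_reg = 0" "rreg \<tau> rem_rr = rreg \<sigma> rem_rr"
      "steps \<tau> = steps \<sigma> + 2" "nreg \<tau> i_reg = i" for \<tau>
  proof (rule min_wp)
    show st\<tau>: "static \<tau>" by (rule static_frame[OF st \<tau>(1)]) (simp_all add: augment_def program_defs)
    show "narr \<tau> estack_arr p < m" if "p < nreg \<tau> sp_reg" for p using fs \<tau> that by simp
    show "nreg \<tau> t_reg = 0" using \<tau> by simp
    fix \<rho> assume fr: "frame (While (NLess t_reg sp_reg) min_step) \<tau> \<rho>"
      and P: "rreg \<rho> gamma_rr \<le> rreg \<tau> gamma_rr"
        "\<And>p. p < nreg \<tau> sp_reg \<Longrightarrow> rreg \<rho> gamma_rr \<le> cap (narr \<tau> estack_arr p)"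
        "rreg \<rho> gamma_rr = rreg \<tau> gamma_rr \<or> (\<exists>p<nreg \<tau> sp_reg. rreg \<rho> gamma_rr = cap (narr \<tau> estack_arr p))"
        "real (steps \<rho>) \<le> real (steps \<tau>) + 7 * real (nreg \<tau> sp_reg) + 1"
    define \<gamma> where "\<gamma> = rreg \<rho> gamma_rr"
    have "frame augment \<tau> \<rho>" using fr by (simp add: frame_def augment_def)
    with \<tau>(1) have fr': "frame augment \<sigma> \<rho>" by (simp add: frame_def)
    have st\<rho>: "static \<rho>" by (rule static_frame[OF st fr']) (simp_all add: augment_def program_defs)
    have eq: "rarr \<rho> = rarr \<sigma>" "narr \<rho> = narr \<sigma>" "nreg \<rho> sp_reg = l" "nreg \<rho> done_reg = 0"
      "rreg \<rho> rem_rr = rreg \<sigma> rem_rr" "nreg \<rho> i_reg = i"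
      using frameD[OF fr] \<tau> by (auto simp: program_defs)
    have "cap (fs p) \<ge> 1" if "p < l" for p using cap_ge_1[OF fs(1)[OF that]] .
    then have \<gamma>0: "0 \<le> \<gamma>"
      using P(3) \<tau> rem fs(2) by (force simp: \<gamma>_def)
    show "wp (block [
      RArith RSub rem_rr rem_rr gamma_rr,
      RArith RDiv inc_rr gamma_rr T_rr,
      RArith RMul gamma_rr gamma_rr kappa_rr,
      NArith NMul row_reg i_reg m_reg,
      NConst t_reg 0,
      While (NLess t_reg sp_reg) push_step]) Q \<rho>"
      by (simp add: wp_simps wp_Skip wp_Seq)
        (rule part2[where \<gamma> = \<gamma>], insert st\<rho>[unfolded static_def One_nat_def] fr' eq \<gamma>0 P \<tau> fs(2),
          simp_all add: \<gamma>_def[symmetric] frame_def augment_def)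
  qed
  show ?thesis
    unfolding augment_def using st i fs dn
    by (simp add: wp_simps wp_Skip wp_Seq)
      (rule part1[unfolded block.simps wp_Seq wp_Skip One_nat_def], simp_all add: frame_def augment_def static_def)
qed

section \<open>Correctness of one iteration\<close>

definition step_rel :: "machine \<Rightarrow> machine \<Rightarrow> bool" where
  "step_rel \<sigma> \<sigma>' \<longleftrightarrow> rreg \<sigma>' sigma_rr = sig (nreg \<sigma>' p_reg) \<and>
     ((next_com (abs_state \<sigma>) (abs_state \<sigma>') \<or> raise_threshold (abs_state \<sigma>) (abs_state \<sigma>') \<or>
         next_center (abs_state \<sigma>) (abs_state \<sigma>')) \<and> steps \<sigma>' \<le> steps \<sigma> + 20 \<or>
      (\<exists>fs l \<gamma>. augments fs l \<gamma> (abs_state \<sigma>) (abs_state \<sigma>') \<and>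
         real (steps \<sigma>') + work_pot (abs_state \<sigma>') \<le>
           real (steps \<sigma>) + work_pot (abs_state \<sigma>) + 160 * real n))"

lemma src_verts2: "i < k \<Longrightarrow> src i \<in> verts2" and snk_verts2: "i < k \<Longrightarrow> n + snk i \<in> verts2"
  and src_less: "i < k \<Longrightarrow> src i < n" and snk_less: "i < k \<Longrightarrow> snk i < n"
  using srcV snkV V_eq by (auto simp: verts2_def)

lemma sig_Suc: "sig p * (1 + 1 / (2 * T')) = sig (Suc p)"
  by (simp add: sig_def)

text \<open>The forward walk from \<open>s\<close> and the backward walk from \<open>n + t\<close>
  meet at the centre. Each is arc-simple, so arcs occur at most twice; the weights add up to at most
  the two labels; and the contributions of the centre to the excess cancel.\<close>

lemma two_chains:
  assumes ch1: "chain c s w lab 0 b vs fs1" "vs b = cent c" "s < n"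
    and ch2: "chain c (n + t) w lab b l vs' fs" "vs' l = n + cent c"
    and agree: "\<And>p. p < b \<Longrightarrow> fs p = fs1 p"
    and w: "\<And>e. e < m \<Longrightarrow> 0 < w e" and lab: "\<And>x. x < 2 * n \<Longrightarrow> 0 \<le> lab (cell c x)"
  shows "p < l \<Longrightarrow> fs p < m" "hits fs l j \<le> 2" "l \<le> 4 * n"
    "(\<Sum>p<l. w (fs p)) \<le> lab (cell c s) + lab (cell c (n + t))"
    "z < n \<Longrightarrow> (\<Sum>p<l. arc_excess (fs p) z) = of_bool (s = z) - of_bool (t = z)"
proof -
  have bl: "b \<le> l" using ch2 by (simp add: chain_def)
  show m: "fs p < m" if "p < l" for p
  proof (cases "p < b")
    case True
    with chainE[OF ch1(1), of p] und_less agree show ?thesis by (metis le0)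
  next
    case False
    with that chainE[OF ch2(1), of p] und_less show ?thesis by (metis not_less)
  qed
  show "l \<le> 4 * n"
    using chain_inj(3)[OF ch1(1) w] chain_inj(3)[OF ch2(1) w] bl by simp
  have split: "(\<Sum>p<l. g (fs p)) = (\<Sum>p\<in>{0..<b}. g (fs1 p)) + (\<Sum>p\<in>{b..<l}. g (fs p))"
    for g :: "nat \<Rightarrow> real"
  proof -
    have "(\<Sum>p<l. g (fs p)) = (\<Sum>p\<in>{0..<b}. g (fs p)) + (\<Sum>p\<in>{b..<l}. g (fs p))"
      using sum.atLeastLessThan_concat[of 0 b l "\<lambda>p. g (fs p)"] bl by (simp add: atLeast0LessThan)
    then show ?thesis using agree by simp
  qed
  have pos: "0 \<le> lab (cell c (cent c))" "0 \<le> lab (cell c (n + cent c))"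
    using lab cent[of c] by auto
  show "(\<Sum>p<l. w (fs p)) \<le> lab (cell c s) + lab (cell c (n + t))"
    unfolding split using chain_sum[OF ch1(1)] chain_sum[OF ch2(1)] ch1(2) ch2(2) pos by simp
  show "(\<Sum>p<l. arc_excess (fs p) z) = of_bool (s = z) - of_bool (t = z)" if "z < n"
    unfolding split[of "\<lambda>e. arc_excess e z"]
    using chain_excess[OF ch1(1), of z] chain_excess[OF ch2(1), of z] ch1 ch2(2) by simp
  let ?A = "{p\<in>{0..<b}. fs1 p = j}" and ?B = "{p\<in>{b..<l}. fs p = j}"
  have "{p. p < l \<and> fs p = j} \<subseteq> ?A \<union> ?B"
    using agree by force
  then have "hits fs l j \<le> card (?A \<union> ?B)"
    unfolding hits_def by (intro card_mono) auto
  also have "\<dots> \<le> card ?A + card ?B" by (rule card_Un_le)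
  finally have "hits fs l j \<le> card ?A + card ?B" .
  moreover have "card ?A \<le> 1"
  proof -
    have "inj_on fs1 ?A" using chain_inj(2)[OF ch1(1) w] by (rule inj_on_subset) auto
    moreover have "fs1 ` ?A \<subseteq> {j}" by auto
    ultimately have "card ?A \<le> card {j}" by (rule card_inj_on_le) simp
    then show ?thesis by simp
  qed
  moreover have "card ?B \<le> 1"
  proof -
    have "inj_on fs ?B" using chain_inj(2)[OF ch2(1) w] by (rule inj_on_subset) auto
    moreover have "fs ` ?B \<subseteq> {j}" by auto
    ultimately have "card ?B \<le> card {j}" by (rule card_inj_on_le) simp
    then show ?thesis by simp
  qed
  ultimately show "hits fs l j \<le> 2" by linarith
qed

lemma step_wp:
  assumes st: "static \<sigma>" and sig: "rreg \<sigma> sigma_rr = sig (nreg \<sigma> p_reg)"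
    and inv: "inv0 (abs_state \<sigma>)"
  shows "wp step (step_rel \<sigma>) (tick \<sigma>)"
proof -
  define i where "i = nreg \<sigma> i_reg"
  define c where "c = nreg \<sigma> c_reg"
  have i: "i < k" and c: "c \<le> N" and lab: "labels_ok (rarr \<sigma> lab_rarr) (narr \<sigma> cur_arr) (rarr \<sigma> wr_rarr)"
    and w: "weights_ok (rarr \<sigma> w_rarr) (rarr \<sigma> wr_rarr)" "\<And>j. j < m \<Longrightarrow> rarr \<sigma> w_rarr j * cap j < 1"
    and th: "rarr \<sigma> theta_rarr i \<le> \<Theta>" and dn: "nreg \<sigma> done_reg = 0"
    using inv by (auto simp: inv0_def abs_state_def i_def c_def)
  have arrs: "narr \<sigma> source_arr i = src i" "narr \<sigma> sink_arr i = snk i" "rarr \<sigma> demand_rarr i = d i"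
    using st i by (auto simp: static_def)
  note F = st[unfolded static_def One_nat_def] i_def[symmetric] c_def[symmetric] dn arrs sig
  consider (commodity) "rreg \<sigma> rem_rr \<le> 0" | (raise) "\<not> rreg \<sigma> rem_rr \<le> 0" "c = N"
    | (skip) "\<not> rreg \<sigma> rem_rr \<le> 0" "c \<noteq> N"
      "\<not> rarr \<sigma> lab_rarr (cell c (src i)) + rarr \<sigma> lab_rarr (cell c (n + snk i)) \<le> rarr \<sigma> theta_rarr i"
    | (aug) "\<not> rreg \<sigma> rem_rr \<le> 0" "c \<noteq> N"
      "rarr \<sigma> lab_rarr (cell c (src i)) + rarr \<sigma> lab_rarr (cell c (n + snk i)) \<le> rarr \<sigma> theta_rarr i"
    by blast
  then show ?thesis
  proof cases
    case commodity
    have k0: "0 < k" using k_pos by simp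
    have dem: "rarr \<sigma> (Suc 0) 0 = d 0" "Suc i \<noteq> k \<Longrightarrow> rarr \<sigma> (Suc 0) (Suc i) = d (Suc i)"
      using st i k0 by (auto simp: static_def)
    show ?thesis
      using commodity dem sig_Suc
      by (simp add: step_def wp_simps wp_Skip wp_Seq F step_rel_def next_com_def abs_state_def)
  next
    case raise
    then show ?thesis
      by (auto simp add: step_def wp_simps wp_Skip wp_Seq F step_rel_def raise_threshold_def abs_state_def)
  next
    case skip
    then show ?thesis
      using c
      by (simp add: step_def wp_simps wp_Skip wp_Seq F step_rel_def next_center_def abs_state_def mult_add_cell)
  next
    case aug
    then have cN: "c < N" using c by simp
    let ?lab = "rarr \<sigma> lab_rarr" and ?wr = "rarr \<sigma> wr_rarr"
    have linv: "lab_inv ?lab (narr \<sigma> cur_arr) ?wr" and tight: "tight ?lab (narr \<sigma> cur_arr) ?wr c {}"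
      using lab cN by (auto simp: labels_ok_def)
    have si: "src i < n" "snk i < n" using src_less snk_less i by auto
    have nonneg: "0 \<le> ?lab (cell c x)" if "x < 2 * n" for x by (rule lab_invD(5)[OF linv cN that])
    \<comment> \<open>The threshold is at most \<open>\<Theta>\<close> and labels are nonnegative,
      so both starting points are live and their cursors can be followed.\<close>
    have le: "?lab (cell c (src i)) \<le> \<Theta>" "?lab (cell c (n + snk i)) \<le> \<Theta>"
      using aug(3) th nonneg[of "src i"] nonneg[of "n + snk i"] si by auto
    have wr_pos: "0 < ?wr e" if "e < m" for e using lab_invD(1)[OF linv that] d0_pos by simp
    have augment: "wp augment (step_rel \<sigma>) \<tau>"
      if fr: "frame step \<sigma> \<tau>" and eq: "rarr \<tau> = rarr \<sigma>" "narr \<tau> cur_arr = narr \<sigma> cur_arr"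
        "nreg \<tau> i_reg = i" "nreg \<tau> p_reg = nreg \<sigma> p_reg" "nreg \<tau> c_reg = c" "rreg \<tau> sigma_rr = rreg \<sigma> sigma_rr"
        "rreg \<tau> rem_rr = rreg \<sigma> rem_rr" "nreg \<tau> done_reg = 0"
        and ch1: "chain c (src i) ?wr ?lab 0 b vs fs1" "vs b = cent c"
        and ch2: "chain c (n + snk i) ?wr ?lab b (nreg \<tau> sp_reg) vs' (narr \<tau> estack_arr)"
          "vs' (nreg \<tau> sp_reg) = n + cent c"
        and agree: "\<And>p. p < b \<Longrightarrow> narr \<tau> estack_arr p = fs1 p"
        and steps: "real (steps \<tau>) \<le> real (steps \<sigma>) + 8 * real (nreg \<tau> sp_reg) + 30" for \<tau> b vs vs' fs1
    proof -
      define l fs where "l = nreg \<tau> sp_reg" "fs = narr \<tau> estack_arr"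
      note two = two_chains[OF ch1 si(1) ch2 agree wr_pos nonneg, folded l_fs_def]
      have st\<tau>: "static \<tau>"
        by (rule static_frame[OF st fr]) (simp_all add: step_def augment_def program_defs)
      show ?thesis
      proof (rule augment_wp[OF st\<tau> eq(3), where fs = fs and l = l])
        fix \<sigma>' \<gamma>
        assume fr': "frame augment \<tau> \<sigma>'" and R: "0 \<le> \<gamma>" "\<gamma> \<le> rreg \<tau> rem_rr" "\<And>p. p < l \<Longrightarrow> \<gamma> \<le> cap (fs p)"
          "\<gamma> = rreg \<tau> rem_rr \<or> (\<exists>p<l. \<gamma> = cap (fs p))" "rreg \<sigma>' rem_rr = rreg \<tau> rem_rr - \<gamma>"
          "augmented i \<gamma> (hits fs l) (rarr \<tau> w_rarr) (rarr \<tau> flow_rarr) (rarr \<sigma>' w_rarr) (rarr \<sigma>' flow_rarr)"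
          "labels_ok (rarr \<sigma>' lab_rarr) (narr \<sigma>' cur_arr) (rarr \<sigma>' wr_rarr)"
          "weights_ok (rarr \<sigma>' w_rarr) (rarr \<sigma>' wr_rarr)" "full_iff (nreg \<sigma>' done_reg) (rarr \<sigma>' w_rarr)"
          "\<And>g. rarr \<tau> lab_rarr g \<le> rarr \<sigma>' lab_rarr g"
          "real (steps \<sigma>') + work_pot (abs_state \<sigma>') \<le> real (steps \<tau>) + work_pot (abs_state \<tau>) + 27 * real l + 9"
        have eq': "nreg \<sigma>' i_reg = i" "nreg \<sigma>' p_reg = nreg \<sigma> p_reg" "nreg \<sigma>' c_reg = c"
          "rreg \<sigma>' sigma_rr = rreg \<sigma> sigma_rr" "rarr \<sigma>' theta_rarr = rarr \<sigma> theta_rarr"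
          using frameD[OF fr'] eq by (simp_all add: augment_def program_defs)
        have "(\<Sum>p<l. ?wr (fs p)) \<le> rarr \<sigma> theta_rarr i"
          using two(4) aug(3) by linarith
        then have "augments fs l \<gamma> (abs_state \<sigma>) (abs_state \<sigma>')"
          using two R aug(1) cN eq eq' i_def c_def unfolding augments_def abs_state_def by auto
        moreover have "real (steps \<sigma>') + work_pot (abs_state \<sigma>') \<le>
           real (steps \<sigma>) + work_pot (abs_state \<sigma>) + 160 * real n"
        proof -
          have "work_pot (abs_state \<tau>) = work_pot (abs_state \<sigma>)"
            using eq by (simp add: work_pot_def abs_state_def)
          moreover have "35 * real l \<le> 140 * real n" using two(3) by simp
          ultimately show ?thesis
            using R(11) steps[folded l_fs_def(1)] n_ge_2 by linarith
        qed
        ultimately show "step_rel \<sigma> \<sigma>'"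
          unfolding step_rel_def using eq' sig by auto
      qed (use two eq lab w aug(1) l_fs_def in auto)
    qed
    have walk2: "wp walk (wp augment (step_rel \<sigma>)) \<tau>"
      if fr: "frame step \<sigma> \<tau>" and eq: "rarr \<tau> = rarr \<sigma>" "narr \<tau> cur_arr = narr \<sigma> cur_arr"
        "nreg \<tau> i_reg = i" "nreg \<tau> p_reg = nreg \<sigma> p_reg" "nreg \<tau> c_reg = c" "rreg \<tau> sigma_rr = rreg \<sigma> sigma_rr"
        "rreg \<tau> rem_rr = rreg \<sigma> rem_rr" "nreg \<tau> done_reg = 0" "nreg \<tau> base_reg = c * (2 * n)"
        "nreg \<tau> x_reg = n + snk i"
        and ch1: "chain c (src i) ?wr ?lab 0 (nreg \<tau> sp_reg) vs (narr \<tau> estack_arr)" "vs (nreg \<tau> sp_reg) = cent c"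
        and steps: "real (steps \<tau>) \<le> real (steps \<sigma>) + 8 * real (nreg \<tau> sp_reg) + 25" for \<tau> vs
    proof (rule walk_wp[where c = c and s = "n + snk i"])
      show st\<tau>: "static \<tau>"
        by (rule static_frame[OF st fr]) (simp_all add: step_def augment_def program_defs)
      fix \<sigma>' vs'
      assume fr': "frame walk \<tau> \<sigma>'"
        and R: "chain c (n + snk i) (rarr \<tau> wr_rarr) (rarr \<tau> lab_rarr) (nreg \<tau> sp_reg) (nreg \<sigma>' sp_reg) vs' (narr \<sigma>' estack_arr)"
          "vs' (nreg \<sigma>' sp_reg) = (if n + snk i < n then cent c else n + cent c)"
          "\<And>p. p < nreg \<tau> sp_reg \<Longrightarrow> narr \<sigma>' estack_arr p = narr \<tau> estack_arr p"
          "real (steps \<sigma>') \<le> real (steps \<tau>) + 8 * real (nreg \<sigma>' sp_reg - nreg \<tau> sp_reg) + 3"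
      have "frame step \<tau> \<sigma>'" using fr' by (simp add: frame_def step_def)
      with fr have fr2: "frame step \<sigma> \<sigma>'" by (simp add: frame_def)
      have "nreg \<tau> sp_reg \<le> nreg \<sigma>' sp_reg" using R(1) by (simp add: chain_def)
      then have "real (steps \<sigma>') \<le> real (steps \<sigma>) + 8 * real (nreg \<sigma>' sp_reg) + 30"
        using R(4) steps by simp
      then show "wp augment (step_rel \<sigma>) \<sigma>'"
        using fr2 frameD[OF fr'] eq ch1 R
        by (intro augment[where b = "nreg \<tau> sp_reg" and vs = vs and vs' = vs' and ?fs1.0 = "narr \<tau> estack_arr"])
          (auto simp: program_defs)
    qed (use linv cN tight le eq snk_verts2 i in auto)
    have walk1: "wp walk (wp (NArith NAdd x_reg y_reg zero_reg) (wp walk (wp augment (step_rel \<sigma>)))) \<tau>"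
      if fr: "frame step \<sigma> \<tau>" and eq: "rarr \<tau> = rarr \<sigma>" "narr \<tau> cur_arr = narr \<sigma> cur_arr"
        "nreg \<tau> i_reg = i" "nreg \<tau> p_reg = nreg \<sigma> p_reg" "nreg \<tau> c_reg = c" "rreg \<tau> sigma_rr = rreg \<sigma> sigma_rr"
        "rreg \<tau> rem_rr = rreg \<sigma> rem_rr" "nreg \<tau> done_reg = 0" "nreg \<tau> base_reg = c * (2 * n)"
        "nreg \<tau> x_reg = src i" "nreg \<tau> y_reg = n + snk i" "nreg \<tau> sp_reg = 0"
        and steps: "steps \<tau> \<le> steps \<sigma> + 20" for \<tau>
    proof (rule walk_wp[where c = c and s = "src i"])
      show st\<tau>: "static \<tau>"
        by (rule static_frame[OF st fr]) (simp_all add: step_def augment_def program_defs)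
      fix \<sigma>' vs
      assume fr': "frame walk \<tau> \<sigma>'"
        and R: "chain c (src i) (rarr \<tau> wr_rarr) (rarr \<tau> lab_rarr) (nreg \<tau> sp_reg) (nreg \<sigma>' sp_reg) vs (narr \<sigma>' estack_arr)"
          "vs (nreg \<sigma>' sp_reg) = (if src i < n then cent c else n + cent c)"
          "\<And>p. p < nreg \<tau> sp_reg \<Longrightarrow> narr \<sigma>' estack_arr p = narr \<tau> estack_arr p"
          "real (steps \<sigma>') \<le> real (steps \<tau>) + 8 * real (nreg \<sigma>' sp_reg - nreg \<tau> sp_reg) + 3"
      have "frame step \<tau> \<sigma>'" using fr' by (simp add: frame_def step_def)
      with fr have fr2: "frame step \<sigma> \<sigma>'" by (simp add: frame_def)
      then have zero: "nreg \<sigma>' zero_reg = 0"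
        using static_frame[OF st fr2] by (simp add: step_def augment_def program_defs static_def)
      have eq': "rarr \<sigma>' = rarr \<sigma>" "narr \<sigma>' cur_arr = narr \<sigma> cur_arr"
        "nreg \<sigma>' i_reg = i" "nreg \<sigma>' p_reg = nreg \<sigma> p_reg" "nreg \<sigma>' c_reg = c" "rreg \<sigma>' sigma_rr = rreg \<sigma> sigma_rr"
        "rreg \<sigma>' rem_rr = rreg \<sigma> rem_rr" "nreg \<sigma>' done_reg = 0" "nreg \<sigma>' base_reg = c * (2 * n)"
        "nreg \<sigma>' y_reg = n + snk i"
        using frameD[OF fr'] eq by (auto simp: program_defs)
      show "wp (NArith NAdd x_reg y_reg zero_reg) (wp walk (wp augment (step_rel \<sigma>))) \<sigma>'"
        unfolding wp_simps using fr2 zero eq' R eq si steps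
        by (intro walk2[where vs = vs]) (simp_all add: frame_def step_def program_defs)
    qed (use linv cN tight le eq src_verts2 i in auto)
    show ?thesis
      using aug
      by (simp add: step_def wp_simps wp_Skip wp_Seq F mult_add_cell)
        (rule walk1, simp_all add: F frame_def step_def)
  qed
qed

end

section \<open>Invariants and running time\<close>

text \<open>A form of Bernoulli's inequality, from convexity of \<open>exp\<close>. Shipping a
  fraction \<open>y\<close> of a capacity multiplies the weight by \<open>1 + \<kappa> * y\<close>,
  which thus counts as at least \<open>y\<close> full factors \<open>1 + \<kappa>\<close>.\<close>

lemma powr_le_linear:
  fixes a y :: real
  assumes "0 \<le> a" "0 \<le> y" "y \<le> 1"
  shows "(1 + a) powr y \<le> 1 + a * y"
proof -
  have "exp ((1 - y) * 0 + y * ln (1 + a)) \<le> (1 - y) * exp 0 + y * exp (ln (1 + a))"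
    using convex_onD[OF exp_convex, of y 0 "ln (1 + a)"] assms by simp
  with assms show ?thesis by (simp add: powr_def algebra_simps)
qed

text \<open>Turns logarithms to base \<open>1 + 1 / y\<close> into counts of at most
  \<open>y + 1\<close> per unit. It serves the number of rounds, the label raises with ratio
  \<open>q c\<close>, the threshold raises with ratio \<open>1 + \<kappa>\<close>, and the harmonic
  sum.\<close>

lemma inverse_less_ln_one_plus:
  fixes y :: real
  assumes "0 < y"
  shows "1 / (y + 1) \<le> ln (1 + 1 / y)"
proof -
  have "ln (y / (y + 1)) \<le> y / (y + 1) - 1" using assms by (intro ln_le_minus_one) auto
  moreover have "ln (y / (y + 1)) = - ln (1 + 1 / y)"
  proof -
    have "y / (y + 1) = inverse (1 + 1 / y)" using assms by (simp add: field_simps)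
    then show ?thesis using assms by (simp add: ln_inverse)
  qed
  moreover have "y / (y + 1) - 1 = - (1 / (y + 1))" using assms by (simp add: field_simps)
  ultimately show ?thesis by simp
qed

context mcf_run
begin

definition "usage f j = (\<Sum>i<k. f (i * m + j))" for f :: "nat \<Rightarrow> real"
definition "shipped p = (\<Sum>q<p. sig q)"
definition "in_round s i = (if i < ai s then sig (ap s) * d i else if i = ai s then sig (ap s) * d i - arem s else 0)"
text \<open>Unscaled amount of commodity \<open>i\<close> shipped so far; the stored flow carries it
  divided by \<open>T'\<close>.\<close>

definition "routed s i = shipped (ap s) * d i + in_round s i"

definition flow_ok :: "astate \<Rightarrow> bool" where
  "flow_ok s \<longleftrightarrow> (\<forall>i<k. \<forall>j<m. 0 \<le> af s (i * m + j)) \<and>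
     (\<forall>i<k. \<forall>z<n. (\<Sum>j<m. af s (i * m + j) * arc_excess j z) =
        routed s i / T' * (of_bool (src i = z) - of_bool (snk i = z)))"

text \<open>\<open>T' * usage / cap\<close> is the unscaled relative load of an arc. By the lower
  bound, weights grow at least geometrically with the load; by the upper bound they cannot grow far.
  The two together limit the load and yield feasibility.\<close>

definition growth_ok :: "astate \<Rightarrow> bool" where
  "growth_ok s \<longleftrightarrow> (\<forall>j<m. \<delta> * (1 + \<kappa>) powr (T' * usage (af s) j / cap j) \<le> aw s j * cap j \<and>
     aw s j * cap j \<le> (1 + \<kappa>)\<^sup>2)"

text \<open>There are two reasons to stop, a saturated arc and a threshold beyond
  \<open>\<Theta>\<close>; with favourable centres and a positive optimum only the former occurs.
  The last clause is the memory of the centres rejected at the present threshold.\<close>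

definition main_inv :: "astate \<Rightarrow> bool" where
  "main_inv s \<longleftrightarrow> labels_ok (alab s) (acur s) (awr s) \<and> weights_ok (aw s) (awr s) \<and>
     ai s < k \<and> ac s \<le> N \<and> adn s \<le> 1 \<and>
     (adn s = 0 \<longrightarrow> (\<forall>i<k. ath s i \<le> \<Theta>) \<and> (\<forall>j<m. aw s j * cap j < 1)) \<and>
     (adn s = 1 \<longrightarrow> (\<exists>j<m. 1 \<le> aw s j * cap j) \<or> (\<exists>i<k. \<Theta> < ath s i)) \<and>
     (\<forall>i<k. d0 \<le> ath s i \<and> ath s i \<le> \<Theta> * (1 + \<kappa>)) \<and>
     0 \<le> arem s \<and> arem s \<le> sig (ap s) * d (ai s) \<and> flow_ok s \<and> growth_ok s \<and>
     (\<forall>c<ac s. ath s (ai s) < alab s (cell c (src (ai s))) + alab s (cell c (n + snk (ai s))))"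

lemma main_inv_inv0: "main_inv s \<Longrightarrow> adn s = 0 \<Longrightarrow> inv0 s"
  by (simp add: main_inv_def inv0_def)

lemma usage_le:
  assumes "growth_ok s" "j < m"
  shows "T' * usage (af s) j / cap j \<le> T'"
proof -
  have k1: "1 < 1 + \<kappa>" using kappa_pos by simp
  have "\<delta> * (1 + \<kappa>) powr (T' * usage (af s) j / cap j) \<le> (1 + \<kappa>)\<^sup>2"
    using assms unfolding growth_ok_def by fastforce
  then have "(1 + \<kappa>) powr (T' * usage (af s) j / cap j) \<le> (1 + \<kappa>)\<^sup>2 * (1 + \<kappa>) ^ T"
    using k1 by (simp add: \<delta>_def field_simps)
  also have "\<dots> = (1 + \<kappa>) ^ (T + 2)" by (simp only: power_add mult.commute)
  also have "\<dots> = (1 + \<kappa>) powr T'"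
    using k1 by (subst powr_realpow[symmetric]) (auto simp: T'_def add.commute)
  finally show ?thesis using k1 by simp
qed

lemma augmented_usage:
  assumes "augmented i \<gamma> h w f w' f'" "i < k" "j < m"
  shows "usage f' j = usage f j + real (h j) * (\<gamma> / T')"
proof -
  have "usage f' j = f' (i * m + j) + (\<Sum>i'\<in>{..<k} - {i}. f' (i' * m + j))"
    unfolding usage_def using assms(2) by (intro sum.remove) auto
  also have "(\<Sum>i'\<in>{..<k} - {i}. f' (i' * m + j)) = (\<Sum>i'\<in>{..<k} - {i}. f (i' * m + j))"
    using assms(1,3) by (intro sum.cong) (auto simp: augmented_def)
  also have "f' (i * m + j) = f (i * m + j) + real (h j) * (\<gamma> / T')"
    using assms(1,3) by (simp add: augmented_def)
  finally show ?thesis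
    unfolding usage_def using assms(2) by (subst sum.remove[of "{..<k}" i]) auto
qed

lemma growth_ok_augments:
  assumes g: "growth_ok s" and a: "augments fs l \<gamma> s s'" and i: "ai s < k"
    and w: "weights_ok (aw s) (awr s)" "labels_ok (alab s) (acur s) (awr s)"
    and dn: "\<forall>j<m. aw s j * cap j < 1"
  shows "growth_ok s'"
  unfolding growth_ok_def
proof (intro allI impI conjI)
  fix j assume j: "j < m"
  let ?h = "hits fs l"
  have aug: "augmented (ai s) \<gamma> ?h (aw s) (af s) (aw s') (af s')" and \<gamma>: "0 \<le> \<gamma>" and two: "?h j \<le> 2"
    using a by (auto simp: augments_def)
  have \<gamma>_le: "\<gamma> \<le> cap j" if "?h j > 0"
  proof -
    have "{p. p < l \<and> fs p = j} \<noteq> {}" using that by (auto simp: hits_def card_gt_0_iff)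
    with a show ?thesis by (auto simp: augments_def)
  qed
  have "d0 \<le> awr s j" using lab_invD(1) w(2) j by (auto simp: labels_ok_def)
  then have wpos: "0 < aw s j" using w(1) j d0_pos by (fastforce simp: weights_ok_def)
  show "aw s' j * cap j \<le> (1 + \<kappa>)\<^sup>2"
    using augmented_weight_le(1)[OF aug j two \<gamma> \<gamma>_le _ wpos] dn j by simp
  have c: "cap j \<ge> 1" using cap_ge_1[OF j] .
  define y where "y = \<gamma> / cap j"
  have pw: "(1 + \<kappa>) powr (real (?h j) * y) \<le> (1 + \<gamma> * \<kappa> / cap j) ^ ?h j"
  proof (cases "?h j = 0")
    case True
    then show ?thesis using kappa_pos by simp
  next
    case False
    then have y: "0 \<le> y" "y \<le> 1" using \<gamma>_le \<gamma> c by (auto simp: y_def)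
    have "(1 + \<kappa>) powr (real (?h j) * y) = ((1 + \<kappa>) powr y) ^ ?h j"
      using kappa_pos by (simp add: powr_powr[symmetric] powr_realpow mult.commute)
    also have "\<dots> \<le> (1 + \<kappa> * y) ^ ?h j"
      using powr_le_linear[OF _ y, of \<kappa>] kappa_pos by (intro power_mono) auto
    finally show ?thesis by (simp add: y_def mult.commute)
  qed
  have "T' * usage (af s') j / cap j = T' * usage (af s) j / cap j + real (?h j) * y"
    using augmented_usage[OF aug i j] T'_ge
    by (simp add: y_def distrib_left add_divide_distrib)
  then have "\<delta> * (1 + \<kappa>) powr (T' * usage (af s') j / cap j) =
      (\<delta> * (1 + \<kappa>) powr (T' * usage (af s) j / cap j)) * (1 + \<kappa>) powr (real (?h j) * y)"
    by (simp add: powr_add)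
  also have "\<dots> \<le> (aw s j * cap j) * (1 + \<gamma> * \<kappa> / cap j) ^ ?h j"
    by (rule mult_mono) (use g j pw wpos c in \<open>auto simp: growth_ok_def\<close>)
  also have "\<dots> = aw s' j * cap j" using aug j by (simp add: augmented_def mult_ac)
  finally show "\<delta> * (1 + \<kappa>) powr (T' * usage (af s') j / cap j) \<le> aw s' j * cap j" .
qed

lemma flow_ok_augments:
  assumes f: "flow_ok s" and a: "augments fs l \<gamma> s s'" and i: "ai s < k"
  shows "flow_ok s'"
  unfolding flow_ok_def
proof (intro conjI allI impI)
  let ?h = "hits fs l"
  have aug: "augmented (ai s) \<gamma> ?h (aw s) (af s) (aw s') (af s')" and \<gamma>: "0 \<le> \<gamma>"
    and eq: "ai s' = ai s" "ap s' = ap s" "arem s' = arem s - \<gamma>" and fs: "\<And>p. p < l \<Longrightarrow> fs p < m"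
    using a by (auto simp: augments_def)
  fix i' assume i': "i' < k"
  show "0 \<le> af s' (i' * m + j)" if "j < m" for j
    using f aug that i' \<gamma> T'_ge by (cases "i' = ai s") (auto simp: flow_ok_def augmented_def)
  fix z assume z: "z < n"
  show "(\<Sum>j<m. af s' (i' * m + j) * arc_excess j z) =
      routed s' i' / T' * (of_bool (src i' = z) - of_bool (snk i' = z))"
  proof (cases "i' = ai s")
    case True
    have "(\<Sum>j<m. af s' (i' * m + j) * arc_excess j z) =
        (\<Sum>j<m. af s (i' * m + j) * arc_excess j z) + \<gamma> / T' * (\<Sum>j<m. real (?h j) * arc_excess j z)"
      unfolding sum_distrib_left sum.distrib[symmetric] using aug True
      by (intro sum.cong) (auto simp: augmented_def algebra_simps)
    also have "(\<Sum>j<m. real (?h j) * arc_excess j z) = (\<Sum>p<l. arc_excess (fs p) z)"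
      using sum_hits[of l fs "\<lambda>j. arc_excess j z"] fs by simp
    also have "\<dots> = of_bool (src i' = z) - of_bool (snk i' = z)"
      using a z True by (auto simp: augments_def)
    also have "(\<Sum>j<m. af s (i' * m + j) * arc_excess j z) =
        routed s i' / T' * (of_bool (src i' = z) - of_bool (snk i' = z))"
      using f i' z by (simp add: flow_ok_def)
    finally have "(\<Sum>j<m. af s' (i' * m + j) * arc_excess j z) =
        (routed s i' + \<gamma>) / T' * (of_bool (src i' = z) - of_bool (snk i' = z))"
      using True by (simp only: add_divide_distrib distrib_right)
    moreover have "routed s' i' = routed s i' + \<gamma>"
      using True by (simp add: routed_def in_round_def eq)
    ultimately show ?thesis by simp
  next
    case False
    then have "(\<Sum>j<m. af s' (i' * m + j) * arc_excess j z) = (\<Sum>j<m. af s (i' * m + j) * arc_excess j z)"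
      using aug by (intro sum.cong) (auto simp: augmented_def)
    then show ?thesis
      using f i' z False by (simp add: flow_ok_def routed_def in_round_def eq)
  qed
qed

text \<open>Closing a round moves the finished shares from \<open>in_round\<close> to
  \<open>shipped\<close>; an exhausted remainder makes the two accounts agree.\<close>

lemma routed_next_com:
  assumes "next_com s s'" "arem s = 0" "ai s < k" "i < k"
  shows "routed s' i = routed s i"
proof (cases "Suc (ai s) = k")
  case True
  with assms show ?thesis
    by (auto simp: next_com_def routed_def in_round_def shipped_def algebra_simps)
next
  case False
  with assms show ?thesis
    by (auto simp: next_com_def routed_def in_round_def Let_def less_Suc_eq)
qed

lemma main_inv_step:
  assumes inv: "main_inv s" and dn: "adn s = 0"
    and tr: "next_com s s' \<or> raise_threshold s s' \<or> next_center s s' \<or> (\<exists>fs l \<gamma>. augments fs l \<gamma> s s')"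
  shows "main_inv s'"
  using tr
proof (elim disjE exE)
  assume nc: "next_com s s'"
  have rem: "arem s = 0" using nc inv by (auto simp: next_com_def main_inv_def)
  have i: "ai s < k" using inv by (simp add: main_inv_def)
  have eq: "alab s' = alab s" "acur s' = acur s" "awr s' = awr s" "aw s' = aw s" "ath s' = ath s"
    "adn s' = adn s" "ac s' = 0" "af s' = af s" "arem s' = sig (ap s') * d (ai s')"
    and i': "ai s' < k"
    using nc i by (auto simp: next_com_def Let_def)
  have "flow_ok s'"
    using inv routed_next_com[OF nc rem i] by (simp add: main_inv_def flow_ok_def eq)
  moreover have "0 \<le> sig (ap s') * d (ai s')" using sig_pos[of "ap s'"] d_pos[OF i'] by simp
  ultimately show ?thesis
    using inv i' unfolding main_inv_def eq by (simp add: growth_ok_def eq)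
next
  assume r: "raise_threshold s s'"
  define t where "t = ath s (ai s) * (1 + \<kappa>)"
  have s': "s' = s\<lparr>ath := (ath s)(ai s := t), ac := 0, adn := if \<Theta> < t then 1 else 0\<rparr>"
    using r by (simp add: raise_threshold_def t_def Let_def)
  have i: "ai s < k" "d0 \<le> ath s (ai s)" "ath s (ai s) \<le> \<Theta>"
    using inv dn by (auto simp: main_inv_def)
  have t: "d0 \<le> t" "t \<le> \<Theta> * (1 + \<kappa>)"
  proof -
    have "ath s (ai s) * 1 \<le> t"
      unfolding t_def using i(2) d0_pos kappa_pos by (intro mult_left_mono) auto
    with i(2) show "d0 \<le> t" by simp
    show "t \<le> \<Theta> * (1 + \<kappa>)"
      unfolding t_def using i(3) kappa_pos by (intro mult_right_mono) auto
  qed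
  have "flow_ok s'" "growth_ok s'"
    using inv by (auto simp: s' main_inv_def flow_ok_def growth_ok_def routed_def in_round_def)
  then show ?thesis
    using inv t i dn unfolding main_inv_def s' by (auto simp: s')
next
  assume nc: "next_center s s'"
  have s': "s' = s\<lparr>ac := Suc (ac s)\<rparr>" using nc by (simp add: next_center_def)
  have "flow_ok s'" "growth_ok s'"
    using inv by (auto simp: s' main_inv_def flow_ok_def growth_ok_def routed_def in_round_def)
  then show ?thesis
    using inv nc unfolding main_inv_def s' next_center_def by (auto simp: less_Suc_eq)
next
  fix fs l \<gamma> assume a: "augments fs l \<gamma> s s'"
  have i: "ai s < k" and w: "weights_ok (aw s) (awr s)" "labels_ok (alab s) (acur s) (awr s)"
    "\<forall>j<m. aw s j * cap j < 1" and th: "\<forall>i<k. ath s i \<le> \<Theta>"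
    using inv dn by (auto simp: main_inv_def)
  have eq: "ath s' = ath s" "ai s' = ai s" "ap s' = ap s" "ac s' = ac s" "arem s' = arem s - \<gamma>"
    and new: "labels_ok (alab s') (acur s') (awr s')" "weights_ok (aw s') (awr s')" "full_iff (adn s') (aw s')"
      "0 \<le> \<gamma>" "\<gamma> \<le> arem s" "\<And>g. alab s g \<le> alab s' g"
    using a unfolding augments_def by auto
  have "ath s' (ai s') < alab s' (cell c (src (ai s'))) + alab s' (cell c (n + snk (ai s')))"
    if "c < ac s'" for c
  proof -
    have "ath s (ai s) < alab s (cell c (src (ai s))) + alab s (cell c (n + snk (ai s)))"
      using inv that eq by (simp add: main_inv_def)
    then show ?thesis
      using new(6)[of "cell c (src (ai s))"] new(6)[of "cell c (n + snk (ai s))"] by (simp add: eq)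
  qed
  moreover have "flow_ok s'" "growth_ok s'"
    using flow_ok_augments[OF _ a i] growth_ok_augments[OF _ a i w] inv by (auto simp: main_inv_def)
  moreover have "(adn s' = 0 \<longrightarrow> (\<forall>j<m. aw s' j * cap j < 1))" "adn s' \<le> 1"
    "(adn s' = 1 \<longrightarrow> (\<exists>j<m. 1 \<le> aw s' j * cap j))"
    using new(3) by (auto simp: full_iff_def not_le)
  ultimately show ?thesis
    using inv new i th unfolding main_inv_def eq by auto
qed

section \<open>Potential for the running time\<close>

definition "c_aug = 160 * real n"
definition "lvl t = ln (\<Theta> * (1 + \<kappa>) / t) / ln (1 + \<kappa>)"
definition "rounds_max = 1 + (2 * T' + 1) * ln (1 + real k * real m * U)"
text \<open>Total relative capacity not yet used, in unscaled units; an augmentation limited by an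
  arc capacity consumes at least one unit.\<close>

definition "slack s = (\<Sum>j<m. T' - T' * usage (af s) j / cap j)"
text \<open>Every kind of transition is paid by its own summand. Raising a threshold resets the
  centre counter and must refill \<open>25 * N\<close>; changing the commodity moreover restores the
  credit \<open>c_aug\<close> for the one augmentation that exhausts the remainder. All other
  augmentations are limited by an arc and paid by \<open>slack\<close>. Label repair is covered by
  \<open>work_pot\<close>.\<close>

definition "psi s = work_pot s + 25 * real (N - ac s) + (25 * real N + 40) * (\<Sum>i<k. lvl (ath s i)) +
   (25 * real N + 60 + c_aug) * (rounds_max * real k - real (ap s * k + ai s)) +
   (if 0 < arem s then c_aug else 0) + c_aug * slack s"

lemma shipped_eq: "shipped p = ((1 + 1 / (2 * T')) ^ p - 1) * T' / (real k * D)"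
proof -
  let ?x = "1 + 1 / (2 * T')"
  have "shipped p = (\<Sum>q<p. ?x ^ q) / (2 * real k * D)"
    by (simp add: shipped_def sig_def sum_divide_distrib)
  also have "(\<Sum>q<p. ?x ^ q) = (?x ^ p - 1) / (?x - 1)"
    using T'_ge by (intro geometric_sum) auto
  also have "\<dots> = (?x ^ p - 1) * (2 * T')" by simp
  finally show ?thesis by simp
qed

lemma in_round_nonneg: "main_inv s \<Longrightarrow> i < k \<Longrightarrow> 0 \<le> in_round s i"
  using sig_pos d_pos by (auto simp: in_round_def main_inv_def less_imp_le)

lemma usage_le_cap:
  assumes "main_inv s" "j < m"
  shows "usage (af s) j \<le> cap j"
proof -
  have "T' * (usage (af s) j / cap j) \<le> T' * 1"
    using usage_le[of s j] assms by (simp add: main_inv_def)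
  then have "usage (af s) j / cap j \<le> 1"
    using T'_ge by (subst (asm) mult_le_cancel_left_pos) auto
  then show ?thesis using cap_ge_1[OF assms(2)] by (simp add: divide_le_eq)
qed

lemma flow_le_usage:
  assumes "main_inv s" "i < k" "j < m"
  shows "af s (i * m + j) \<le> usage (af s) j"
  unfolding usage_def using assms
  by (intro member_le_sum[of i "{..<k}" "\<lambda>i. af s (i * m + j)"]) (auto simp: main_inv_def flow_ok_def)

text \<open>For a commodity of largest demand the scaled flow out of its source is at most
  \<open>m * U\<close>, whereas the shipped amount grows geometrically. The optimum does not enter,
  so the bound is available for arbitrary centres.\<close>

lemma rounds_bound:
  assumes inv: "main_inv s"
  shows "real (ap s) + 1 \<le> rounds_max"
proof -
  have "D \<in> d ` {..<k}" unfolding D_def using k_pos by (intro Max_in) (auto simp: lessThan_empty_iff)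
  then obtain i where i: "i < k" "d i = D" by auto
  let ?x = "1 + 1 / (2 * T')"
  have "shipped (ap s) * D \<le> routed s i"
    using in_round_nonneg[OF inv i(1)] i(2) by (simp add: routed_def)
  then have "shipped (ap s) * D / T' \<le> routed s i / T'"
    using T'_ge by (intro divide_right_mono) auto
  also have "\<dots> = (\<Sum>j<m. af s (i * m + j) * arc_excess j (src i))"
    using inv i(1) src_less[OF i(1)] src_snk[OF i(1)] by (auto simp: main_inv_def flow_ok_def)
  also have "\<dots> \<le> (\<Sum>j<m. U)"
  proof (rule sum_mono)
    fix j assume "j \<in> {..<m}"
    then have j: "j < m" by simp
    have f: "0 \<le> af s (i * m + j)" using inv i j by (auto simp: main_inv_def flow_ok_def)
    have "af s (i * m + j) * arc_excess j (src i) \<le> af s (i * m + j) * 1"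
      using f by (intro mult_left_mono) (auto simp: arc_excess_def)
    also have "\<dots> \<le> U"
      using flow_le_usage[OF inv i(1) j] usage_le_cap[OF inv j] cap_le_U[OF j] by simp
    finally show "af s (i * m + j) * arc_excess j (src i) \<le> U" .
  qed
  finally have "shipped (ap s) * D / T' \<le> real m * U" by simp
  then have "(?x ^ ap s - 1) / real k \<le> real m * U"
    using T'_ge D_pos by (simp add: shipped_eq)
  then have "?x ^ ap s \<le> 1 + real k * real m * U"
    using k_pos by (simp add: divide_le_eq algebra_simps)
  then have "ln (?x ^ ap s) \<le> ln (1 + real k * real m * U)"
    using T'_ge by (intro ln_mono) (auto intro!: zero_less_power add_pos_pos)
  moreover have "ln (?x ^ ap s) = real (ap s) * ln ?x"
    using T'_ge by (subst ln_realpow) (auto intro!: add_pos_pos)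
  moreover have "real (ap s) * (1 / (2 * T' + 1)) \<le> real (ap s) * ln ?x"
    using inverse_less_ln_one_plus[of "2 * T'"] T'_ge by (intro mult_left_mono) auto
  ultimately have "real (ap s) / (2 * T' + 1) \<le> ln (1 + real k * real m * U)" by simp
  then have "real (ap s) \<le> ln (1 + real k * real m * U) * (2 * T' + 1)"
    using T'_ge by (subst (asm) pos_divide_le_eq) auto
  then show ?thesis by (simp add: rounds_max_def mult.commute)
qed

lemma work_pot_nonneg:
  assumes "main_inv s"
  shows "0 \<le> work_pot s"
proof -
  have l: "lab_inv (alab s) (acur s) (awr s)" and w: "weights_ok (aw s) (awr s)" and g: "growth_ok s"
    using assms by (auto simp: main_inv_def labels_ok_def)
  have "0 \<le> ev_pot (awr s)"
  proof (rule ev_pot_nonneg)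
    fix j assume j: "j < m"
    have "awr s j * cap j \<le> aw s j * cap j"
      using w j cap_ge_1[OF j] by (intro mult_right_mono) (auto simp: weights_ok_def)
    then show "0 < awr s j \<and> awr s j * cap j \<le> (1 + \<kappa>)\<^sup>2"
      using lab_invD(1)[OF l j] d0_pos g j by (fastforce simp: growth_ok_def)
  qed
  then show ?thesis
    using pot_nonneg[OF l] by (simp add: work_pot_def ev_cost_def)
qed

lemma lvl_nonneg:
  assumes "d0 \<le> t" "t \<le> \<Theta> * (1 + \<kappa>)"
  shows "0 \<le> lvl t"
proof -
  have "1 \<le> \<Theta> * (1 + \<kappa>) / t" using assms d0_pos by (simp add: pos_le_divide_eq)
  then show ?thesis using kappa_pos by (simp add: lvl_def)
qed

lemma lvl_raise:
  assumes "0 < t"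
  shows "lvl (t * (1 + \<kappa>)) = lvl t - 1"
proof -
  have k1: "ln (1 + \<kappa>) > 0" using kappa_pos by simp
  have "ln (\<Theta> * (1 + \<kappa>) / t) = ln (\<Theta> * (1 + \<kappa>) / (t * (1 + \<kappa>))) + ln (1 + \<kappa>)"
    using assms kappa_pos Theta_ge ln_mult_pos[of "\<Theta> * (1 + \<kappa>) / (t * (1 + \<kappa>))" "1 + \<kappa>"] by simp
  with k1 show ?thesis by (simp add: lvl_def add_divide_distrib)
qed

lemma slack_nonneg:
  assumes "main_inv s"
  shows "0 \<le> slack s"
  unfolding slack_def using usage_le[of s] assms by (intro sum_nonneg) (auto simp: main_inv_def)

lemma psi_nonneg:
  assumes inv: "main_inv s"
  shows "0 \<le> psi s"
proof -
  have "0 \<le> (\<Sum>i<k. lvl (ath s i))"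
    using inv by (intro sum_nonneg lvl_nonneg) (auto simp: main_inv_def)
  moreover have "real (ap s * k + ai s) \<le> (real (ap s) + 1) * real k"
    using inv by (simp add: main_inv_def algebra_simps)
  then have "real (ap s * k + ai s) \<le> rounds_max * real k"
    using rounds_bound[OF inv] by (meson mult_right_mono of_nat_0_le_iff order_trans)
  ultimately show ?thesis
    unfolding psi_def using work_pot_nonneg[OF inv] slack_nonneg[OF inv]
    by (intro add_nonneg_nonneg mult_nonneg_nonneg) (auto simp: c_aug_def)
qed

lemma slack_augments:
  assumes inv: "main_inv s" and a: "augments fs l \<gamma> s s'"
  shows "slack s' \<le> slack s" "\<gamma> \<noteq> arem s \<Longrightarrow> slack s' \<le> slack s - 1"
proof -
  let ?h = "hits fs l" and ?t = "\<lambda>s j. T' - T' * usage (af s) j / cap j"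
  have i: "ai s < k" using inv by (simp add: main_inv_def)
  have aug: "augmented (ai s) \<gamma> ?h (aw s) (af s) (aw s') (af s')" and \<gamma>: "0 \<le> \<gamma>"
    using a by (auto simp: augments_def)
  have eq: "?t s' j = ?t s j - real (?h j) * (\<gamma> / cap j)" if "j < m" for j
    using augmented_usage[OF aug i that] T'_ge by (simp add: distrib_left add_divide_distrib)
  have le: "?t s' j \<le> ?t s j" if "j < m" for j
    using \<gamma> cap_ge_1[OF that] unfolding eq[OF that] by simp
  then show "slack s' \<le> slack s" unfolding slack_def by (intro sum_mono) auto
  assume "\<gamma> \<noteq> arem s"
  then obtain p where p: "p < l" "\<gamma> = cap (fs p)" and m: "fs p < m"
    using a by (auto simp: augments_def)
  have "?h (fs p) \<noteq> 0" using p(1) by (auto simp: hits_def)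
  then have "1 * 1 \<le> real (?h (fs p)) * (\<gamma> / cap (fs p))"
    using p(2) cap_ge_1[OF m] by (intro mult_mono) auto
  then have "?t s' (fs p) \<le> ?t s (fs p) - 1" unfolding eq[OF m] by simp
  moreover have "(\<Sum>j\<in>{..<m} - {fs p}. ?t s' j) \<le> (\<Sum>j\<in>{..<m} - {fs p}. ?t s j)"
    using le by (intro sum_mono) auto
  ultimately show "slack s' \<le> slack s - 1"
    unfolding slack_def using m by (simp add: sum.remove[of "{..<m}" "fs p"])
qed

lemma psi_step:
  assumes inv: "main_inv (abs_state \<sigma>)" and inv': "main_inv (abs_state \<sigma>')" and rel: "step_rel \<sigma> \<sigma>'"
  shows "real (steps \<sigma>') + psi (abs_state \<sigma>') \<le> real (steps \<sigma>) + psi (abs_state \<sigma>)"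
proof -
  define s where "s = abs_state \<sigma>"
  define s' where "s' = abs_state \<sigma>'"
  have i: "ai s < k" and rem: "0 \<le> arem s" and c: "ac s \<le> N" using inv by (auto simp: main_inv_def s_def)
  have c0: "0 \<le> c_aug" by (simp add: c_aug_def)
  from rel consider (comm) "next_com s s'" "steps \<sigma>' \<le> steps \<sigma> + 20"
    | (raise) "raise_threshold s s'" "steps \<sigma>' \<le> steps \<sigma> + 20"
    | (center) "next_center s s'" "steps \<sigma>' \<le> steps \<sigma> + 20"
    | (aug) fs l \<gamma> where "augments fs l \<gamma> s s'"
      "real (steps \<sigma>') + work_pot s' \<le> real (steps \<sigma>) + work_pot s + 160 * real n"
    unfolding step_rel_def s_def s'_def by blast
  then have "real (steps \<sigma>') + psi s' \<le> real (steps \<sigma>) + psi s"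
  proof cases
    case comm
    have eq: "alab s' = alab s" "acur s' = acur s" "awr s' = awr s" "ath s' = ath s" "ac s' = 0" "af s' = af s"
      using comm(1) by (auto simp: next_com_def Let_def)
    have num: "ap s' * k + ai s' = Suc (ap s * k + ai s)"
      using comm(1) i by (auto simp: next_com_def Let_def)
    have rem0: "arem s = 0" using comm(1) rem by (simp add: next_com_def)
    have "real (steps \<sigma>') \<le> real (steps \<sigma>) + 20" using comm(2) by linarith
    moreover have "real (N - ac s') = real N" by (simp add: eq)
    moreover have "(25 * real N + 60 + c_aug) * (rounds_max * real k - real (ap s' * k + ai s')) =
        (25 * real N + 60 + c_aug) * (rounds_max * real k - real (ap s * k + ai s)) - (25 * real N + 60 + c_aug)"
      unfolding num by (simp add: algebra_simps)
    moreover have "work_pot s' = work_pot s" "slack s' = slack s" by (simp_all add: work_pot_def slack_def eq)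
    ultimately show ?thesis
      using rem0 c0 unfolding psi_def eq(4) by simp
  next
    case raise
    define t where "t = ath s (ai s)"
    have eq: "ath s' = (ath s)(ai s := t * (1 + \<kappa>))" "ac s = N" "ac s' = 0"
      "work_pot s' = work_pot s" "slack s' = slack s" "ap s' = ap s" "ai s' = ai s" "arem s' = arem s"
      using raise(1) by (auto simp: raise_threshold_def Let_def t_def work_pot_def slack_def)
    have "0 < t" using inv i d0_pos by (fastforce simp: main_inv_def t_def s_def)
    then have "(\<Sum>i<k. lvl (ath s' i)) = (\<Sum>i<k. lvl (ath s i)) - 1"
      using i by (simp add: eq(1) sum.remove[of "{..<k}" "ai s"] lvl_raise t_def)
    then have "(25 * real N + 40) * (\<Sum>i<k. lvl (ath s' i)) =
        (25 * real N + 40) * (\<Sum>i<k. lvl (ath s i)) - (25 * real N + 40)"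
      by (simp only: right_diff_distrib mult_1_right)
    moreover have "real (steps \<sigma>') \<le> real (steps \<sigma>) + 20" using raise(2) by linarith
    ultimately show ?thesis
      unfolding psi_def eq(2-) by simp
  next
    case center
    have s': "s' = s\<lparr>ac := Suc (ac s)\<rparr>" and "ac s < N" using center(1) by (auto simp: next_center_def)
    then have "25 * real (N - ac s') = 25 * real (N - ac s) - 25" by (simp add: of_nat_diff)
    moreover have "real (steps \<sigma>') \<le> real (steps \<sigma>) + 20" using center(2) by linarith
    ultimately show ?thesis
      unfolding psi_def by (simp add: s' work_pot_def slack_def)
  next
    case aug
    have eq: "ath s' = ath s" "ai s' = ai s" "ap s' = ap s" "ac s' = ac s" "arem s' = arem s - \<gamma>" "0 < arem s" "0 \<le> \<gamma>"
      using aug(1) unfolding augments_def by auto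
    have inv_s: "main_inv s" using inv by (simp add: s_def)
    have "(if 0 < arem s' then c_aug else 0) + c_aug * slack s' + c_aug \<le>
        (if 0 < arem s then c_aug else 0) + c_aug * slack s"
    proof (cases "\<gamma> = arem s")
      case True
      then show ?thesis
        using slack_augments(1)[OF inv_s aug(1)] c0 eq by (auto intro: mult_left_mono)
    next
      case False
      have "c_aug * slack s' \<le> c_aug * (slack s - 1)"
        using slack_augments(2)[OF inv_s aug(1) False] c0 by (intro mult_left_mono) auto
      then show ?thesis using eq(6) c0 by (simp add: algebra_simps)
    qed
    then show ?thesis
      using aug(2) unfolding psi_def eq(1-4) by (simp add: c_aug_def)
  qed
  then show ?thesis by (simp add: s_def s'_def)
qed

text \<open>
  The invariant \<open>J\<close> is a parameter: it is preserved by all transitions and carries the analysis of the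
  approximation guarantee, which is only available for favourable centres.
\<close>

lemma main_wp:
  assumes st: "static \<sigma>" and sig: "rreg \<sigma> sigma_rr = sig (nreg \<sigma> p_reg)"
    and inv: "main_inv (abs_state \<sigma>)" and J: "J (abs_state \<sigma>)"
    and J_step: "\<And>s s'. J s \<Longrightarrow> main_inv s \<Longrightarrow> main_inv s' \<Longrightarrow> adn s = 0 \<Longrightarrow>
      next_com s s' \<or> raise_threshold s s' \<or> next_center s s' \<or> (\<exists>fs l \<gamma>. augments fs l \<gamma> s s') \<Longrightarrow> J s'"
  shows "wp (While (NEq done_reg zero_reg) step) (\<lambda>\<sigma>'. main_inv (abs_state \<sigma>') \<and> J (abs_state \<sigma>') \<and>
    adn (abs_state \<sigma>') = 1 \<and> real (steps \<sigma>') \<le> real (steps \<sigma>) + psi (abs_state \<sigma>) + 1) \<sigma>"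
proof (rule wp_While[where Bd = "real (steps \<sigma>) + psi (abs_state \<sigma>)" and
      Inv = "\<lambda>\<sigma>'. main_inv (abs_state \<sigma>') \<and> J (abs_state \<sigma>') \<and> rreg \<sigma>' sigma_rr = sig (nreg \<sigma>' p_reg) \<and>
        real (steps \<sigma>') + psi (abs_state \<sigma>') \<le> real (steps \<sigma>) + psi (abs_state \<sigma>)"])
  fix \<sigma>' assume Inv: "main_inv (abs_state \<sigma>') \<and> J (abs_state \<sigma>') \<and> rreg \<sigma>' sigma_rr = sig (nreg \<sigma>' p_reg) \<and>
        real (steps \<sigma>') + psi (abs_state \<sigma>') \<le> real (steps \<sigma>) + psi (abs_state \<sigma>)"
    and fr: "frame step \<sigma> \<sigma>'"
  have st': "static \<sigma>'" by (rule static_frame[OF st fr]) (simp_all add: step_def augment_def program_defs)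
  have dn_eq: "adn (abs_state \<sigma>') = nreg \<sigma>' done_reg" by (simp add: abs_state_def)
  show "real (steps \<sigma>') \<le> real (steps \<sigma>) + psi (abs_state \<sigma>)"
    using psi_nonneg[of "abs_state \<sigma>'"] Inv by linarith
  {
    assume "\<not> holds (NEq done_reg zero_reg) \<sigma>'"
    then have "nreg \<sigma>' done_reg \<noteq> 0" using st' by (simp add: static_def)
    then have "adn (abs_state \<sigma>') = 1" using Inv by (auto simp: main_inv_def dn_eq)
    moreover have "abs_state (tick \<sigma>') = abs_state \<sigma>'" by (simp add: abs_state_def)
    ultimately show "main_inv (abs_state (tick \<sigma>')) \<and> J (abs_state (tick \<sigma>')) \<and> adn (abs_state (tick \<sigma>')) = 1 \<and>
        real (steps (tick \<sigma>')) \<le> real (steps \<sigma>) + psi (abs_state \<sigma>) + 1"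
      using psi_nonneg[of "abs_state \<sigma>'"] Inv by auto
  next
    assume "holds (NEq done_reg zero_reg) \<sigma>'"
    then have dn: "adn (abs_state \<sigma>') = 0" using st' by (simp add: static_def dn_eq)
    have "wp step (step_rel \<sigma>') (tick \<sigma>')"
      using Inv by (intro step_wp st' main_inv_inv0 dn) auto
    then show "wp step (\<lambda>\<sigma>'. main_inv (abs_state \<sigma>') \<and> J (abs_state \<sigma>') \<and> rreg \<sigma>' sigma_rr = sig (nreg \<sigma>' p_reg) \<and>
        real (steps \<sigma>') + psi (abs_state \<sigma>') \<le> real (steps \<sigma>) + psi (abs_state \<sigma>)) (tick \<sigma>')"
    proof (rule wp_mono)
      fix \<tau> assume rel: "step_rel \<sigma>' \<tau>"
      then have tr: "next_com (abs_state \<sigma>') (abs_state \<tau>) \<or> raise_threshold (abs_state \<sigma>') (abs_state \<tau>) \<or>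
         next_center (abs_state \<sigma>') (abs_state \<tau>) \<or> (\<exists>fs l \<gamma>. augments fs l \<gamma> (abs_state \<sigma>') (abs_state \<tau>))"
        unfolding step_rel_def by blast
      have inv\<tau>: "main_inv (abs_state \<tau>)" using main_inv_step[OF _ dn tr] Inv by blast
      moreover have "J (abs_state \<tau>)" using J_step[OF _ _ inv\<tau> dn tr] Inv by blast
      ultimately show "main_inv (abs_state \<tau>) \<and> J (abs_state \<tau>) \<and> rreg \<tau> sigma_rr = sig (nreg \<tau> p_reg) \<and>
        real (steps \<tau>) + psi (abs_state \<tau>) \<le> real (steps \<sigma>) + psi (abs_state \<sigma>)"
        using psi_step[OF _ inv\<tau> rel] Inv rel by (auto simp: step_rel_def)
    qed
  }
qed (use assms in auto)

end

section \<open>Approximation guarantee\<close>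

context mcf_run
begin

section \<open>Feasibility and value of the output\<close>

definition "out_flow f i e = f (i * m + the_inv_into {..<m} ((!) es) e)"
  for f :: "nat \<Rightarrow> real" and i :: nat and e :: "nat \<times> nat"

lemma bij_es: "bij_betw ((!) es) {..<m} E"
  using bij_betw_nth[of es "{..<m}" E] es by auto

lemma sum_arcs: "(\<Sum>e\<in>E. g e) = (\<Sum>j<m. g (es ! j))"
  using sum.reindex_bij_betw[OF bij_es, of g] by simp

lemma out_flow_nth: "j < m \<Longrightarrow> out_flow f i (es ! j) = f (i * m + j)"
  unfolding out_flow_def using bij_es by (subst the_inv_into_f_f) (auto simp: bij_betw_def)

lemma arcE: "e \<in> E \<Longrightarrow> (\<And>j. j < m \<Longrightarrow> e = es ! j \<Longrightarrow> thesis) \<Longrightarrow> thesis"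
  using bij_es by (auto simp: bij_betw_def)

lemma excess_out_flow: "excess E (out_flow f i) z = (\<Sum>j<m. f (i * m + j) * arc_excess j z)"
  unfolding excess_def sum_arcs arc_excess_def tail_of_def head_of_def
  by (intro sum.cong) (auto simp: out_flow_nth)

lemma feasible_out_flow:
  assumes inv: "main_inv s"
  shows "feasible_mcf I (out_flow (af s))"
    "i < k \<Longrightarrow> excess E (out_flow (af s) i) (src i) = routed s i / T'"
    "i < k \<Longrightarrow> shipped (ap s) * d i \<le> routed s i"
proof -
  have f: "flow_ok s" using inv by (simp add: main_inv_def)
  have "excess E (out_flow (af s) i) z = 0" if "i < k" "z \<noteq> src i" "z \<noteq> snk i" for i z
  proof (cases "z < n")
    case True
    with f that show ?thesis by (simp add: excess_out_flow flow_ok_def)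
  next
    case False
    then show ?thesis using excess_outside V_eq by simp
  qed
  moreover have "(\<Sum>i<k. out_flow (af s) i e) \<le> u e" if "e \<in> E" for e
    using that
  proof (rule arcE)
    fix j assume "j < m" "e = es ! j"
    then show ?thesis
      using usage_le_cap[OF inv] by (simp add: out_flow_nth usage_def cap_def)
  qed
  moreover have "0 \<le> out_flow (af s) i e" if "i < k" "e \<in> E" for i e
    using that(2) by (rule arcE) (use f that(1) in \<open>auto simp: out_flow_nth flow_ok_def\<close>)
  ultimately show "feasible_mcf I (out_flow (af s))"
    by (simp add: feasible_mcf_iff)
  show "excess E (out_flow (af s) i) (src i) = routed s i / T'" if "i < k"
    using f that src_less[OF that] src_snk[OF that] by (auto simp: excess_out_flow flow_ok_def)
  show "shipped (ap s) * d i \<le> routed s i" if "i < k"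
    using in_round_nonneg[OF inv that] by (simp add: routed_def)
qed

lemma shipped_nonneg: "0 \<le> shipped p"
  unfolding shipped_def using sig_pos by (intro sum_nonneg) (auto intro: less_imp_le)

lemma shipped_values:
  assumes "main_inv s" "i < k"
  shows "shipped (ap s) / T' * d i \<le> excess E (out_flow (af s) i) (src i)"
proof -
  have "shipped (ap s) * d i / T' \<le> routed s i / T'"
    using feasible_out_flow(3)[OF assms] T'_ge by (intro divide_right_mono) auto
  then show ?thesis using feasible_out_flow(2)[OF assms] by simp
qed

lemma shipped_le:
  assumes "main_inv s"
  shows "shipped (ap s) / T' \<le> max_throughput I"
  using shipped_values[OF assms] shipped_nonneg T'_ge
  by (intro le_max_throughput[OF feasible_out_flow(1)[OF assms]]) auto

text \<open>\<open>sig p\<close> is the average of \<open>shipped p / T'\<close> and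
  \<open>1 / (k * D)\<close>. The former is at most the optimum because the scaled flow shipped so
  far is feasible, the latter by \<open>max_throughput_lower\<close>.\<close>

lemma sig_le:
  assumes "main_inv s" "0 < max_throughput I"
  shows "sig (ap s) \<le> max_throughput I"
proof -
  let ?X = "(1 + 1 / (2 * T')) ^ ap s"
  have kD: "real k * D > 0" using k_pos D_pos by simp
  define y where "y = ?X / (real k * D)"
  have "shipped (ap s) / T' = y - 1 / (real k * D)"
    using T'_ge by (simp add: shipped_eq diff_divide_distrib y_def)
  moreover have "sig (ap s) = y / 2" by (simp add: sig_def y_def)
  moreover have "1 / (real k * D) \<le> max_throughput I"
    using max_throughput_lower[OF assms(2)] d_le_D by blast
  ultimately show ?thesis
    using shipped_le[OF assms(1)] by linarith
qed

end

text \<open>Favourable centres: each path of a fixed decomposition of an optimal flow, given by arc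
  indices, passes a centre whose rounding is fine enough for its length. Optimum 0 is excluded here
  and treated in \<open>solver_prob\<close>.\<close>

locale mcf_good = mcf_run +
  fixes ps :: "nat \<Rightarrow> (real \<times> nat list) list"
  assumes lambda_pos: "0 < max_throughput I"
    and ps_path: "i < num_com I \<Longrightarrow> (a, P) \<in> set (ps i) \<Longrightarrow> a \<ge> 0 \<and> distinct P \<and>
        set P \<subseteq> {..<num_arcs I} \<and> pcas (source I i) (map ((!) es) P) (sink I i)"
    and ps_sum: "i < num_com I \<Longrightarrow> sum_list (map fst (ps i)) = max_throughput I * demand I i"
    and ps_cap: "j < num_arcs I \<Longrightarrow>
        (\<Sum>i<num_com I. \<Sum>(a, P)\<leftarrow>ps i. if j \<in> set P then a else 0) \<le> capacity I (es ! j)"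
    and ps_hit: "i < num_com I \<Longrightarrow> (a, P) \<in> set (ps i) \<Longrightarrow> \<exists>c<N. Suc c * length P \<le> N \<and>
        cent c \<in> set (pawalk_verts (source I i) (map ((!) es) P))"
begin

abbreviation "lam \<equiv> max_throughput I"
definition "plen w P = (\<Sum>j\<leftarrow>P. w j)" for w :: "nat \<Rightarrow> real" and P :: "nat list"
text \<open>The minimum runs over the decomposition paths, not over all paths: for these a centre is
  guaranteed, and weak duality holds for them just as well.\<close>

definition "pdist w i = Min ((\<lambda>(a, P). plen w P) ` set (ps i))"
definition "Phi w = (\<Sum>j<m. cap j * w j)"

text \<open>
  A search threshold exceeds the distance by at most the factor \<open>(1 + \<kappa>) * exp \<kappa>\<close>; of the
  other factors \<open>1 + \<kappa>\<close> in \<open>ra\<close>, one comes from the rounding of weights and one from arcs that the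
  path uses twice. One round multiplies \<open>Phi\<close> by at most
  \<open>1 / (1 - ra * sig p / lam) \<le> exp (rb * sig p / lam)\<close>, whence the bound \<open>Gam p\<close>.
\<close>

definition "ra = \<kappa> * (1 + \<kappa>) ^ 3 * exp \<kappa>"
definition "rb = ra / (1 - ra)"
definition "Gam p = real m * \<delta> * exp (rb * shipped p / lam)"
definition "good s \<longleftrightarrow> Phi (aw s) \<le> Gam (ap s) + ra * (\<Sum>i<k. in_round s i * pdist (aw s) i) \<and>
  (\<forall>i<k. ath s i \<le> (1 + \<kappa>) * exp \<kappa> * pdist (aw s) i)"

lemma ps_nonempty: "i < k \<Longrightarrow> ps i \<noteq> []"
  using ps_sum[of i] lambda_pos d_pos[of i] by auto

lemma pdist_le: "i < k \<Longrightarrow> (a, P) \<in> set (ps i) \<Longrightarrow> pdist w i \<le> plen w P"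
  unfolding pdist_def by (intro Min_le) force+

lemma pdist_attained:
  assumes "i < k"
  obtains a P where "(a, P) \<in> set (ps i)" "pdist w i = plen w P"
proof -
  have "pdist w i \<in> (\<lambda>(a, P). plen w P) ` set (ps i)"
    unfolding pdist_def using ps_nonempty[OF assms] by (intro Min_in) auto
  with that show thesis by auto
qed

lemma plen_mono: "set P \<subseteq> {..<m} \<Longrightarrow> (\<And>j. j < m \<Longrightarrow> w j \<le> w' j) \<Longrightarrow> plen w P \<le> plen w' P"
  unfolding plen_def by (induction P) (auto intro: add_mono)

lemma pdist_mono:
  assumes "i < k" "\<And>j. j < m \<Longrightarrow> w j \<le> w' j"
  shows "pdist w i \<le> pdist w' i"
proof -
  obtain a P where P: "(a, P) \<in> set (ps i)" "pdist w' i = plen w' P" using pdist_attained[OF assms(1)] .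
  have "pdist w i \<le> plen w P" using pdist_le[OF assms(1) P(1)] .
  also have "\<dots> \<le> plen w' P" using ps_path[OF assms(1) P(1)] assms(2) by (intro plen_mono) auto
  finally show ?thesis using P(2) by simp
qed

lemma plen_eq_sum: "distinct P \<Longrightarrow> set P \<subseteq> {..<m} \<Longrightarrow> plen w P = (\<Sum>j<m. if j \<in> set P then w j else 0)"
  unfolding plen_def
  by (simp add: sum_list_distinct_conv_sum_set sum.If_cases inf_absorb2)

text \<open>Weak duality between flows and weights.\<close>

lemma pdist_le_Phi:
  assumes "\<And>j. j < m \<Longrightarrow> 0 \<le> w j"
  shows "lam * (\<Sum>i<k. d i * pdist w i) \<le> Phi w"
proof -
  have "lam * (\<Sum>i<k. d i * pdist w i) = (\<Sum>i<k. sum_list (map fst (ps i)) * pdist w i)"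
    by (simp add: sum_distrib_left ps_sum mult.assoc)
  also have "\<dots> = (\<Sum>i<k. \<Sum>(a, P)\<leftarrow>ps i. a * pdist w i)"
    by (simp add: sum_list_mult_const[symmetric] case_prod_unfold)
  also have "\<dots> \<le> (\<Sum>i<k. \<Sum>(a, P)\<leftarrow>ps i. a * plen w P)"
  proof (intro sum_mono sum_list_mono)
    fix i x assume x: "i \<in> {..<k}" "x \<in> set (ps i)"
    obtain a P where "x = (a, P)" by (cases x)
    with x show "(case x of (a, P) \<Rightarrow> a * pdist w i) \<le> (case x of (a, P) \<Rightarrow> a * plen w P)"
      using ps_path[of i a P] pdist_le[of i a P w] by (auto intro: mult_left_mono)
  qed
  also have "\<dots> = (\<Sum>i<k. \<Sum>(a, P)\<leftarrow>ps i. \<Sum>j<m. w j * (if j \<in> set P then a else 0))"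
  proof (intro sum.cong refl arg_cong[of _ _ sum_list] map_cong)
    fix i x assume x: "i \<in> {..<k}" "x \<in> set (ps i)"
    obtain a P where aP: "x = (a, P)" by (cases x)
    then have "distinct P" "set P \<subseteq> {..<m}" using ps_path[of i a P] x by auto
    then have "a * plen w P = (\<Sum>j<m. a * (if j \<in> set P then w j else 0))"
      by (simp add: plen_eq_sum sum_distrib_left)
    also have "\<dots> = (\<Sum>j<m. w j * (if j \<in> set P then a else 0))"
      by (intro sum.cong) auto
    finally show "(case x of (a, P) \<Rightarrow> a * plen w P) =
        (case x of (a, P) \<Rightarrow> \<Sum>j<m. w j * (if j \<in> set P then a else 0))"
      by (simp add: aP)
  qed
  also have "\<dots> = (\<Sum>j<m. w j * (\<Sum>i<k. \<Sum>(a, P)\<leftarrow>ps i. if j \<in> set P then a else 0))"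
  proof -
    have "(\<Sum>(a, P)\<leftarrow>xs. \<Sum>j<m. w j * (if j \<in> set P then a else 0)) =
        (\<Sum>j<m. w j * (\<Sum>(a, P)\<leftarrow>xs. if j \<in> set P then a else 0))" for xs :: "(real \<times> nat list) list"
      by (induction xs) (auto simp: sum.distrib distrib_left)
    then show ?thesis
      by (simp add: sum_distrib_left) (rule sum.swap)
  qed
  also have "\<dots> \<le> Phi w"
    unfolding Phi_def using ps_cap assms
    by (intro sum_mono) (auto simp: cap_def mult.commute[of "u _"] intro: mult_left_mono)
  finally show ?thesis .
qed

text \<open>Here the error \<open>(c + 1) / (K * N)\<close> per arc meets the restriction on path
  lengths: over a whole path it compounds to at most \<open>exp \<kappa>\<close>.\<close>

lemma q_power_le:
  assumes "Suc c * l \<le> N"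
  shows "q c ^ l \<le> exp \<kappa>"
proof -
  have "q c \<le> exp (real (Suc c) / (real K * real N))"
    unfolding q_def by (rule exp_ge_add_one_self)
  then have "q c ^ l \<le> exp (real (Suc c) / (real K * real N)) ^ l"
    using q_gt_1[of c] by (intro power_mono) auto
  also have "\<dots> = exp (real (Suc c * l) / (real K * real N))"
    by (simp add: exp_of_nat_mult[symmetric] algebra_simps)
  also have "\<dots> \<le> exp \<kappa>"
  proof -
    have "real (Suc c * l) / (real K * real N) \<le> real N / (real K * real N)"
      using assms K_pos N_pos by (intro divide_right_mono) (auto simp only: of_nat_le_iff, simp)
    also have "\<dots> = \<kappa>" using N_pos by (simp add: \<kappa>_def)
    finally show ?thesis by simp
  qed
  finally show ?thesis .
qed

text \<open>The shortest decomposition path is cut at its centre. The labels of that centre bound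
  both parts up to the factor \<open>exp \<kappa>\<close>, so a threshold rejected at every centre
  is below \<open>exp \<kappa>\<close> times the length of this path.\<close>

lemma labels_le_pdist:
  assumes inv: "main_inv s" and i: "i < k"
    and above: "\<And>c. c < N \<Longrightarrow> t < alab s (cell c (src i)) + alab s (cell c (n + snk i))"
  shows "t \<le> exp \<kappa> * pdist (aw s) i"
proof -
  obtain a P where aP: "(a, P) \<in> set (ps i)" "pdist (aw s) i = plen (aw s) P"
    using pdist_attained[OF i] .
  have P: "set P \<subseteq> {..<m}" "pcas (src i) (map ((!) es) P) (snk i)" using ps_path[OF i aP(1)] by auto
  obtain c where c: "c < N" "Suc c * length P \<le> N"
    "cent c \<in> set (pawalk_verts (src i) (map ((!) es) P))" using ps_hit[OF i aP(1)] by blast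
  obtain Q1 Q2 where Q: "map ((!) es) P = Q1 @ Q2" "pcas (src i) Q1 (cent c)" "pcas (cent c) Q2 (snk i)"
    using pawalk_verts_split[OF P(2) c(3)] .
  then obtain P1 P2 where P12: "P = P1 @ P2" "Q1 = map ((!) es) P1" "Q2 = map ((!) es) P2"
    by (auto simp: map_eq_append_conv)
  have l: "lab_inv (alab s) (acur s) (awr s)" and w: "weights_ok (aw s) (awr s)"
    using inv by (auto simp: main_inv_def labels_ok_def)
  have q1: "1 \<le> q c" using q_gt_1[of c] by simp
  have pos: "0 \<le> awr s j" if "j < m" for j using lab_invD(1)[OF l that] d0_pos by simp
  have plen_pos: "0 \<le> plen (awr s) R" if "set R \<subseteq> {..<m}" for R
    using that pos unfolding plen_def by (induction R) auto
  have part: "q c ^ length R * plen (awr s) R \<le> exp \<kappa> * plen (awr s) R"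
    if "length R \<le> length P" "set R \<subseteq> {..<m}" for R
  proof -
    have "Suc c * length R \<le> N" using that(1) c(2) by (meson mult_le_mono2 order_trans)
    then show ?thesis using q_power_le plen_pos[OF that(2)] by (intro mult_right_mono) auto
  qed
  have "t < alab s (cell c (src i)) + alab s (cell c (n + snk i))" using above c(1) .
  also have "\<dots> \<le> q c ^ length P1 * plen (awr s) P1 + q c ^ length P2 * plen (awr s) P2"
    unfolding plen_def using Q P P12
    by (intro add_mono lab_path[OF l c(1)]) auto
  also have "\<dots> \<le> exp \<kappa> * plen (awr s) P1 + exp \<kappa> * plen (awr s) P2"
    using P P12 by (intro add_mono part) auto
  also have "\<dots> = exp \<kappa> * plen (awr s) P" by (simp add: P12 plen_def distrib_left)
  also have "\<dots> \<le> exp \<kappa> * plen (aw s) P"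
    using w P(1) by (intro mult_left_mono plen_mono) (auto simp: weights_ok_def)
  finally show ?thesis using aP(2) by simp
qed

lemma aw_pos:
  assumes "main_inv s" "j < m"
  shows "0 < aw s j"
proof -
  have "d0 \<le> awr s j" "awr s j \<le> aw s j"
    using assms lab_invD(1) by (auto simp: main_inv_def labels_ok_def weights_ok_def)
  then show ?thesis using d0_pos by simp
qed

lemma ra_pos: "0 < ra"
  using kappa_pos by (simp add: ra_def)

text \<open>Weak duality bounds the second term of \<open>good\<close> by \<open>x * Phi\<close>
  with \<open>x = ra * sig p / lam\<close>, and the inequality is solved for \<open>Phi\<close>.
  This uses \<open>x \<le> ra < 1\<close>, that is, a round that ships at most the optimum.\<close>

lemma Phi_bound:
  assumes inv: "main_inv s" and g: "good s" and ra: "ra < 1"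
  shows "Phi (aw s) \<le> Gam (Suc (ap s))"
proof -
  define x where "x = ra * sig (ap s) / lam"
  have wpos: "0 \<le> aw s j" if "j < m" for j using aw_pos[OF inv that] by simp
  have pdist_pos: "0 \<le> pdist (aw s) i" if i: "i < k" for i
  proof -
    obtain a P where "(a, P) \<in> set (ps i)" "pdist (aw s) i = plen (aw s) P" using pdist_attained[OF i] .
    moreover have "0 \<le> plen (aw s) P" if "set P \<subseteq> {..<m}"
      using that wpos unfolding plen_def by (induction P) auto
    ultimately show ?thesis using ps_path[OF i] by auto
  qed
  have s: "0 < sig (ap s)" "sig (ap s) \<le> lam" using sig_pos sig_le[OF inv lambda_pos] by auto
  have x: "0 < x" "x \<le> ra"
    using ra_pos s lambda_pos by (auto simp: x_def divide_le_eq)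
  have Phi0: "0 \<le> Phi (aw s)"
    unfolding Phi_def using wpos cap_ge_1 by (intro sum_nonneg mult_nonneg_nonneg) (auto intro: order_trans[of 0 1])
  have "(\<Sum>i<k. in_round s i * pdist (aw s) i) \<le> (\<Sum>i<k. sig (ap s) * d i * pdist (aw s) i)"
  proof (rule sum_mono)
    fix i assume "i \<in> {..<k}"
    then have i: "i < k" by simp
    have "in_round s i \<le> sig (ap s) * d i"
      using inv s d_pos[OF i] by (auto simp: in_round_def main_inv_def)
    then show "in_round s i * pdist (aw s) i \<le> sig (ap s) * d i * pdist (aw s) i"
      using pdist_pos[OF i] by (intro mult_right_mono) auto
  qed
  also have "\<dots> = sig (ap s) / lam * (lam * (\<Sum>i<k. d i * pdist (aw s) i))"
    using lambda_pos by (simp add: sum_distrib_left mult.assoc)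
  also have "\<dots> \<le> sig (ap s) / lam * Phi (aw s)"
    using pdist_le_Phi[of "aw s"] wpos s lambda_pos by (intro mult_left_mono) auto
  finally have "ra * (\<Sum>i<k. in_round s i * pdist (aw s) i) \<le> ra * (sig (ap s) / lam * Phi (aw s))"
    using ra_pos by (intro mult_left_mono) auto
  then have "Phi (aw s) \<le> Gam (ap s) + x * Phi (aw s)"
    using g by (simp add: good_def x_def)
  then have "Phi (aw s) * (1 - x) \<le> Gam (ap s)" by (simp add: algebra_simps)
  then have "Phi (aw s) \<le> Gam (ap s) * (1 / (1 - x))"
    using x ra by (simp add: pos_le_divide_eq)
  also have "1 / (1 - x) \<le> exp (rb * sig (ap s) / lam)"
  proof -
    have "1 / (1 - x) = 1 + x / (1 - x)" using x ra by (simp add: field_simps)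
    also have "x / (1 - x) \<le> x / (1 - ra)" using x ra by (intro divide_left_mono mult_pos_pos) auto
    also have "1 + x / (1 - ra) \<le> exp (x / (1 - ra))" by (rule exp_ge_add_one_self)
    also have "x / (1 - ra) = rb * sig (ap s) / lam" by (simp add: x_def rb_def)
    finally show ?thesis by simp
  qed
  then have "Gam (ap s) * (1 / (1 - x)) \<le> Gam (ap s) * exp (rb * sig (ap s) / lam)"
    using delta_pos by (intro mult_left_mono) (auto simp: Gam_def)
  also have "\<dots> = Gam (Suc (ap s))"
    by (simp add: Gam_def shipped_def exp_add[symmetric] distrib_left add_divide_distrib)
  finally show ?thesis .
qed

end

section \<open>Numerical estimates for the choice of parameters\<close>

lemma growth_rate_bounds:
  fixes \<kappa> :: real
  assumes "0 < \<kappa>" "\<kappa> \<le> 1 / 100"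
  defines "r \<equiv> \<kappa> * (1 + \<kappa>) ^ 3 * exp \<kappa>"
  shows "r \<le> \<kappa> * (1 + 7 * \<kappa>)" "r < 1" "(1 - 8 * \<kappa>) / \<kappa> \<le> 1 / (r / (1 - r))"
    "(1 + \<kappa>) ^ 3 * exp \<kappa> < 2"
proof -
  have e: "exp \<kappa> \<le> 1 + 2 * \<kappa>"
  proof -
    have "exp \<kappa> \<le> 1 + \<kappa> + \<kappa>\<^sup>2" using assms by (intro exp_bound) auto
    also have "\<kappa>\<^sup>2 \<le> \<kappa> * 1" unfolding power2_eq_square using assms by (intro mult_left_mono) auto
    finally show ?thesis by simp
  qed
  have k2: "\<kappa> * \<kappa> \<le> \<kappa> / 100" using assms mult_left_mono[of \<kappa> "1 / 100" \<kappa>] by simp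
  have k3: "\<kappa> * \<kappa> * \<kappa> \<le> \<kappa> / 100"
  proof -
    have "\<kappa> * \<kappa> * \<kappa> \<le> \<kappa> * \<kappa> * 1" using assms by (intro mult_left_mono) auto
    with k2 show ?thesis by simp
  qed
  have p: "(1 + \<kappa>) ^ 3 \<le> 1 + 4 * \<kappa>"
  proof -
    have "(1 + \<kappa>) ^ 3 = 1 + 3 * \<kappa> + 3 * (\<kappa> * \<kappa>) + \<kappa> * \<kappa> * \<kappa>"
      by (simp add: power3_eq_cube algebra_simps)
    with k2 k3 assms(1) show ?thesis by linarith
  qed
  have c: "(1 + \<kappa>) ^ 3 * exp \<kappa> \<le> 1 + 7 * \<kappa>"
  proof -
    have "(1 + \<kappa>) ^ 3 * exp \<kappa> \<le> (1 + 4 * \<kappa>) * (1 + 2 * \<kappa>)"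
      using e p assms by (intro mult_mono) auto
    also have "\<dots> = 1 + 6 * \<kappa> + 8 * (\<kappa> * \<kappa>)" by (simp add: algebra_simps)
    also have "\<dots> \<le> 1 + 7 * \<kappa>" using k2 assms(1) by linarith
    finally show ?thesis .
  qed
  then show "(1 + \<kappa>) ^ 3 * exp \<kappa> < 2" using assms by simp
  show r: "r \<le> \<kappa> * (1 + 7 * \<kappa>)"
    using c assms(1) mult_left_mono[OF c, of \<kappa>] by (simp add: r_def mult.assoc)
  have "\<kappa> * (1 + 7 * \<kappa>) \<le> 1 / 100 * (1 + 7)" using assms by (intro mult_mono) auto
  with r show r1: "r < 1" by simp
  have r0: "0 < r" using assms by (simp add: r_def)
  have "(1 - 7 * \<kappa>) * (\<kappa> * (1 + 7 * \<kappa>)) \<le> \<kappa>"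
    using assms by (simp add: algebra_simps)
  moreover have "(1 - 7 * \<kappa>) * r \<le> (1 - 7 * \<kappa>) * (\<kappa> * (1 + 7 * \<kappa>))"
    using r assms by (intro mult_left_mono) auto
  ultimately have "(1 - 7 * \<kappa>) * r \<le> \<kappa>" by linarith
  then have "(1 - 7 * \<kappa>) / \<kappa> \<le> 1 / r" using r0 assms by (simp add: field_simps)
  moreover have "1 / (r / (1 - r)) = 1 / r - 1" using r0 by (simp add: field_simps)
  moreover have "(1 - 8 * \<kappa>) / \<kappa> = (1 - 7 * \<kappa>) / \<kappa> - 1" using assms by (simp add: field_simps)
  ultimately show "(1 - 8 * \<kappa>) / \<kappa> \<le> 1 / (r / (1 - r))" by simp
qed

text \<open>\<open>t\<close> stands for \<open>T\<close>, \<open>lm\<close> for \<open>ln m\<close>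
  and \<open>b\<close> for \<open>1 / rb\<close>. The logarithm, \<open>lm\<close> and
  \<open>b\<close> together lose a relative \<open>11 * \<kappa> \<le> 0.55 * \<epsilon>\<close>;
  the additive terms are small against \<open>\<epsilon> * t \<ge> 400\<close>, so the allowance
  \<open>4 * \<epsilon>\<close> is ample.\<close>

lemma rounds_suffice:
  fixes \<epsilon> \<kappa> b t lm :: real
  assumes eps: "0 < \<epsilon>" "\<epsilon> < 0.15" and k: "0 < \<kappa>" "\<kappa> \<le> \<epsilon> / 20" and t: "1 / \<kappa>\<^sup>2 \<le> t"
    and lm: "lm \<le> 2 * t * \<kappa>\<^sup>2" and b: "(1 - 8 * \<kappa>) / \<kappa> \<le> b"
  shows "(1 - 4 * \<epsilon>) * (t + 2) \<le> (t * ln (1 + \<kappa>) - lm) * b - 1"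
proof -
  have k1: "\<kappa> < 1 / 100" using eps k by simp
  have t0: "0 < t" using t k by (smt (verit) zero_less_divide_1_iff zero_less_power)
  have "\<kappa> - \<kappa>\<^sup>2 \<le> ln (1 + \<kappa>)" using k k1 by (intro ln_one_plus_pos_lower_bound) auto
  then have "t * (\<kappa> - \<kappa>\<^sup>2) \<le> t * ln (1 + \<kappa>)" using t0 by (intro mult_left_mono) auto
  with lm have l: "t * \<kappa> * (1 - 3 * \<kappa>) \<le> t * ln (1 + \<kappa>) - lm"
    by (simp add: algebra_simps power2_eq_square)
  have "t * \<kappa> * (1 - 3 * \<kappa>) * ((1 - 8 * \<kappa>) / \<kappa>) \<le> (t * ln (1 + \<kappa>) - lm) * b"
  proof (rule mult_mono[OF l b])
    have "0 \<le> t * \<kappa> * (1 - 3 * \<kappa>)" using t0 k k1 by simp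
    then show "0 \<le> t * ln (1 + \<kappa>) - lm" using l by linarith
    show "0 \<le> (1 - 8 * \<kappa>) / \<kappa>" using k k1 by simp
  qed
  moreover have "t * \<kappa> * (1 - 3 * \<kappa>) * ((1 - 8 * \<kappa>) / \<kappa>) = t * ((1 - 3 * \<kappa>) * (1 - 8 * \<kappa>))"
    using k by simp
  moreover have "t * (1 - 11 * \<kappa>) \<le> t * ((1 - 3 * \<kappa>) * (1 - 8 * \<kappa>))"
    using t0 k by (intro mult_left_mono) (auto simp: algebra_simps)
  ultimately have 1: "t * (1 - 11 * \<kappa>) \<le> (t * ln (1 + \<kappa>) - lm) * b" by linarith
  have "\<kappa>\<^sup>2 \<le> (\<epsilon> / 20)\<^sup>2" using k by (intro power_mono) auto
  then have "1 / (\<epsilon> / 20)\<^sup>2 \<le> 1 / \<kappa>\<^sup>2" using k eps by (intro divide_left_mono) auto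
  then have "400 / \<epsilon>\<^sup>2 \<le> t" using t by (simp add: power_divide)
  then have "\<epsilon> * (400 / \<epsilon>\<^sup>2) \<le> \<epsilon> * t" using eps by (intro mult_left_mono) auto
  then have "400 / \<epsilon> \<le> \<epsilon> * t" using eps by (simp add: power2_eq_square)
  moreover have "400 \<le> 400 / \<epsilon>" using eps by (simp add: pos_le_divide_eq)
  ultimately have "400 \<le> \<epsilon> * t" by linarith
  moreover have "t * (11 * \<kappa>) \<le> t * (11 * (\<epsilon> / 20))" using t0 k by (intro mult_left_mono) auto
  ultimately have "(1 - 4 * \<epsilon>) * (t + 2) \<le> t * (1 - 11 * \<kappa>) - 1"
    using eps by (simp add: algebra_simps)
  with 1 show ?thesis by linarith
qed

context mcf_run
begin

lemma m_le: "real m \<le> real n ^ 2"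
proof -
  have "E \<subseteq> V \<times> V" using arcsV by (auto simp: mem_Times_iff)
  then have "card E \<le> card (V \<times> V)" using finV by (intro card_mono) auto
  then have "m \<le> n * n" using V_eq by (simp add: num_arcs_def card_cartesian_product)
  then show ?thesis by (simp add: power2_eq_square flip: of_nat_mult)
qed

lemma ln_n_le: "ln (real n) \<le> real B * ln 2" "ln (real n) \<le> real B"
proof -
  have "real n \<le> 2 ^ B" using bits(1) by (metis of_nat_le_iff of_nat_numeral of_nat_power)
  then have "ln (real n) \<le> ln (2 ^ B)" using n_ge_2 by (intro ln_mono) auto
  then show *: "ln (real n) \<le> real B * ln 2" by (simp add: ln_realpow)
  have "real B * ln 2 \<le> real B * 1" using ln_2_less_1 by (intro mult_left_mono) auto
  with * show "ln (real n) \<le> real B" by simp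
qed

lemma ln_m_le: "ln (real m) \<le> 2 * real B"
proof -
  have "ln (real m) \<le> ln (real n ^ 2)" using m_le m_pos by (intro ln_mono) auto
  also have "\<dots> = 2 * ln (real n)" using n_ge_2 by (simp add: ln_realpow)
  finally show ?thesis using ln_n_le(2) by simp
qed

end

context mcf_good
begin

text \<open>A threshold is raised only after all centres have rejected it, which keeps it near
  \<open>pdist\<close>. An augmentation ships \<open>\<gamma>\<close> along a walk of rounded weight
  at most the threshold and so raises \<open>Phi\<close> by at most
  \<open>ra * \<gamma> * pdist\<close>. At the end of a round \<open>Phi_bound\<close> trades the
  accumulated terms for the next \<open>Gam\<close>.\<close>

lemma good_step:
  assumes g: "good s" and inv: "main_inv s" and inv': "main_inv s'" and dn: "adn s = 0" and ra: "ra < 1"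
    and tr: "next_com s s' \<or> raise_threshold s s' \<or> next_center s s' \<or> (\<exists>fs l \<gamma>. augments fs l \<gamma> s s')"
  shows "good s'"
  using tr
proof (elim disjE exE)
  assume nc: "next_com s s'"
  have eq: "aw s' = aw s" "ath s' = ath s" and rem: "arem s = 0" and i: "ai s < k"
    using nc inv by (auto simp: next_com_def Let_def main_inv_def)
  show ?thesis
  proof (cases "Suc (ai s) = k")
    case True
    then have "ap s' = Suc (ap s)" "ai s' = 0" "arem s' = sig (ap s') * d 0"
      using nc by (auto simp: next_com_def Let_def)
    then have "in_round s' i = 0" for i by (simp add: in_round_def)
    then show ?thesis
      using g Phi_bound[OF inv g ra] \<open>ap s' = Suc (ap s)\<close> by (simp add: good_def eq)
  next
    case False
    then have ap: "ap s' = ap s" using nc by (auto simp: next_com_def Let_def)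
    then have "in_round s' i = in_round s i" if "i < k" for i
      using routed_next_com[OF nc rem i that] by (simp add: routed_def)
    then show ?thesis using g ap by (simp add: good_def eq)
  qed
next
  assume r: "raise_threshold s s'"
  define t where "t = ath s (ai s) * (1 + \<kappa>)"
  have s': "s' = s\<lparr>ath := (ath s)(ai s := t), ac := 0, adn := if \<Theta> < t then 1 else 0\<rparr>" and ac: "ac s = N"
    using r by (auto simp: raise_threshold_def t_def Let_def)
  have i: "ai s < k" using inv by (simp add: main_inv_def)
  have "ath s (ai s) \<le> exp \<kappa> * pdist (aw s) (ai s)"
    using inv ac by (intro labels_le_pdist[OF inv i]) (simp add: main_inv_def)
  then have "t \<le> (1 + \<kappa>) * exp \<kappa> * pdist (aw s) (ai s)"
    using kappa_pos mult_right_mono[of "ath s (ai s)" "exp \<kappa> * pdist (aw s) (ai s)" "1 + \<kappa>"]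
    by (simp add: t_def mult_ac)
  moreover have "in_round s' i = in_round s i" for i
    unfolding s' in_round_def by simp
  moreover have "aw s' = aw s" "ap s' = ap s" "ath s' = (ath s)(ai s := t)" unfolding s' by simp_all
  ultimately show ?thesis
    using g by (simp add: good_def)
next
  assume "next_center s s'"
  then have s': "s' = s\<lparr>ac := Suc (ac s)\<rparr>" by (simp add: next_center_def)
  have "in_round s' i = in_round s i" for i
    unfolding s' in_round_def by simp
  moreover have "aw s' = aw s" "ap s' = ap s" "ath s' = ath s" unfolding s' by simp_all
  ultimately show ?thesis using g by (simp add: good_def)
next
  fix fs l \<gamma> assume a: "augments fs l \<gamma> s s'"
  let ?h = "hits fs l"
  have i: "ai s < k" and w: "weights_ok (aw s) (awr s)" using inv by (auto simp: main_inv_def)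
  have eq: "ath s' = ath s" "ai s' = ai s" "ap s' = ap s" "arem s' = arem s - \<gamma>" and \<gamma>: "0 \<le> \<gamma>"
    and two: "\<And>j. ?h j \<le> 2" and fs: "\<And>p. p < l \<Longrightarrow> fs p < m" "\<And>p. p < l \<Longrightarrow> \<gamma> \<le> cap (fs p)"
    and aug: "augmented (ai s) \<gamma> ?h (aw s) (af s) (aw s') (af s')"
    and len: "(\<Sum>p<l. awr s (fs p)) \<le> ath s (ai s)"
    using a unfolding augments_def by auto
  have wpos: "0 < aw s j" if "j < m" for j using aw_pos[OF inv that] .
  have gain: "cap j * aw s' j - cap j * aw s j \<le> \<gamma> * \<kappa> * (1 + \<kappa>) * (real (?h j) * aw s j)"
    and mono: "aw s j \<le> aw s' j" if j: "j < m" for j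
  proof -
    define y where "y = \<gamma> * \<kappa> / cap j"
    have c: "cap j \<ge> 1" using cap_ge_1[OF j] .
    have y0: "0 \<le> y" using \<gamma> kappa_pos c by (simp add: y_def)
    \<comment> \<open>A double hit produces a quadratic term \<open>y * y\<close>; since
      \<open>y \<le> \<kappa>\<close> in that case, the extra factor \<open>1 + \<kappa>\<close>
      absorbs it.\<close>
    have "(1 + y) ^ ?h j - 1 \<le> real (?h j) * (y * (1 + \<kappa>))"
    proof -
      consider "?h j = 0" | "?h j = 1" | "?h j = 2" using two[of j] by linarith
      then show ?thesis
      proof cases
        case 3
        then have "{p. p < l \<and> fs p = j} \<noteq> {}" unfolding hits_def by (metis card.empty zero_neq_numeral)
        then obtain p where "p < l" "fs p = j" by blast
        then have "y \<le> \<kappa>" using fs(2)[of p] c kappa_pos by (simp add: y_def divide_le_eq mult.commute)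
        then have "y * y \<le> y * \<kappa>" using y0 by (intro mult_left_mono)
        moreover have "(1 + y) ^ ?h j - 1 = 2 * y + y * y" "real (?h j) * (y * (1 + \<kappa>)) = 2 * y + 2 * (y * \<kappa>)"
          unfolding 3 by (simp_all add: power2_eq_square algebra_simps)
        moreover have "0 \<le> y * \<kappa>" using y0 kappa_pos by simp
        ultimately show ?thesis by linarith
      qed (use y0 kappa_pos in \<open>auto simp: algebra_simps\<close>)
    qed
    then have "cap j * aw s j * ((1 + y) ^ ?h j - 1) \<le> cap j * aw s j * (real (?h j) * (y * (1 + \<kappa>)))"
      using c wpos[OF j] by (intro mult_left_mono) auto
    also have "\<dots> = \<gamma> * \<kappa> * (1 + \<kappa>) * (real (?h j) * aw s j)"
      using c by (simp add: y_def)
    finally show "cap j * aw s' j - cap j * aw s j \<le> \<gamma> * \<kappa> * (1 + \<kappa>) * (real (?h j) * aw s j)"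
      using aug j by (simp add: augmented_def y_def algebra_simps)
    have "1 \<le> (1 + y) ^ ?h j" using y0 by (simp add: one_le_power)
    then have "aw s j * 1 \<le> aw s j * (1 + y) ^ ?h j" using wpos[OF j] by (intro mult_left_mono) auto
    then show "aw s j \<le> aw s' j" using aug j by (simp add: augmented_def y_def)
  qed
  have pd: "pdist (aw s) i \<le> pdist (aw s') i" if "i < k" for i
    using mono by (intro pdist_mono that)
  have "Phi (aw s') - Phi (aw s) \<le> (\<Sum>j<m. \<gamma> * \<kappa> * (1 + \<kappa>) * (real (?h j) * aw s j))"
    unfolding Phi_def sum_subtractf[symmetric] using gain by (intro sum_mono) auto
  also have "\<dots> = \<gamma> * \<kappa> * (1 + \<kappa>) * (\<Sum>p<l. aw s (fs p))"
    using sum_hits[of l fs "aw s"] fs(1) by (simp add: sum_distrib_left)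
  also have "(\<Sum>p<l. aw s (fs p)) \<le> (\<Sum>p<l. awr s (fs p) * (1 + \<kappa>))"
    using w fs(1) by (intro sum_mono) (auto simp: weights_ok_def less_imp_le)
  also have "\<dots> \<le> ath s (ai s) * (1 + \<kappa>)"
    unfolding sum_distrib_right[symmetric] using len kappa_pos by (intro mult_right_mono) auto
  also have "\<dots> \<le> (1 + \<kappa>) * exp \<kappa> * pdist (aw s) (ai s) * (1 + \<kappa>)"
    using g i kappa_pos by (intro mult_right_mono) (auto simp: good_def)
  also have "\<dots> \<le> (1 + \<kappa>) * exp \<kappa> * pdist (aw s') (ai s) * (1 + \<kappa>)"
    using pd[OF i] kappa_pos by (intro mult_right_mono mult_left_mono) auto
  finally have "Phi (aw s') - Phi (aw s) \<le>
      \<gamma> * \<kappa> * (1 + \<kappa>) * ((1 + \<kappa>) * exp \<kappa> * pdist (aw s') (ai s) * (1 + \<kappa>))"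
    using \<gamma> kappa_pos by (simp add: mult_left_mono)
  also have "\<dots> = ra * (\<gamma> * pdist (aw s') (ai s))"
    by (simp add: ra_def power3_eq_cube)
  finally have "Phi (aw s') \<le> Phi (aw s) + ra * (\<gamma> * pdist (aw s') (ai s))" by simp
  also have "Phi (aw s) \<le> Gam (ap s) + ra * (\<Sum>i<k. in_round s i * pdist (aw s) i)"
    using g by (simp add: good_def)
  \<comment> \<open>Earlier contributions are re-evaluated at the new weights, which can only
    increase the bound; afterwards all terms refer to the same weights.\<close>
  also have "(\<Sum>i<k. in_round s i * pdist (aw s) i) \<le> (\<Sum>i<k. in_round s i * pdist (aw s') i)"
    using in_round_nonneg[OF inv] pd by (intro sum_mono mult_left_mono) auto
  also have "Gam (ap s) + ra * (\<Sum>i<k. in_round s i * pdist (aw s') i) + ra * (\<gamma> * pdist (aw s') (ai s))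
      = Gam (ap s') + ra * (\<Sum>i<k. in_round s' i * pdist (aw s') i)"
  proof -
    have "in_round s' i = in_round s i + (if i = ai s then \<gamma> else 0)" for i
      by (simp add: in_round_def eq)
    then have "(\<Sum>i<k. in_round s' i * pdist (aw s') i) =
        (\<Sum>i<k. in_round s i * pdist (aw s') i + (if i = ai s then \<gamma> * pdist (aw s') i else 0))"
      by (intro sum.cong) (auto simp: distrib_right)
    also have "\<dots> = (\<Sum>i<k. in_round s i * pdist (aw s') i) + \<gamma> * pdist (aw s') (ai s)"
      using i by (simp add: sum.distrib)
    finally show ?thesis by (simp add: eq distrib_left)
  qed
  finally have "Phi (aw s') \<le> Gam (ap s') + ra * (\<Sum>i<k. in_round s' i * pdist (aw s') i)"
    using ra_pos by (simp add: mult_left_mono)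
  moreover have "ath s' i \<le> (1 + \<kappa>) * exp \<kappa> * pdist (aw s') i" if "i < k" for i
  proof -
    have "ath s i \<le> (1 + \<kappa>) * exp \<kappa> * pdist (aw s) i" using g that by (simp add: good_def)
    also have "\<dots> \<le> (1 + \<kappa>) * exp \<kappa> * pdist (aw s') i"
      using pd[OF that] kappa_pos by (intro mult_left_mono) auto
    finally show ?thesis by (simp add: eq)
  qed
  ultimately show ?thesis by (simp add: good_def)
qed

text \<open>Thresholds cannot pass \<open>\<Theta>\<close>, because no weight exceeds
  \<open>(1 + \<kappa>) ^ 2\<close>; hence the run ended with a saturated arc, and
  \<open>Phi\<close> is at least 1. Comparing with \<open>Gam\<close> at the next round and taking
  logarithms bounds \<open>shipped\<close> from below. The unfinished last round costs at most one
  unit of \<open>shipped / lam\<close>.\<close>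

lemma good_final:
  assumes g: "good s" and inv: "main_inv s" and dn: "adn s = 1"
    and eps: "0 < \<epsilon>" "\<epsilon> < 0.15" and K: "20 / \<epsilon> \<le> real K"
  shows "(1 - 4 * \<epsilon>) * max_throughput I \<le> shipped (ap s) / T'"
proof -
  have kappa: "\<kappa> \<le> \<epsilon> / 20" "\<kappa> \<le> 1 / 100"
  proof -
    show "\<kappa> \<le> \<epsilon> / 20" using K eps K_pos by (simp add: \<kappa>_def field_simps)
    then show "\<kappa> \<le> 1 / 100" using eps by simp
  qed
  note bounds = growth_rate_bounds[OF kappa_pos(1) kappa(2)]
  have ra1: "ra < 1" using bounds(2) by (simp add: ra_def)
  have wpos: "0 < aw s j" if "j < m" for j using aw_pos[OF inv that] .
  have "\<not> \<Theta> < ath s i" if i: "i < k" for i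
  proof -
    obtain a P where P: "(a, P) \<in> set (ps i)" "pdist (aw s) i = plen (aw s) P" using pdist_attained[OF i] .
    have "pdist (aw s) i = (\<Sum>j<m. if j \<in> set P then aw s j else 0)"
      using ps_path[OF i P(1)] by (simp add: P(2) plen_eq_sum)
    also have "\<dots> \<le> (\<Sum>j<m. (1 + \<kappa>)\<^sup>2)"
    proof (rule sum_mono)
      fix j assume "j \<in> {..<m}"
      then have j: "j < m" by simp
      have "aw s j * 1 \<le> aw s j * cap j" using wpos[OF j] cap_ge_1[OF j] by (intro mult_left_mono) auto
      also have "\<dots> \<le> (1 + \<kappa>)\<^sup>2" using inv j by (simp add: main_inv_def growth_ok_def)
      finally show "(if j \<in> set P then aw s j else 0) \<le> (1 + \<kappa>)\<^sup>2" by simp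
    qed
    also have "\<dots> = real m * (1 + \<kappa>)\<^sup>2" by simp
    finally have "(1 + \<kappa>) * exp \<kappa> * pdist (aw s) i \<le> (1 + \<kappa>) * exp \<kappa> * (real m * (1 + \<kappa>)\<^sup>2)"
      using kappa_pos by (intro mult_left_mono) auto
    also have "\<dots> = real m * ((1 + \<kappa>) ^ 3 * exp \<kappa>)" by (simp add: power3_eq_cube power2_eq_square)
    also have "\<dots> \<le> real m * 2" using bounds(4) by (intro mult_left_mono) auto
    finally show ?thesis using g i m_pos by (force simp: good_def \<Theta>_def)
  qed
  then obtain j where j: "j < m" "1 \<le> aw s j * cap j" using inv dn by (auto simp: main_inv_def)
  have "aw s j * cap j \<le> Phi (aw s)"
    unfolding Phi_def mult.commute[of "aw s j"] using j wpos cap_ge_1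
    by (intro member_le_sum[of j "{..<m}" "\<lambda>j. cap j * aw s j"] mult_nonneg_nonneg) (auto intro: less_imp_le order_trans[of 0 1])
  with j(2) have "1 \<le> Gam (Suc (ap s))" using Phi_bound[OF inv g ra1] by linarith
  then have "ln 1 \<le> ln (Gam (Suc (ap s)))" by (intro ln_mono) auto
  also have "\<dots> = ln (real m) + ln \<delta> + rb * shipped (Suc (ap s)) / lam"
    using m_pos delta_pos by (simp add: Gam_def ln_mult_pos)
  also have "ln \<delta> = - (real T * ln (1 + \<kappa>))"
    using kappa_pos by (simp add: \<delta>_def ln_div ln_realpow)
  finally have "(real T * ln (1 + \<kappa>) - ln (real m)) \<le> shipped (Suc (ap s)) / lam * rb"
    by (simp add: mult.commute)
  moreover have rb: "0 < rb" using ra_pos ra1 by (simp add: rb_def)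
  ultimately have "(real T * ln (1 + \<kappa>) - ln (real m)) * (1 / rb) \<le> shipped (Suc (ap s)) / lam"
    by (simp add: divide_le_eq)
  moreover have "(1 - 4 * \<epsilon>) * (real T + 2) \<le> (real T * ln (1 + \<kappa>) - ln (real m)) * (1 / rb) - 1"
  proof (rule rounds_suffice[OF eps kappa_pos(1) kappa(1)])
    have B: "real B = real T * \<kappa>\<^sup>2"
      using K_pos by (simp add: T_def \<kappa>_def power2_eq_square)
    then show "ln (real m) \<le> 2 * real T * \<kappa>\<^sup>2" using ln_m_le by simp
    have "1 \<le> real T * \<kappa>\<^sup>2" using bits(3) B by simp
    then show "1 / \<kappa>\<^sup>2 \<le> real T" using kappa_pos by (simp add: divide_le_eq)
    show "(1 - 8 * \<kappa>) / \<kappa> \<le> 1 / rb" using bounds(3) by (simp add: rb_def ra_def)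
  qed
  moreover have "shipped (Suc (ap s)) / lam \<le> shipped (ap s) / lam + 1"
    using sig_le[OF inv lambda_pos] lambda_pos by (simp add: shipped_def add_divide_distrib)
  ultimately have "(1 - 4 * \<epsilon>) * T' \<le> shipped (ap s) / lam" by (simp add: T'_def)
  then show ?thesis
    using lambda_pos T'_ge by (simp add: pos_le_divide_eq mult_ac)
qed

end

section \<open>Sampling the centres\<close>

text \<open>Quantitative counterpart of \<open>wp\<close>, used for probabilities of events. Mass
  lost to nontermination counts as zero.\<close>

definition ewp :: "program \<Rightarrow> (machine \<Rightarrow> ennreal) \<Rightarrow> machine \<Rightarrow> ennreal" where
  "ewp P f \<sigma> = (\<integral>\<^sup>+ \<sigma>'. f \<sigma>' \<partial>measure_spmf (exec P \<sigma>))"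

lemma nn_integral_bind_spmf:
  "(\<integral>\<^sup>+ y. f y \<partial>measure_spmf (p \<bind> g)) = (\<integral>\<^sup>+ x. \<integral>\<^sup>+ y. f y \<partial>measure_spmf (g x) \<partial>measure_spmf p)"
  unfolding measure_spmf_bind
  by (subst nn_integral_bind[where B = "count_space UNIV"]) (auto simp: o_def space_subprob_algebra)

lemma nn_integral_return_spmf: "(\<integral>\<^sup>+ y. f y \<partial>measure_spmf (return_spmf x)) = f x"
  by (simp add: measure_spmf_return_spmf nn_integral_return)

lemma ewp_simps:
  "ewp Skip f = f"
  "ewp (NConst x a) f = (\<lambda>\<sigma>. f (set_nreg x a (tick \<sigma>)))"
  "ewp (NArith c x y z) f = (\<lambda>\<sigma>. f (set_nreg x (nat_arith c (nreg \<sigma> y) (nreg \<sigma> z)) (tick \<sigma>)))"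
  "ewp (NStore A y x) f = (\<lambda>\<sigma>. f (set_narr A (nreg \<sigma> y) (nreg \<sigma> x) (tick \<sigma>)))"
  "ewp (Seq P Q) f = ewp P (ewp Q f)"
  "ewp (Cond b P Q) f = (\<lambda>\<sigma>. if holds b \<sigma> then ewp P f (tick \<sigma>) else ewp Q f (tick \<sigma>))"
  by (auto simp: ewp_def fun_eq_iff nn_integral_return_spmf nn_integral_bind_spmf)

lemma ewp_Flip:
  "ewp (Flip x) f \<sigma> = (f (set_nreg x 1 (tick \<sigma>)) + f (set_nreg x 0 (tick \<sigma>))) * ennreal (1 / 2)"
proof -
  have "inverse (2 :: ennreal) = ennreal (1 / 2)"
    using inverse_ennreal[of 2] by simp
  then show ?thesis
    by (simp add: ewp_def nn_integral_spmf_of_set UNIV_bool add.commute divide_ennreal_def)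
qed

lemma ewp_While:
  "ewp (While b P) f \<sigma> = (if holds b \<sigma> then ewp P (ewp (While b P) f) (tick \<sigma>) else f (tick \<sigma>))"
  by (simp add: ewp_def nn_integral_return_spmf nn_integral_bind_spmf
      while_spmf.simps[of "holds b" tick "exec P" \<sigma>] fun_eq_iff)

lemma ewp_mono:
  assumes "\<And>\<sigma>'. frame P \<sigma> \<sigma>' \<Longrightarrow> \<sigma>' \<in> set_spmf (exec P \<sigma>) \<Longrightarrow> f \<sigma>' \<le> g \<sigma>'"
  shows "ewp P f \<sigma> \<le> ewp P g \<sigma>"
  unfolding ewp_def nn_integral_measure_spmf
proof (rule nn_integral_mono)
  fix \<sigma>'
  show "ennreal (spmf (exec P \<sigma>) \<sigma>') * f \<sigma>' \<le> ennreal (spmf (exec P \<sigma>) \<sigma>') * g \<sigma>'"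
  proof (cases "\<sigma>' \<in> set_spmf (exec P \<sigma>)")
    case True
    with assms frame_exec show ?thesis by (intro mult_left_mono) auto
  next
    case False
    then show ?thesis by (simp add: in_set_spmf_iff_spmf)
  qed
qed

section \<open>Drawing random centres\<close>

definition bit_step :: program where
  "bit_step = block [
     NArith NAdd z_reg z_reg z_reg,
     Flip b_reg,
     NArith NAdd z_reg z_reg b_reg,
     NArith NAdd t_reg t_reg one_reg]"

text \<open>A draw of \<open>B\<close> bits that is not a vertex is replaced by vertex 0 instead of
  being repeated. This keeps the running time bounded on every outcome, and each vertex still has
  probability at least \<open>1 / 2 ^ B\<close>.\<close>

definition sample_step :: program where
  "sample_step = block [
     NConst z_reg 0,
     NConst t_reg 0,
     While (NLess t_reg B_reg) bit_step,
     Cond (NLess z_reg n_reg) Skip (NConst z_reg 0),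
     NStore cent_arr c_reg z_reg,
     NArith NAdd c_reg c_reg one_reg]"

definition sample :: program where
  "sample = block [NConst c_reg 0, While (NLess c_reg N_reg) sample_step]"

lemma sum_double:
  fixes h :: "nat \<Rightarrow> 'a :: comm_monoid_add"
  shows "(\<Sum>r<2 * l. h r) = (\<Sum>r<l. h r) + (\<Sum>r<l. h (l + r))"
  using sum.nat_group[of h l 2] by (simp add: numeral_2_eq_2 lessThan_Suc add.commute atLeast0LessThan
      sum.shift_bounds_nat_ivl[of h 0 l l, simplified] )

text \<open>The bits appended to \<open>z_reg\<close> are uniform. The induction over the remaining
  bits needs the form with an arbitrary prefix already in \<open>z_reg\<close>.\<close>

lemma ewp_bits:
  assumes "nreg \<sigma> t_reg \<le> nreg \<sigma> B_reg" "nreg \<sigma> one_reg = 1"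
    and "\<And>\<sigma>'. frame (While (NLess t_reg B_reg) bit_step) \<sigma> \<sigma>' \<Longrightarrow> f \<sigma>' = h (nreg \<sigma>' z_reg)"
  shows "ewp (While (NLess t_reg B_reg) bit_step) f \<sigma> =
    (\<Sum>r<2 ^ (nreg \<sigma> B_reg - nreg \<sigma> t_reg). h (nreg \<sigma> z_reg * 2 ^ (nreg \<sigma> B_reg - nreg \<sigma> t_reg) + r)) *
      ennreal (1 / 2 ^ (nreg \<sigma> B_reg - nreg \<sigma> t_reg))"
  using assms
proof (induction "nreg \<sigma> B_reg - nreg \<sigma> t_reg" arbitrary: \<sigma>)
  case 0
  then have "nreg \<sigma> B_reg = nreg \<sigma> t_reg" by simp
  moreover have "frame (While (NLess t_reg B_reg) bit_step) \<sigma> (tick \<sigma>)" by (simp add: frame_def)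
  then have "f (tick \<sigma>) = h (nreg \<sigma> z_reg)" using "0.prems"(3) by simp
  ultimately show ?case by (subst ewp_While) simp
next
  case (Suc l)
  let ?W = "While (NLess t_reg B_reg) bit_step"
  have lt: "nreg \<sigma> t_reg < nreg \<sigma> B_reg" using Suc.hyps(2) by simp
  define z where "z = nreg \<sigma> z_reg"
  define F where "F = ewp ?W f"
  have IH: "F \<tau> = (\<Sum>r<2 ^ l. h (nreg \<tau> z_reg * 2 ^ l + r)) * ennreal (1 / 2 ^ l)"
    if "frame ?W \<sigma> \<tau>" "nreg \<tau> t_reg = Suc (nreg \<sigma> t_reg)" for \<tau>
  proof -
    have fr: "nreg \<tau> B_reg = nreg \<sigma> B_reg" "nreg \<tau> one_reg = nreg \<sigma> one_reg"
      using frameD(1)[OF that(1)] by (simp_all add: bit_step_def)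
    have l: "l = nreg \<tau> B_reg - nreg \<tau> t_reg" using Suc.hyps(2) that fr by simp
    have "f \<sigma>' = h (nreg \<sigma>' z_reg)" if "frame ?W \<tau> \<sigma>'" for \<sigma>'
      using Suc.prems(3) \<open>frame ?W \<sigma> \<tau>\<close> that by (simp add: frame_def)
    then show ?thesis
      using Suc.hyps(1)[OF l] Suc.prems fr that lt unfolding F_def l[symmetric] by simp
  qed
  have step: "ewp bit_step F (tick \<sigma>) =
      ((\<Sum>r<2 ^ l. h ((2 * z + 1) * 2 ^ l + r)) * ennreal (1 / 2 ^ l) +
       (\<Sum>r<2 ^ l. h (2 * z * 2 ^ l + r)) * ennreal (1 / 2 ^ l)) * ennreal (1 / 2)"
    using Suc.prems(2)
    by (simp add: bit_step_def ewp_simps ewp_Flip IH frame_def z_def mult_2[symmetric])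
  have e: "ennreal (1 / 2 ^ Suc l) = ennreal (1 / 2 ^ l) * ennreal (1 / 2)"
    by (subst ennreal_mult'[symmetric]) auto
  have "(\<Sum>r<2 ^ Suc l. h (z * 2 ^ Suc l + r)) =
      (\<Sum>r<2 ^ l. h (z * 2 ^ Suc l + r)) + (\<Sum>r<2 ^ l. h (z * 2 ^ Suc l + (2 ^ l + r)))"
    using sum_double[of "\<lambda>r. h (z * 2 ^ Suc l + r)" "2 ^ l"] by simp
  also have "\<dots> = (\<Sum>r<2 ^ l. h (2 * z * 2 ^ l + r)) + (\<Sum>r<2 ^ l. h ((2 * z + 1) * 2 ^ l + r))"
    by (simp add: algebra_simps)
  finally have "(\<Sum>r<2 ^ Suc l. h (z * 2 ^ Suc l + r)) * ennreal (1 / 2 ^ Suc l) =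
      ((\<Sum>r<2 ^ l. h ((2 * z + 1) * 2 ^ l + r)) * ennreal (1 / 2 ^ l) +
       (\<Sum>r<2 ^ l. h (2 * z * 2 ^ l + r)) * ennreal (1 / 2 ^ l)) * ennreal (1 / 2)"
    by (simp only: e distrib_right mult.assoc add.commute)
  then show ?case
    using lt step Suc.hyps(2)[symmetric] by (subst ewp_While) (simp add: z_def F_def)
qed

text \<open>Induction over the remaining draws: given that the centres drawn so far avoid
  \<open>S\<close>, each draw up to the \<open>L\<close>-th avoids it with probability at most
  \<open>p\<close>. This is only an inequality because the replacement by 0 may hit \<open>S\<close>
  as well.\<close>

lemma sample_loop_miss:
  fixes S :: "nat set" and f :: "machine \<Rightarrow> ennreal"
  assumes "nreg \<sigma> c_reg \<le> nreg \<sigma> N_reg" "nreg \<sigma> one_reg = 1" "L \<le> nreg \<sigma> N_reg"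
    and S: "S \<subseteq> {..<nreg \<sigma> n_reg}" "nreg \<sigma> n_reg \<le> 2 ^ nreg \<sigma> B_reg"
    and p: "p = 1 - real (card S) / 2 ^ nreg \<sigma> B_reg"
  defines "f \<equiv> \<lambda>\<sigma>. if \<forall>c<L. narr \<sigma> cent_arr c \<notin> S then 1 else 0"
  shows "ewp (While (NLess c_reg N_reg) sample_step) f \<sigma> \<le>
    (if \<forall>c<min (nreg \<sigma> c_reg) L. narr \<sigma> cent_arr c \<notin> S then ennreal (p ^ (L - nreg \<sigma> c_reg)) else 0)"
  using assms(1-6)
proof (induction "nreg \<sigma> N_reg - nreg \<sigma> c_reg" arbitrary: \<sigma>)
  case 0
  then have "nreg \<sigma> c_reg = nreg \<sigma> N_reg" by simp
  with "0.prems" show ?case by (subst ewp_While) (simp add: f_def min_absorb2)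
next
  case (Suc l)
  let ?W = "While (NLess c_reg N_reg) sample_step" and ?bits = "While (NLess t_reg B_reg) bit_step"
  define c B n where cBn: "c = nreg \<sigma> c_reg" "B = nreg \<sigma> B_reg" "n = nreg \<sigma> n_reg"
  have lt: "c < nreg \<sigma> N_reg" using Suc.hyps(2) by (simp add: cBn)
  define G where "G = ewp ?W f"
  define free where "free \<longleftrightarrow> (\<forall>c'<min c L. narr \<sigma> cent_arr c' \<notin> S)"
  define h where "h z = (if free \<and> (c < L \<longrightarrow> (if z < n then z else 0) \<notin> S) then ennreal (p ^ (L - Suc c)) else 0)" for z
  have IH: "G \<tau> \<le> h z"
    if \<tau>: "frame ?W \<sigma> \<tau>" "nreg \<tau> c_reg = Suc c"
      "narr \<tau> cent_arr = (narr \<sigma> cent_arr)(c := if z < n then z else 0)" for \<tau> z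
  proof -
    have fr: "nreg \<tau> N_reg = nreg \<sigma> N_reg" "nreg \<tau> B_reg = nreg \<sigma> B_reg" "nreg \<tau> n_reg = nreg \<sigma> n_reg"
      "nreg \<tau> one_reg = nreg \<sigma> one_reg"
      using frameD(1)[OF \<tau>(1)] by (simp_all add: sample_step_def bit_step_def)
    have "G \<tau> \<le> (if \<forall>c<min (nreg \<tau> c_reg) L. narr \<tau> cent_arr c \<notin> S then ennreal (p ^ (L - nreg \<tau> c_reg)) else 0)"
      unfolding G_def using Suc.hyps(2) Suc.prems fr lt \<tau>(2) by (intro Suc.hyps(1)) (auto simp: cBn)
    moreover have "(\<forall>c'<min (nreg \<tau> c_reg) L. narr \<tau> cent_arr c' \<notin> S) \<longleftrightarrow>
        free \<and> (c < L \<longrightarrow> (if z < n then z else 0) \<notin> S)"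
      unfolding \<tau>(2,3) free_def by (auto simp: less_Suc_eq)
    ultimately show ?thesis by (simp only: h_def \<tau>(2))
  qed
  define F where "F = ewp (block [Cond (NLess z_reg n_reg) Skip (NConst z_reg 0),
     NStore cent_arr c_reg z_reg, NArith NAdd c_reg c_reg one_reg]) G"
  have F_le: "F \<tau> \<le> h (nreg \<tau> z_reg)" if "frame ?bits (set_nreg t_reg 0 (set_nreg z_reg 0 \<sigma>)) \<tau>" for \<tau>
  proof -
    have fr: "nreg \<tau> c_reg = c" "nreg \<tau> n_reg = n" "narr \<tau> cent_arr = narr \<sigma> cent_arr" "nreg \<tau> one_reg = 1"
      using frameD[OF that] Suc.prems(2) by (simp_all add: bit_step_def cBn)
    have frW: "frame ?W \<sigma> \<tau>"
      using that by (simp add: frame_def sample_step_def)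
    show ?thesis
      unfolding F_def using frW fr
      by (simp add: ewp_simps) (intro conjI impI IH, simp_all add: frame_def sample_step_def)
  qed
  define \<sigma>0 where "\<sigma>0 = set_nreg t_reg 0 (tick (set_nreg z_reg 0 (tick (tick \<sigma>))))"
  have fr0: "frame ?bits \<sigma>0 \<tau> \<Longrightarrow> frame ?bits (set_nreg t_reg 0 (set_nreg z_reg 0 \<sigma>)) \<tau>" for \<tau>
    by (simp add: \<sigma>0_def frame_def)
  have "ewp ?W f \<sigma> = ewp sample_step G (tick \<sigma>)"
    using lt by (subst ewp_While) (simp add: G_def cBn)
  also have "\<dots> = ewp ?bits F \<sigma>0"
    by (simp add: sample_step_def F_def ewp_simps \<sigma>0_def)
  also have "\<dots> \<le> ewp ?bits (\<lambda>\<tau>. h (nreg \<tau> z_reg)) \<sigma>0"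
    using F_le fr0 by (intro ewp_mono) auto
  also have "\<dots> = (\<Sum>r<2 ^ B. h r) * ennreal (1 / 2 ^ B)"
    using ewp_bits[of \<sigma>0 "\<lambda>\<tau>. h (nreg \<tau> z_reg)" h] Suc.prems(2) by (simp add: \<sigma>0_def cBn)
  also have "\<dots> \<le> (if free then ennreal (p ^ (L - c)) else 0)"
  proof (cases free)
    case False
    then show ?thesis by (simp add: h_def)
  next
    case free: True
    have card_S: "card S \<le> 2 ^ B"
      using card_mono[OF _ Suc.prems(4)] Suc.prems(5) by (simp add: cBn)
    have p0: "0 \<le> p" using card_S Suc.prems(6) by (simp add: cBn divide_le_eq flip: of_nat_le_iff)
    \<comment> \<open>The draws that keep the event alive; from the \<open>L\<close>-th index on no
      condition is imposed.\<close>
    define A where "A = {r \<in> {..<2 ^ B}. c < L \<longrightarrow> (if r < n then r else 0) \<notin> S}"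
    have "card A \<le> (if c < L then 2 ^ B - card S else 2 ^ B)"
    proof (cases "c < L")
      case True
      have "A \<subseteq> {..<2 ^ B} - S"
        using True Suc.prems(4) by (auto simp: A_def cBn split: if_splits)
      then have "card A \<le> card ({..<2 ^ B} - S)"
        by (intro card_mono) auto
      also have "\<dots> = 2 ^ B - card S"
      proof (subst card_Diff_subset)
        show "finite S" using Suc.prems(4) finite_subset by blast
        show "S \<subseteq> {..<2 ^ B}" using Suc.prems(4,5) by (auto simp: cBn)
      qed simp
      finally show ?thesis using True by simp
    next
      case False
      have "card A \<le> card {..<2 ^ B :: nat}" unfolding A_def by (intro card_mono) auto
      with False show ?thesis by simp
    qed
    then have "real (card A) \<le> (if c < L then 2 ^ B - real (card S) else 2 ^ B)"
    proof (cases "c < L")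
      case True
      with \<open>card A \<le> _\<close> have "card A + card S \<le> 2 ^ B" using card_S by simp
      then have "real (card A) + real (card S) \<le> 2 ^ B"
        by (metis of_nat_add of_nat_le_iff of_nat_numeral of_nat_power)
      with True show ?thesis by simp
    next
      case False
      with \<open>card A \<le> _\<close> have "card A \<le> 2 ^ B" by simp
      then have "real (card A) \<le> 2 ^ B" by (metis of_nat_le_iff of_nat_numeral of_nat_power)
      with False show ?thesis by simp
    qed
    then have "real (card A) / 2 ^ B \<le> (if c < L then 2 ^ B - real (card S) else 2 ^ B) / 2 ^ B"
      by (rule divide_right_mono) simp
    then have le: "real (card A) / 2 ^ B \<le> (if c < L then p else 1)"
      using Suc.prems(6) by (simp add: cBn diff_divide_distrib split: if_splits)
    have "(\<Sum>r<2 ^ B. h r) = of_nat (card A) * ennreal (p ^ (L - Suc c))"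
      using free by (simp add: h_def A_def sum.If_cases Int_def)
    then have "(\<Sum>r<2 ^ B. h r) * ennreal (1 / 2 ^ B) =
       ennreal (real (card A) / 2 ^ B * p ^ (L - Suc c))"
      using p0 by (simp add: ennreal_of_nat_eq_real_of_nat mult_ac flip: ennreal_mult')
    also have "\<dots> \<le> ennreal ((if c < L then p else 1) * p ^ (L - Suc c))"
      using le p0 by (intro ennreal_leI mult_right_mono) auto
    also have "(if c < L then p else 1) * p ^ (L - Suc c) = p ^ (L - c)"
      by (auto simp: Suc_diff_Suc simp flip: power_Suc)
    finally show ?thesis using free by simp
  qed
  finally show ?case unfolding free_def cBn(1) .
qed

lemma sample_wp:
  assumes regs: "nreg \<sigma> one_reg = 1" "nreg \<sigma> n_reg \<ge> 1"
    and Q: "\<And>\<sigma>'. frame sample \<sigma> \<sigma>' \<Longrightarrow> (\<And>c. c < nreg \<sigma> N_reg \<Longrightarrow> narr \<sigma>' cent_arr c < nreg \<sigma> n_reg) \<Longrightarrow>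
      real (steps \<sigma>') \<le> real (steps \<sigma>) + real (nreg \<sigma> N_reg) * (6 * real (nreg \<sigma> B_reg) + 10) + 2 \<Longrightarrow> Q \<sigma>'"
  shows "wp sample Q \<sigma>"
proof -
  define \<sigma>0 where "\<sigma>0 = set_nreg c_reg 0 (tick \<sigma>)"
  have "wp (While (NLess c_reg N_reg) sample_step) Q \<sigma>0"
  proof (rule wp_For[where L = "nreg \<sigma> N_reg" and Bd = "6 * real (nreg \<sigma> B_reg) + 10" and
        Inv = "\<lambda>c \<sigma>'. \<forall>c'<c. narr \<sigma>' cent_arr c' < nreg \<sigma> n_reg"])
    fix \<sigma>' assume "\<forall>c'<nreg \<sigma> N_reg. narr \<sigma>' cent_arr c' < nreg \<sigma> n_reg" "frame sample_step \<sigma>0 \<sigma>'"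
      "real (steps \<sigma>') \<le> real (steps \<sigma>0) + real (nreg \<sigma> N_reg - nreg \<sigma>0 c_reg) * (6 * real (nreg \<sigma> B_reg) + 10) + 1"
    then show "Q \<sigma>'" by (intro Q) (auto simp: \<sigma>0_def frame_def sample_def)
  next
    fix \<sigma>' c assume Inv: "\<forall>c'<c. narr \<sigma>' cent_arr c' < nreg \<sigma> n_reg" and fr: "frame sample_step \<sigma>0 \<sigma>'"
      and c: "nreg \<sigma>' c_reg = c" "c < nreg \<sigma> N_reg"
    have regs': "nreg \<sigma>' n_reg = nreg \<sigma> n_reg" "nreg \<sigma>' B_reg = nreg \<sigma> B_reg" "nreg \<sigma>' one_reg = 1"
      using frameD(1)[OF fr] regs by (simp_all add: sample_step_def bit_step_def \<sigma>0_def)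
    define post where "post \<tau> \<longleftrightarrow> nreg \<tau> c_reg = Suc c \<and> (\<forall>c'<Suc c. narr \<tau> cent_arr c' < nreg \<sigma> n_reg) \<and>
      real (steps \<tau>) \<le> real (steps \<sigma>') + (6 * real (nreg \<sigma> B_reg) + 10)" for \<tau> :: machine
    have bits: "wp (While (NLess t_reg B_reg) bit_step) (wp (block [Cond (NLess z_reg n_reg) Skip (NConst z_reg 0),
       NStore cent_arr c_reg z_reg, NArith NAdd c_reg c_reg one_reg]) post) \<tau>"
      if \<tau>: "nreg \<tau> t_reg = 0" "frame sample_step \<sigma>' \<tau>" "narr \<tau> = narr \<sigma>'" "nreg \<tau> c_reg = c"
        "steps \<tau> \<le> steps \<sigma>' + 3" for \<tau>
    proof (rule wp_For[where L = "nreg \<sigma> B_reg" and Bd = 6 and Inv = "\<lambda>j \<rho>. True"])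
      have eq: "nreg \<tau> B_reg = nreg \<sigma> B_reg" "nreg \<tau> one_reg = 1" "nreg \<tau> n_reg = nreg \<sigma> n_reg"
        using frameD(1)[OF \<tau>(2)] regs' by (simp_all add: sample_step_def bit_step_def)
      show "nreg \<tau> t_reg \<le> nreg \<sigma> B_reg" "nreg \<tau> B_reg = nreg \<sigma> B_reg" using eq \<tau> by auto
      show "B_reg \<notin> wrN bit_step" by (simp add: bit_step_def)
      show "wp bit_step (\<lambda>\<rho>'. nreg \<rho>' t_reg = Suc j \<and> True \<and> real (steps \<rho>') \<le> real (steps \<rho>) + 6) (tick \<rho>)"
        if "frame bit_step \<tau> \<rho>" "nreg \<rho> t_reg = j" for \<rho> j
      proof -
        have "nreg \<rho> one_reg = 1" using frameD(1)[OF that(1)] eq by (simp add: bit_step_def)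
        then show ?thesis using that(2) by (simp add: bit_step_def wp_simps wp_Skip wp_Seq)
      qed
      fix \<rho> assume fr\<rho>: "frame bit_step \<tau> \<rho>"
        and st: "real (steps \<rho>) \<le> real (steps \<tau>) + real (nreg \<sigma> B_reg - nreg \<tau> t_reg) * 6 + 1"
      have eq': "narr \<rho> = narr \<sigma>'" "nreg \<rho> n_reg = nreg \<sigma> n_reg" "nreg \<rho> one_reg = 1" "nreg \<rho> c_reg = c"
        using frameD[OF fr\<rho>] eq \<tau> by (auto simp: bit_step_def)
      show "wp (block [Cond (NLess z_reg n_reg) Skip (NConst z_reg 0),
          NStore cent_arr c_reg z_reg, NArith NAdd c_reg c_reg one_reg]) post \<rho>"
        using st eq' Inv regs \<tau>(1,5)
        by (auto simp: wp_simps wp_Skip wp_Seq post_def less_Suc_eq)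
    qed simp_all
    have "wp sample_step post (tick \<sigma>')"
      by (simp add: sample_step_def wp_simps wp_Skip wp_Seq)
        (rule bits[unfolded block.simps wp_Seq wp_Skip], simp_all add: c frame_def sample_step_def)
    then show "wp sample_step (\<lambda>\<tau>. nreg \<tau> c_reg = Suc c \<and> (\<forall>c'<Suc c. narr \<tau> cent_arr c' < nreg \<sigma> n_reg) \<and>
      real (steps \<tau>) \<le> real (steps \<sigma>') + (6 * real (nreg \<sigma> B_reg) + 10)) (tick \<sigma>')"
      unfolding post_def .
  qed (auto simp: \<sigma>0_def sample_step_def bit_step_def)
  then show ?thesis by (simp add: sample_def wp_simps wp_Skip wp_Seq \<sigma>0_def)
qed

section \<open>Initialisation\<close>

text \<open>\<open>\<delta>\<close> is obtained by \<open>T\<close> successive divisions;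
  \<open>T = K * K * B\<close> steps are within the time bound.\<close>

definition delta_step :: program where
  "delta_step = block [RArith RDiv delta_rr delta_rr kappa1_rr, NArith NAdd t_reg t_reg one_reg]"

definition init_constants :: program where
  "init_constants = block [
     NArith NAdd nn_reg n_reg n_reg,
     NArith NMul T_reg K_reg K_reg,
     NArith NMul T_reg T_reg B_reg,
     RofN one_rr one_reg,
     RofN kappa_rr K_reg,
     RArith RDiv kappa_rr one_rr kappa_rr,
     RArith RAdd kappa1_rr one_rr kappa_rr,
     RofN KN_rr K_reg,
     RofN a_rr N_reg,
     RArith RMul KN_rr KN_rr a_rr,
     RofN T_rr T_reg,
     RArith RAdd T_rr T_rr one_rr,
     RArith RAdd T_rr T_rr one_rr,
     RArith RAdd fac_rr T_rr T_rr,
     RArith RDiv fac_rr one_rr fac_rr,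
     RArith RAdd fac_rr one_rr fac_rr,
     NArith NAdd mm_reg m_reg m_reg,
     NArith NAdd mm_reg mm_reg one_reg,
     NConst c_reg 0,
     RofN Theta_rr m_reg,
     RArith RAdd Theta_rr Theta_rr Theta_rr,
     RArith RAdd Theta_rr Theta_rr Theta_rr,
     RArith RAdd delta_rr one_rr zero_rr,
     NConst t_reg 0,
     While (NLess t_reg T_reg) delta_step]"

definition max_step :: program where
  "max_step = block [
     RLoad a_rr cap_rarr t_reg,
     Cond (RLess U_rr a_rr) (RArith RAdd U_rr a_rr zero_rr) Skip,
     NArith NAdd t_reg t_reg one_reg]"

definition init_capacity :: program where
  "init_capacity = block [
     RArith RAdd U_rr one_rr zero_rr,
     NConst t_reg 0,
     While (NLess t_reg m_reg) max_step,
     RArith RDiv d0_rr delta_rr U_rr]"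

definition weight_step :: program where
  "weight_step = block [
     RLoad a_rr cap_rarr t_reg,
     RArith RDiv a_rr delta_rr a_rr,
     RStore w_rarr t_reg a_rr,
     RStore wr_rarr t_reg a_rr,
     NArith NAdd t_reg t_reg one_reg]"

definition init_weights :: program where
  "init_weights = block [NConst t_reg 0, While (NLess t_reg m_reg) weight_step]"

definition demand_step :: program where
  "demand_step = block [
     RLoad a_rr demand_rarr t_reg,
     Cond (RLess D_rr a_rr) (RArith RAdd D_rr a_rr zero_rr) Skip,
     RStore theta_rarr t_reg d0_rr,
     NArith NAdd t_reg t_reg one_reg]"

definition init_demands :: program where
  "init_demands = block [
     RArith RAdd D_rr zero_rr zero_rr,
     NConst t_reg 0,
     While (NLess t_reg k_reg) demand_step,
     RofN sigma_rr k_reg,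
     RArith RAdd sigma_rr sigma_rr sigma_rr,
     RArith RMul sigma_rr sigma_rr D_rr,
     RArith RDiv sigma_rr one_rr sigma_rr,
     RLoad a_rr demand_rarr zero_reg,
     RArith RMul rem_rr sigma_rr a_rr]"

text \<open>Each arc is prepended to the list of its tail, so lists run through decreasing numbers,
  as \<open>prev_arc\<close> describes.\<close>

definition arc_step :: program where
  "arc_step = block [
     NArith NSub e_reg t_reg one_reg,
     Cond (NLeq t_reg m_reg)
       (block [NLoad x_reg tail_arr e_reg, NLoad y_reg head_arr e_reg])
       (block [
         NArith NSub e_reg e_reg m_reg,
         NLoad x_reg head_arr e_reg,
         NArith NAdd x_reg n_reg x_reg,
         NLoad y_reg tail_arr e_reg,
         NArith NAdd y_reg n_reg y_reg]),
     NLoad z_reg first_arr x_reg,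
     NStore nxt_arr t_reg z_reg,
     NStore first_arr x_reg t_reg,
     NStore tgt_arr t_reg y_reg,
     NStore und_arr t_reg e_reg,
     NArith NAdd t_reg t_reg one_reg]"

definition init_arcs :: program where
  "init_arcs = block [NConst t_reg 1, While (NLess t_reg mm_reg) arc_step]"

context mcf_run
begin

definition input_ok :: "machine \<Rightarrow> bool" where
  "input_ok \<sigma> \<longleftrightarrow> nreg \<sigma> n_reg = n \<and> nreg \<sigma> m_reg = m \<and> nreg \<sigma> k_reg = k \<and> nreg \<sigma> one_reg = 1 \<and>
     nreg \<sigma> zero_reg = 0 \<and> nreg \<sigma> N_reg = N \<and> nreg \<sigma> B_reg = B \<and> nreg \<sigma> K_reg = K \<and>
     nreg \<sigma> i_reg = 0 \<and> nreg \<sigma> p_reg = 0 \<and> nreg \<sigma> done_reg = 0 \<and> rreg \<sigma> zero_rr = 0 \<and>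
     (\<forall>i<k. narr \<sigma> source_arr i = src i \<and> narr \<sigma> sink_arr i = snk i \<and> rarr \<sigma> demand_rarr i = d i) \<and>
     (\<forall>j<m. rarr \<sigma> cap_rarr j = cap j \<and> narr \<sigma> tail_arr j = tail_of j \<and> narr \<sigma> head_arr j = head_of j)"

lemma input_ok_frame:
  assumes "input_ok \<sigma>" "frame P \<sigma> \<sigma>'"
    "wrN P \<inter> {n_reg, m_reg, k_reg, one_reg, zero_reg, N_reg, B_reg, K_reg, i_reg, p_reg, done_reg} = {}"
    "zero_rr \<notin> wrR P" "wrNA P \<inter> {source_arr, sink_arr, tail_arr, head_arr} = {}"
    "wrRA P \<inter> {cap_rarr, demand_rarr} = {}"
  shows "input_ok \<sigma>'"
proof -
  have "r \<notin> wrN P" if "r \<in> {n_reg, m_reg, k_reg, one_reg, zero_reg, N_reg, B_reg, K_reg, i_reg, p_reg, done_reg}" for r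
    using assms(3) that by blast
  moreover have "r \<notin> wrNA P" if "r \<in> {source_arr, sink_arr, tail_arr, head_arr}" for r
    using assms(5) that by blast
  moreover have "r \<notin> wrRA P" if "r \<in> {cap_rarr, demand_rarr}" for r
    using assms(6) that by blast
  ultimately show ?thesis
    using assms(1,4) unfolding input_ok_def by (simp add: frameD[OF assms(2)])
qed

lemma init_constants_wp:
  assumes "input_ok \<sigma>"
    and Q: "\<And>\<sigma>'. frame init_constants \<sigma> \<sigma>' \<Longrightarrow> nreg \<sigma>' nn_reg = 2 * n \<Longrightarrow> rreg \<sigma>' one_rr = 1 \<Longrightarrow>
      rreg \<sigma>' kappa_rr = \<kappa> \<Longrightarrow> rreg \<sigma>' kappa1_rr = 1 + \<kappa> \<Longrightarrow> rreg \<sigma>' KN_rr = real K * real N \<Longrightarrow>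
      rreg \<sigma>' T_rr = T' \<Longrightarrow> rreg \<sigma>' fac_rr = 1 + 1 / (2 * T') \<Longrightarrow> nreg \<sigma>' mm_reg = Suc (2 * m) \<Longrightarrow>
      nreg \<sigma>' c_reg = 0 \<Longrightarrow> rreg \<sigma>' Theta_rr = \<Theta> \<Longrightarrow> rreg \<sigma>' delta_rr = \<delta> \<Longrightarrow>
      real (steps \<sigma>') \<le> real (steps \<sigma>) + 4 * real T + 30 \<Longrightarrow> Q \<sigma>'"
  shows "wp init_constants Q \<sigma>"
proof -
  have loop: "wp (While (NLess t_reg T_reg) delta_step) Q \<tau>"
    if \<tau>: "frame init_constants \<sigma> \<tau>" "nreg \<tau> nn_reg = 2 * n" "rreg \<tau> one_rr = 1"
      "rreg \<tau> kappa_rr = \<kappa>" "rreg \<tau> kappa1_rr = 1 + \<kappa>" "rreg \<tau> KN_rr = real K * real N"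
      "rreg \<tau> T_rr = T'" "rreg \<tau> fac_rr = 1 + 1 / (2 * T')" "nreg \<tau> mm_reg = Suc (2 * m)"
      "nreg \<tau> c_reg = 0" "rreg \<tau> Theta_rr = \<Theta>" "rreg \<tau> delta_rr = 1" "nreg \<tau> t_reg = 0" "nreg \<tau> T_reg = T"
      "steps \<tau> \<le> steps \<sigma> + 25" for \<tau>
  proof (rule wp_For[where L = T and Bd = 3 and Inv = "\<lambda>j \<rho>. rreg \<rho> delta_rr = 1 / (1 + \<kappa>) ^ j"])
    have ok: "input_ok \<tau>"
      by (rule input_ok_frame[OF assms(1) \<tau>(1)]) (simp_all add: init_constants_def delta_step_def)
    fix \<rho> j assume "rreg \<rho> delta_rr = 1 / (1 + \<kappa>) ^ j" "frame delta_step \<tau> \<rho>" "nreg \<rho> t_reg = j" "j < T"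
    moreover have "nreg \<rho> one_reg = 1" "rreg \<rho> kappa1_rr = 1 + \<kappa>"
      using frameD[OF \<open>frame delta_step \<tau> \<rho>\<close>] ok \<tau> by (simp_all add: delta_step_def input_ok_def)
    ultimately show "wp delta_step (\<lambda>\<rho>'. nreg \<rho>' t_reg = Suc j \<and> rreg \<rho>' delta_rr = 1 / (1 + \<kappa>) ^ Suc j \<and>
        real (steps \<rho>') \<le> real (steps \<rho>) + 3) (tick \<rho>)"
      by (simp add: delta_step_def wp_simps wp_Skip wp_Seq)
  next
    fix \<rho> assume *: "rreg \<rho> delta_rr = 1 / (1 + \<kappa>) ^ T" "frame delta_step \<tau> \<rho>"
      "real (steps \<rho>) \<le> real (steps \<tau>) + real (T - nreg \<tau> t_reg) * 3 + 1"
    have "frame init_constants \<tau> \<rho>" using *(2) by (simp add: frame_def init_constants_def)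
    then have "frame init_constants \<sigma> \<rho>" using \<tau>(1) by (simp add: frame_def)
    then show "Q \<rho>"
      using * \<tau> frameD[OF *(2)] by (intro Q) (simp_all add: \<delta>_def delta_step_def)
  qed (use \<tau> in \<open>simp_all add: delta_step_def\<close>)
  show ?thesis
    using assms(1)[unfolded input_ok_def One_nat_def]
    by (simp add: init_constants_def wp_simps wp_Skip wp_Seq)
      (rule loop, simp_all add: frame_def init_constants_def \<kappa>_def T'_def T_def \<Theta>_def)
qed

lemma init_capacity_wp:
  assumes ok: "input_ok \<sigma>" and regs: "rreg \<sigma> one_rr = 1" "rreg \<sigma> delta_rr = \<delta>"
    and Q: "\<And>\<sigma>'. frame init_capacity \<sigma> \<sigma>' \<Longrightarrow> rreg \<sigma>' d0_rr = d0 \<Longrightarrow>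
      real (steps \<sigma>') \<le> real (steps \<sigma>) + 6 * real m + 10 \<Longrightarrow> Q \<sigma>'"
  shows "wp init_capacity Q \<sigma>"
proof -
  have loop: "wp (While (NLess t_reg m_reg) max_step) (wp (RArith RDiv d0_rr delta_rr U_rr) Q) \<tau>"
    if \<tau>: "frame init_capacity \<sigma> \<tau>" "rreg \<tau> U_rr = 1" "nreg \<tau> t_reg = 0" "rreg \<tau> delta_rr = \<delta>"
      "steps \<tau> \<le> steps \<sigma> + 3" for \<tau>
  proof (rule wp_For[where L = m and Bd = 5 and Inv = "\<lambda>j \<rho>. rreg \<rho> U_rr = Max (insert 1 (cap ` {..<j}))"])
    have ok': "input_ok \<tau>"
      by (rule input_ok_frame[OF ok \<tau>(1)]) (simp_all add: init_capacity_def max_step_def)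
    then show "nreg \<tau> m_reg = m" by (simp add: input_ok_def)
    fix \<rho> j assume *: "rreg \<rho> U_rr = Max (insert 1 (cap ` {..<j}))" "frame max_step \<tau> \<rho>" "nreg \<rho> t_reg = j" "j < m"
    have ok\<rho>: "input_ok \<rho>"
      by (rule input_ok_frame[OF ok' *(2)]) (simp_all add: max_step_def)
    have "insert 1 (cap ` {..<Suc j}) = insert (cap j) (insert 1 (cap ` {..<j}))" by (auto simp: lessThan_Suc)
    then have M: "Max (insert 1 (cap ` {..<Suc j})) = max (cap j) (Max (insert 1 (cap ` {..<j})))" by simp
    define M0 where "M0 = Max (insert 1 (cap ` {..<j}))"
    show "wp max_step (\<lambda>\<rho>'. nreg \<rho>' t_reg = Suc j \<and> rreg \<rho>' U_rr = Max (insert 1 (cap ` {..<Suc j})) \<and>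
        real (steps \<rho>') \<le> real (steps \<rho>) + 5) (tick \<rho>)"
      unfolding M M0_def[symmetric]
      using *(1)[folded M0_def] *(3,4) ok\<rho>[unfolded input_ok_def One_nat_def]
      by (simp add: max_step_def wp_simps wp_Skip wp_Seq max_def)
  next
    fix \<rho> assume *: "rreg \<rho> U_rr = Max (insert 1 (cap ` {..<m}))" "frame max_step \<tau> \<rho>"
      "real (steps \<rho>) \<le> real (steps \<tau>) + real (m - nreg \<tau> t_reg) * 5 + 1"
    have "cap ` {..<m} = u ` E"
      using bij_es by (auto simp: cap_def bij_betw_def image_image[symmetric])
    then have "Max (insert 1 (cap ` {..<m})) = U"
      using U_ge_1 finE valid by (simp add: U_def max_capacity_def valid_instance_def)
    moreover have "rreg \<rho> delta_rr = \<delta>" using frameD[OF *(2)] \<tau> by (simp add: max_step_def)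
    moreover have "frame init_capacity \<sigma> (set_rreg d0_rr v (tick \<rho>))" for v
      using *(2) \<tau>(1) by (simp add: frame_def init_capacity_def)
    ultimately show "wp (RArith RDiv d0_rr delta_rr U_rr) Q \<rho>"
      using * \<tau> by (simp add: wp_simps) (intro Q, simp_all add: d0_def)
  qed (use \<tau> in \<open>simp_all add: max_step_def\<close>)
  show ?thesis
    using ok[unfolded input_ok_def One_nat_def] regs
    by (simp add: init_capacity_def wp_simps wp_Skip wp_Seq)
      (rule loop[unfolded One_nat_def], simp_all add: frame_def init_capacity_def)
qed

lemma init_weights_wp:
  assumes ok: "input_ok \<sigma>" and regs: "rreg \<sigma> delta_rr = \<delta>"
    and Q: "\<And>\<sigma>'. frame init_weights \<sigma> \<sigma>' \<Longrightarrow>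
      (\<And>j. j < m \<Longrightarrow> rarr \<sigma>' w_rarr j = \<delta> / cap j \<and> rarr \<sigma>' wr_rarr j = \<delta> / cap j) \<Longrightarrow>
      real (steps \<sigma>') \<le> real (steps \<sigma>) + 6 * real m + 10 \<Longrightarrow> Q \<sigma>'"
  shows "wp init_weights Q \<sigma>"
proof -
  have loop: "wp (While (NLess t_reg m_reg) weight_step) Q \<tau>"
    if \<tau>: "frame init_weights \<sigma> \<tau>" "nreg \<tau> t_reg = 0" "steps \<tau> \<le> steps \<sigma> + 3" for \<tau>
  proof (rule wp_For[where L = m and Bd = 6 and Inv = "\<lambda>l \<rho>.
        \<forall>j<l. rarr \<rho> w_rarr j = \<delta> / cap j \<and> rarr \<rho> wr_rarr j = \<delta> / cap j"])
    have ok': "input_ok \<tau>"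
      by (rule input_ok_frame[OF ok \<tau>(1)]) (simp_all add: init_weights_def weight_step_def)
    then show "nreg \<tau> m_reg = m" by (simp add: input_ok_def)
    fix \<rho> l assume *: "\<forall>j<l. rarr \<rho> w_rarr j = \<delta> / cap j \<and> rarr \<rho> wr_rarr j = \<delta> / cap j"
      "frame weight_step \<tau> \<rho>" "nreg \<rho> t_reg = l" "l < m"
    have ok\<rho>: "input_ok \<rho>"
      by (rule input_ok_frame[OF ok' *(2)]) (simp_all add: weight_step_def)
    have "rreg \<rho> delta_rr = \<delta>" using frameD[OF *(2)] frameD[OF \<tau>(1)] regs by (simp add: weight_step_def init_weights_def)
    then show "wp weight_step (\<lambda>\<rho>'. nreg \<rho>' t_reg = Suc l \<and>
        (\<forall>j<Suc l. rarr \<rho>' w_rarr j = \<delta> / cap j \<and> rarr \<rho>' wr_rarr j = \<delta> / cap j) \<and>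
        real (steps \<rho>') \<le> real (steps \<rho>) + 6) (tick \<rho>)"
      using * ok\<rho>[unfolded input_ok_def One_nat_def]
      by (auto simp add: weight_step_def wp_simps wp_Skip wp_Seq less_Suc_eq)
  next
    fix \<rho> assume *: "\<forall>j<m. rarr \<rho> w_rarr j = \<delta> / cap j \<and> rarr \<rho> wr_rarr j = \<delta> / cap j" "frame weight_step \<tau> \<rho>"
      "real (steps \<rho>) \<le> real (steps \<tau>) + real (m - nreg \<tau> t_reg) * 6 + 1"
    have "frame init_weights \<sigma> \<rho>"
      using *(2) \<tau>(1) by (simp add: frame_def init_weights_def)
    then show "Q \<rho>" using * \<tau> by (intro Q) simp_all
  qed (use \<tau> in \<open>simp_all add: weight_step_def\<close>)
  show ?thesis
    by (simp add: init_weights_def wp_simps wp_Skip wp_Seq)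
      (rule loop[unfolded One_nat_def], simp_all add: frame_def init_weights_def)
qed

lemma init_demands_wp:
  assumes ok: "input_ok \<sigma>" and regs: "rreg \<sigma> one_rr = 1" "rreg \<sigma> d0_rr = d0"
    and Q: "\<And>\<sigma>'. frame init_demands \<sigma> \<sigma>' \<Longrightarrow> (\<And>i. i < k \<Longrightarrow> rarr \<sigma>' theta_rarr i = d0) \<Longrightarrow>
      rreg \<sigma>' sigma_rr = sig 0 \<Longrightarrow> rreg \<sigma>' rem_rr = sig 0 * d 0 \<Longrightarrow>
      real (steps \<sigma>') \<le> real (steps \<sigma>) + 7 * real k + 20 \<Longrightarrow> Q \<sigma>'"
  shows "wp init_demands Q \<sigma>"
proof -
  have loop: "wp (While (NLess t_reg k_reg) demand_step) (wp (block [
     RofN sigma_rr k_reg,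
     RArith RAdd sigma_rr sigma_rr sigma_rr,
     RArith RMul sigma_rr sigma_rr D_rr,
     RArith RDiv sigma_rr one_rr sigma_rr,
     RLoad a_rr demand_rarr zero_reg,
     RArith RMul rem_rr sigma_rr a_rr]) Q) \<tau>"
    if \<tau>: "frame init_demands \<sigma> \<tau>" "nreg \<tau> t_reg = 0" "rreg \<tau> D_rr = 0" "steps \<tau> \<le> steps \<sigma> + 3" for \<tau>
  proof (rule wp_For[where L = k and Bd = 6 and Inv = "\<lambda>l \<rho>.
        (\<forall>i<l. rarr \<rho> theta_rarr i = d0) \<and> rreg \<rho> D_rr = Max (insert 0 (d ` {..<l}))"])
    have ok': "input_ok \<tau>"
      by (rule input_ok_frame[OF ok \<tau>(1)]) (simp_all add: init_demands_def demand_step_def)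
    then show "nreg \<tau> k_reg = k" by (simp add: input_ok_def)
    fix \<rho> l assume *: "(\<forall>i<l. rarr \<rho> theta_rarr i = d0) \<and> rreg \<rho> D_rr = Max (insert 0 (d ` {..<l}))"
      "frame demand_step \<tau> \<rho>" "nreg \<rho> t_reg = l" "l < k"
    have ok\<rho>: "input_ok \<rho>"
      by (rule input_ok_frame[OF ok' *(2)]) (simp_all add: demand_step_def)
    have "insert 0 (d ` {..<Suc l}) = insert (d l) (insert 0 (d ` {..<l}))" by (auto simp: lessThan_Suc)
    then have M: "Max (insert 0 (d ` {..<Suc l})) = max (d l) (Max (insert 0 (d ` {..<l})))" by simp
    define M0 where "M0 = Max (insert 0 (d ` {..<l}))"
    have "rreg \<rho> d0_rr = d0" using frameD[OF *(2)] frameD[OF \<tau>(1)] regs by (simp add: demand_step_def init_demands_def)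
    then show "wp demand_step (\<lambda>\<rho>'. nreg \<rho>' t_reg = Suc l \<and>
        ((\<forall>i<Suc l. rarr \<rho>' theta_rarr i = d0) \<and> rreg \<rho>' D_rr = Max (insert 0 (d ` {..<Suc l}))) \<and>
        real (steps \<rho>') \<le> real (steps \<rho>) + 6) (tick \<rho>)"
      unfolding M M0_def[symmetric]
      using *(1)[folded M0_def] *(3,4) ok\<rho>[unfolded input_ok_def One_nat_def]
      by (auto simp add: demand_step_def wp_simps wp_Skip wp_Seq less_Suc_eq max_def)
  next
    fix \<rho> assume *: "(\<forall>i<k. rarr \<rho> theta_rarr i = d0) \<and> rreg \<rho> D_rr = Max (insert 0 (d ` {..<k}))" "frame demand_step \<tau> \<rho>"
      "real (steps \<rho>) \<le> real (steps \<tau>) + real (k - nreg \<tau> t_reg) * 6 + 1"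
    have fr: "frame init_demands \<sigma> \<rho>"
      using *(2) \<tau>(1) by (simp add: frame_def init_demands_def)
    have ok\<rho>: "input_ok \<rho>"
      by (rule input_ok_frame[OF ok fr]) (simp_all add: init_demands_def demand_step_def)
    have "d ` {..<k} \<noteq> {}" using k_pos by (auto simp: lessThan_empty_iff)
    then have "Max (insert 0 (d ` {..<k})) = D"
      using D_pos by (simp add: D_def)
    then have D: "rreg \<rho> D_rr = D" using * by simp
    have one: "rreg \<rho> one_rr = 1" using frameD[OF *(2)] frameD[OF \<tau>(1)] regs by (simp add: demand_step_def init_demands_def)
    have d_0: "rarr \<rho> demand_rarr 0 = d 0" using ok\<rho> k_pos by (auto simp: input_ok_def)
    have sig0: "1 / ((real k + real k) * D) = sig 0" by (simp add: sig_def)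
    show "wp (block [
     RofN sigma_rr k_reg,
     RArith RAdd sigma_rr sigma_rr sigma_rr,
     RArith RMul sigma_rr sigma_rr D_rr,
     RArith RDiv sigma_rr one_rr sigma_rr,
     RLoad a_rr demand_rarr zero_reg,
     RArith RMul rem_rr sigma_rr a_rr]) Q \<rho>"
      using *(1)[THEN conjunct1] *(2,3) \<tau> fr
      by (simp add: wp_simps wp_Skip wp_Seq ok\<rho>[unfolded input_ok_def One_nat_def] D one[unfolded One_nat_def] d_0[unfolded One_nat_def] sig0)
        (intro Q, simp_all add: frame_def init_demands_def sig_def)
  qed (use \<tau> in \<open>simp_all add: demand_step_def\<close>)
  show ?thesis
    using ok[unfolded input_ok_def One_nat_def]
    by (simp add: init_demands_def wp_simps wp_Skip wp_Seq)
      (rule loop[unfolded block.simps wp_Seq wp_Skip One_nat_def], simp_all add: frame_def init_demands_def)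
qed

lemma prev_arc_Suc: "1 \<le> r \<Longrightarrow> prev_arc x (Suc r) = (if usrc r = x then r else prev_arc x r)"
proof -
  assume r: "1 \<le> r"
  let ?A = "\<lambda>b. {r'. 1 \<le> r' \<and> r' < b \<and> usrc r' = x}"
  show ?thesis
  proof (cases "usrc r = x")
    case True
    then have "Max (insert 0 (?A (Suc r))) = r"
      using r by (intro Max_eqI) auto
    then show ?thesis using True by (simp add: prev_arc_def)
  next
    case False
    then have "?A (Suc r) = ?A r" by (auto simp: less_Suc_eq)
    then show ?thesis using False unfolding prev_arc_def by simp
  qed
qed

lemma init_arcs_wp:
  assumes ok: "input_ok \<sigma>" and mm: "nreg \<sigma> mm_reg = Suc (2 * m)"
    and first: "\<And>x. narr \<sigma> first_arr x = 0"
    and Q: "\<And>\<sigma>'. frame init_arcs \<sigma> \<sigma>' \<Longrightarrow>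
      (\<And>r. r \<in> {1..2 * m} \<Longrightarrow> narr \<sigma>' nxt_arr r = prev_arc (usrc r) r \<and> narr \<sigma>' tgt_arr r = utgt r \<and>
        narr \<sigma>' und_arr r = und r) \<Longrightarrow>
      (\<And>x. narr \<sigma>' first_arr x = prev_arc x (Suc (2 * m))) \<Longrightarrow>
      real (steps \<sigma>') \<le> real (steps \<sigma>) + 30 * real m + 10 \<Longrightarrow> Q \<sigma>'"
  shows "wp init_arcs Q \<sigma>"
proof -
  have loop: "wp (While (NLess t_reg mm_reg) arc_step) Q \<tau>"
    if \<tau>: "frame init_arcs \<sigma> \<tau>" "nreg \<tau> t_reg = 1" "narr \<tau> first_arr = narr \<sigma> first_arr" "steps \<tau> \<le> steps \<sigma> + 3" for \<tau>
  proof (rule wp_For[where L = "Suc (2 * m)" and Bd = 15 and Inv = "\<lambda>l \<rho>. 1 \<le> l \<and>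
        (\<forall>r\<in>{1..<l}. narr \<rho> nxt_arr r = prev_arc (usrc r) r \<and> narr \<rho> tgt_arr r = utgt r \<and>
        narr \<rho> und_arr r = und r) \<and> (\<forall>x. narr \<rho> first_arr x = prev_arc x l)"])
    have ok': "input_ok \<tau>"
      by (rule input_ok_frame[OF ok \<tau>(1)]) (simp_all add: init_arcs_def arc_step_def)
    show "nreg \<tau> mm_reg = Suc (2 * m)"
      using frameD(1)[OF \<tau>(1), of mm_reg] mm by (simp add: init_arcs_def arc_step_def)
    have "{r. 1 \<le> r \<and> r < (1::nat) \<and> usrc r = x} = {}" for x by auto
    then have "prev_arc x 1 = 0" for x by (simp only: prev_arc_def Max_singleton)
    then show "1 \<le> nreg \<tau> t_reg \<and> (\<forall>r\<in>{1..<nreg \<tau> t_reg}. narr \<tau> nxt_arr r = prev_arc (usrc r) r \<and>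
        narr \<tau> tgt_arr r = utgt r \<and> narr \<tau> und_arr r = und r) \<and> (\<forall>x. narr \<tau> first_arr x = prev_arc x (nreg \<tau> t_reg))"
      using \<tau> first by simp
    fix \<rho> l assume *: "1 \<le> l \<and> (\<forall>r\<in>{1..<l}. narr \<rho> nxt_arr r = prev_arc (usrc r) r \<and> narr \<rho> tgt_arr r = utgt r \<and>
        narr \<rho> und_arr r = und r) \<and> (\<forall>x. narr \<rho> first_arr x = prev_arc x l)"
      "frame arc_step \<tau> \<rho>" "nreg \<rho> t_reg = l" "l < Suc (2 * m)"
    have ok\<rho>: "input_ok \<rho>"
      by (rule input_ok_frame[OF ok' *(2)]) (simp_all add: arc_step_def)
    define e where "e = und l"
    have l: "l \<in> {1..2 * m}" using * by auto
    have e: "e < m" using und_less[OF l] by (simp add: e_def)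
    have arrs: "narr \<rho> 0 e = tail_of e" "narr \<rho> (Suc 0) e = head_of e" "nreg \<rho> 0 = n" "nreg \<rho> (Suc 0) = m"
      "nreg \<rho> one_reg = Suc 0" "nreg \<rho> t_reg = l"
      using ok\<rho> e *(3) by (auto simp: input_ok_def)
    define post where "post \<rho>' \<longleftrightarrow> nreg \<rho>' t_reg = Suc l \<and> (1 \<le> Suc l \<and>
        (\<forall>r\<in>{1..<Suc l}. narr \<rho>' nxt_arr r = prev_arc (usrc r) r \<and> narr \<rho>' tgt_arr r = utgt r \<and>
        narr \<rho>' und_arr r = und r) \<and> (\<forall>x. narr \<rho>' first_arr x = prev_arc x (Suc l))) \<and>
        real (steps \<rho>') \<le> real (steps \<rho>) + 15" for \<rho>' :: machine
    have fin: "post \<rho>'"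
      if "nreg \<rho>' t_reg = Suc l" "narr \<rho>' nxt_arr = (narr \<rho> nxt_arr)(l := prev_arc (usrc l) l)"
        "narr \<rho>' tgt_arr = (narr \<rho> tgt_arr)(l := utgt l)" "narr \<rho>' und_arr = (narr \<rho> und_arr)(l := und l)"
        "narr \<rho>' first_arr = (narr \<rho> first_arr)(usrc l := l)" "steps \<rho>' \<le> steps \<rho> + 15" for \<rho>'
      using that * by (auto simp: post_def prev_arc_Suc less_Suc_eq)
    have firsts: "narr \<rho> first_arr x = prev_arc x l" for x using * by simp
    have "wp arc_step post (tick \<rho>)"
    proof (cases "l \<le> m")
      case True
      then have el: "l - Suc 0 = e" "usrc l = tail_of e" "utgt l = head_of e" by (auto simp: e_def und_def usrc_def utgt_def)
      show ?thesis
        using True el e_def[symmetric]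
        by (simp add: arc_step_def wp_simps wp_Skip wp_Seq arrs firsts) (rule fin, simp_all add: arrs)
    next
      case False
      then have el: "l - Suc 0 - m = e" "usrc l = n + head_of e" "utgt l = n + tail_of e"
        by (auto simp: e_def und_def usrc_def utgt_def)
      show ?thesis
        using False el e_def[symmetric]
        by (simp add: arc_step_def wp_simps wp_Skip wp_Seq arrs firsts) (rule fin, simp_all add: arrs)
    qed
    then show "wp arc_step (\<lambda>\<rho>'. nreg \<rho>' t_reg = Suc l \<and> (1 \<le> Suc l \<and>
        (\<forall>r\<in>{1..<Suc l}. narr \<rho>' nxt_arr r = prev_arc (usrc r) r \<and> narr \<rho>' tgt_arr r = utgt r \<and>
        narr \<rho>' und_arr r = und r) \<and> (\<forall>x. narr \<rho>' first_arr x = prev_arc x (Suc l))) \<and>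
        real (steps \<rho>') \<le> real (steps \<rho>) + 15) (tick \<rho>)"
      unfolding post_def .
  next
    fix \<rho> assume *: "1 \<le> Suc (2 * m) \<and> (\<forall>r\<in>{1..<Suc (2 * m)}. narr \<rho> nxt_arr r = prev_arc (usrc r) r \<and> narr \<rho> tgt_arr r = utgt r \<and>
        narr \<rho> und_arr r = und r) \<and> (\<forall>x. narr \<rho> first_arr x = prev_arc x (Suc (2 * m)))" "frame arc_step \<tau> \<rho>"
      "real (steps \<rho>) \<le> real (steps \<tau>) + real (Suc (2 * m) - nreg \<tau> t_reg) * 15 + 1"
    have "frame init_arcs \<sigma> \<rho>"
      using *(2) \<tau>(1) by (simp add: frame_def init_arcs_def)
    moreover have "{1..<Suc (2 * m)} = {1..2 * m}" by auto
    ultimately show "Q \<rho>" using * \<tau> by (intro Q) simp_all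
  qed (use \<tau> in \<open>simp_all add: arc_step_def\<close>)
  show ?thesis
    by (simp add: init_arcs_def wp_simps wp_Skip wp_Seq)
      (rule loop[unfolded One_nat_def], simp_all add: frame_def init_arcs_def)
qed

end

section \<open>Initial search labels\<close>

definition push_arc :: program where
  "push_arc = block [
     NLoad y_reg tgt_arr t_reg,
     NStore work_arr wsp_reg y_reg,
     NArith NAdd wsp_reg wsp_reg one_reg,
     Cond (NLess y_reg n_reg) (NArith NAdd y_reg y_reg n_reg) (NArith NSub y_reg y_reg n_reg),
     NStore work_arr wsp_reg y_reg,
     NArith NAdd wsp_reg wsp_reg one_reg,
     NArith NAdd t_reg t_reg one_reg]"

definition push_com :: program where
  "push_com = block [
     NLoad y_reg source_arr t_reg,
     NStore work_arr wsp_reg y_reg,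
     NArith NAdd wsp_reg wsp_reg one_reg,
     NLoad y_reg sink_arr t_reg,
     NArith NAdd y_reg n_reg y_reg,
     NStore work_arr wsp_reg y_reg,
     NArith NAdd wsp_reg wsp_reg one_reg,
     NArith NAdd t_reg t_reg one_reg]"

definition push_all :: program where
  "push_all = block [
     NConst wsp_reg 0,
     NConst t_reg 1,
     While (NLess t_reg mm_reg) push_arc,
     NConst t_reg 0,
     While (NLess t_reg k_reg) push_com]"

text \<open>At the start every label and cursor is 0, which satisfies \<open>lab_inv\<close> but in
  general not \<open>tight\<close>. With all of \<open>verts2\<close> on the worklist tightness is
  vacuous, and the ordinary repair does the rest.\<close>

definition label_step :: program where
  "label_step = block [enter_center, push_all, fix_labels, NArith NAdd cc_reg cc_reg one_reg]"

definition init_labels :: program where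
  "init_labels = block [NConst cc_reg 0, While (NLess cc_reg N_reg) label_step]"

lemma image_fun_upd_lessThan_Suc: "(f(l := y)) ` {..<Suc l} = insert y (f ` {..<l})"
  by (auto simp: lessThan_Suc)

context mcf_run
begin

text \<open>Pushing the head of every arc together with its mirror image also reaches all tails,
  because tails are mirror images of the heads of opposite copies.\<close>

lemma verts2_eq: "verts2 = utgt ` {1..2 * m} \<union> (mir \<circ> utgt) ` {1..2 * m} \<union>
    (src ` {..<k} \<union> (\<lambda>i. n + snk i) ` {..<k})"
proof -
  have "usrc ` {1..2 * m} = (mir \<circ> utgt) ` {1..2 * m}"
  proof (intro equalityI subsetI)
    fix x assume "x \<in> usrc ` {1..2 * m}"
    then obtain r where r: "r \<in> {1..2 * m}" "x = usrc r" by blast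
    have "x = (mir \<circ> utgt) (opp r)" using opp(3)[OF r(1)] mir_mir[OF usrc_less[OF r(1)]] r(2) by simp
    with opp(1)[OF r(1)] show "x \<in> (mir \<circ> utgt) ` {1..2 * m}" by blast
  next
    fix x assume "x \<in> (mir \<circ> utgt) ` {1..2 * m}"
    then obtain r where r: "r \<in> {1..2 * m}" "x = mir (utgt r)" by auto
    have "x = usrc (opp r)" using opp(2)[OF r(1)] r(2) by simp
    with opp(1)[OF r(1)] show "x \<in> usrc ` {1..2 * m}" by blast
  qed
  then show ?thesis by (auto simp: verts2_def)
qed

lemma push_all_wp:
  assumes st: "static \<sigma>" and mm: "nreg \<sigma> mm_reg = Suc (2 * m)"
    and Q: "\<And>\<sigma>'. frame push_all \<sigma> \<sigma>' \<Longrightarrow> nreg \<sigma>' wsp_reg = 4 * m + 2 * k \<Longrightarrow>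
      narr \<sigma>' work_arr ` {..<4 * m + 2 * k} = verts2 \<Longrightarrow>
      real (steps \<sigma>') \<le> real (steps \<sigma>) + 20 * real m + 10 * real k + 10 \<Longrightarrow> Q \<sigma>'"
  shows "wp push_all Q \<sigma>"
proof -
  let ?V1 = "utgt ` {1..2 * m} \<union> (mir \<circ> utgt) ` {1..2 * m}"
  note defs_simps = push_all_def push_arc_def push_com_def
  have coms: "wp (While (NLess t_reg k_reg) push_com) Q \<tau>"
    if \<tau>: "frame push_all \<sigma> \<tau>" "nreg \<tau> t_reg = 0" "nreg \<tau> wsp_reg = 4 * m"
      "narr \<tau> work_arr ` {..<4 * m} = ?V1" "real (steps \<tau>) \<le> real (steps \<sigma>) + 20 * real m + 8" for \<tau>
  proof (rule wp_For[where L = k and Bd = 10 and Inv = "\<lambda>i \<rho>. nreg \<rho> wsp_reg = 4 * m + 2 * i \<and>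
        narr \<rho> work_arr ` {..<4 * m + 2 * i} = ?V1 \<union> (src ` {..<i} \<union> (\<lambda>i. n + snk i) ` {..<i})"])
    have st': "static \<tau>" by (rule static_frame[OF st \<tau>(1)]) (simp_all add: defs_simps)
    then show "nreg \<tau> k_reg = k" by (simp add: static_def)
    fix \<rho> i assume *: "nreg \<rho> wsp_reg = 4 * m + 2 * i \<and>
        narr \<rho> work_arr ` {..<4 * m + 2 * i} = ?V1 \<union> (src ` {..<i} \<union> (\<lambda>i. n + snk i) ` {..<i})"
      "frame push_com \<tau> \<rho>" "nreg \<rho> t_reg = i" "i < k"
    have st\<rho>: "static \<rho>" by (rule static_frame[OF st' *(2)]) (simp_all add: defs_simps)
    define post where "post \<rho>' \<longleftrightarrow> nreg \<rho>' t_reg = Suc i \<and> (nreg \<rho>' wsp_reg = 4 * m + 2 * Suc i \<and>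
        narr \<rho>' work_arr ` {..<4 * m + 2 * Suc i} = ?V1 \<union> (src ` {..<Suc i} \<union> (\<lambda>i. n + snk i) ` {..<Suc i})) \<and>
        real (steps \<rho>') \<le> real (steps \<rho>) + 10" for \<rho>' :: machine
    have fin: "post \<rho>'"
      if "nreg \<rho>' t_reg = Suc i" "nreg \<rho>' wsp_reg = Suc (Suc (4 * m + 2 * i))"
        "narr \<rho>' work_arr = (narr \<rho> work_arr)(4 * m + 2 * i := src i, Suc (4 * m + 2 * i) := n + snk i)"
        "steps \<rho>' \<le> steps \<rho> + 10" for \<rho>'
    proof -
      have e: "4 * m + 2 * Suc i = Suc (Suc (4 * m + 2 * i))" by simp
      have "narr \<rho>' work_arr ` {..<4 * m + 2 * Suc i} =
          insert (n + snk i) (insert (src i) (narr \<rho> work_arr ` {..<4 * m + 2 * i}))"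
        unfolding e that(3) image_fun_upd_lessThan_Suc ..
      then show ?thesis using that *(1) by (auto simp: post_def lessThan_Suc)
    qed
    have "wp push_com post (tick \<rho>)"
      using *(1)[THEN conjunct1] *(3,4) st\<rho>[unfolded static_def One_nat_def]
      by (simp add: push_com_def wp_simps wp_Skip wp_Seq) (rule fin, simp_all)
    then show "wp push_com (\<lambda>\<rho>'. nreg \<rho>' t_reg = Suc i \<and> (nreg \<rho>' wsp_reg = 4 * m + 2 * Suc i \<and>
        narr \<rho>' work_arr ` {..<4 * m + 2 * Suc i} = ?V1 \<union> (src ` {..<Suc i} \<union> (\<lambda>i. n + snk i) ` {..<Suc i})) \<and>
        real (steps \<rho>') \<le> real (steps \<rho>) + 10) (tick \<rho>)"
      unfolding post_def .
  next
    fix \<rho> assume *: "nreg \<rho> wsp_reg = 4 * m + 2 * k \<and>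
        narr \<rho> work_arr ` {..<4 * m + 2 * k} = ?V1 \<union> (src ` {..<k} \<union> (\<lambda>i. n + snk i) ` {..<k})"
      "frame push_com \<tau> \<rho>" "real (steps \<rho>) \<le> real (steps \<tau>) + real (k - nreg \<tau> t_reg) * 10 + 1"
    have "frame push_all \<sigma> \<rho>" using *(2) \<tau>(1) by (simp add: frame_def push_all_def)
    then show "Q \<rho>" using * \<tau> by (intro Q) (simp_all add: verts2_eq)
  qed (use \<tau> in \<open>simp_all add: push_com_def\<close>)
  have arcs: "wp (While (NLess t_reg mm_reg) push_arc) (wp (NConst t_reg 0) (wp (While (NLess t_reg k_reg) push_com) Q)) \<tau>"
    if \<tau>: "frame push_all \<sigma> \<tau>" "nreg \<tau> t_reg = 1" "nreg \<tau> wsp_reg = 0" "steps \<tau> \<le> steps \<sigma> + 3" for \<tau>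
  proof (rule wp_For[where L = "Suc (2 * m)" and Bd = 10 and Inv = "\<lambda>l \<rho>. 1 \<le> l \<and> nreg \<rho> wsp_reg = 2 * (l - 1) \<and>
        narr \<rho> work_arr ` {..<2 * (l - 1)} = utgt ` {1..<l} \<union> (mir \<circ> utgt) ` {1..<l}"])
    have st': "static \<tau>" by (rule static_frame[OF st \<tau>(1)]) (simp_all add: defs_simps)
    show "nreg \<tau> mm_reg = Suc (2 * m)"
      using frameD(1)[OF \<tau>(1), of mm_reg] mm by (simp add: defs_simps)
    fix \<rho> l assume *: "1 \<le> l \<and> nreg \<rho> wsp_reg = 2 * (l - 1) \<and>
        narr \<rho> work_arr ` {..<2 * (l - 1)} = utgt ` {1..<l} \<union> (mir \<circ> utgt) ` {1..<l}"
      "frame push_arc \<tau> \<rho>" "nreg \<rho> t_reg = l" "l < Suc (2 * m)"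
    have st\<rho>: "static \<rho>" by (rule static_frame[OF st' *(2)]) (simp_all add: defs_simps)
    have l: "l \<in> {1..2 * m}" using * by auto
    have tgt: "narr \<rho> tgt_arr l = utgt l" using st\<rho> l by (simp add: static_def)
    have mir': "utgt l < n \<Longrightarrow> utgt l + n = mir (utgt l)" "\<not> utgt l < n \<Longrightarrow> utgt l - n = mir (utgt l)"
      by (simp_all add: mir_def)
    define a where "a = 2 * (l - 1)"
    define post where "post \<rho>' \<longleftrightarrow> nreg \<rho>' t_reg = Suc l \<and> (1 \<le> Suc l \<and> nreg \<rho>' wsp_reg = 2 * (Suc l - 1) \<and>
        narr \<rho>' work_arr ` {..<2 * (Suc l - 1)} = utgt ` {1..<Suc l} \<union> (mir \<circ> utgt) ` {1..<Suc l}) \<and>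
        real (steps \<rho>') \<le> real (steps \<rho>) + 10" for \<rho>' :: machine
    have fin: "post \<rho>'"
      if "nreg \<rho>' t_reg = Suc l" "nreg \<rho>' wsp_reg = Suc (Suc a)"
        "narr \<rho>' work_arr = (narr \<rho> work_arr)(a := utgt l, Suc a := mir (utgt l))"
        "steps \<rho>' \<le> steps \<rho> + 10" for \<rho>'
    proof -
      have e: "2 * (Suc l - 1) = Suc (Suc a)" using l by (cases l) (simp_all add: a_def)
      have r: "{1..<Suc l} = insert l {1..<l}" using l by auto
      have "narr \<rho>' work_arr ` {..<2 * (Suc l - 1)} =
          insert (mir (utgt l)) (insert (utgt l) (narr \<rho> work_arr ` {..<a}))"
        unfolding e that(3) image_fun_upd_lessThan_Suc ..
      also have "\<dots> = utgt ` {1..<Suc l} \<union> (mir \<circ> utgt) ` {1..<Suc l}"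
        using *(1) unfolding r a_def by auto
      finally show ?thesis using that e unfolding post_def by simp
    qed
    have "nreg \<rho> wsp_reg = a" using * by (simp add: a_def)
    then have "wp push_arc post (tick \<rho>)"
      using *(3) tgt st\<rho>[unfolded static_def One_nat_def] mir'
      by (cases "utgt l < n"; simp add: push_arc_def wp_simps wp_Skip wp_Seq)
        (rule fin; simp)+
    then show "wp push_arc (\<lambda>\<rho>'. nreg \<rho>' t_reg = Suc l \<and> (1 \<le> Suc l \<and> nreg \<rho>' wsp_reg = 2 * (Suc l - 1) \<and>
        narr \<rho>' work_arr ` {..<2 * (Suc l - 1)} = utgt ` {1..<Suc l} \<union> (mir \<circ> utgt) ` {1..<Suc l}) \<and>
        real (steps \<rho>') \<le> real (steps \<rho>) + 10) (tick \<rho>)"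
      unfolding post_def .
  next
    fix \<rho> assume *: "1 \<le> Suc (2 * m) \<and> nreg \<rho> wsp_reg = 2 * (Suc (2 * m) - 1) \<and>
        narr \<rho> work_arr ` {..<2 * (Suc (2 * m) - 1)} = utgt ` {1..<Suc (2 * m)} \<union> (mir \<circ> utgt) ` {1..<Suc (2 * m)}"
      "frame push_arc \<tau> \<rho>" "real (steps \<rho>) \<le> real (steps \<tau>) + real (Suc (2 * m) - nreg \<tau> t_reg) * 10 + 1"
    have "frame push_all \<sigma> (set_nreg t_reg 0 (tick \<rho>))"
      using *(2) \<tau>(1) by (simp add: frame_def push_all_def)
    then show "wp (NConst t_reg 0) (wp (While (NLess t_reg k_reg) push_com) Q) \<rho>"
      using * \<tau> unfolding wp_simps
      by (intro coms) (simp_all add: atLeastLessThanSuc_atLeastAtMost)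
  qed (use \<tau> in \<open>simp_all add: push_arc_def\<close>)
  show ?thesis
    by (simp add: push_all_def wp_simps wp_Skip wp_Seq)
      (rule arcs[unfolded One_nat_def], simp_all add: frame_def push_all_def)
qed

lemma init_labels_wp:
  assumes st: "static \<sigma>" and mm: "nreg \<sigma> mm_reg = Suc (2 * m)"
    and inv: "lab_inv (rarr \<sigma> lab_rarr) (narr \<sigma> cur_arr) (rarr \<sigma> wr_rarr)"
    and Q: "\<And>\<sigma>'. frame init_labels \<sigma> \<sigma>' \<Longrightarrow>
      labels_ok (rarr \<sigma>' lab_rarr) (narr \<sigma>' cur_arr) (rarr \<sigma>' wr_rarr) \<Longrightarrow>
      real (steps \<sigma>') + 20 * pot (rarr \<sigma>' lab_rarr) (narr \<sigma>' cur_arr) \<le>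
        real (steps \<sigma>) + 20 * pot (rarr \<sigma> lab_rarr) (narr \<sigma> cur_arr) +
        real N * (100 * real m + 50 * real k + 30) + 2 \<Longrightarrow> Q \<sigma>'"
  shows "wp init_labels Q \<sigma>"
proof -
  define \<sigma>0 where "\<sigma>0 = set_nreg cc_reg 0 (tick \<sigma>)"
  let ?Bd = "100 * real m + 50 * real k + 30"
  define Inv where "Inv j \<sigma>' \<longleftrightarrow>
     lab_inv (rarr \<sigma>' lab_rarr) (narr \<sigma>' cur_arr) (rarr \<sigma> wr_rarr) \<and>
     (\<forall>c<min N j. tight (rarr \<sigma>' lab_rarr) (narr \<sigma>' cur_arr) (rarr \<sigma> wr_rarr) c {})"
    for j :: nat and \<sigma>' :: machine
  note defs_simps = label_step_def enter_center_def push_all_def push_arc_def push_com_def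
    fix_labels_def fix_step_def scan_def scan_step_def
  have "wp (While (NLess cc_reg N_reg) label_step) Q \<sigma>0"
  proof (rule wp_For_pot[where Inv = Inv and L = N and Bd = ?Bd and
        \<phi> = "\<lambda>\<sigma>. 20 * pot (rarr \<sigma> lab_rarr) (narr \<sigma> cur_arr)"])
    show "Inv (nreg \<sigma>0 cc_reg) \<sigma>0" using inv by (simp add: Inv_def \<sigma>0_def)
    show "nreg \<sigma>0 N_reg = N" using st by (simp add: \<sigma>0_def static_def)
    show "nreg \<sigma>0 cc_reg \<le> N" by (simp add: \<sigma>0_def)
    show "N_reg \<notin> wrN label_step" by (simp add: defs_simps)
    show "Inv j (tick \<sigma>') = Inv j \<sigma>'" for j \<sigma>' by (simp add: Inv_def)
    show "0 \<le> 20 * pot (rarr \<sigma>' lab_rarr) (narr \<sigma>' cur_arr)" if "Inv j \<sigma>'" for \<sigma>' j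
      using pot_nonneg that by (auto simp: Inv_def)
    have st0: "static \<sigma>0" using st by (simp add: \<sigma>0_def static_def)
    fix \<sigma>' j
    assume fr: "frame label_step \<sigma>0 \<sigma>'"
    have st': "static \<sigma>'" by (rule static_frame[OF st0 fr]) (simp_all add: defs_simps)
    have fr': "rarr \<sigma>' wr_rarr = rarr \<sigma> wr_rarr" "nreg \<sigma>' mm_reg = Suc (2 * m)"
      using frameD(4)[OF fr, of wr_rarr] frameD(1)[OF fr, of mm_reg] mm by (simp_all add: defs_simps \<sigma>0_def)
    {
      assume Inv: "Inv N \<sigma>'"
        and steps: "real (steps \<sigma>') + 20 * pot (rarr \<sigma>' lab_rarr) (narr \<sigma>' cur_arr) \<le>
          real (steps \<sigma>0) + 20 * pot (rarr \<sigma>0 lab_rarr) (narr \<sigma>0 cur_arr) + real (N - nreg \<sigma>0 cc_reg) * ?Bd + 1"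
      have "frame init_labels \<sigma> \<sigma>'" using fr by (simp add: frame_def init_labels_def \<sigma>0_def)
      then show "Q \<sigma>'"
        using Inv steps fr' by (intro Q) (simp_all add: Inv_def labels_ok_def \<sigma>0_def)
    }
    assume Inv: "Inv j \<sigma>'" and j: "nreg \<sigma>' cc_reg = j" "j < N"
    have inv': "lab_inv (rarr \<sigma>' lab_rarr) (narr \<sigma>' cur_arr) (rarr \<sigma> wr_rarr)"
      and t': "\<And>c. c < j \<Longrightarrow> tight (rarr \<sigma>' lab_rarr) (narr \<sigma>' cur_arr) (rarr \<sigma> wr_rarr) c {}"
      using Inv j by (auto simp: Inv_def)
    define post where "post \<tau> \<longleftrightarrow> nreg \<tau> cc_reg = Suc j \<and> Inv (Suc j) \<tau> \<and>
             real (steps \<tau>) + 20 * pot (rarr \<tau> lab_rarr) (narr \<tau> cur_arr)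
             \<le> real (steps \<sigma>') + 20 * pot (rarr \<sigma>' lab_rarr) (narr \<sigma>' cur_arr) + ?Bd" for \<tau> :: machine
    have q: "1 + real (Suc j) / (real K * real N) = q j" by (simp add: q_def)
    have key: "wp push_all (wp fix_labels (wp (NArith NAdd cc_reg cc_reg one_reg) post)) \<tau>"
      if \<tau>: "frame label_step \<sigma>' \<tau>" "rarr \<tau> = rarr \<sigma>'" "narr \<tau> = narr \<sigma>'"
        "nreg \<tau> base_reg = j * (2 * n)" "rreg \<tau> q_rr = q j" "nreg \<tau> v_reg = cent j"
        "nreg \<tau> v2_reg = n + cent j" "steps \<tau> \<le> steps \<sigma>' + 8" "nreg \<tau> cc_reg = j" for \<tau>
    proof (rule push_all_wp)
      show st\<tau>: "static \<tau>" by (rule static_frame[OF st' \<tau>(1)]) (simp_all add: defs_simps)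
      show "nreg \<tau> mm_reg = Suc (2 * m)" using frameD(1)[OF \<tau>(1), of mm_reg] fr' by (simp add: defs_simps)
      fix \<rho> assume fr\<rho>: "frame push_all \<tau> \<rho>" and wsp: "nreg \<rho> wsp_reg = 4 * m + 2 * k"
        and wk: "narr \<rho> work_arr ` {..<4 * m + 2 * k} = verts2"
        and steps\<rho>: "real (steps \<rho>) \<le> real (steps \<tau>) + 20 * real m + 10 * real k + 10"
      have eq: "rarr \<rho> = rarr \<sigma>'" "narr \<rho> cur_arr = narr \<sigma>' cur_arr"
        "nreg \<rho> base_reg = j * (2 * n)" "rreg \<rho> q_rr = q j" "nreg \<rho> v_reg = cent j"
        "nreg \<rho> v2_reg = n + cent j" "nreg \<rho> cc_reg = j"
        using frameD[OF fr\<rho>] \<tau> by (auto simp: defs_simps)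
      show "wp fix_labels (wp (NArith NAdd cc_reg cc_reg one_reg) post) \<rho>"
      proof (rule fix_wp[where c = j])
        show st\<rho>: "static \<rho>" by (rule static_frame[OF st\<tau> fr\<rho>]) (simp_all add: defs_simps)
        show "lab_inv (rarr \<rho> lab_rarr) (narr \<rho> cur_arr) (rarr \<rho> wr_rarr)"
          using inv' eq fr' by simp
        show "narr \<rho> work_arr p \<in> verts2" if "p < nreg \<rho> wsp_reg" for p
          using that wk wsp by auto
        show "tight (rarr \<rho> lab_rarr) (narr \<rho> cur_arr) (rarr \<rho> wr_rarr) j
            (narr \<rho> work_arr ` {..<nreg \<rho> wsp_reg})"
          unfolding wsp wk by (simp add: tight_def)
        fix \<rho>' assume fr\<rho>': "frame fix_labels \<rho> \<rho>'"
          and R: "lab_inv (rarr \<rho>' lab_rarr) (narr \<rho>' cur_arr) (rarr \<rho>' wr_rarr)"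
            "tight (rarr \<rho>' lab_rarr) (narr \<rho>' cur_arr) (rarr \<rho>' wr_rarr) j {}"
            "\<And>c' x. c' \<noteq> j \<Longrightarrow> x < 2 * n \<Longrightarrow> rarr \<rho>' lab_rarr (cell c' x) = rarr \<rho> lab_rarr (cell c' x) \<and>
              narr \<rho>' cur_arr (cell c' x) = narr \<rho> cur_arr (cell c' x)"
            "real (steps \<rho>') + 20 * pot (rarr \<rho>' lab_rarr) (narr \<rho>' cur_arr) \<le>
              real (steps \<rho>) + 20 * pot (rarr \<rho> lab_rarr) (narr \<rho> cur_arr) + 20 * real (nreg \<rho> wsp_reg) + 1"
        have eq': "nreg \<rho>' cc_reg = j" "nreg \<rho>' one_reg = 1" "rarr \<rho>' wr_rarr = rarr \<sigma> wr_rarr"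
          using frameD[OF fr\<rho>'] eq fr' st\<rho> by (simp_all add: defs_simps static_def)
        have "tight (rarr \<rho>' lab_rarr) (narr \<rho>' cur_arr) (rarr \<sigma> wr_rarr) c {}" if "c < N" "c < Suc j" for c
        proof (cases "c = j")
          case True
          with R(2) eq' show ?thesis by simp
        next
          case False
          with that have "c < j" by simp
          show ?thesis
            by (rule tight_cong[OF t'[OF \<open>c < j\<close>] inv' that(1)]) (use R(3)[OF False] eq in auto)
        qed
        then show "wp (NArith NAdd cc_reg cc_reg one_reg) post \<rho>'"
          using R(1,4) eq eq' \<tau> wsp steps\<rho> by (simp add: wp_simps post_def Inv_def)
      qed (use eq j in auto)
    qed
    have "wp label_step post (tick \<sigma>')"
      using j fr' st'[unfolded static_def] q
      by (simp add: label_step_def enter_center_def wp_simps wp_Skip wp_Seq)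
        (rule key, simp_all add: frame_def defs_simps)
    then show "wp label_step (\<lambda>\<tau>. nreg \<tau> cc_reg = Suc j \<and> Inv (Suc j) \<tau> \<and>
             real (steps \<tau>) + 20 * pot (rarr \<tau> lab_rarr) (narr \<tau> cur_arr)
             \<le> real (steps \<sigma>') + 20 * pot (rarr \<sigma>' lab_rarr) (narr \<sigma>' cur_arr) + ?Bd) (tick \<sigma>')"
      unfolding post_def .
  qed simp_all
  then show ?thesis
    by (simp add: init_labels_def wp_simps wp_Skip \<sigma>0_def)
qed

end

definition init :: program where
  "init = block [init_constants, init_capacity, init_weights, init_demands, init_arcs, init_labels]"

context mcf_run
begin

definition start :: "astate \<Rightarrow> bool" where
  "start s \<longleftrightarrow> labels_ok (alab s) (acur s) (awr s) \<and> (\<forall>j<m. aw s j = \<delta> / cap j \<and> awr s j = \<delta> / cap j) \<and>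
     (\<forall>i<k. ath s i = d0) \<and> (\<forall>j. af s j = 0) \<and> ai s = 0 \<and> ap s = 0 \<and> ac s = 0 \<and> adn s = 0 \<and>
     arem s = sig 0 * d 0"

lemma init_wp:
  assumes ok: "input_ok \<sigma>" and cents: "\<And>c. c < N \<Longrightarrow> narr \<sigma> cent_arr c = cent c"
    and zero: "narr \<sigma> first_arr = (\<lambda>_. 0)" "narr \<sigma> cur_arr = (\<lambda>_. 0)" "rarr \<sigma> lab_rarr = (\<lambda>_. 0)"
      "rarr \<sigma> flow_rarr = (\<lambda>_. 0)"
    and Q: "\<And>\<sigma>'. static \<sigma>' \<Longrightarrow> rreg \<sigma>' sigma_rr = sig (nreg \<sigma>' p_reg) \<Longrightarrow> start (abs_state \<sigma>') \<Longrightarrow>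
      real (steps \<sigma>') + 20 * pot (alab (abs_state \<sigma>')) (acur (abs_state \<sigma>')) \<le>
        real (steps \<sigma>) + 20 * pot (\<lambda>_. 0) (\<lambda>_. 0) +
        real N * (100 * real m + 50 * real k + 30) + 4 * real T + 42 * real m + 7 * real k + 90 \<Longrightarrow> Q \<sigma>'"
  shows "wp init Q \<sigma>"
proof -
  have "wp init_constants (wp init_capacity (wp init_weights (wp init_demands (wp init_arcs (wp init_labels Q))))) \<sigma>"
  proof (rule init_constants_wp[OF ok])
    note defs_simps = init_constants_def delta_step_def init_capacity_def max_step_def init_weights_def weight_step_def
      init_demands_def demand_step_def init_arcs_def arc_step_def init_labels_def label_step_def enter_center_def
      push_all_def push_arc_def push_com_def fix_labels_def fix_step_def scan_def scan_step_def
    fix \<sigma>1 assume f1: "frame init_constants \<sigma> \<sigma>1" and r1: "nreg \<sigma>1 nn_reg = 2 * n" "rreg \<sigma>1 one_rr = 1"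
      "rreg \<sigma>1 kappa_rr = \<kappa>" "rreg \<sigma>1 kappa1_rr = 1 + \<kappa>" "rreg \<sigma>1 KN_rr = real K * real N"
      "rreg \<sigma>1 T_rr = T'" "rreg \<sigma>1 fac_rr = 1 + 1 / (2 * T')" "nreg \<sigma>1 mm_reg = Suc (2 * m)"
      "nreg \<sigma>1 c_reg = 0" "rreg \<sigma>1 Theta_rr = \<Theta>" "rreg \<sigma>1 delta_rr = \<delta>"
      and s1: "real (steps \<sigma>1) \<le> real (steps \<sigma>) + 4 * real T + 30"
    have ok1: "input_ok \<sigma>1" by (rule input_ok_frame[OF ok f1]) (simp_all add: defs_simps)
    show "wp init_capacity (wp init_weights (wp init_demands (wp init_arcs (wp init_labels Q)))) \<sigma>1"
    proof (rule init_capacity_wp[OF ok1 r1(2,11)])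
      fix \<sigma>2 assume f2: "frame init_capacity \<sigma>1 \<sigma>2" and d0: "rreg \<sigma>2 d0_rr = d0"
        and s2: "real (steps \<sigma>2) \<le> real (steps \<sigma>1) + 6 * real m + 10"
      have ok2: "input_ok \<sigma>2" by (rule input_ok_frame[OF ok1 f2]) (simp_all add: defs_simps)
      have r2: "rreg \<sigma>2 delta_rr = \<delta>" "rreg \<sigma>2 one_rr = 1" using frameD(2)[OF f2] r1 by (simp_all add: defs_simps)
      show "wp init_weights (wp init_demands (wp init_arcs (wp init_labels Q))) \<sigma>2"
      proof (rule init_weights_wp[OF ok2 r2(1)])
        fix \<sigma>3 assume f3: "frame init_weights \<sigma>2 \<sigma>3"
          and w: "\<And>j. j < m \<Longrightarrow> rarr \<sigma>3 w_rarr j = \<delta> / cap j \<and> rarr \<sigma>3 wr_rarr j = \<delta> / cap j"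
          and s3: "real (steps \<sigma>3) \<le> real (steps \<sigma>2) + 6 * real m + 10"
        have ok3: "input_ok \<sigma>3" by (rule input_ok_frame[OF ok2 f3]) (simp_all add: defs_simps)
        have r3: "rreg \<sigma>3 one_rr = 1" "rreg \<sigma>3 d0_rr = d0"
          using frameD(2)[OF f3] r2 d0 by (simp_all add: defs_simps)
        show "wp init_demands (wp init_arcs (wp init_labels Q)) \<sigma>3"
        proof (rule init_demands_wp[OF ok3 r3])
          fix \<sigma>4 assume f4: "frame init_demands \<sigma>3 \<sigma>4" and th: "\<And>i. i < k \<Longrightarrow> rarr \<sigma>4 theta_rarr i = d0"
            and r4: "rreg \<sigma>4 sigma_rr = sig 0" "rreg \<sigma>4 rem_rr = sig 0 * d 0"
            and s4: "real (steps \<sigma>4) \<le> real (steps \<sigma>3) + 7 * real k + 20"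
          have ok4: "input_ok \<sigma>4" by (rule input_ok_frame[OF ok3 f4]) (simp_all add: defs_simps)
          have mm4: "nreg \<sigma>4 mm_reg = Suc (2 * m)"
            using frameD(1)[OF f4, of mm_reg] frameD(1)[OF f3, of mm_reg] frameD(1)[OF f2, of mm_reg] r1
            by (simp add: defs_simps)
          have first4: "narr \<sigma>4 first_arr x = 0" for x
            using frameD(3)[OF f4, of first_arr] frameD(3)[OF f3, of first_arr] frameD(3)[OF f2, of first_arr]
              frameD(3)[OF f1, of first_arr] zero
            by (simp add: defs_simps)
          show "wp init_arcs (wp init_labels Q) \<sigma>4"
          proof (rule init_arcs_wp[OF ok4 mm4 first4])
            fix \<sigma>5 assume f5: "frame init_arcs \<sigma>4 \<sigma>5"
              and arcs: "\<And>r. r \<in> {1..2 * m} \<Longrightarrow> narr \<sigma>5 nxt_arr r = prev_arc (usrc r) r \<and> narr \<sigma>5 tgt_arr r = utgt r \<and>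
                narr \<sigma>5 und_arr r = und r" "\<And>x. narr \<sigma>5 first_arr x = prev_arc x (Suc (2 * m))"
              and s5: "real (steps \<sigma>5) \<le> real (steps \<sigma>4) + 30 * real m + 10"
            have ok5: "input_ok \<sigma>5" by (rule input_ok_frame[OF ok4 f5]) (simp_all add: defs_simps)
            note frN = frameD(1)[OF f5] frameD(1)[OF f4] frameD(1)[OF f3] frameD(1)[OF f2]
              and frR = frameD(2)[OF f5] frameD(2)[OF f4] frameD(2)[OF f3] frameD(2)[OF f2]
              and frNA = frameD(3)[OF f5] frameD(3)[OF f4] frameD(3)[OF f3] frameD(3)[OF f2] frameD(3)[OF f1]
              and frRA = frameD(4)[OF f5] frameD(4)[OF f4] frameD(4)[OF f3] frameD(4)[OF f2] frameD(4)[OF f1]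
            have n5: "nreg \<sigma>5 nn_reg = 2 * n" "nreg \<sigma>5 mm_reg = Suc (2 * m)" "nreg \<sigma>5 c_reg = 0"
              using r1 by (simp_all add: frN defs_simps)
            have R5: "rreg \<sigma>5 one_rr = 1"
              "rreg \<sigma>5 kappa_rr = \<kappa>" "rreg \<sigma>5 kappa1_rr = 1 + \<kappa>" "rreg \<sigma>5 KN_rr = real K * real N"
              "rreg \<sigma>5 T_rr = T'" "rreg \<sigma>5 fac_rr = 1 + 1 / (2 * T')" "rreg \<sigma>5 Theta_rr = \<Theta>"
              using r1 by (simp_all add: frR defs_simps)
            have R5': "rreg \<sigma>5 d0_rr = d0" "rreg \<sigma>5 sigma_rr = sig 0" "rreg \<sigma>5 rem_rr = sig 0 * d 0"
              using r3(2) r4 frameD(2)[OF f5] frameD(2)[OF f4, of d0_rr] by (simp_all add: defs_simps)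
            have A5: "narr \<sigma>5 cent_arr = narr \<sigma> cent_arr" "narr \<sigma>5 cur_arr = (\<lambda>_. 0)"
              using zero(2) by (simp_all add: frNA defs_simps)
            have A5': "rarr \<sigma>5 lab_rarr = (\<lambda>_. 0)" "rarr \<sigma>5 flow_rarr = (\<lambda>_. 0)"
              using zero by (simp_all add: frRA defs_simps)
            have W5: "rarr \<sigma>5 w_rarr = rarr \<sigma>3 w_rarr" "rarr \<sigma>5 wr_rarr = rarr \<sigma>3 wr_rarr"
              "rarr \<sigma>5 theta_rarr = rarr \<sigma>4 theta_rarr"
              using frameD(4)[OF f5] frameD(4)[OF f4, of w_rarr] frameD(4)[OF f4, of wr_rarr] by (simp_all add: defs_simps)
            have st5: "static \<sigma>5"
              using ok5 n5 R5 R5' A5 cents arcs unfolding static_def input_ok_def by simp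
            \<comment> \<open>Zero labels lie below positive weights, so all arcs are inadmissible
              and a cursor at 0 is correct everywhere.\<close>
            have inv5: "lab_inv (rarr \<sigma>5 lab_rarr) (narr \<sigma>5 cur_arr) (rarr \<sigma>5 wr_rarr)"
            proof -
              have wr: "d0 \<le> rarr \<sigma>5 wr_rarr j" if "j < m" for j
                using w[OF that] W5 cap_le_U[OF that] cap_ge_1[OF that] delta_pos
                by (auto simp: d0_def intro!: divide_left_mono)
              have wr0: "0 < rarr \<sigma>5 wr_rarr (und r)" if "r \<in> {1..2 * m}" for r
                using wr[OF und_less[OF that]] d0_pos by simp
              show ?thesis
                unfolding lab_inv_def A5 A5' using wr wr0 less_imp_le[OF less_trans[OF zero_less_one q_gt_1]] Theta_ge
                by (auto intro!: mult_nonneg_nonneg less_imp_le[OF wr0])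
            qed
            show "wp init_labels Q \<sigma>5"
            proof (rule init_labels_wp[OF st5 n5(2) inv5])
              fix \<sigma>6 assume f6: "frame init_labels \<sigma>5 \<sigma>6"
                and lab: "labels_ok (rarr \<sigma>6 lab_rarr) (narr \<sigma>6 cur_arr) (rarr \<sigma>6 wr_rarr)"
                and s6: "real (steps \<sigma>6) + 20 * pot (rarr \<sigma>6 lab_rarr) (narr \<sigma>6 cur_arr) \<le>
                  real (steps \<sigma>5) + 20 * pot (rarr \<sigma>5 lab_rarr) (narr \<sigma>5 cur_arr) +
                  real N * (100 * real m + 50 * real k + 30) + 2"
              have st6: "static \<sigma>6" by (rule static_frame[OF st5 f6]) (simp_all add: defs_simps)
              have n6: "nreg \<sigma>6 i_reg = 0" "nreg \<sigma>6 p_reg = 0" "nreg \<sigma>6 c_reg = 0" "nreg \<sigma>6 done_reg = 0"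
                using frameD(1)[OF f6] ok5 n5 by (simp_all add: input_ok_def defs_simps)
              have R6: "rreg \<sigma>6 sigma_rr = sig 0" "rreg \<sigma>6 rem_rr = sig 0 * d 0"
                using frameD(2)[OF f6] R5' by (simp_all add: defs_simps)
              have A6: "rarr \<sigma>6 w_rarr = rarr \<sigma>3 w_rarr" "rarr \<sigma>6 wr_rarr = rarr \<sigma>3 wr_rarr"
                "rarr \<sigma>6 theta_rarr = rarr \<sigma>4 theta_rarr" "rarr \<sigma>6 flow_rarr = (\<lambda>_. 0)"
                using frameD(4)[OF f6] W5 A5' by (simp_all add: defs_simps)
              have "start (abs_state \<sigma>6)"
                using lab w th n6 R6 A6 by (simp add: start_def abs_state_def)
              then show "Q \<sigma>6"
                using s1 s2 s3 s4 s5 s6 R6 n6 A5 A5'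
                by (intro Q st6) (simp_all add: abs_state_def)
            qed
          qed
        qed
      qed
    qed
  qed
  then show ?thesis by (simp only: init_def block.simps wp_Seq wp_Skip)
qed

lemma start_main_inv:
  assumes s: "start s"
  shows "main_inv s"
proof -
  have w: "weights_ok (aw s) (awr s)"
    unfolding weights_ok_def
  proof (intro allI impI)
    fix j assume j: "j < m"
    define x where "x = \<delta> / cap j"
    have "0 < x" using delta_pos cap_ge_1[OF j] by (simp add: x_def)
    moreover have "aw s j = x" "awr s j = x" using s j by (simp_all add: start_def x_def)
    ultimately show "awr s j \<le> aw s j \<and> aw s j < awr s j * (1 + \<kappa>)"
      using kappa_pos by simp
  qed
  have wc: "aw s j * cap j = \<delta>" if "j < m" for j
    using s that cap_ge_1[OF that] by (simp add: start_def)
  have us: "usage (af s) j = 0" for j using s by (simp add: start_def usage_def)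
  have d1: "\<delta> < 1" using kappa_pos T_pos by (simp add: \<delta>_def divide_less_eq one_less_power)
  have g: "growth_ok s"
    unfolding growth_ok_def using delta_pos wc us kappa_pos by (auto intro: order_trans[OF _ one_le_power])
  have "routed s i = 0" if "i < k" for i
    using s by (simp add: routed_def in_round_def shipped_def start_def)
  then have f: "flow_ok s" using s by (simp add: flow_ok_def start_def)
  have th: "d0 \<le> \<Theta>" "d0 \<le> \<Theta> * (1 + \<kappa>)"
  proof -
    show "d0 \<le> \<Theta>" using d0_pos Theta_ge by simp
    also have "\<Theta> * 1 \<le> \<Theta> * (1 + \<kappa>)" using kappa_pos Theta_ge by (intro mult_left_mono) auto
    finally show "d0 \<le> \<Theta> * (1 + \<kappa>)" by simp
  qed
  show ?thesis
    unfolding main_inv_def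
    using s w g f th wc d1 k_pos sig_pos[of 0] d_pos[of 0] by (simp add: start_def)
qed

section \<open>Initial values of potential and invariants\<close>

definition "weight_sum = (\<Sum>x\<in>verts2. weight x)"

lemma sum_deg_le:
  assumes "finite X"
  shows "(\<Sum>x\<in>X. deg x) \<le> 2 * m"
proof -
  have "(\<Sum>x\<in>X. deg x) = card (\<Union>x\<in>X. {r\<in>{1..2 * m}. usrc r = x})"
    unfolding deg_def using assms by (subst card_UN_disjoint) auto
  also have "\<dots> \<le> card {1..2 * m}" by (intro card_mono) auto
  finally show ?thesis by simp
qed

lemma card_verts2: "card verts2 \<le> 4 * m + 2 * k"
proof -
  let ?A = "usrc ` {1..2 * m}" and ?B = "utgt ` {1..2 * m}" and ?C = "src ` {..<k}" and ?D = "(\<lambda>i. n + snk i) ` {..<k}"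
  have "card (?A \<union> ?B \<union> ?C \<union> ?D) \<le> card ?A + card ?B + card ?C + card ?D"
    by (meson add_mono_thms_linordered_semiring(1) card_Un_le order_refl order_trans)
  moreover have "card ?A \<le> 2 * m" "card ?B \<le> 2 * m"
    using card_image_le[of "{1..2 * m}" usrc] card_image_le[of "{1..2 * m}" utgt] by auto
  moreover have "card ?C \<le> k" "card ?D \<le> k"
    using card_image_le[of "{..<k}" src] card_image_le[of "{..<k}" "\<lambda>i. n + snk i"] by auto
  ultimately show ?thesis unfolding verts2_def by linarith
qed

lemma weight_sum_le: "weight_sum \<le> 10 * real m + 2 * real k"
proof -
  have inj: "inj_on mir verts2"
    by (rule inj_on_inverseI[where g = mir]) (use verts2_less mir_mir in auto)
  have "(\<Sum>x\<in>verts2. real (deg x)) \<le> real (2 * m)"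
    using sum_deg_le[OF finite_verts2] by (simp flip: of_nat_sum)
  moreover have "(\<Sum>x\<in>verts2. real (deg (mir x))) \<le> real (2 * m)"
    using sum_deg_le[of "mir ` verts2"] finite_verts2 by (simp add: sum.reindex[OF inj] flip: of_nat_sum)
  moreover have "real (card verts2) \<le> 4 * real m + 2 * real k" using card_verts2 by linarith
  ultimately show ?thesis
    by (simp add: weight_sum_def weight_def sum.distrib flip: sum_distrib_left)
qed

lemma pot_zero: "pot (\<lambda>_. 0) (\<lambda>_. 0) = (\<Sum>c<N. cnt_max c) * weight_sum"
  unfolding pot_def weight_sum_def sum_product sum.cartesian_product
  by (intro sum.cong) (auto simp: pot1_def cnt_def rest_def)

lemma ev_pot_start:
  assumes "start s"
  shows "ev_pot (awr s) = real m * T'"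
proof -
  have k1: "ln (1 + \<kappa>) > 0" using kappa_pos by simp
  have "ln ((1 + \<kappa>)\<^sup>2 / (cap j * awr s j)) / ln (1 + \<kappa>) = T'" if "j < m" for j
  proof -
    have "cap j * awr s j = \<delta>" using assms that cap_ge_1[OF that] by (simp add: start_def)
    then have "(1 + \<kappa>)\<^sup>2 / (cap j * awr s j) = (1 + \<kappa>) ^ (T + 2)"
      unfolding power_add by (simp add: \<delta>_def mult.commute)
    then have "ln ((1 + \<kappa>)\<^sup>2 / (cap j * awr s j)) = real (T + 2) * ln (1 + \<kappa>)"
      using kappa_pos ln_realpow[of "1 + \<kappa>" "T + 2"] by (simp only:)
    then show ?thesis using k1 by (simp add: T'_def)
  qed
  then show ?thesis unfolding ev_pot_def by simp
qed

lemma psi_start: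
  assumes s: "start s"
  shows "psi s = 20 * pot (alab s) (acur s) + ev_cost * (real m * T') + 25 * real N +
    (25 * real N + 40) * (real k * lvl d0) + (25 * real N + 60 + c_aug) * (rounds_max * real k) +
    c_aug + c_aug * (real m * T')"
proof -
  have "0 < arem s" using s sig_pos[of 0] d_pos[of 0] k_pos by (simp add: start_def)
  moreover have "slack s = real m * T'" using s by (simp add: slack_def usage_def start_def)
  moreover have "(\<Sum>i<k. lvl (ath s i)) = real k * lvl d0" using s by (simp add: start_def)
  ultimately show ?thesis
    using s ev_pot_start[OF s] by (simp add: psi_def work_pot_def start_def)
qed

end

context mcf_good
begin

text \<open>Initially \<open>Phi = m * \<delta> = Gam 0\<close>. The threshold \<open>d0\<close> is
  at most any arc weight, hence at most the length of any decomposition path, which has an arc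
  because source and sink differ.\<close>

lemma start_good:
  assumes s: "start s"
  shows "good s"
proof -
  have "Phi (aw s) = (\<Sum>j<m. \<delta>)"
    unfolding Phi_def
  proof (intro sum.cong refl)
    show "cap j * aw s j = \<delta>" if "j \<in> {..<m}" for j
      using s that cap_ge_1[of j] by (simp add: start_def)
  qed
  then have "Phi (aw s) = Gam (ap s)" using s by (simp add: Gam_def start_def shipped_def)
  moreover have "in_round s i = 0" for i using s by (simp add: in_round_def start_def)
  moreover have "d0 \<le> (1 + \<kappa>) * exp \<kappa> * pdist (aw s) i" if i: "i < k" for i
  proof -
    obtain a P where P: "(a, P) \<in> set (ps i)" "pdist (aw s) i = plen (aw s) P" using pdist_attained[OF i] .
    have "P \<noteq> []" using ps_path[OF i P(1)] src_snk[OF i] by auto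
    then obtain j P' where jP: "P = j # P'" by (cases P) auto
    have P': "set P \<subseteq> {..<m}" using ps_path[OF i P(1)] by simp
    have w: "d0 \<le> aw s j" if "j < m" for j
      using s that cap_le_U[OF that] cap_ge_1[OF that] delta_pos
      by (auto simp: start_def d0_def intro!: divide_left_mono)
    have "0 \<le> plen (aw s) P'"
      unfolding plen_def using P' jP w d0_pos by (intro sum_list_nonneg) (auto, metis lessThan_iff less_imp_le order_trans subsetD)
    then have "d0 \<le> pdist (aw s) i"
      using w[of j] P' by (simp add: P(2) jP plen_def)
    also have "1 * pdist (aw s) i \<le> (1 + \<kappa>) * exp \<kappa> * pdist (aw s) i"
      using kappa_pos d0_pos \<open>d0 \<le> pdist (aw s) i\<close> mult_mono[of 1 "1 + \<kappa>" 1 "exp \<kappa>"]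
      by (intro mult_right_mono) auto
    finally show ?thesis by simp
  qed
  ultimately show ?thesis using s by (simp add: good_def start_def)
qed

end

section \<open>The complete algorithm\<close>

definition run :: program where
  "run = block [init, While (NEq done_reg zero_reg) step]"

lemma sum_inverse_Suc_le:
  assumes "1 \<le> N"
  shows "(\<Sum>c<N. 1 / real (Suc c)) \<le> 1 + ln (real N)"
  using assms
proof (induction N rule: dec_induct)
  case (step N)
  have "1 / real (Suc N) \<le> ln (1 + 1 / real N)"
    using inverse_less_ln_one_plus[of "real N"] step by (simp add: add.commute)
  also have "1 + 1 / real N = real (Suc N) / real N" using step by (simp add: field_simps)
  also have "ln (real (Suc N) / real N) = ln (real (Suc N)) - ln (real N)"
    using step by (simp add: ln_div)
  finally show ?case using step by simp
qed simp

context mcf_run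
begin

definition "init_time = real N * (100 * real m + 50 * real k + 30) + 4 * real T + 42 * real m + 7 * real k + 90"
definition "loop_time = ev_cost * (real m * T') + 25 * real N +
    (25 * real N + 40) * (real k * lvl d0) + (25 * real N + 60 + c_aug) * (rounds_max * real k) +
    c_aug + c_aug * (real m * T') + 1"
definition "run_time = 20 * pot (\<lambda>_. 0) (\<lambda>_. 0) + init_time + loop_time"

lemma run_wp:
  assumes ok: "input_ok \<sigma>" and cents: "\<And>c. c < N \<Longrightarrow> narr \<sigma> cent_arr c = cent c"
    and zero: "narr \<sigma> first_arr = (\<lambda>_. 0)" "narr \<sigma> cur_arr = (\<lambda>_. 0)" "rarr \<sigma> lab_rarr = (\<lambda>_. 0)"
      "rarr \<sigma> flow_rarr = (\<lambda>_. 0)"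
    and J_start: "\<And>s. start s \<Longrightarrow> J s"
    and J_step: "\<And>s s'. J s \<Longrightarrow> main_inv s \<Longrightarrow> main_inv s' \<Longrightarrow> adn s = 0 \<Longrightarrow>
      next_com s s' \<or> raise_threshold s s' \<or> next_center s s' \<or> (\<exists>fs l \<gamma>. augments fs l \<gamma> s s') \<Longrightarrow> J s'"
  shows "wp run (\<lambda>\<sigma>'. main_inv (abs_state \<sigma>') \<and> J (abs_state \<sigma>') \<and> adn (abs_state \<sigma>') = 1 \<and>
    real (steps \<sigma>') \<le> real (steps \<sigma>) + run_time) \<sigma>"
  unfolding run_def block.simps wp_Seq wp_Skip
proof (rule init_wp[OF ok cents zero])
  fix \<tau> assume \<tau>: "static \<tau>" "rreg \<tau> sigma_rr = sig (nreg \<tau> p_reg)" "start (abs_state \<tau>)"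
    and steps: "real (steps \<tau>) + 20 * pot (alab (abs_state \<tau>)) (acur (abs_state \<tau>)) \<le>
        real (steps \<sigma>) + 20 * pot (\<lambda>_. 0) (\<lambda>_. 0) +
        real N * (100 * real m + 50 * real k + 30) + 4 * real T + 42 * real m + 7 * real k + 90"
  note main = main_wp[where J = J, OF \<tau>(1,2) start_main_inv[OF \<tau>(3)] J_start[OF \<tau>(3)] J_step]
  show "wp (While (NEq done_reg zero_reg) step) (\<lambda>\<sigma>'. main_inv (abs_state \<sigma>') \<and> J (abs_state \<sigma>') \<and>
      adn (abs_state \<sigma>') = 1 \<and> real (steps \<sigma>') \<le> real (steps \<sigma>) + run_time) \<tau>"
    by (rule wp_mono[OF main], assumption+)
      (use steps psi_start[OF \<tau>(3)] in \<open>auto simp: run_time_def init_time_def loop_time_def\<close>)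
qed

lemma approx_out_flow:
  assumes inv: "main_inv s" and "r * max_throughput I \<le> shipped (ap s) / T'"
  shows "approx_solution r I (out_flow (af s))"
  unfolding approx_solution_def value_eq
  using feasible_out_flow(1)[OF inv] shipped_values[OF inv] assms(2) by blast

lemma output_flow_eq: "output_flow I es \<sigma> = out_flow (af (abs_state \<sigma>))"
  by (simp add: fun_eq_iff output_flow_def out_flow_def abs_state_def)

section \<open>Estimates of the running time\<close>

lemma k_le: "real k \<le> real n ^ 2"
proof -
  have "(\<lambda>i. (src i, snk i)) ` {..<k} \<subseteq> V \<times> V" using srcV snkV by auto
  then have "card ((\<lambda>i. (src i, snk i)) ` {..<k}) \<le> card (V \<times> V)" using finV by (intro card_mono) auto
  moreover have "card ((\<lambda>i. (src i, snk i)) ` {..<k}) = k"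
    using valid by (subst card_image) (auto simp: valid_instance_def)
  ultimately have "k \<le> n * n" using V_eq by (simp add: card_cartesian_product)
  then show ?thesis by (simp add: power2_eq_square flip: of_nat_mult)
qed

lemma ln_k_le: "ln (real k) \<le> 2 * real B"
proof -
  have "ln (real k) \<le> ln (real n ^ 2)" using k_le k_pos by (intro ln_mono) auto
  also have "\<dots> = 2 * ln (real n)" using n_ge_2 by (simp add: ln_realpow)
  finally show ?thesis using ln_n_le(2) by simp
qed

lemma log1_U: "ln U \<le> log1 U" "1 \<le> log1 U"
  by (auto simp: log1_def)

lemma ln_Theta_le: "ln \<Theta> \<le> 4 * real B"
proof -
  have "ln \<Theta> = ln 4 + ln (real m)" unfolding \<Theta>_def using m_pos by (intro ln_mult_pos) auto
  moreover have "ln (4 :: real) = 2 * ln 2" using ln_realpow[of 2 2] by simp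
  moreover have "real B \<ge> 1" using bits by simp
  ultimately show ?thesis using ln_m_le ln_2_less_1 by linarith
qed

lemma inverse_ln_q_le: "1 / ln (q c) \<le> real K * real N * (1 / real (Suc c)) + 1"
proof -
  define y where "y = real K * real N / real (Suc c)"
  have y: "0 < y" using K_pos N_pos by (simp add: y_def)
  have "q c = 1 + 1 / y" by (simp add: q_def y_def)
  then have "1 / (y + 1) \<le> ln (q c)" using inverse_less_ln_one_plus[OF y] by simp
  then have "1 \<le> ln (q c) * (y + 1)" using y by (simp add: divide_le_eq)
  then have "1 / ln (q c) \<le> y + 1" using q_gt_1[of c] by (simp add: divide_le_eq mult.commute)
  then show ?thesis by (simp add: y_def)
qed

lemma inverse_ln_kappa_le: "1 / ln (1 + \<kappa>) \<le> 2 * real K"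
proof -
  have K: "1 \<le> real K" using K_pos by simp
  have "1 / (real K + 1) \<le> ln (1 + \<kappa>)"
    using inverse_less_ln_one_plus[of "real K"] K by (simp add: \<kappa>_def)
  then have "1 \<le> ln (1 + \<kappa>) * (real K + 1)" using K by (simp add: divide_le_eq)
  then have "1 / ln (1 + \<kappa>) \<le> real K + 1" using kappa_pos by (simp add: divide_le_eq mult.commute)
  with K show ?thesis by simp
qed

lemma ln_d0: "ln d0 = - real T * ln (1 + \<kappa>) - ln U"
proof -
  have "ln \<delta> = - real T * ln (1 + \<kappa>)"
    unfolding \<delta>_def using kappa_pos ln_realpow[of "1 + \<kappa>" T] by (simp add: ln_div)
  then show ?thesis unfolding d0_def using delta_pos U_ge_1 by (simp add: ln_div)
qed

text \<open>Common unit of the estimates. With \<open>N = 20 * n * B\<close> and \<open>K\<close> of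
  order \<open>1 / \<epsilon>\<close>, the product \<open>N * Y * (m + k)\<close> is the claimed
  time with three logarithmic factors \<open>B\<close>.\<close>

definition "Y = real K ^ 2 * real B ^ 2 * log1 U"

lemma Y_ge:
  shows "real K ^ 2 * real B * log1 U \<le> Y" "real K ^ 2 * real B \<le> real K ^ 2 * real B * log1 U" "real T \<le> Y" "1 \<le> Y"
proof -
  have ge: "1 \<le> real K" "1 \<le> real B" "1 \<le> log1 U" using K_pos bits log1_U by auto
  have "real K ^ 2 * real B * 1 * log1 U \<le> real K ^ 2 * real B * real B * log1 U"
    using ge by (intro mult_right_mono mult_left_mono) auto
  then show 1: "real K ^ 2 * real B * log1 U \<le> Y" by (simp add: Y_def power2_eq_square[of "real B"] mult.assoc)
  have "real K ^ 2 * real B * 1 \<le> real K ^ 2 * real B * log1 U" using ge by (intro mult_left_mono) auto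
  then show 2: "real K ^ 2 * real B \<le> real K ^ 2 * real B * log1 U" by simp
  have "real T = real K ^ 2 * real B" by (simp add: T_def power2_eq_square)
  with 1 2 show "real T \<le> Y" by simp
  moreover have "1 \<le> real T" using T_pos by simp
  ultimately show "1 \<le> Y" by simp
qed

lemma T'_le: "T' \<le> 3 * Y"
  using Y_ge(3,4) by (simp add: T'_def)

lemma lvl_le: "lvl d0 \<le> 14 * Y"
proof -
  have ge: "1 \<le> real K" "1 \<le> real B" using K_pos bits by auto
  have l1: "0 < ln (1 + \<kappa>)" using kappa_pos by simp
  have "ln (\<Theta> * (1 + \<kappa>) / d0) = ln \<Theta> + ln (1 + \<kappa>) - ln d0"
    using Theta_ge kappa_pos d0_pos by (simp add: ln_div ln_mult_pos)
  then have "ln (\<Theta> * (1 + \<kappa>) / d0) = ln \<Theta> + ln U + (real T + 1) * ln (1 + \<kappa>)"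
    by (simp add: ln_d0 algebra_simps)
  then have "lvl d0 = (ln \<Theta> + ln U) * (1 / ln (1 + \<kappa>)) + (real T + 1)"
    using l1 by (simp add: lvl_def add_divide_distrib)
  also have "\<dots> \<le> (4 * real B + log1 U) * (2 * real K) + (real T + 1)"
    using ln_Theta_le log1_U inverse_ln_kappa_le l1 Theta_ge U_ge_1
    by (intro add_mono mult_mono) auto
  also have "(4 * real B + log1 U) * (2 * real K) \<le> (5 * (real B * log1 U)) * (2 * real K ^ 2)"
  proof (rule mult_mono)
    have "real B * 1 \<le> real B * log1 U" using ge log1_U by (intro mult_left_mono) auto
    moreover have "1 * log1 U \<le> real B * log1 U" using ge log1_U by (intro mult_right_mono) auto
    ultimately show "4 * real B + log1 U \<le> 5 * (real B * log1 U)" by linarith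
    show "2 * real K \<le> 2 * (real K)\<^sup>2" using ge mult_left_mono[of 1 "real K" "real K"] by (simp add: power2_eq_square)
  qed (use ge log1_U in auto)
  also have "\<dots> = 10 * (real K ^ 2 * real B * log1 U)" by simp
  finally show ?thesis using Y_ge by linarith
qed

lemma rounds_le: "rounds_max \<le> 50 * Y"
proof -
  have ge: "1 \<le> real K" "1 \<le> real B" using K_pos bits by auto
  have kmU: "1 \<le> real k * real m * U"
    using mult_mono[of 1 "real k * real m" 1 U] mult_mono[of 1 "real k" 1 "real m"] k_pos m_pos U_ge_1 by simp
  have "ln (1 + real k * real m * U) \<le> ln (2 * (real k * real m * U))"
    using kmU by (intro ln_mono; linarith)
  also have "\<dots> = ln 2 + (ln (real k) + ln (real m) + ln U)"
    using k_pos m_pos U_ge_1 by (simp add: ln_mult_pos)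
  also have "\<dots> \<le> 1 + (2 * real B + 2 * real B + log1 U)"
    using ln_2_less_1 ln_k_le ln_m_le log1_U by linarith
  also have "\<dots> \<le> 6 * (real B * log1 U)"
  proof -
    have "real B * 1 \<le> real B * log1 U" using ge log1_U by (intro mult_left_mono) auto
    moreover have "1 * log1 U \<le> real B * log1 U" using ge log1_U by (intro mult_right_mono) auto
    ultimately show ?thesis using ge by linarith
  qed
  finally have l: "ln (1 + real k * real m * U) \<le> 6 * (real B * log1 U)" .
  have T1: "1 \<le> real T" using T_pos by simp
  have "rounds_max = 1 + (2 * T' + 1) * ln (1 + real k * real m * U)" by (simp add: rounds_max_def)
  also have "(2 * T' + 1) * ln (1 + real k * real m * U) \<le> (7 * real T) * (6 * (real B * log1 U))"
    using l kmU T1 ge log1_U by (intro mult_mono) (auto simp: T'_def)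
  also have "\<dots> = 42 * Y" by (simp add: T_def Y_def power2_eq_square)
  finally show ?thesis using Y_ge by linarith
qed

lemma ln_N_le: "ln (real N) \<le> 6 * real B"
proof -
  have B: "1 \<le> real B" using bits by simp
  have "ln (real N) = ln 20 + ln (real n) + ln (real B)"
    using n_ge_2 B by (simp add: N_def ln_mult_pos)
  moreover have "ln (20 :: real) \<le> ln (2 ^ 5)" by (intro ln_mono) auto
  moreover have "ln ((2 :: real) ^ 5) = 5 * ln 2" by (subst ln_realpow) auto
  moreover have "ln (2 :: real) \<le> 25 / 36" by (rule ln2_le_25_over_36)
  moreover have "ln (real B) \<le> real B - 1" using B by (intro ln_le_minus_one) auto
  ultimately show ?thesis using ln_n_le(2) B by linarith
qed

text \<open>The harmonic sum: centre \<open>c\<close> admits about \<open>K * N / (c + 1)\<close>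
  raises of a label per unit of \<open>ln (\<Theta> / d0)\<close>, so all centres together admit
  about \<open>K * N * ln N\<close>. The logarithm of the label range is of order
  \<open>K * B * log1 U\<close>, because \<open>\<delta>\<close> is the power
  \<open>T = K * K * B\<close> of \<open>1 / (1 + \<kappa>)\<close>.\<close>

lemma sum_cnt_max_le: "(\<Sum>c<N. cnt_max c) \<le> 50 * (real N * Y)"
proof -
  have ge: "1 \<le> real K" "1 \<le> real B" "1 \<le> real N" using K_pos bits N_pos by auto
  have "(\<Sum>c<N. 1 / ln (q c)) \<le> (\<Sum>c<N. real K * real N * (1 / real (Suc c)) + 1)"
    by (intro sum_mono inverse_ln_q_le)
  also have "\<dots> = real K * real N * (\<Sum>c<N. 1 / real (Suc c)) + real N"
    by (simp add: sum.distrib sum_distrib_left)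
  also have "\<dots> \<le> real K * real N * (1 + ln (real N)) + real N"
    using sum_inverse_Suc_le[OF N_pos] by (intro add_right_mono mult_left_mono) auto
  also have "\<dots> \<le> real K * real N * (7 * real B) + real K * real N * real B"
    using ln_N_le ge mult_mono[of 1 "real K" 1 "real B"]
    by (intro add_mono mult_left_mono) (auto simp: mult.commute mult.left_commute)
  finally have inv: "(\<Sum>c<N. 1 / ln (q c)) \<le> 8 * (real K * real N * real B)" by (simp add: mult_ac)
  have "real T * ln (1 + \<kappa>) \<le> real T * \<kappa>"
    using ln_add_one_self_le_self[of \<kappa>] kappa_pos by (intro mult_left_mono) auto
  also have "\<dots> = real K * real B" using ge by (simp add: T_def \<kappa>_def)
  finally have "real T * ln (1 + \<kappa>) \<le> real K * real B" .
  moreover have "real B \<le> real K * real B * log1 U" "log1 U \<le> real K * real B * log1 U"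
    "real K * real B \<le> real K * real B * log1 U"
  proof -
    have KB: "1 \<le> real K * real B" using ge mult_mono[of 1 "real K" 1 "real B"] by simp
    show KBu: "real K * real B \<le> real K * real B * log1 U"
      using log1_U(2) KB mult_left_mono[of 1 "log1 U" "real K * real B"] by simp
    show "log1 U \<le> real K * real B * log1 U"
      using log1_U(2) KB mult_right_mono[of 1 "real K * real B" "log1 U"] by simp
    have "real B \<le> real K * real B" using ge by simp
    with KBu show "real B \<le> real K * real B * log1 U" by simp
  qed
  moreover have "ln (\<Theta> / d0) = ln \<Theta> + real T * ln (1 + \<kappa>) + ln U"
    using Theta_ge d0_pos by (simp add: ln_div ln_d0)
  ultimately have l: "ln (\<Theta> / d0) \<le> 6 * (real K * real B * log1 U)"
    using ln_Theta_le log1_U(1) by linarith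
  have l0: "0 \<le> ln (\<Theta> / d0)" using Theta_ge d0_pos by (simp add: divide_simps)
  have "(\<Sum>c<N. cnt_max c) = 2 * real N + ln (\<Theta> / d0) * (\<Sum>c<N. 1 / ln (q c))"
    by (simp add: cnt_max_def sum.distrib sum_distrib_left)
  also have "\<dots> \<le> 2 * real N + 6 * (real K * real B * log1 U) * (8 * (real K * real N * real B))"
  proof (intro add_left_mono mult_mono l inv sum_nonneg)
    show "0 \<le> 1 / ln (q c)" for c using q_gt_1[of c] by simp
  qed (use log1_U ge in auto)
  also have "\<dots> = 2 * real N * 1 + 48 * (real N * Y)" by (simp add: Y_def power2_eq_square)
  also have "2 * real N * 1 \<le> 2 * real N * Y" using Y_ge by (intro mult_left_mono) auto
  finally show ?thesis by (simp add: mult_ac)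
qed

lemma run_time_le: "run_time \<le> 20000 * (real N * Y * (real m + real k))"
proof -
  define M where "M = real m + real k"
  define X where "X = real N * Y * M"
  have M: "1 \<le> M" "real m \<le> M" "real k \<le> M" using m_pos by (auto simp: M_def)
  have N: "1 \<le> real N" "8 * real n \<le> real N" "0 \<le> real n"
  proof -
    show "1 \<le> real N" using N_pos by simp
    have "20 * real n * 1 \<le> 20 * real n * real B" using bits by (intro mult_left_mono) auto
    then show "8 * real n \<le> real N" by (simp add: N_def)
  qed simp
  have Y: "1 \<le> Y" by (rule Y_ge)
  have X: "a * b * c \<le> X" if "0 \<le> a" "a \<le> real N" "0 \<le> b" "b \<le> Y" "0 \<le> c" "c \<le> M" for a b c
    unfolding X_def using that Y M N by (intro mult_mono) auto
  \<comment> \<open>Following and augmenting a spliced walk takes time linear in \<open>n\<close>,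
    so apart from label repair an augmentation is no more expensive, up to a constant, than one pass
    over the centres.\<close>
  have c_aug: "0 \<le> c_aug" "c_aug \<le> 8 * real N" using N(2) by (auto simp: c_aug_def N_def) (use bits in auto)
  have a1: "pot (\<lambda>_. 0) (\<lambda>_. 0) \<le> 500 * X"
  proof -
    have "0 \<le> weight_sum" unfolding weight_sum_def weight_def by (intro sum_nonneg) auto
    moreover have "weight_sum \<le> 10 * M" using weight_sum_le by (simp add: M_def)
    moreover have "0 \<le> real N * Y" using Y by simp
    ultimately have "pot (\<lambda>_. 0) (\<lambda>_. 0) \<le> 50 * (real N * Y) * (10 * M)"
      unfolding pot_zero using sum_cnt_max_le by (intro mult_mono) auto
    then show ?thesis by (simp add: X_def)
  qed
  have a2: "init_time \<le> 400 * X"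
  proof -
    have "real N * 1 * real m \<le> X" "real N * 1 * real k \<le> X" "real N * 1 * 1 \<le> X" "1 * real T * 1 \<le> X"
      "1 * 1 * real m \<le> X" "1 * 1 * real k \<le> X" "1 * 1 * 1 \<le> X"
      using M N Y Y_ge(3) by (intro X; simp)+
    then show ?thesis by (simp add: init_time_def distrib_left)
  qed
  have a3: "loop_time \<le> 9000 * X"
  proof -
    have T': "0 \<le> T'" "T' \<le> 3 * Y" using T'_le T'_ge by auto
    have lvl: "0 \<le> lvl d0"
      using Theta_ge d0_pos kappa_pos mult_mono[of 1 \<Theta> 1 "1 + \<kappa>"] by (intro lvl_nonneg) auto
    have rounds: "0 \<le> rounds_max"
      unfolding rounds_max_def using T'_ge U_ge_1
      by (intro add_nonneg_nonneg mult_nonneg_nonneg ln_ge_zero) auto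
    have b1: "ev_cost * (real m * T') \<le> (80 * real N) * (M * (3 * Y))"
      using T' M N by (intro mult_mono) (auto simp: ev_cost_def)
    have b2: "(25 * real N + 40) * (real k * lvl d0) \<le> (65 * real N) * (M * (14 * Y))"
      using lvl lvl_le M N by (intro mult_mono) auto
    have b3: "(25 * real N + 60 + c_aug) * (rounds_max * real k) \<le> (85 * real N + 8 * real N) * ((50 * Y) * M)"
      using rounds rounds_le M N c_aug Y by (intro mult_mono) auto
    have b4: "c_aug * (real m * T') \<le> (8 * real N) * (M * (3 * Y))"
      using T' M N c_aug by (intro mult_mono) auto
    have b5: "real N * 1 * 1 \<le> X" "1 * 1 * 1 \<le> X" using M N Y by (intro X; simp)+
    have e: "(80 * real N) * (M * (3 * Y)) = 240 * X" "(65 * real N) * (M * (14 * Y)) = 910 * X"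
      "(85 * real N + 8 * real N) * ((50 * Y) * M) = 4650 * X" "(8 * real N) * (M * (3 * Y)) = 24 * X"
      by (simp_all add: X_def)
    show ?thesis
      using b1 b2 b3 b4 b5 c_aug unfolding loop_time_def e by linarith
  qed
  have "0 \<le> X" using Y M by (simp add: X_def)
  then show ?thesis using a1 a2 a3 unfolding run_time_def X_def M_def by linarith
qed

end

section \<open>Setup and the probability of favourable centres\<close>

definition double_step :: program where
  "double_step = block [NArith NAdd a_reg a_reg a_reg, NArith NAdd B_reg B_reg one_reg]"

text \<open>\<open>K\<close> is a constant of the program, chosen for \<open>\<epsilon>\<close>;
  thus no real has to be rounded at run time. \<open>B\<close> is found by repeated
  doubling.\<close>

definition setup_program :: "nat \<Rightarrow> program" where
  "setup_program K = block [
     NConst one_reg 1,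
     NConst K_reg K,
     NConst a_reg 1,
     While (NLess a_reg n_reg) double_step,
     NConst b_reg 20,
     NArith NMul N_reg b_reg n_reg,
     NArith NMul N_reg N_reg B_reg]"

definition sampler :: "nat \<Rightarrow> program" where
  "sampler K = Seq (setup_program K) sample"

definition solver :: "nat \<Rightarrow> program" where
  "solver K = Seq (sampler K) run"

lemma le_two_power_bits: "n \<le> 2 ^ bits n"
  unfolding bits_def by (rule LeastI[of _ n]) (rule less_imp_le, rule less_exp)

lemma setup_wp:
  assumes "nreg \<sigma> B_reg = 0"
    and Q: "\<And>\<sigma>'. frame (setup_program K) \<sigma> \<sigma>' \<Longrightarrow> nreg \<sigma>' one_reg = 1 \<Longrightarrow> nreg \<sigma>' K_reg = K \<Longrightarrow>
      nreg \<sigma>' B_reg = bits (nreg \<sigma> n_reg) \<Longrightarrow> nreg \<sigma>' N_reg = 20 * nreg \<sigma> n_reg * bits (nreg \<sigma> n_reg) \<Longrightarrow>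
      steps \<sigma>' \<le> steps \<sigma> + 3 * bits (nreg \<sigma> n_reg) + 10 \<Longrightarrow> Q \<sigma>'"
  shows "wp (setup_program K) Q \<sigma>"
proof -
  define n where "n = nreg \<sigma> n_reg"
  define rest where "rest = wp (block [NConst b_reg 20, NArith NMul N_reg b_reg n_reg, NArith NMul N_reg N_reg B_reg]) Q"
  define Inv where "Inv \<tau> \<longleftrightarrow> nreg \<tau> a_reg = 2 ^ nreg \<tau> B_reg \<and> (\<forall>b<nreg \<tau> B_reg. 2 ^ b < n) \<and>
    steps \<tau> \<le> steps \<sigma> + 3 + 3 * nreg \<tau> B_reg" for \<tau> :: machine
  have Inv_B: "nreg \<tau> B_reg \<le> bits n" if "Inv \<tau>" for \<tau>
  proof (rule ccontr)
    assume "\<not> nreg \<tau> B_reg \<le> bits n"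
    then have "2 ^ bits n < n" using that by (simp add: Inv_def)
    then show False using le_two_power_bits[of n] by simp
  qed
  have loop: "wp (While (NLess a_reg n_reg) double_step) rest \<tau>"
    if \<tau>: "Inv \<tau>" "frame (setup_program K) \<sigma> \<tau>" "nreg \<tau> one_reg = 1" "nreg \<tau> K_reg = K" for \<tau>
  proof (rule wp_While[where Inv = Inv and Bd = "real (steps \<sigma> + 3 + 3 * bits n)"])
    fix \<rho> assume inv: "Inv \<rho>" and fr: "frame double_step \<tau> \<rho>"
    have regs: "nreg \<rho> one_reg = 1" "nreg \<rho> n_reg = n" "nreg \<rho> K_reg = K"
      using frameD(1)[OF fr] frameD(1)[OF \<tau>(2), of n_reg] \<tau>
      by (simp_all add: double_step_def setup_program_def n_def)
    show "real (steps \<rho>) \<le> real (steps \<sigma> + 3 + 3 * bits n)"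
      using inv Inv_B[OF inv] by (simp only: of_nat_le_iff Inv_def) linarith
    {
      assume "holds (NLess a_reg n_reg) \<rho>"
      then show "wp double_step Inv (tick \<rho>)"
        using inv regs by (auto simp: double_step_def wp_simps wp_Skip wp_Seq Inv_def less_Suc_eq)
    next
      assume "\<not> holds (NLess a_reg n_reg) \<rho>"
      then have "n \<le> 2 ^ nreg \<rho> B_reg" using inv regs by (simp add: Inv_def)
      then have "bits n \<le> nreg \<rho> B_reg" unfolding bits_def by (rule Least_le)
      then have B: "nreg \<rho> B_reg = bits n" using Inv_B[OF inv] by simp
      have frame': "frame (setup_program K) \<sigma> \<rho>"
        using fr \<tau>(2) by (simp add: frame_def setup_program_def)
      have "steps \<rho> \<le> steps \<sigma> + 3 + 3 * bits n" using inv B by (simp add: Inv_def)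
      then show "rest (tick \<rho>)"
        using B regs frame' unfolding rest_def
        by (simp add: wp_simps wp_Skip wp_Seq) (rule Q, simp_all add: frame_def setup_program_def n_def)
    }
  qed (use \<tau> in simp_all)
  show ?thesis
    using assms(1)
    by (simp add: setup_program_def wp_simps wp_Skip wp_Seq)
      (rule loop[unfolded rest_def block.simps wp_Seq wp_Skip One_nat_def],
        simp_all add: frame_def setup_program_def Inv_def)
qed

lemma ewp_const_le: "ewp P (\<lambda>_. c) \<sigma> \<le> c"
proof -
  have "c * emeasure (measure_spmf (exec P \<sigma>)) (space (measure_spmf (exec P \<sigma>))) \<le> c * 1"
    by (intro mult_left_mono measure_spmf.emeasure_space_le_1) simp
  then show ?thesis by (simp add: ewp_def)
qed

lemma ewp_lossless: "lossless_spmf (exec P \<sigma>) \<Longrightarrow> ewp P (\<lambda>_. 1) \<sigma> = 1"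
  by (simp add: ewp_def lossless_spmf_def weight_spmf_def measure_spmf.emeasure_eq_measure)

lemma ewp_indicator: "ewp P (indicator A) \<sigma> = ennreal (measure (measure_spmf (exec P \<sigma>)) A)"
  by (simp add: ewp_def measure_spmf.emeasure_eq_measure)

text \<open>Bridge from qualitative to quantitative reasoning: losslessness is part of
  \<open>wp\<close>, so a postcondition that holds on the whole support has probability 1.\<close>

lemma wp_ewp:
  assumes "wp P Q \<sigma>"
  shows "ewp P (indicator {\<sigma>'. Q \<sigma>'}) \<sigma> = 1"
proof (rule antisym)
  have "ewp P (indicator {\<sigma>'. Q \<sigma>'}) \<sigma> \<le> ewp P (\<lambda>_. 1) \<sigma>"
    by (intro ewp_mono) (simp add: indicator_def)
  then show "ewp P (indicator {\<sigma>'. Q \<sigma>'}) \<sigma> \<le> 1"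
    using ewp_const_le order_trans by blast
  have "ewp P (\<lambda>_. 1) \<sigma> \<le> ewp P (indicator {\<sigma>'. Q \<sigma>'}) \<sigma>"
    using assms by (intro ewp_mono) (auto simp: wp_def)
  then show "1 \<le> ewp P (indicator {\<sigma>'. Q \<sigma>'}) \<sigma>"
    using assms by (simp add: ewp_lossless wp_def)
qed

text \<open>A bound valid on every outcome bounds the expectation, and losslessness excludes the
  infinite value.\<close>

lemma expected_steps_le:
  assumes "wp P (\<lambda>\<sigma>'. real (steps \<sigma>') \<le> b) \<sigma>"
  shows "expected_steps (exec P \<sigma>) \<le> ennreal b"
proof -
  have "ewp P (\<lambda>\<sigma>'. ennreal (real (steps \<sigma>'))) \<sigma> \<le> ewp P (\<lambda>_. ennreal b) \<sigma>"
    using assms by (intro ewp_mono ennreal_leI) (auto simp: wp_def)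
  also have "\<dots> \<le> ennreal b" by (rule ewp_const_le)
  finally show ?thesis using assms by (simp add: expected_steps_def wp_def ewp_def)
qed

lemma distinct_pawalk_verts_arcs:
  "distinct (pawalk_verts v p) \<Longrightarrow> distinct p"
proof (induction p arbitrary: v)
  case (Cons e p)
  have *: "e' \<in> set p \<Longrightarrow> fst e' \<in> set (pawalk_verts v p)" for e' v and p :: "('a \<times> 'a) list"
    by (induction p arbitrary: v) auto
  show ?case using Cons *[of e p] by auto
qed simp

lemma pawalk_verts_subset: "v \<in> V \<Longrightarrow> (\<And>e. e \<in> set p \<Longrightarrow> fst e \<in> V \<and> snd e \<in> V) \<Longrightarrow> set (pawalk_verts v p) \<subseteq> V"
  by (induction p arbitrary: v) auto

context mcf_run
begin

text \<open>The decomposition of an optimal flow with arcs renamed to their positions in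
  \<open>es\<close>, which is how the machine numbers them.\<close>

lemma index_paths:
  obtains ps :: "nat \<Rightarrow> (real \<times> nat list) list" where
    "\<And>i. i < k \<Longrightarrow> length (ps i) \<le> m"
    "\<And>i a P. i < k \<Longrightarrow> (a, P) \<in> set (ps i) \<Longrightarrow> a \<ge> 0 \<and> distinct P \<and> set P \<subseteq> {..<m} \<and>
       pcas (src i) (map ((!) es) P) (snk i) \<and> distinct (pawalk_verts (src i) (map ((!) es) P))"
    "\<And>i. i < k \<Longrightarrow> sum_list (map fst (ps i)) = max_throughput I * d i"
    "\<And>j. j < m \<Longrightarrow> (\<Sum>i<k. \<Sum>(a, P)\<leftarrow>ps i. if j \<in> set P then a else 0) \<le> u (es ! j)"
proof -
  obtain ps where len: "\<And>i. i < k \<Longrightarrow> length (ps i) \<le> card E"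
    and path: "\<And>i a P. i < k \<Longrightarrow> (a, P) \<in> set (ps i) \<Longrightarrow>
       a \<ge> 0 \<and> pcas (src i) P (snk i) \<and> set P \<subseteq> E \<and> distinct (pawalk_verts (src i) P)"
    and sum: "\<And>i. i < k \<Longrightarrow> sum_list (map fst (ps i)) = max_throughput I * d i"
    and cap: "\<And>e. e \<in> E \<Longrightarrow> (\<Sum>i<k. \<Sum>(a, P)\<leftarrow>ps i. if e \<in> set P then a else 0) \<le> u e"
    using max_throughput_paths by metis
  define idx where "idx = the_inv_into {..<m} ((!) es)"
  have idx: "idx e < m" "es ! idx e = e" if "e \<in> E" for e
    using bij_es that the_inv_into_into[of "(!) es" "{..<m}" e "{..<m}"] f_the_inv_into_f_bij_betw[OF bij_es, of e]
    by (auto simp: idx_def bij_betw_def)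
  define ps' where "ps' i = map (\<lambda>(a, P). (a, map idx P)) (ps i)" for i
  have nth: "map ((!) es) (map idx P) = P" if "set P \<subseteq> E" for P
    using that idx by (induction P) auto
  show thesis
  proof (rule that[of ps'])
    show "length (ps' i) \<le> m" if "i < k" for i using len[OF that] by (simp add: ps'_def num_arcs_def)
    show "sum_list (map fst (ps' i)) = max_throughput I * d i" if "i < k" for i
      using sum[OF that] by (simp add: ps'_def case_prod_unfold comp_def)
    fix i a P assume i: "i < k" and "(a, P) \<in> set (ps' i)"
    then obtain P0 where P0: "(a, P0) \<in> set (ps i)" "P = map idx P0" by (auto simp: ps'_def)
    note p = path[OF i P0(1)]
    then have eq: "map ((!) es) P = P0" unfolding P0(2) using nth by blast
    then have "distinct (map ((!) es) P)" using p distinct_pawalk_verts_arcs[of "src i" P0] by simp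
    then have "distinct P" by (simp add: distinct_map)
    moreover have "set P \<subseteq> {..<m}" using p idx(1) by (auto simp: P0(2))
    ultimately show "a \<ge> 0 \<and> distinct P \<and> set P \<subseteq> {..<m} \<and>
       pcas (src i) (map ((!) es) P) (snk i) \<and> distinct (pawalk_verts (src i) (map ((!) es) P))"
      using p eq by simp
  next
    fix j assume j: "j < m"
    have iff: "j \<in> set (map idx P) \<longleftrightarrow> es ! j \<in> set P" if "set P \<subseteq> E" for P
    proof -
      have "idx (es ! j) = j" using j bij_es by (simp add: idx_def bij_betw_def the_inv_into_f_f)
      then show ?thesis using that idx by (force simp: subset_iff)
    qed
    have "(\<Sum>(a, P)\<leftarrow>ps' i. if j \<in> set P then a else 0) = (\<Sum>(a, P)\<leftarrow>ps i. if es ! j \<in> set P then a else 0)"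
      if "i < k" for i
      unfolding ps'_def map_map comp_def
      using path[OF that] iff by (intro arg_cong[of _ _ sum_list] map_cong refl) fastforce
    then show "(\<Sum>i<k. \<Sum>(a, P)\<leftarrow>ps' i. if j \<in> set P then a else 0) \<le> u (es ! j)"
      using cap[OF es_nth[OF j]] by simp
  qed
qed

definition sampled :: "machine \<Rightarrow> bool" where
  "sampled \<sigma> \<longleftrightarrow> input_ok \<sigma> \<and> (\<forall>c<N. narr \<sigma> cent_arr c < n) \<and>
     narr \<sigma> first_arr = (\<lambda>_. 0) \<and> narr \<sigma> cur_arr = (\<lambda>_. 0) \<and> rarr \<sigma> lab_rarr = (\<lambda>_. 0) \<and> rarr \<sigma> flow_rarr = (\<lambda>_. 0) \<and>
     real (steps \<sigma>) \<le> 3 * real B + 12 + real N * (6 * real B + 10)"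

lemma sampler_wp: "wp (sampler K) sampled (input_state \<epsilon> I es)"
proof -
  define \<sigma>0 where "\<sigma>0 = input_state \<epsilon> I es"
  have \<sigma>0: "nreg \<sigma>0 n_reg = n" "nreg \<sigma>0 m_reg = m" "nreg \<sigma>0 k_reg = k" "rreg \<sigma>0 zero_rr = 0" "steps \<sigma>0 = 0"
    "\<And>r. 2 < r \<Longrightarrow> nreg \<sigma>0 r = 0" "\<And>A. 3 < A \<Longrightarrow> narr \<sigma>0 A = (\<lambda>_. 0)" "\<And>A. 1 < A \<Longrightarrow> rarr \<sigma>0 A = (\<lambda>_. 0)"
    "\<And>i. i < k \<Longrightarrow> narr \<sigma>0 source_arr i = src i \<and> narr \<sigma>0 sink_arr i = snk i \<and> rarr \<sigma>0 demand_rarr i = d i"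
    "\<And>j. j < m \<Longrightarrow> rarr \<sigma>0 cap_rarr j = cap j \<and> narr \<sigma>0 tail_arr j = tail_of j \<and> narr \<sigma>0 head_arr j = head_of j"
    by (auto simp: \<sigma>0_def input_state_def Let_def cap_def tail_of_def head_of_def)
  note defs_simps = setup_program_def double_step_def sample_def sample_step_def bit_step_def
  have "wp (setup_program K) (wp sample sampled) \<sigma>0"
  proof (rule setup_wp)
    show "nreg \<sigma>0 B_reg = 0" using \<sigma>0(6) by simp
    fix \<sigma>1 assume f1: "frame (setup_program K) \<sigma>0 \<sigma>1" and r1: "nreg \<sigma>1 one_reg = 1" "nreg \<sigma>1 K_reg = K"
      "nreg \<sigma>1 B_reg = bits (nreg \<sigma>0 n_reg)" "nreg \<sigma>1 N_reg = 20 * nreg \<sigma>0 n_reg * bits (nreg \<sigma>0 n_reg)"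
      and s1: "steps \<sigma>1 \<le> steps \<sigma>0 + 3 * bits (nreg \<sigma>0 n_reg) + 10"
    have n1: "nreg \<sigma>1 n_reg = n" using frameD(1)[OF f1] \<sigma>0(1) by (simp add: defs_simps)
    show "wp sample sampled \<sigma>1"
    proof (rule sample_wp[OF r1(1)])
      show "1 \<le> nreg \<sigma>1 n_reg" using n1 n_ge_2 by simp
      fix \<sigma>2 assume f2: "frame sample \<sigma>1 \<sigma>2" and cents: "\<And>c. c < nreg \<sigma>1 N_reg \<Longrightarrow> narr \<sigma>2 cent_arr c < nreg \<sigma>1 n_reg"
        and s2: "real (steps \<sigma>2) \<le> real (steps \<sigma>1) + real (nreg \<sigma>1 N_reg) * (6 * real (nreg \<sigma>1 B_reg) + 10) + 2"
      have B: "nreg \<sigma>1 B_reg = B" "nreg \<sigma>1 N_reg = N" using r1 \<sigma>0(1) by (simp_all add: B_def N_def)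
      have "input_ok \<sigma>2"
        using \<sigma>0 r1 B n1 unfolding input_ok_def
        by (simp add: frameD(1)[OF f2] frameD(2)[OF f2] frameD(3)[OF f2] frameD(4)[OF f2]
          frameD(1)[OF f1] frameD(2)[OF f1] frameD(3)[OF f1] frameD(4)[OF f1] defs_simps)
      moreover have "narr \<sigma>2 first_arr = (\<lambda>_. 0)" "narr \<sigma>2 cur_arr = (\<lambda>_. 0)" "rarr \<sigma>2 lab_rarr = (\<lambda>_. 0)"
        "rarr \<sigma>2 flow_rarr = (\<lambda>_. 0)"
        using \<sigma>0(7,8) by (simp_all add: frameD(3)[OF f2] frameD(4)[OF f2] frameD(3)[OF f1] frameD(4)[OF f1] defs_simps)
      moreover have "real (steps \<sigma>2) \<le> 3 * real B + 12 + real N * (6 * real B + 10)"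
        using s1 s2 \<sigma>0(1,5) B by (simp add: B_def)
      ultimately show "sampled \<sigma>2" using cents B n1 by (simp add: sampled_def)
    qed
  qed
  then show ?thesis by (simp add: sampler_def wp_Seq \<sigma>0_def)
qed

lemma miss_le:
  assumes S: "S \<subseteq> {..<n}" and L: "L \<le> N"
  shows "measure (measure_spmf (exec (sampler K) (input_state \<epsilon> I es))) {\<sigma>. \<forall>c<L. narr \<sigma> cent_arr c \<notin> S}
    \<le> (1 - real (card S) / 2 ^ B) ^ L"
proof -
  define \<sigma>0 where "\<sigma>0 = input_state \<epsilon> I es"
  define f :: "machine \<Rightarrow> ennreal" where "f = (\<lambda>\<sigma>. if \<forall>c<L. narr \<sigma> cent_arr c \<notin> S then 1 else 0)"
  define p where "p = 1 - real (card S) / 2 ^ B"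
  define R where "R \<sigma> \<longleftrightarrow> nreg \<sigma> one_reg = 1 \<and> nreg \<sigma> B_reg = B \<and> nreg \<sigma> N_reg = N \<and> nreg \<sigma> n_reg = n" for \<sigma> :: machine
  have \<sigma>0: "nreg \<sigma>0 n_reg = n" "nreg \<sigma>0 B_reg = 0" by (simp_all add: \<sigma>0_def input_state_def Let_def)
  have "card S \<le> 2 ^ B" using card_mono[OF _ S] bits(1) by simp
  then have "real (card S) \<le> 2 ^ B" by (metis of_nat_le_iff of_nat_numeral of_nat_power)
  then have p: "0 \<le> p" by (simp add: p_def)
  have R: "wp (setup_program K) R \<sigma>0"
  proof (rule setup_wp[OF \<sigma>0(2)])
    fix \<sigma> assume *: "frame (setup_program K) \<sigma>0 \<sigma>" "nreg \<sigma> one_reg = 1" "nreg \<sigma> B_reg = bits (nreg \<sigma>0 n_reg)"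
      "nreg \<sigma> N_reg = 20 * nreg \<sigma>0 n_reg * bits (nreg \<sigma>0 n_reg)"
    have "nreg \<sigma> n_reg = n" using frameD(1)[OF *(1), of n_reg] \<sigma>0 by (simp add: setup_program_def double_step_def)
    then show "R \<sigma>" using * \<sigma>0 by (simp add: R_def B_def N_def)
  qed
  have sample: "ewp sample f \<sigma> \<le> ennreal (p ^ L)" if "R \<sigma>" for \<sigma>
  proof -
    define \<tau> where "\<tau> = set_nreg c_reg 0 (tick \<sigma>)"
    have "ewp sample f \<sigma> = ewp (While (NLess c_reg N_reg) sample_step) f \<tau>"
      by (simp add: sample_def ewp_simps \<tau>_def)
    also have "\<dots> \<le> (if \<forall>c<min (nreg \<tau> c_reg) L. narr \<tau> cent_arr c \<notin> S then ennreal (p ^ (L - nreg \<tau> c_reg)) else 0)"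
      unfolding f_def
      using that L S bits(1) by (intro sample_loop_miss) (auto simp: R_def \<tau>_def p_def)
    finally show ?thesis by (simp add: \<tau>_def)
  qed
  have f_eq: "indicator {\<sigma>. \<forall>c<L. narr \<sigma> cent_arr c \<notin> S} = f"
    by (rule ext) (simp add: f_def indicator_def)
  have "ewp (sampler K) (indicator {\<sigma>. \<forall>c<L. narr \<sigma> cent_arr c \<notin> S}) \<sigma>0 = ewp (setup_program K) (ewp sample f) \<sigma>0"
    unfolding f_eq by (simp add: sampler_def ewp_simps)
  also have "\<dots> \<le> ewp (setup_program K) (\<lambda>_. ennreal (p ^ L)) \<sigma>0"
    using R sample by (intro ewp_mono) (auto simp: wp_def)
  also have "\<dots> \<le> ennreal (p ^ L)" by (rule ewp_const_le)
  finally show ?thesis using p by (simp add: ewp_indicator p_def[symmetric] \<sigma>0_def)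
qed

definition hit :: "machine \<Rightarrow> nat \<Rightarrow> nat list \<Rightarrow> bool" where
  "hit \<sigma> s P \<longleftrightarrow> (\<exists>c<N. Suc c * length P \<le> N \<and> narr \<sigma> cent_arr c \<in> set (pawalk_verts s (map ((!) es) P)))"

text \<open>For a path with \<open>h\<close> arcs the initial \<open>L = N div h\<close> centres
  count, and it has \<open>h + 1\<close> distinct vertices to be hit. From
  \<open>N < 2 * L * h\<close> and \<open>2 ^ B < 2 * n\<close> the expected number of hits is at
  least \<open>N / (4 * n) = 5 * B\<close>; all draws miss with probability at most
  \<open>exp\<close> of its negative.\<close>

lemma path_miss:
  assumes P: "set P \<subseteq> {..<m}" "distinct (pawalk_verts s (map ((!) es) P))" "P \<noteq> []" and s: "s < n"
  shows "measure (measure_spmf (exec (sampler K) (input_state \<epsilon> I es))) {\<sigma>. \<not> hit \<sigma> s P} \<le> exp (- 5 * real B)"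
proof -
  define S where "S = set (pawalk_verts s (map ((!) es) P))"
  define h L where "h = length P" "L = N div h"
  have h: "1 \<le> h" using P(3) by (cases P) (auto simp: h_L_def)
  have S: "S \<subseteq> {..<n}"
    unfolding S_def
  proof (rule pawalk_verts_subset)
    fix e assume "e \<in> set (map ((!) es) P)"
    then obtain j where "j < m" "e = es ! j" using P(1) by auto
    then show "fst e \<in> {..<n} \<and> snd e \<in> {..<n}"
      using tail_less head_less by (simp add: tail_of_def head_of_def)
  qed (use s in simp)
  have card_S: "card S = Suc h"
    unfolding S_def using distinct_card[OF P(2)] by (simp add: length_pawalk_verts h_L_def)
  have "Suc h \<le> n" using card_mono[OF _ S] card_S by simp
  moreover have "n * 1 \<le> 20 * n * B" using bits(3) by (intro mult_mono) auto
  ultimately have hN: "h \<le> N" unfolding N_def by linarith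
  have L: "L \<le> N" "1 \<le> L" using h hN by (auto simp: h_L_def div_le_dividend Suc_le_eq div_greater_zero_iff)
  have sub: "{\<sigma>. \<not> hit \<sigma> s P} \<subseteq> {\<sigma>. \<forall>c<L. narr \<sigma> cent_arr c \<notin> S}"
  proof (intro subsetI CollectI allI impI notI)
    fix \<sigma> c assume \<sigma>: "\<sigma> \<in> {\<sigma>. \<not> hit \<sigma> s P}" and c: "c < L" "narr \<sigma> cent_arr c \<in> S"
    have "Suc c * h \<le> L * h" using c by (intro mult_right_mono) auto
    also have "\<dots> \<le> N" by (simp add: h_L_def)
    finally have "hit \<sigma> s P" using c less_le_trans[OF c(1) L(1)] by (auto simp: hit_def S_def h_L_def intro!: exI[of _ c])
    with \<sigma> show False by simp
  qed
  have x: "5 * real B \<le> real L * (real (card S) / 2 ^ B)"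
  proof -
    have "N < Suc L * h" using dividend_less_div_times[of h N] h P(3) by (simp add: h_L_def add.commute)
    also have "\<dots> \<le> (2 * L) * h" using L by (intro mult_right_mono) auto
    also have "\<dots> \<le> 2 * (L * card S)" by (simp add: card_S)
    finally have "real N \<le> 2 * (real L * real (card S))"
      by (metis less_imp_le of_nat_le_iff of_nat_mult of_nat_numeral)
    then have LS: "10 * real n * real B \<le> real L * real (card S)" by (simp add: N_def)
    have pow: "2 ^ B \<le> 2 * real n"
      using bits(2) by (metis less_imp_le of_nat_le_iff of_nat_mult of_nat_numeral of_nat_power)
    have "5 * real B * 2 ^ B \<le> 5 * real B * (2 * real n)" using pow by (intro mult_left_mono) auto
    also have "\<dots> \<le> real L * real (card S)" using LS by (simp add: mult_ac)
    finally show ?thesis by (simp add: pos_le_divide_eq)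
  qed
  have c1: "real (card S) / 2 ^ B \<le> 1"
  proof -
    have "card S \<le> 2 ^ B" using card_mono[OF _ S] bits(1) by simp
    then have "real (card S) \<le> 2 ^ B" by (metis of_nat_le_iff of_nat_numeral of_nat_power)
    then show ?thesis by simp
  qed
  have "measure (measure_spmf (exec (sampler K) (input_state \<epsilon> I es))) {\<sigma>. \<not> hit \<sigma> s P}
      \<le> measure (measure_spmf (exec (sampler K) (input_state \<epsilon> I es))) {\<sigma>. \<forall>c<L. narr \<sigma> cent_arr c \<notin> S}"
    using sub by (intro measure_spmf.finite_measure_mono) auto
  also have "\<dots> \<le> (1 - real (card S) / 2 ^ B) ^ L" by (rule miss_le[OF S L(1)])
  also have "\<dots> \<le> exp (- (real (card S) / 2 ^ B)) ^ L"
    using c1 exp_ge_add_one_self[of "- (real (card S) / 2 ^ B)"] by (intro power_mono) auto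
  also have "\<dots> = exp (- (real L * (real (card S) / 2 ^ B)))"
    by (simp flip: exp_of_nat_mult)
  also have "\<dots> \<le> exp (- 5 * real B)" using x by simp
  finally show ?thesis .
qed

lemma exp_B_le: "real n ^ 4 * exp (- 5 * real B) \<le> 1 / real n"
proof -
  have "real n \<le> exp (real B)"
    using ln_n_le(2) n_ge_2 by (metis exp_le_cancel_iff exp_ln of_nat_0_less_iff pos2 order_less_le_trans)
  then have "real n ^ 5 \<le> exp (real B) ^ 5" by (intro power_mono) auto
  also have "\<dots> = exp (5 * real B)" using exp_of_nat_mult[of 5 "real B"] by simp
  finally have "real n ^ 5 * exp (- 5 * real B) \<le> 1" by (simp add: exp_minus field_simps)
  then have "real n * (real n ^ 4 * exp (- 5 * real B)) \<le> 1" by (simp add: power_numeral_reduce)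
  then show ?thesis using n_ge_2 by (simp add: pos_le_divide_eq mult.commute)
qed

definition all_hit :: "(nat \<Rightarrow> (real \<times> nat list) list) \<Rightarrow> machine \<Rightarrow> bool" where
  "all_hit ps \<sigma> \<longleftrightarrow> (\<forall>i<k. \<forall>(a, P)\<in>set (ps i). hit \<sigma> (src i) P)"

text \<open>Union bound over at most \<open>k * m \<le> n ^ 4\<close> paths, each missed with
  probability at most \<open>exp (- 5 * B) \<le> 1 / n ^ 5\<close>. The paths are fixed before any
  coin is flipped.\<close>

lemma all_hit_prob:
  assumes len: "\<And>i. i < k \<Longrightarrow> length (ps i) \<le> m"
    and path: "\<And>i a P. i < k \<Longrightarrow> (a, P) \<in> set (ps i) \<Longrightarrow> set P \<subseteq> {..<m} \<and> P \<noteq> [] \<and>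
       distinct (pawalk_verts (src i) (map ((!) es) P))"
  shows "1 - 1 / real n \<le> measure (measure_spmf (exec (sampler K) (input_state \<epsilon> I es))) {\<sigma>. all_hit ps \<sigma>}"
proof -
  define M where "M = measure_spmf (exec (sampler K) (input_state \<epsilon> I es))"
  define X where "X = (SIGMA i:{..<k}. set (ps i))"
  define miss where "miss = (\<lambda>(i, a :: real, P). {\<sigma>. \<not> hit \<sigma> (src i) P})"
  have fin: "finite X" by (simp add: X_def)
  have "card X = (\<Sum>i<k. card (set (ps i)))" by (simp add: X_def)
  also have "\<dots> \<le> (\<Sum>i<k. m)" using len card_length order_trans by (intro sum_mono) fastforce
  finally have "card X \<le> k * m" by simp
  then have "real (card X) \<le> real k * real m" by (metis of_nat_le_iff of_nat_mult)
  also have "\<dots> \<le> real n ^ 2 * real n ^ 2" using k_le m_le by (intro mult_mono) auto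
  finally have card_X: "real (card X) \<le> real n ^ 4" by (simp flip: power_add)
  have "measure M {\<sigma>. \<not> all_hit ps \<sigma>} \<le> measure M (\<Union>x\<in>X. miss x)"
    unfolding M_def by (intro measure_spmf.finite_measure_mono) (auto simp: all_hit_def X_def miss_def)
  also have "\<dots> \<le> (\<Sum>x\<in>X. measure M (miss x))"
    unfolding M_def using fin by (intro measure_spmf.finite_measure_subadditive_finite) auto
  also have "\<dots> \<le> (\<Sum>x\<in>X. exp (- 5 * real B))"
  proof (rule sum_mono)
    fix x assume x: "x \<in> X"
    obtain i a P where iaP: "x = (i, a, P)" by (cases x)
    with x have i: "i < k" "(a, P) \<in> set (ps i)" by (auto simp: X_def)
    have "src i < n" using srcV[OF i(1)] V_eq by simp
    with path[OF i] show "measure M (miss x) \<le> exp (- 5 * real B)"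
      unfolding M_def miss_def iaP by (simp only: prod.case) (intro path_miss; blast)
  qed
  also have "\<dots> = real (card X) * exp (- 5 * real B)" by simp
  also have "\<dots> \<le> real n ^ 4 * exp (- 5 * real B)" using card_X by (intro mult_right_mono) auto
  also have "\<dots> \<le> 1 / real n" by (rule exp_B_le)
  finally have "measure M {\<sigma>. \<not> all_hit ps \<sigma>} \<le> 1 / real n" .
  moreover have "measure M {\<sigma>. \<not> all_hit ps \<sigma>} = 1 - measure M {\<sigma>. all_hit ps \<sigma>}"
  proof -
    have "lossless_spmf (exec (sampler K) (input_state \<epsilon> I es))"
      using sampler_wp by (simp add: wp_def)
    then have "measure M (space M) = 1"
      by (simp add: M_def lossless_spmf_def weight_spmf_def)
    moreover have "{\<sigma>. \<not> all_hit ps \<sigma>} = space M - {\<sigma>. all_hit ps \<sigma>}" by (auto simp: M_def space_measure_spmf)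
    moreover have "measure M (space M - {\<sigma>. all_hit ps \<sigma>}) = measure M (space M) - measure M {\<sigma>. all_hit ps \<sigma>}"
      unfolding M_def by (intro measure_spmf.finite_measure_compl) simp
    ultimately show ?thesis by simp
  qed
  ultimately show ?thesis by (simp add: M_def)
qed

text \<open>From index \<open>N\<close> on the centres are set to 0, since the locale asks for a
  vertex at every index.\<close>

lemma sampled_run:
  assumes \<sigma>: "sampled \<sigma>"
  defines "cent' \<equiv> \<lambda>c. if c < N then narr \<sigma> cent_arr c else 0"
  shows "mcf_run I es K cent'" "c < N \<Longrightarrow> narr \<sigma> cent_arr c = cent' c"
proof -
  have "cent' c < n" for c using \<sigma> n_ge_2 by (simp add: sampled_def cent'_def)
  then show "mcf_run I es K cent'"
    using listing K_pos by unfold_locales auto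
qed (simp add: cent'_def)

text \<open>Available for every outcome of the sampling. Ratio 0 expresses feasibility with
  nonnegative values, which also settles the case of optimum 0.\<close>

lemma run_time_wp:
  assumes \<sigma>: "sampled \<sigma>"
  shows "wp run (\<lambda>\<sigma>'. real (steps \<sigma>') \<le> 20100 * (real N * Y * (real m + real k)) \<and>
    approx_solution 0 I (output_flow I es \<sigma>')) \<sigma>"
proof -
  define cent' where "cent' = (\<lambda>c. if c < N then narr \<sigma> cent_arr c else 0)"
  interpret R: mcf_run I es K cent' using sampled_run[OF \<sigma>] by (simp add: cent'_def)
  have ge: "1 \<le> real N" "1 \<le> Y" "1 \<le> real m + real k" "real B \<le> Y" "0 \<le> real N * real B"
  proof -
    have "1 * real B \<le> real K ^ 2 * real B" using K_pos by (intro mult_right_mono) auto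
    then show "real B \<le> Y" using Y_ge by linarith
  qed (use N_pos Y_ge m_pos in auto)
  have "real N * 1 \<le> real N * Y" "real N * real B \<le> real N * Y" using ge by (intro mult_left_mono; simp)+
  moreover have NY: "1 * Y \<le> real N * Y" using ge by (intro mult_right_mono) auto
  moreover have "real N * Y * 1 \<le> real N * Y * (real m + real k)" using ge by (intro mult_left_mono) auto
  moreover have "real (steps \<sigma>) \<le> 3 * real B + 12 + (6 * (real N * real B) + 10 * real N)"
    using \<sigma> by (simp add: sampled_def algebra_simps)
  ultimately have st: "real (steps \<sigma>) \<le> 100 * (real N * Y * (real m + real k))"
    using ge by linarith
  show ?thesis
  proof (rule wp_mono[OF R.run_wp[where J = "\<lambda>_. True"]])
    fix \<sigma>' assume *: "R.main_inv (abs_state \<sigma>') \<and> True \<and> adn (abs_state \<sigma>') = 1 \<and>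
      real (steps \<sigma>') \<le> real (steps \<sigma>) + R.run_time"
    have "approx_solution 0 I (R.out_flow (af (abs_state \<sigma>')))"
      using * R.shipped_nonneg R.T'_ge by (intro R.approx_out_flow) auto
    then show "real (steps \<sigma>') \<le> 20100 * (real N * Y * (real m + real k)) \<and>
        approx_solution 0 I (output_flow I es \<sigma>')"
      using * st R.run_time_le by (simp add: R.output_flow_eq)
  qed (use \<sigma> sampled_run(2)[OF \<sigma>] in \<open>simp_all add: sampled_def cent'_def\<close>)
qed

lemma run_approx_wp:
  assumes \<sigma>: "sampled \<sigma>" "all_hit ps \<sigma>" and lam: "0 < max_throughput I"
    and eps: "0 < \<epsilon>" "\<epsilon> < 0.15" and K: "20 / \<epsilon> \<le> real K"
    and path: "\<And>i a P. i < k \<Longrightarrow> (a, P) \<in> set (ps i) \<Longrightarrow> a \<ge> 0 \<and> distinct P \<and> set P \<subseteq> {..<m} \<and>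
       pcas (src i) (map ((!) es) P) (snk i)"
    and sum: "\<And>i. i < k \<Longrightarrow> sum_list (map fst (ps i)) = max_throughput I * d i"
    and cap: "\<And>j. j < m \<Longrightarrow> (\<Sum>i<k. \<Sum>(a, P)\<leftarrow>ps i. if j \<in> set P then a else 0) \<le> u (es ! j)"
  shows "wp run (\<lambda>\<sigma>'. approx_solution (1 - 4 * \<epsilon>) I (output_flow I es \<sigma>')) \<sigma>"
proof -
  define cent' where "cent' = (\<lambda>c. if c < N then narr \<sigma> cent_arr c else 0)"
  interpret R: mcf_run I es K cent' using sampled_run[OF \<sigma>(1)] by (simp add: cent'_def)
  interpret G: mcf_good I es K cent' ps
  proof
    fix i a P assume i: "i < k" and aP: "(a, P) \<in> set (ps i)"
    then have "hit \<sigma> (src i) P" using \<sigma>(2) by (auto simp: all_hit_def)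
    then show "\<exists>c<R.N. Suc c * length P \<le> R.N \<and> cent' c \<in> set (pawalk_verts (src i) (map ((!) es) P))"
      by (auto simp: hit_def cent'_def)
  qed (use lam path sum cap in auto)
  have "100 \<le> 20 / \<epsilon>" using eps by (simp add: pos_le_divide_eq)
  with K have "100 \<le> real K" by linarith
  then have "R.\<kappa> \<le> 1 / 100" by (simp add: R.\<kappa>_def field_simps)
  then have ra: "G.ra < 1"
    using growth_rate_bounds(2)[OF R.kappa_pos(1)] by (simp add: G.ra_def)
  show ?thesis
  proof (rule wp_mono[OF R.run_wp[where J = G.good]])
    fix \<sigma>' assume "R.main_inv (abs_state \<sigma>') \<and> G.good (abs_state \<sigma>') \<and> adn (abs_state \<sigma>') = 1 \<and>
      real (steps \<sigma>') \<le> real (steps \<sigma>) + R.run_time"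
    then show "approx_solution (1 - 4 * \<epsilon>) I (output_flow I es \<sigma>')"
      unfolding R.output_flow_eq using eps K by (intro R.approx_out_flow G.good_final) auto
  next
    show "G.good s" if "R.start s" for s by (rule G.start_good[OF that])
    show "G.good s'" if "G.good s" "R.main_inv s" "R.main_inv s'" "adn s = 0"
      "R.next_com s s' \<or> R.raise_threshold s s' \<or> R.next_center s s' \<or> (\<exists>fs l \<gamma>. R.augments fs l \<gamma> s s')" for s s'
      by (rule G.good_step[OF that(1-4) ra that(5)])
  qed (use \<sigma>(1) sampled_run(2)[OF \<sigma>(1)] in \<open>simp_all add: sampled_def cent'_def\<close>)
qed

section \<open>Time bound and success probability of the whole program\<close>

lemma solver_time_wp:
  "wp (solver K) (\<lambda>\<sigma>. real (steps \<sigma>) \<le> 20100 * (real N * Y * (real m + real k)) \<and>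
    approx_solution 0 I (output_flow I es \<sigma>)) (input_state \<epsilon> I es)"
  unfolding solver_def wp_Seq by (rule wp_mono[OF sampler_wp run_time_wp])

text \<open>All randomness lies in the sampler: favourable centres have probability at least
  \<open>1 - 1 / n\<close>, and from there on success is certain. For optimum 0 a 0-approximation is
  good enough, as the required throughput is 0.\<close>

lemma solver_prob:
  assumes eps: "0 < \<epsilon>" "\<epsilon> < 0.15" and K: "20 / \<epsilon> \<le> real K"
  shows "1 - 1 / real n \<le> measure (measure_spmf (exec (solver K) (input_state \<epsilon> I es)))
    {\<sigma>. approx_solution (1 - 4 * \<epsilon>) I (output_flow I es \<sigma>)}"
proof -
  let ?\<sigma> = "input_state \<epsilon> I es"
  define G where "G = {\<sigma>. approx_solution (1 - 4 * \<epsilon>) I (output_flow I es \<sigma>)}"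
  obtain ps :: "nat \<Rightarrow> (real \<times> nat list) list" where
    len: "\<And>i. i < k \<Longrightarrow> length (ps i) \<le> m"
    and path: "\<And>i a P. i < k \<Longrightarrow> (a, P) \<in> set (ps i) \<Longrightarrow> a \<ge> 0 \<and> distinct P \<and> set P \<subseteq> {..<m} \<and>
       pcas (src i) (map ((!) es) P) (snk i) \<and> distinct (pawalk_verts (src i) (map ((!) es) P))"
    and sum: "\<And>i. i < k \<Longrightarrow> sum_list (map fst (ps i)) = max_throughput I * d i"
    and cap: "\<And>j. j < m \<Longrightarrow> (\<Sum>i<k. \<Sum>(a, P)\<leftarrow>ps i. if j \<in> set P then a else 0) \<le> u (es ! j)"
    using index_paths by metis
  have ne: "P \<noteq> []" if "i < k" "(a, P) \<in> set (ps i)" for i a P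
    using path[OF that] src_snk[OF that(1)] by auto
  have run: "wp run (\<lambda>\<sigma>'. approx_solution (1 - 4 * \<epsilon>) I (output_flow I es \<sigma>')) \<sigma>"
    if "sampled \<sigma>" "all_hit ps \<sigma>" for \<sigma>
  proof (cases "max_throughput I = 0")
    case True
    show ?thesis
      by (rule wp_mono[OF run_time_wp[OF that(1)]]) (simp add: approx_solution_def True)
  next
    case False
    with max_throughput_nonneg have "0 < max_throughput I" by simp
    then show ?thesis
      by (rule run_approx_wp[OF that _ eps K _ sum cap]) (use path in blast)
  qed
  have "ewp (sampler K) (indicator {\<sigma>. all_hit ps \<sigma>}) ?\<sigma> \<le> ewp (sampler K) (ewp run (indicator G)) ?\<sigma>"
  proof (rule ewp_mono)
    fix \<sigma> assume "\<sigma> \<in> set_spmf (exec (sampler K) ?\<sigma>)"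
    then have "sampled \<sigma>" using sampler_wp by (auto simp: wp_def)
    then show "indicator {\<sigma>. all_hit ps \<sigma>} \<sigma> \<le> ewp run (indicator G) \<sigma>"
      using wp_ewp[OF run] by (auto simp: indicator_def G_def)
  qed
  also have "\<dots> = ewp (solver K) (indicator G) ?\<sigma>" by (simp add: solver_def ewp_simps)
  finally have "measure (measure_spmf (exec (sampler K) ?\<sigma>)) {\<sigma>. all_hit ps \<sigma>} \<le>
      measure (measure_spmf (exec (solver K) ?\<sigma>)) G"
    by (simp add: ewp_indicator)
  moreover have "1 - 1 / real n \<le> measure (measure_spmf (exec (sampler K) ?\<sigma>)) {\<sigma>. all_hit ps \<sigma>}"
    using len path ne by (intro all_hit_prob) blast+
  ultimately show ?thesis by (simp add: G_def)
qed

lemma B_le: "real B \<le> 3 * log1 (real n)"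
proof -
  have "2 ^ B < 2 * real n"
    using bits(2) by (metis of_nat_less_iff of_nat_mult of_nat_numeral of_nat_power)
  then have "ln (2 ^ B) < ln (2 * real n)" using n_ge_2 by (subst ln_less_cancel_iff) auto
  then have "real B * ln 2 < ln 2 + ln (real n)"
    using n_ge_2 by (simp add: ln_realpow ln_mult_pos)
  then have "(real B - 1) * ln 2 \<le> ln (real n)" by (simp add: algebra_simps)
  moreover have "(real B - 1) * (1 / 2) \<le> (real B - 1) * ln 2"
    using bits ln2_ge_two_thirds by (intro mult_left_mono) auto
  ultimately have "(real B - 1) * (1 / 2) \<le> ln (real n)" by (rule order_trans[rotated])
  moreover have "1 \<le> log1 (real n)" "ln (real n) \<le> log1 (real n)" by (auto simp: log1_def)
  ultimately show ?thesis by simp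
qed

lemma time_bound:
  assumes eps: "0 < \<epsilon>" "\<epsilon> < 0.15" and K: "real K \<le> 22 / \<epsilon>"
  shows "20100 * (real N * Y * (real m + real k)) \<le>
    10 ^ 10 * (real m + real k) * real n * \<epsilon> powr (- 2) * log1 U * (log1 (real n) * log1 (1 / \<epsilon>)) ^ 3"
proof -
  let ?l = "log1 (real n)" and ?e = "log1 (1 / \<epsilon>)"
  have l: "1 \<le> ?l" "1 \<le> ?e" by (auto simp: log1_def)
  have "real K ^ 2 \<le> (22 / \<epsilon>) ^ 2" using K by (intro power_mono) auto
  also have "\<dots> = 484 * \<epsilon> powr (- 2)" using eps by (simp add: power_divide powr_minus_divide)
  finally have K2: "real K ^ 2 \<le> 484 * \<epsilon> powr (- 2)" .
  have "real B ^ 3 \<le> (3 * ?l) ^ 3" using B_le by (intro power_mono) auto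
  also have "\<dots> = 27 * ?l ^ 3" by (simp add: power_mult_distrib)
  also have "?l ^ 3 \<le> (?l * ?e) ^ 3" using l by (intro power_mono) auto
  finally have B3: "real B ^ 3 \<le> 27 * (?l * ?e) ^ 3" by simp
  have "20100 * (real N * Y * (real m + real k)) =
      402000 * ((real m + real k) * real n * log1 U) * (real K ^ 2 * real B ^ 3)"
    by (simp add: N_def Y_def power2_eq_square power3_eq_cube)
  also have "\<dots> \<le> 402000 * ((real m + real k) * real n * log1 U) *
      ((484 * \<epsilon> powr (- 2)) * (27 * (?l * ?e) ^ 3))"
    using K2 B3 log1_U by (intro mult_left_mono mult_mono) auto
  \<comment> \<open>The constant is \<open>402000 * 484 * 27\<close>, where
    \<open>484 = 22 ^ 2\<close> stems from \<open>K \<le> 22 / \<epsilon>\<close> and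
    \<open>27 = 3 ^ 3\<close> from \<open>B \<le> 3 * log1 n\<close>.\<close>
  also have "\<dots> = 5253336000 * ((real m + real k) * real n * \<epsilon> powr (- 2) * log1 U * (?l * ?e) ^ 3)"
    by simp
  also have "\<dots> \<le> 10 ^ 10 * ((real m + real k) * real n * \<epsilon> powr (- 2) * log1 U * (?l * ?e) ^ 3)"
    using log1_U l by (intro mult_right_mono mult_nonneg_nonneg) auto
  finally show ?thesis by (simp only: mult.assoc)
qed

end

theorem theorem18:
  shows "\<exists>(C::real) (p::nat) (c::real). C > 0 \<and> c > 0 \<and>
    (\<forall>\<epsilon>::real. 0 < \<epsilon> \<and> \<epsilon> < 0.15 \<longrightarrow>
      (\<exists>A::program. \<forall>I es. valid_instance I \<and> arc_listing I es \<longrightarrow>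
        (let n = real (num_verts I); m = real (num_arcs I); k = real (num_com I);
             U = max_capacity I; result = exec A (input_state \<epsilon> I es)
         in measure (measure_spmf result)
              {\<sigma>. approx_solution (1 - 4 * \<epsilon>) I (output_flow I es \<sigma>)} \<ge> 1 - n powr (- c) \<and>
            expected_steps result \<le>
              ennreal (C * (m + k) * n * \<epsilon> powr (- 2) * log1 U
                       * (log1 n * log1 (1 / \<epsilon>)) ^ p))))"
\<comment> \<open>The exponent 3 counts the factors \<open>B\<close> in \<open>N * Y\<close>, and
  the exponent 1 of the failure probability comes from the union bound.\<close>
proof (rule exI[of _ "10 ^ 10"], rule exI[of _ 3], rule exI[of _ 1], intro conjI allI impI)
  fix \<epsilon> :: real
  assume eps: "0 < \<epsilon> \<and> \<epsilon> < 0.15"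
  \<comment> \<open>The factor 20 gives \<open>\<kappa> \<le> \<epsilon> / 20\<close>, hence also
    \<open>\<kappa> \<le> 1 / 100\<close>. The program depends on \<open>\<epsilon>\<close> through
    this number.\<close>
  define K where "K = nat \<lceil>20 / \<epsilon>\<rceil>"
  have "0 < 20 / \<epsilon>" using eps by simp
  then have K: "20 / \<epsilon> \<le> real K" "real K \<le> 20 / \<epsilon> + 1" "1 \<le> K"
    unfolding K_def by linarith+
  have "1 \<le> 2 / \<epsilon>" using eps by simp
  with K(2) have K22: "real K \<le> 22 / \<epsilon>" using eps by (simp add: add_divide_distrib[symmetric] field_simps)
  show "\<exists>A. \<forall>I es. valid_instance I \<and> arc_listing I es \<longrightarrow>
        (let n = real (num_verts I); m = real (num_arcs I); k = real (num_com I);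
             U = max_capacity I; result = exec A (input_state \<epsilon> I es)
         in measure (measure_spmf result)
              {\<sigma>. approx_solution (1 - 4 * \<epsilon>) I (output_flow I es \<sigma>)} \<ge> 1 - n powr (- 1) \<and>
            expected_steps result \<le>
              ennreal (10 ^ 10 * (m + k) * n * \<epsilon> powr (- 2) * log1 U
                       * (log1 n * log1 (1 / \<epsilon>)) ^ 3))"
  proof (intro exI[of _ "solver K"] allI impI)
    fix I es assume I: "valid_instance I \<and> arc_listing I es"
    then have "num_verts I \<ge> 2" by (simp add: valid_instance_def)
    \<comment> \<open>\<open>\<lambda>_. 0\<close> is a placeholder; the centres used in the run are
      those drawn by the sampler.\<close>
    with I K(3) interpret mcf_run I es K "\<lambda>_. 0" by unfold_locales auto
    have "expected_steps (exec (solver K) (input_state \<epsilon> I es)) \<le> ennreal (20100 * (real N * Y * (real m + real k)))"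
      by (rule expected_steps_le[OF wp_mono[OF solver_time_wp]]) simp
    also have "\<dots> \<le> ennreal (10 ^ 10 * (real m + real k) * real n * \<epsilon> powr (- 2) * log1 (max_capacity I) *
        (log1 (real n) * log1 (1 / \<epsilon>)) ^ 3)"
      using time_bound[OF _ _ K22] eps by (intro ennreal_leI) (simp add: U_def)
    finally have "expected_steps (exec (solver K) (input_state \<epsilon> I es)) \<le> \<dots>" .
    then show "let n = real (num_verts I); m = real (num_arcs I); k = real (num_com I);
             U = max_capacity I; result = exec (solver K) (input_state \<epsilon> I es)
         in measure (measure_spmf result)
              {\<sigma>. approx_solution (1 - 4 * \<epsilon>) I (output_flow I es \<sigma>)} \<ge> 1 - n powr (- 1) \<and>
            expected_steps result \<le>
              ennreal (10 ^ 10 * (m + k) * n * \<epsilon> powr (- 2) * log1 U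
                       * (log1 n * log1 (1 / \<epsilon>)) ^ 3)"
      using solver_prob[OF _ _ K(1)] eps n_ge_2 by (simp add: Let_def powr_minus_divide)
  qed
qed simp_all

end
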